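(* Let every machine have the same communication budget $B\ge\log_2 n$ ($m$ and $B$ may depend on $n$). Let $\hat f=\tilde f(\hat j)$ be the distributed estimator constructed in the context with the $L_2$-type selection rule $$\hat j=\min\big\{j\in\mathcal J:\ \|\tilde f(j)-\tilde f(l)\|_2^2\le\tau 2^l/n_l\ \text{ for all } l>j,\ l\in\mathcal J\big\},$$ where $\tau>1$ is a sufficiently large constant. The construction does not use the smoothness $s$ of $f_0$. Then for every $L,s>0$ (and $n$ large enough) $\hat f\in\mathcal F_{dist}(B,\dots,B;B^s_{2,\infty}(L))$, and for all $s\in[s_{\min},s_{\max})$, $s>0$, $$\sup_{f_0\in B^s_{2,\infty}(L)}\mathbb E_{f_0,T}\|\hat f-f_0\|_2\ \lesssim\ \begin{cases} n^{-s/(1+2s)}, & \text{if } B\ge C_Ln^{1/(1+2s)}\log_2 n,\\[2mm] M_n\Big(\dfrac{n^{1/(1+2s)}}{B\log_2 n}\Big)^{\frac{s}{2+2s}}n^{-\frac{s}{1+2s}}, & \text{if } B<C_Ln^{1/(1+2s)}\log_2 n,\end{cases}$$ with $C_L=4L^{2/(1+2s)}$ and $M_n=(\log_2 n)^{3s/(2+2s)}$.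
   Context: Model. The total sample size is $n$ and there are $m=m_n$ local machines with $n/m\in\mathbb N$. Machine $i\in\{1,\dots,m\}$ observes pairs $(T^{(i)}_\ell,X^{(i)}_\ell)$, $\ell=1,\dots,n/m$, with $X^{(i)}_\ell=f_0(T^{(i)}_\ell)+\sigma\varepsilon^{(i)}_\ell$, where the $T^{(i)}_\ell$ are iid uniform on $(0,1)$, the $\varepsilon^{(i)}_\ell$ are iid $N(0,1)$, independent of the design, $\sigma>0$ is fixed and $f_0\in L_2[0,1]$ is unknown and common to all machines. $\mathbb E_{f_0,T}$ is expectation under the joint law of all data. Distributed estimators. Machine $i$ sends to a central machine a finite binary string $Y^{(i)}$ which is a measurable function of its local data; $l(Y)$ denotes the length of a string $Y$. For $\mathcal F\subset L_2[0,1]$, $\mathcal F_{dist}(B^{(1)},\dots,B^{(m)};\mathcal F)$ is the class of estimators $\hat f$ that are measurable functions of $(Y^{(1)},\dots,Y^{(m)})$ for such strings satisfying $\mathbb E_{f_0,T}[l(Y^{(i)})]\le B^{(i)}$ for all $f_0\in\mathcal F$ and all $i$. Wavelets and Besov balls. $\psi_{jk}$ ($j\ge 0$, $0\le k\le 2^j-1$) is a Cohen–Daubechies–Vial compactly supported orthonormal Daubechies wavelet basis of $L_2[0,1]$ of regularity $s_{\max}$ (which can be chosen arbitrarily large; coarsest-level scaling functions included in the indexing), $f_{jk}=\langle f,\psi_{jk}\rangle$, $\|f\|_{B^s_{2,\infty}}^2=\sup_{j}2^{2js}\sum_{k=0}^{2^j-1}f_{jk}^2$ and $B^s_{2,\infty}(L)=\{f\in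 L_2[0,1]:\|f\|_{B^s_{2,\infty}}<L\}$. Local estimators: $\hat f^{(i)}_{jk}=\frac mn\sum_{\ell=1}^{n/m}X^{(i)}_\ell\psi_{jk}(T^{(i)}_\ell)$. TransApprox. For $x\in\mathbb R$ with binary expansion $|x|=\sum_{k=-\infty}^{\lfloor\log_2|x|\rfloor}b_k2^k$, $b_k\in\{0,1\}$, $\mathrm{TransApprox}(x)$ transmits the sign bit of $x$ and the digits $b_k$ with $-\frac12\log_2 n\le k\le\log_2|x|$; this encodes the number $y$ having the same sign as $x$ and $|y|=\sum_{-\frac12\log_2 n\le k\le\log_2|x|}b_k2^k$. Its length in bits is at most $1+(1\vee\log_2|x|)+\frac12\log_2 n$. $Y^{(i)}_{jk}=\mathrm{TransApprox}(\hat f^{(i)}_{jk})$ denotes both the bit string and the number it encodes. Smoothness range. $s_{\min}=\inf\{s>0:\ (n(\log_2 n)^2/m^{2+2s})^{1/(1+2s)}\le B\text{ for all sufficiently large }n\}$. Construction. Let $j_{B,n}=\lfloor\log_2\lfloor B/\log_2 n\rfloor\rfloor$, $j_{\max}=\lceil(2+2s_{\min})^{-1}\log_2(nB)\rceil\wedge\lceil(1+2s_{\min})^{-1}\log_2 n\rceil$, $\tilde\eta=j_{\max}-j_{B,n}$, $\mathcal J=\{0,\dots,j_{\max}\}$. Let $I$ be the set of the first $\lfloor m/2\rfloor$ machines. Split the remaining $\lceil m/2\rceil$ machines into $\tilde\eta$ groups $I_0,\dots,I_{\tilde\eta-1}$ of size $\lfloor\lceil m/2\rceil/\tilde\eta\rfloor$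 each (leftover machines discarded), and split each $I_t$ into $2^t$ subgroups $I_{t,1},\dots,I_{t,2^t}$ of size $\lfloor2^{-t}\lfloor\lceil m/2\rceil/\tilde\eta\rfloor\rfloor$ each, these sizes being taken to be at least $1$ (leftovers discarded). Machines $i\in I$ transmit $Y^{(i)}_{jk}$ for $0\le j\le j_{B,n}-1$, $0\le k\le2^j-1$. Machines $i\in I_{t,\ell}$ transmit $Y^{(i)}_{jk}$ for $j=j_{B,n}+t$ and $(\ell-1)2^{j_{B,n}}\le k<\ell2^{j_{B,n}}$. The central machine computes $\hat f_{jk}=|I|^{-1}\sum_{i\in I}Y^{(i)}_{jk}$ for $j<j_{B,n}$, and $\hat f_{jk}=|I_{t,\ell}|^{-1}\sum_{i\in I_{t,\ell}}Y^{(i)}_{jk}$ for $j=j_{B,n}+t$, $0\le t\le\tilde\eta-1$, $(\ell-1)2^{j_{B,n}}\le k<\ell2^{j_{B,n}}$. For $j\in\mathcal J$ put $\tilde f(j)=\sum_{l\le j-1}\sum_{k=0}^{2^l-1}\hat f_{lk}\psi_{lk}$. Let $n_j=|I|n/m$ for $j<j_{B,n}$ and $n_j=|I_{j-j_{B,n},1}|\,n/m=\lfloor2^{-(j-j_{B,n})}\lfloor\lceil m/2\rceil/\tilde\eta\rfloor\rfloor\,n/m$ for $j\ge j_{B,n}$ (so $n_j\asymp n$ for $j<j_{B,n}$ and $n_j\asymp nB/(2^j(\log_2 n)^2)$ for $j\ge j_{B,n}$). Notation. $a\wedge b=\min(a,b)$, $a\vee b=\max(a,b)$. For positive sequences, $a_n\lesssim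 b_n$ means $a_n\le Cb_n$ for all sufficiently large $n$ with a constant $C>0$ not depending on $n$ (it may depend on fixed quantities such as $s,L,\tau,\sigma$ and the wavelet basis); $a_n\asymp b_n$ means $a_n\lesssim b_n\lesssim a_n$. "Sufficiently large $\tau$" means larger than a threshold not depending on $n$ or on the smoothness $s$.
   Formalization: The threshold for τ may depend on L, σ, the basis and a lower bound s_low>0 for s (take s_low=s_min if s_min>0); for s_min=0 a threshold uniform over all s>0 does not exist. A bound τ2^l/n_l with n_l=0 is read as infinity. *)

theory Defs
  imports "HOL-Probability.Probability"
begin

section \<open>The space \<open>L\<^sub>2[0,1]\<close>\<close>

definition L2_unit :: "(real \<Rightarrow> real) set" where
  "L2_unit = {f \<in> borel_measurable borel. set_integrable lborel {0..1} (\<lambda>x. (f x)\<^sup>2)}"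

definition L2_inner :: "(real \<Rightarrow> real) \<Rightarrow> (real \<Rightarrow> real) \<Rightarrow> real" where
  "L2_inner f g = (LBINT x:{0..1}. f x * g x)"

definition L2_norm :: "(real \<Rightarrow> real) \<Rightarrow> real" where
  "L2_norm f = sqrt (L2_inner f f)"

section \<open>Cohen--Daubechies--Vial wavelets\<close>

text \<open>
  The data of a CDV construction: the order \<open>N\<close> (number of vanishing moments), the coarsest
  scale \<open>j\<^sub>0\<close>, the Daubechies low-pass filter and its scaling function on the line, and the
  coefficients of the left and right edge functions (\<open>k < N\<close>) with respect to the restrictions
  to a half-line of the integer translates of the scaling function (edge scaling functions), or
  of its dilated translates \<open>x \<mapsto> \<phi> (2 x - l)\<close> (edge wavelets).
\<close>

record cdv =
  order_cdv :: nat
  coarsest :: nat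
  lowpass :: "int \<Rightarrow> real"
  scaling :: "real \<Rightarrow> real"
  left_sc :: "nat \<Rightarrow> int \<Rightarrow> real"
  right_sc :: "nat \<Rightarrow> int \<Rightarrow> real"
  left_wv :: "nat \<Rightarrow> int \<Rightarrow> real"
  right_wv :: "nat \<Rightarrow> int \<Rightarrow> real"

definition mother :: "cdv \<Rightarrow> real \<Rightarrow> real" where
  "mother W x = sqrt 2 * (\<Sum>k\<in>{1 - int (order_cdv W)..int (order_cdv W)}.
     (-1) powi k * lowpass W (1 - k) * scaling W (2 * x - of_int k))"

text \<open>
  Daubechies scaling functions with \<open>N\<close> vanishing moments: \<open>2 N\<close> filter taps, orthonormal
  integer translates. The support is normalised to \<open>[1 - N, N]\<close>.
\<close>

definition daubechies :: "cdv \<Rightarrow> bool" where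
  "daubechies W \<longleftrightarrow>
     (let N = order_cdv W; h = lowpass W; \<phi> = scaling W in
       1 \<le> N \<and>
       (\<forall>k. k \<notin> {1 - int N..int N} \<longrightarrow> h k = 0) \<and>
       \<phi> \<in> borel_measurable borel \<and>
       (\<forall>x. x \<notin> {1 - real N..real N} \<longrightarrow> \<phi> x = 0) \<and>
       (\<forall>x. \<phi> x = sqrt 2 * (\<Sum>k\<in>{1 - int N..int N}. h k * \<phi> (2 * x - of_int k))) \<and>
       (LBINT x. \<phi> x) = 1 \<and>
       (\<forall>k::int. (LBINT x. \<phi> x * \<phi> (x - of_int k)) = (if k = 0 then 1 else 0)) \<and>
       (\<forall>p<N. (LBINT x. x ^ p * mother W x) = 0))"

definition times_cont_differentiable :: "nat \<Rightarrow> (real \<Rightarrow> real) \<Rightarrow> bool" where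
  "times_cont_differentiable r f \<longleftrightarrow>
     (\<forall>i<r. (deriv ^^ i) f differentiable_on UNIV) \<and> continuous_on UNIV ((deriv ^^ r) f)"

text \<open>
  The left edge functions live on \<open>[0,\<infinity>)\<close> and the right ones on \<open>(-\<infinity>,0]\<close>; their supports have
  length at most \<open>2 N - 1\<close>. The interior functions keep the translates \<open>N \<le> k < 2 ^ j - N\<close>, so the
  edge scaling functions combine the remaining translates which meet the half-line.
\<close>

definition left_scaling :: "cdv \<Rightarrow> nat \<Rightarrow> real \<Rightarrow> real" where
  "left_scaling W k x = (if x < 0 then 0 else
     (\<Sum>l\<in>{1 - int (order_cdv W)..int (order_cdv W) - 1}.
        left_sc W k l * scaling W (x - of_int l)))"

definition right_scaling :: "cdv \<Rightarrow> nat \<Rightarrow> real \<Rightarrow> real" where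
  "right_scaling W k x = (if x > 0 then 0 else
     (\<Sum>l\<in>{- int (order_cdv W)..int (order_cdv W) - 2}.
        right_sc W k l * scaling W (x - of_int l)))"

definition left_wavelet :: "cdv \<Rightarrow> nat \<Rightarrow> real \<Rightarrow> real" where
  "left_wavelet W k x = (if x < 0 then 0 else
     (\<Sum>l\<in>{1 - int (order_cdv W)..3 * int (order_cdv W) - 2}.
        left_wv W k l * scaling W (2 * x - of_int l)))"

definition right_wavelet :: "cdv \<Rightarrow> nat \<Rightarrow> real \<Rightarrow> real" where
  "right_wavelet W k x = (if x > 0 then 0 else
     (\<Sum>l\<in>{1 - 3 * int (order_cdv W)..int (order_cdv W) - 2}.
        right_wv W k l * scaling W (2 * x - of_int l)))"

definition on_interval ::
  "nat \<Rightarrow> (nat \<Rightarrow> real \<Rightarrow> real) \<Rightarrow> (real \<Rightarrow> real) \<Rightarrow> (nat \<Rightarrow> real \<Rightarrow> real) \<Rightarrow>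
   nat \<Rightarrow> nat \<Rightarrow> real \<Rightarrow> real" where
  "on_interval N lf mid rt j k x =
     (if x \<notin> {0..1} then 0
      else 2 powr (real j / 2) *
        (if k < N then lf k (2 ^ j * x)
         else if k < 2 ^ j - N then mid (2 ^ j * x - real k)
         else rt (2 ^ j - 1 - k) (2 ^ j * (x - 1))))"

definition cdv_scaling :: "cdv \<Rightarrow> nat \<Rightarrow> nat \<Rightarrow> real \<Rightarrow> real" where
  "cdv_scaling W =
     on_interval (order_cdv W) (left_scaling W) (scaling W) (right_scaling W)"

definition cdv_wavelet :: "cdv \<Rightarrow> nat \<Rightarrow> nat \<Rightarrow> real \<Rightarrow> real" where
  "cdv_wavelet W =
     on_interval (order_cdv W) (left_wavelet W) (mother W) (right_wavelet W)"

definition cdv_space :: "cdv \<Rightarrow> nat \<Rightarrow> (real \<Rightarrow> real) set" where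
  "cdv_space W j =
     {f. \<exists>c. \<forall>x\<in>{0<..<1}. f x = (\<Sum>k<2 ^ j. c k * cdv_scaling W j k x)}"

text \<open>
  The basis \<open>\<psi>\<^sub>j\<^sub>k\<close>. The \<open>2 ^ j\<^sub>0\<close> scaling functions of the coarsest scale \<open>j\<^sub>0\<close> occupy the
  positions below level \<open>j\<^sub>0\<close>. As the levels \<open>0 \<le> j < j\<^sub>0\<close> with \<open>2 ^ j\<close> positions each offer only
  \<open>2 ^ j\<^sub>0 - 1\<close> of them, there is one additional position \<open>j = -1\<close>, \<open>k = 0\<close>; so exactly \<open>2 ^ j\<close>
  basis functions have level less than \<open>j\<close>, for each \<open>j \<ge> 0\<close>. Note \<open>positions (-1) = {0}\<close>.
\<close>

definition positions :: "int \<Rightarrow> nat set" where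
  "positions j = {..<2 ^ nat j}"

definition cdv_basis :: "cdv \<Rightarrow> int \<Rightarrow> nat \<Rightarrow> real \<Rightarrow> real" where
  "cdv_basis W j k =
     (if j < int (coarsest W)
      then cdv_scaling W (coarsest W) (if j < 0 then 0 else 2 ^ nat j + k)
      else cdv_wavelet W (nat j) k)"

definition orthonormal_basis :: "(int \<Rightarrow> nat \<Rightarrow> real \<Rightarrow> real) \<Rightarrow> bool" where
  "orthonormal_basis \<psi> \<longleftrightarrow>
     (\<forall>j\<ge>-1. \<forall>k\<in>positions j. \<psi> j k \<in> L2_unit) \<and>
     (\<forall>j\<ge>-1. \<forall>k\<in>positions j. \<forall>j'\<ge>-1. \<forall>k'\<in>positions j'.
        L2_inner (\<psi> j k) (\<psi> j' k') = (if j = j' \<and> k = k' then 1 else 0)) \<and>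
     (\<forall>f\<in>L2_unit. (\<forall>j\<ge>-1. \<forall>k\<in>positions j. L2_inner f (\<psi> j k) = 0) \<longrightarrow> L2_norm f = 0)"

definition is_cdv :: "cdv \<Rightarrow> nat \<Rightarrow> bool" where
  "is_cdv W r \<longleftrightarrow>
     daubechies W \<and> r \<le> order_cdv W \<and> times_cont_differentiable r (scaling W) \<and>
     2 * order_cdv W \<le> 2 ^ coarsest W \<and>
     (\<forall>j\<ge>coarsest W.
        (\<forall>p<order_cdv W. (\<lambda>x. x ^ p) \<in> cdv_space W j) \<and>
        (\<forall>k<2 ^ j. \<forall>k'<2 ^ j.
           L2_inner (cdv_scaling W j k) (cdv_scaling W j k') = (if k = k' then 1 else 0)) \<and>
        (\<forall>k<2 ^ j. cdv_scaling W j k \<in> cdv_space W (Suc j) \<and>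
                   cdv_wavelet W j k \<in> cdv_space W (Suc j))) \<and>
     orthonormal_basis (cdv_basis W)"

section \<open>Besov balls\<close>

definition besov_norm_sq :: "(int \<Rightarrow> nat \<Rightarrow> real \<Rightarrow> real) \<Rightarrow> real \<Rightarrow> (real \<Rightarrow> real) \<Rightarrow> ennreal" where
  "besov_norm_sq \<psi> s f =
     (SUP j\<in>{-1..}. ennreal (2 powr (2 * of_int j * s) * (\<Sum>k\<in>positions j. (L2_inner f (\<psi> j k))\<^sup>2)))"

definition besov_ball :: "(int \<Rightarrow> nat \<Rightarrow> real \<Rightarrow> real) \<Rightarrow> real \<Rightarrow> real \<Rightarrow> (real \<Rightarrow> real) set" where
  "besov_ball \<psi> s L = {f \<in> L2_unit. besov_norm_sq \<psi> s f < ennreal (L\<^sup>2)}"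

section \<open>The distributed regression model\<close>

text \<open>
  \<open>d l = (T\<^sub>l, X\<^sub>l)\<close> for a local sample \<open>d\<close>, and \<open>d i\<close> is the local sample of machine \<open>i < m\<close>
  for a full sample \<open>d\<close>; \<open>p = n / m\<close> is the local sample size.
\<close>

type_synonym local_sample = "nat \<Rightarrow> real \<times> real"
type_synonym sample = "nat \<Rightarrow> local_sample"

definition obs_law :: "real \<Rightarrow> (real \<Rightarrow> real) \<Rightarrow> (real \<times> real) measure" where
  "obs_law \<sigma> f0 =
     distr (uniform_measure lborel {0<..<1} \<Otimes>\<^sub>M density lborel (\<lambda>x. ennreal (std_normal_density x)))
       (borel \<Otimes>\<^sub>M borel) (\<lambda>(t, e). (t, f0 t + \<sigma> * e))"

definition sample_law :: "nat \<Rightarrow> nat \<Rightarrow> real \<Rightarrow> (real \<Rightarrow> real) \<Rightarrow> sample measure" where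
  "sample_law m p \<sigma> f0 = (\<Pi>\<^sub>M i\<in>{..<m}. \<Pi>\<^sub>M l\<in>{..<p}. obs_law \<sigma> f0)"

definition local_space :: "nat \<Rightarrow> local_sample measure" where
  "local_space p = (\<Pi>\<^sub>M l\<in>{..<p}. borel \<Otimes>\<^sub>M borel)"

definition sample_space :: "nat \<Rightarrow> nat \<Rightarrow> sample measure" where
  "sample_space m p = (\<Pi>\<^sub>M i\<in>{..<m}. local_space p)"

text \<open>
  The class \<open>\<F>\<^sub>d\<^sub>i\<^sub>s\<^sub>t (Bud 0, \<dots>, Bud (m - 1); Fs)\<close>. Tuples of binary strings form a countable discrete
  space, so that every map \<open>G\<close> on them is measurable.
\<close>

definition dist_estimators ::
  "nat \<Rightarrow> nat \<Rightarrow> real \<Rightarrow> (nat \<Rightarrow> real) \<Rightarrow> (real \<Rightarrow> real) set \<Rightarrow> (sample \<Rightarrow> real \<Rightarrow> real) set" where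
  "dist_estimators m p \<sigma> Bud Fs =
     {fh. \<exists>(Y :: nat \<Rightarrow> local_sample \<Rightarrow> bool list) (G :: (nat \<Rightarrow> bool list) \<Rightarrow> real \<Rightarrow> real).
        (\<forall>i<m. Y i \<in> measurable (local_space p) (count_space UNIV)) \<and>
        (\<forall>y. G y \<in> L2_unit) \<and>
        (\<forall>d\<in>space (sample_space m p). fh d = G (\<lambda>i\<in>{..<m}. Y i (d i))) \<and>
        (\<forall>f0\<in>Fs. \<forall>i<m.
           (\<integral>\<^sup>+ d. ennreal (real (length (Y i (d i)))) \<partial>sample_law m p \<sigma> f0) \<le> ennreal (Bud i))}"

section \<open>Transmission of approximate numbers\<close>

definition lowest_digit :: "nat \<Rightarrow> int" where
  "lowest_digit n = \<lceil>- (1/2) * log 2 (real n)\<rceil>"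

text \<open>The sign bit is followed by the digits in increasing order of significance.\<close>

definition trans_approx_bits :: "nat \<Rightarrow> real \<Rightarrow> bool list" where
  "trans_approx_bits n x =
     (x < 0) # map (\<lambda>k. odd \<lfloor>\<bar>x\<bar> / 2 powi k\<rfloor>) [lowest_digit n..\<lfloor>log 2 \<bar>x\<bar>\<rfloor>]"

definition decode_bits :: "nat \<Rightarrow> bool list \<Rightarrow> real" where
  "decode_bits n bs =
     (if hd bs then -1 else 1) *
     (\<Sum>i<length (tl bs). of_bool (tl bs ! i) * 2 powi (lowest_digit n + int i))"

definition trans_approx :: "nat \<Rightarrow> real \<Rightarrow> real" where
  "trans_approx n x = decode_bits n (trans_approx_bits n x)"

section \<open>The adaptive distributed estimator\<close>

text \<open>The infimum is taken in the extended reals, so \<open>s_min m B = \<infinity>\<close> if no \<open>s\<close> qualifies.\<close>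

definition s_min :: "(nat \<Rightarrow> nat) \<Rightarrow> (nat \<Rightarrow> real) \<Rightarrow> ereal" where
  "s_min m B = Inf (ereal ` {s. 0 < s \<and>
     (\<forall>\<^sub>F n in sequentially.
        (real n * (log 2 (real n))\<^sup>2 / real (m n) powr (2 + 2 * s)) powr (1 / (1 + 2 * s)) \<le> B n)})"

text \<open>
  Below, \<open>n\<close> is the sample size, \<open>m\<close> the number of machines, \<open>b\<close> the budget and \<open>sm\<close> the value
  of \<open>s_min\<close>. Machines are numbered \<open>0, \<dots>, m - 1\<close>, and the subgroups within a group \<open>I\<^sub>t\<close> are
  numbered \<open>0, \<dots>, 2 ^ t - 1\<close>.
\<close>

definition j_B :: "nat \<Rightarrow> real \<Rightarrow> int" where
  "j_B n b = \<lfloor>log 2 (of_int \<lfloor>b / log 2 (real n)\<rfloor>)\<rfloor>"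

definition j_max :: "nat \<Rightarrow> real \<Rightarrow> ereal \<Rightarrow> int" where
  "j_max n b sm =
     min \<lceil>real_of_ereal (ereal (log 2 (real n * b)) / (2 + 2 * sm))\<rceil>
         \<lceil>real_of_ereal (ereal (log 2 (real n)) / (1 + 2 * sm))\<rceil>"

text \<open>If \<open>j_max \<le> j_B\<close> there are no groups; this is \<open>n_groups = 0\<close>.\<close>

definition n_groups :: "nat \<Rightarrow> real \<Rightarrow> ereal \<Rightarrow> nat" where
  "n_groups n b sm = nat (j_max n b sm - j_B n b)"

definition group_size :: "nat \<Rightarrow> nat \<Rightarrow> real \<Rightarrow> ereal \<Rightarrow> nat" where
  "group_size n m b sm = ((m + 1) div 2) div n_groups n b sm"

definition subgroup_size :: "nat \<Rightarrow> nat \<Rightarrow> real \<Rightarrow> ereal \<Rightarrow> nat \<Rightarrow> nat" where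
  "subgroup_size n m b sm t = group_size n m b sm div 2 ^ t"

definition first_half :: "nat \<Rightarrow> nat set" where
  "first_half m = {..<m div 2}"

definition subgroup :: "nat \<Rightarrow> nat \<Rightarrow> real \<Rightarrow> ereal \<Rightarrow> nat \<Rightarrow> nat \<Rightarrow> nat set" where
  "subgroup n m b sm t l =
     (let a = m div 2 + t * group_size n m b sm; r = subgroup_size n m b sm t
      in {a + l * r..<a + (l + 1) * r})"

definition transmitters :: "nat \<Rightarrow> nat \<Rightarrow> real \<Rightarrow> ereal \<Rightarrow> int \<Rightarrow> nat \<Rightarrow> nat set" where
  "transmitters n m b sm j k =
     (if j < j_B n b then first_half m
      else subgroup n m b sm (nat (j - j_B n b)) (k div 2 ^ nat (j_B n b)))"

definition local_coeff :: "(int \<Rightarrow> nat \<Rightarrow> real \<Rightarrow> real) \<Rightarrow> nat \<Rightarrow> local_sample \<Rightarrow> int \<Rightarrow> nat \<Rightarrow> real" where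
  "local_coeff \<psi> p d j k = (\<Sum>l<p. snd (d l) * \<psi> j k (fst (d l))) / real p"

definition central_coeff ::
  "(int \<Rightarrow> nat \<Rightarrow> real \<Rightarrow> real) \<Rightarrow> nat \<Rightarrow> nat \<Rightarrow> real \<Rightarrow> ereal \<Rightarrow> sample \<Rightarrow> int \<Rightarrow> nat \<Rightarrow> real" where
  "central_coeff \<psi> n m b sm d j k =
     (\<Sum>i\<in>transmitters n m b sm j k. trans_approx n (local_coeff \<psi> (n div m) (d i) j k))
     / real (card (transmitters n m b sm j k))"

definition f_level ::
  "(int \<Rightarrow> nat \<Rightarrow> real \<Rightarrow> real) \<Rightarrow> nat \<Rightarrow> nat \<Rightarrow> real \<Rightarrow> ereal \<Rightarrow> sample \<Rightarrow> int \<Rightarrow> real \<Rightarrow> real" where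
  "f_level \<psi> n m b sm d j x =
     (\<Sum>l\<in>{-1..j - 1}. \<Sum>k\<in>positions l. central_coeff \<psi> n m b sm d l k * \<psi> l k x)"

definition eff_size :: "nat \<Rightarrow> nat \<Rightarrow> real \<Rightarrow> ereal \<Rightarrow> int \<Rightarrow> nat" where
  "eff_size n m b sm j =
     (if j < j_B n b then card (first_half m) else subgroup_size n m b sm (nat (j - j_B n b)))
     * (n div m)"

text \<open>
  The guard reads the bound \<open>\<tau> 2 ^ l / n\<^sub>l\<close> as \<open>\<infinity>\<close> when \<open>n\<^sub>l = 0\<close>. This can only happen for
  \<open>l = j_max\<close>, a level to which no group of machines is assigned.
\<close>

definition j_hat ::
  "(int \<Rightarrow> nat \<Rightarrow> real \<Rightarrow> real) \<Rightarrow> real \<Rightarrow> nat \<Rightarrow> nat \<Rightarrow> real \<Rightarrow> ereal \<Rightarrow> sample \<Rightarrow> int" where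
  "j_hat \<psi> \<tau> n m b sm d =
     Min {j \<in> {0..j_max n b sm}. \<forall>l\<in>{0..j_max n b sm}. j < l \<longrightarrow> 0 < eff_size n m b sm l \<longrightarrow>
       (L2_norm (\<lambda>x. f_level \<psi> n m b sm d j x - f_level \<psi> n m b sm d l x))\<^sup>2
         \<le> \<tau> * 2 ^ nat l / real (eff_size n m b sm l)}"

definition f_hat ::
  "(int \<Rightarrow> nat \<Rightarrow> real \<Rightarrow> real) \<Rightarrow> real \<Rightarrow> nat \<Rightarrow> nat \<Rightarrow> real \<Rightarrow> ereal \<Rightarrow> sample \<Rightarrow> real \<Rightarrow> real" where
  "f_hat \<psi> \<tau> n m b sm d = f_level \<psi> n m b sm d (j_hat \<psi> \<tau> n m b sm d)"

text \<open>
  The conditions under which the model and the construction make sense at sample size \<open>n\<close>: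
  equal local sample sizes, and no empty set of machines to average over.
\<close>

definition admissible :: "nat \<Rightarrow> nat \<Rightarrow> real \<Rightarrow> ereal \<Rightarrow> bool" where
  "admissible n m b sm \<longleftrightarrow>
     m dvd n \<and> 1 \<le> card (first_half m) \<and> (\<forall>t<n_groups n b sm. 1 \<le> subgroup_size n m b sm t)"

section \<open>Risk and rate\<close>

definition risk :: "nat \<Rightarrow> nat \<Rightarrow> real \<Rightarrow> (sample \<Rightarrow> real \<Rightarrow> real) \<Rightarrow> (real \<Rightarrow> real) \<Rightarrow> ennreal" where
  "risk m p \<sigma> fh f0 = (\<integral>\<^sup>+ d. ennreal (L2_norm (\<lambda>x. fh d x - f0 x)) \<partial>sample_law m p \<sigma> f0)"

definition rate :: "real \<Rightarrow> real \<Rightarrow> nat \<Rightarrow> real \<Rightarrow> real" where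
  "rate L s n b =
     (if b \<ge> 4 * L powr (2 / (1 + 2 * s)) * real n powr (1 / (1 + 2 * s)) * log 2 (real n)
      then real n powr (- s / (1 + 2 * s))
      else log 2 (real n) powr (3 * s / (2 + 2 * s))
           * (real n powr (1 / (1 + 2 * s)) / (b * log 2 (real n))) powr (s / (2 + 2 * s))
           * real n powr (- s / (1 + 2 * s)))"

end

(* Let v_l = 2^l / n_l be the size of the noise V_l in level l of the aggregated coefficients, and
   let q be the level at which the squared bias 2^(-2 j s) first falls to the order of v_(j+1). If
   the selected level is at most q, the selection rule itself bounds its distance to level q by
   tau v_q. If it is larger, then the level before it was rejected, which for large tau forces
   the noise of some level l >= q to exceed a large multiple of v_l. Hence the loss is at most the
   oracle loss at q plus the sum over l of (sqrt V_l - c sqrt v_l)_+.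

   Second moments suffice to control this excess. V_l is the squared norm of a sum of independent
   centred vectors, and for a bounded signal the covariance in every direction is of order 1 / n_l,
   so that Var V_l is of order v_l^2 / 2^l. For small s the signal need not be bounded; one splits
   off its levels above (1 + s') q (s' = min(s, 1/4)), whose contribution is polynomially small in 2^q, while the
   sup-norm of the remaining part grows more slowly than 2^(q / 2). The polynomial gain absorbs all
   logarithms.

   For the budget, real numbers are sent by a prefix-free code of mean length (log n) / 2 + O(1), and
   every machine sends at most 2^(j_B) <= B / log n of them. *)

theory Submission
  imports Defs
begin

section \<open>Square-integrable functions and Parseval's identity\<close>

text \<open>The threshold \<tau> must serve all s, while for small s the signal need not even lie in
  L4. So the two sizes of the covariance are kept apart. Its trace involves the signal only through
  its L2 norm, which is bounded over the ball; it fixes the constant c in the excess and thereby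
  \<tau>. The sup-norm K of the truncated signal enters only the expected excess, as K^2 / 2^l,
  where it may grow with q.

  The truncation height balances two errors. Cutting at (1 + s') q makes the remainder smaller than
  2^(-q s) by the factor 2^(-s s' q), and K is of order 2^((1 + s') q (1/2 - s')), so that K^2 / 2^q
  is of order 2^(-s' q) because (1 + s') (1 - 2 s') <= 1 - s'. The value 1/4 keeps the exponent 1/2
  - s' away from zero, so that the geometric sum behind K has a constant independent of s.

  The logarithms in M_n have two sources. A machine can send about B / log n coefficients, and up to
  order log n groups share the machines; hence v_l is at most of order 4^l (log n)^2 / (n B) above
  \<open>j_B\<close>.\<close>

definition unif :: "real measure" where
  "unif = uniform_measure lborel {0<..<1}"

lemma unif_density: "unif = density lborel (\<lambda>x. ennreal (indicator {0<..<1} x))"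
  by (simp add: unif_def uniform_measure_def ennreal_indicator divide_ennreal_def)

lemma sets_unif [simp, measurable_cong]: "sets unif = sets borel"
  by (simp add: unif_def)

lemma space_unif [simp]: "space unif = UNIV"
  by (simp add: unif_def)

lemma measurable_unif [simp]: "measurable unif N = measurable borel N"
  by (rule measurable_cong_sets) simp_all

lemma prob_space_unif: "prob_space unif"
  unfolding unif_def by (rule prob_space_uniform_measure) auto

interpretation unif: prob_space unif
  by (rule prob_space_unif)

text \<open>The design lives on the open unit interval, while \<open>L2_inner\<close> integrates
  over the closed one. The endpoints form a null set, so every integral can be moved to the
  probability measure \<open>unif\<close>.\<close>

lemma AE_indicator_open_closed:
  "AE x::real in lborel. indicator {0<..<1} x = (indicator {0..1} x :: real)"
proof -
  have "AE x in lborel. x \<noteq> (0::real)" "AE x in lborel. x \<noteq> (1::real)"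
    by (rule AE_lborel_singleton)+
  then show ?thesis by eventually_elim (auto simp: indicator_def)
qed

lemma integral_unif:
  fixes f :: "real \<Rightarrow> real"
  assumes [measurable]: "f \<in> borel_measurable borel"
  shows "(\<integral>x. f x \<partial>unif) = (LBINT x:{0..1}. f x)"
proof -
  have "(\<integral>x. f x \<partial>unif) = (\<integral>x. indicator {0<..<1} x * f x \<partial>lborel)"
    unfolding unif_density by (subst integral_density) auto
  also have "\<dots> = (\<integral>x. indicator {0..1} x * f x \<partial>lborel)"
    using AE_indicator_open_closed by (intro integral_cong_AE) auto
  finally show ?thesis by (simp add: set_lebesgue_integral_def)
qed

lemma integrable_unif:
  fixes f :: "real \<Rightarrow> real"
  assumes [measurable]: "f \<in> borel_measurable borel"
  shows "integrable unif f \<longleftrightarrow> set_integrable lborel {0..1} f"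
proof -
  have "integrable unif f \<longleftrightarrow> integrable lborel (\<lambda>x. indicator {0<..<1} x * f x)"
    unfolding unif_density by (subst integrable_density) auto
  also have "\<dots> \<longleftrightarrow> integrable lborel (\<lambda>x. indicator {0..1} x * f x)"
    using AE_indicator_open_closed by (intro integrable_cong_AE) auto
  finally show ?thesis by (simp add: set_integrable_def)
qed

lemma L2_unit_iff:
  "f \<in> L2_unit \<longleftrightarrow> f \<in> borel_measurable borel \<and> integrable unif (\<lambda>x. (f x)\<^sup>2)"
  by (auto simp: L2_unit_def integrable_unif)

lemma L2_unit_measurable [measurable_dest]: "f \<in> L2_unit \<Longrightarrow> f \<in> borel_measurable borel"
  by (simp add: L2_unit_iff)

lemma L2_inner_unif:
  assumes [measurable]: "f \<in> borel_measurable borel" "g \<in> borel_measurable borel"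
  shows "L2_inner f g = (\<integral>x. f x * g x \<partial>unif)"
  unfolding L2_inner_def by (rule integral_unif[symmetric]) simp

lemma L2_norm_nonneg: "0 \<le> L2_norm f"
  by (auto simp: L2_norm_def L2_inner_def set_lebesgue_integral_def indicator_def
      intro!: integral_nonneg_AE)

lemma L2_norm_sq:
  assumes "f \<in> borel_measurable borel"
  shows "(L2_norm f)\<^sup>2 = (\<integral>x. (f x)\<^sup>2 \<partial>unif)"
  using assms by (simp add: L2_norm_def L2_inner_unif integral_nonneg_AE power2_eq_square)

lemma abs_mult_le_sum_sq: "\<bar>a * b\<bar> \<le> a\<^sup>2 + b\<^sup>2" for a b :: real
proof -
  have "0 \<le> (\<bar>a\<bar> - \<bar>b\<bar>)\<^sup>2" by simp
  then have "2 * (\<bar>a\<bar> * \<bar>b\<bar>) \<le> a\<^sup>2 + b\<^sup>2" by (simp add: power2_diff)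
  moreover have "0 \<le> \<bar>a\<bar> * \<bar>b\<bar>" by simp
  ultimately show ?thesis unfolding abs_mult by linarith
qed

lemma integrable_mult_of_sq:
  fixes f g :: "'a \<Rightarrow> real"
  assumes [measurable]: "f \<in> borel_measurable M" "g \<in> borel_measurable M"
    and "integrable M (\<lambda>x. (f x)\<^sup>2)" "integrable M (\<lambda>x. (g x)\<^sup>2)"
  shows "integrable M (\<lambda>x. f x * g x)"
proof (rule Bochner_Integration.integrable_bound)
  show "integrable M (\<lambda>x. (f x)\<^sup>2 + (g x)\<^sup>2)" using assms by simp
  show "AE x in M. norm (f x * g x) \<le> norm ((f x)\<^sup>2 + (g x)\<^sup>2)"
    by (simp add: abs_mult_le_sum_sq)
qed simp

lemma integrable_sq_add:
  fixes f g :: "'a \<Rightarrow> real"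
  assumes [measurable]: "f \<in> borel_measurable M" "g \<in> borel_measurable M"
    and "integrable M (\<lambda>x. (f x)\<^sup>2)" "integrable M (\<lambda>x. (g x)\<^sup>2)"
  shows "integrable M (\<lambda>x. (f x + g x)\<^sup>2)"
proof -
  have "(\<lambda>x. (f x + g x)\<^sup>2) = (\<lambda>x. (f x)\<^sup>2 + (g x)\<^sup>2 + 2 * (f x * g x))"
    by (simp add: power2_sum fun_eq_iff)
  then show ?thesis using assms integrable_mult_of_sq[OF assms] by simp
qed

lemma integrable_sq_sum:
  fixes f :: "'i \<Rightarrow> 'a \<Rightarrow> real"
  assumes "finite F" "\<And>a. a \<in> F \<Longrightarrow> f a \<in> borel_measurable M"
    and "\<And>a. a \<in> F \<Longrightarrow> integrable M (\<lambda>x. (f a x)\<^sup>2)"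
  shows "integrable M (\<lambda>x. (\<Sum>a\<in>F. f a x)\<^sup>2)"
  using assms
proof (induction F)
  case (insert b F)
  have "integrable M (\<lambda>x. (f b x + (\<Sum>a\<in>F. f a x))\<^sup>2)"
    using insert by (intro integrable_sq_add) auto
  then show ?case using insert(1,2) by simp
qed simp

lemma L2_unit_mult_integrable:
  assumes "f \<in> L2_unit" "g \<in> L2_unit"
  shows "integrable unif (\<lambda>x. f x * g x)"
  using assms by (intro integrable_mult_of_sq) (auto simp: L2_unit_iff)

lemma L2_unit_scale: "f \<in> L2_unit \<Longrightarrow> (\<lambda>x. c * f x) \<in> L2_unit"
  by (auto simp: L2_unit_iff power_mult_distrib)

lemma L2_unit_sum:
  assumes "finite F" "\<And>a. a \<in> F \<Longrightarrow> f a \<in> L2_unit"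
  shows "(\<lambda>x. \<Sum>a\<in>F. f a x) \<in> L2_unit"
  using assms by (auto simp: L2_unit_iff intro!: integrable_sq_sum borel_measurable_sum)

lemma L2_unit_diff:
  assumes "f \<in> L2_unit" "g \<in> L2_unit"
  shows "(\<lambda>x. f x - g x) \<in> L2_unit"
  using assms integrable_sq_add[of f unif "\<lambda>x. - g x"] by (auto simp: L2_unit_iff)

lemma finite_positions [simp]: "finite (positions j)"
  by (simp add: positions_def)

section \<open>Finite expansions in the wavelet basis and Parseval's identity on Besov balls\<close>

definition idx :: "(int \<times> nat) set" where
  "idx = (SIGMA l:{-1..}. positions l)"

definition below :: "int \<Rightarrow> (int \<times> nat) set" where
  "below j = (SIGMA l:{-1..j-1}. positions l)"

lemma finite_below [simp]: "finite (below j)"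
  by (auto simp: below_def)

lemma below_subset_idx: "below j \<subseteq> idx"
  by (auto simp: below_def idx_def)

locale onb =
  fixes \<psi> :: "int \<Rightarrow> nat \<Rightarrow> real \<Rightarrow> real"
  assumes onb: "orthonormal_basis \<psi>"
begin

definition cf :: "(real \<Rightarrow> real) \<Rightarrow> int \<times> nat \<Rightarrow> real" where
  "cf f a = L2_inner f (\<psi> (fst a) (snd a))"

definition comb :: "(int \<times> nat) set \<Rightarrow> (int \<times> nat \<Rightarrow> real) \<Rightarrow> real \<Rightarrow> real" where
  "comb F c x = (\<Sum>a\<in>F. c a * \<psi> (fst a) (snd a) x)"

definition energy :: "(real \<Rightarrow> real) \<Rightarrow> int \<Rightarrow> real" where
  "energy f l = (\<Sum>k\<in>positions l. (cf f (l, k))\<^sup>2)"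

lemma psi_L2: "a \<in> idx \<Longrightarrow> \<psi> (fst a) (snd a) \<in> L2_unit"
  using onb by (auto simp: orthonormal_basis_def idx_def)

lemma psi_inner:
  assumes "a \<in> idx" "b \<in> idx"
  shows "L2_inner (\<psi> (fst a) (snd a)) (\<psi> (fst b) (snd b)) = of_bool (a = b)"
  using onb assms by (auto simp: orthonormal_basis_def idx_def prod_eq_iff)

lemma psi_inner_unif:
  assumes "a \<in> idx" "b \<in> idx"
  shows "(\<integral>x. \<psi> (fst a) (snd a) x * \<psi> (fst b) (snd b) x \<partial>unif) = of_bool (a = b)"
  using psi_inner[OF assms] L2_inner_unif psi_L2[OF assms(1)] psi_L2[OF assms(2)]
  by (metis L2_unit_iff)

lemma energy_nonneg: "0 \<le> energy f l"
  by (simp add: energy_def sum_nonneg)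

lemma sum_energy: "(\<Sum>l\<in>{-1..j-1}. energy f l) = (\<Sum>a\<in>below j. (cf f a)\<^sup>2)"
  unfolding energy_def below_def by (subst sum.Sigma) auto

lemma cf_unif:
  assumes "f \<in> L2_unit" "a \<in> idx"
  shows "cf f a = (\<integral>x. f x * \<psi> (fst a) (snd a) x \<partial>unif)"
  using assms psi_L2[OF assms(2)] by (simp add: cf_def L2_inner_unif L2_unit_iff)

lemma comb_L2:
  assumes "finite F" "F \<subseteq> idx"
  shows "comb F c \<in> L2_unit"
proof -
  have "(\<lambda>x. \<Sum>a\<in>F. c a * \<psi> (fst a) (snd a) x) \<in> L2_unit"
    using assms by (intro L2_unit_sum L2_unit_scale psi_L2) auto
  moreover have "comb F c = (\<lambda>x. \<Sum>a\<in>F. c a * \<psi> (fst a) (snd a) x)"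
    by (rule ext) (simp add: comb_def)
  ultimately show ?thesis by simp
qed

lemma integral_mult_comb:
  assumes "f \<in> L2_unit" "finite F" "F \<subseteq> idx"
  shows "(\<integral>x. f x * comb F c x \<partial>unif) = (\<Sum>a\<in>F. c a * cf f a)"
proof -
  have i: "integrable unif (\<lambda>x. f x * \<psi> (fst a) (snd a) x)" if "a \<in> F" for a
    using assms that by (intro L2_unit_mult_integrable psi_L2) auto
  have "(\<integral>x. f x * comb F c x \<partial>unif)
      = (\<integral>x. (\<Sum>a\<in>F. c a * (f x * \<psi> (fst a) (snd a) x)) \<partial>unif)"
    by (simp add: comb_def sum_distrib_left ac_simps)
  also have "\<dots> = (\<Sum>a\<in>F. c a * (\<integral>x. f x * \<psi> (fst a) (snd a) x \<partial>unif))"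
    using i by (subst Bochner_Integration.integral_sum) auto
  also have "\<dots> = (\<Sum>a\<in>F. c a * cf f a)"
    using assms by (intro sum.cong) (auto simp: cf_unif)
  finally show ?thesis .
qed

lemma cf_comb:
  assumes "finite F" "F \<subseteq> idx" "b \<in> idx"
  shows "cf (comb F c) b = (if b \<in> F then c b else 0)"
proof -
  have "cf (comb F c) b = (\<integral>x. \<psi> (fst b) (snd b) x * comb F c x \<partial>unif)"
    using assms comb_L2 by (simp add: cf_unif mult.commute)
  also have "\<dots> = (\<Sum>a\<in>F. c a * of_bool (b = a))"
  proof -
    have "cf (\<psi> (fst b) (snd b)) a = of_bool (b = a)" if "a \<in> F" for a
      using that assms psi_inner[of b a] by (auto simp: cf_def)
    then show ?thesis
      using assms by (simp add: integral_mult_comb psi_L2)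
  qed
  also have "\<dots> = (if b \<in> F then c b else 0)"
    using assms by (auto simp: of_bool_def if_distrib cong: if_cong)
  finally show ?thesis .
qed

lemma integral_comb_sq:
  assumes "finite F" "F \<subseteq> idx"
  shows "(\<integral>x. (comb F c x)\<^sup>2 \<partial>unif) = (\<Sum>a\<in>F. (c a)\<^sup>2)"
proof -
  have "(\<integral>x. (comb F c x)\<^sup>2 \<partial>unif) = (\<Sum>a\<in>F. c a * cf (comb F c) a)"
    using assms by (simp add: power2_eq_square integral_mult_comb comb_L2)
  also have "\<dots> = (\<Sum>a\<in>F. (c a)\<^sup>2)"
    using assms by (intro sum.cong refl) (simp add: cf_comb[OF assms] power2_eq_square subsetD[OF assms(2)])
  finally show ?thesis .
qed

text \<open>Pythagoras: the error of a linear combination splits into the coefficient errors and the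
  part of f orthogonal to the span. In the application these are the noise and the squared
  bias.\<close>

lemma integral_comb_diff_sq:
  assumes "f \<in> L2_unit" "finite F" "F \<subseteq> idx"
  shows "(\<integral>x. (comb F c x - f x)\<^sup>2 \<partial>unif)
       = (\<Sum>a\<in>F. (c a - cf f a)\<^sup>2) + ((\<integral>x. (f x)\<^sup>2 \<partial>unif) - (\<Sum>a\<in>F. (cf f a)\<^sup>2))"
proof -
  have i: "integrable unif (\<lambda>x. (f x)\<^sup>2)" "integrable unif (\<lambda>x. (comb F c x)\<^sup>2)"
    "integrable unif (\<lambda>x. f x * comb F c x)"
    using assms comb_L2[OF assms(2,3)] by (auto simp: L2_unit_iff intro!: L2_unit_mult_integrable)
  have "(\<integral>x. (comb F c x - f x)\<^sup>2 \<partial>unif)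
      = (\<integral>x. (comb F c x)\<^sup>2 - 2 * (f x * comb F c x) + (f x)\<^sup>2 \<partial>unif)"
    by (simp add: power2_diff algebra_simps)
  also have "\<dots> = (\<Sum>a\<in>F. (c a)\<^sup>2) - 2 * (\<Sum>a\<in>F. c a * cf f a) + (\<integral>x. (f x)\<^sup>2 \<partial>unif)"
    using i assms by (simp add: integral_comb_sq integral_mult_comb)
  also have "\<dots> = (\<Sum>a\<in>F. (c a - cf f a)\<^sup>2) + ((\<integral>x. (f x)\<^sup>2 \<partial>unif) - (\<Sum>a\<in>F. (cf f a)\<^sup>2))"
    by (simp add: power2_diff sum.distrib sum_subtractf sum_distrib_left ac_simps)
  finally show ?thesis .
qed

lemma besov_ball_L2: "f \<in> besov_ball \<psi> s L \<Longrightarrow> f \<in> L2_unit"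
  by (simp add: besov_ball_def)

lemma besov_ball_energy:
  assumes "f \<in> besov_ball \<psi> s L" "-1 \<le> l"
  shows "energy f l \<le> L\<^sup>2 * 2 powr (- 2 * of_int l * s)"
proof -
  have "ennreal (2 powr (2 * of_int l * s) * energy f l) \<le> besov_norm_sq \<psi> s f"
    unfolding besov_norm_sq_def energy_def cf_def using assms(2) by (intro SUP_upper2[of l]) auto
  also have "\<dots> < ennreal (L\<^sup>2)"
    using assms by (simp add: besov_ball_def)
  finally have "2 powr (2 * of_int l * s) * energy f l < L\<^sup>2"
    by (simp add: ennreal_less_iff energy_nonneg)
  then show ?thesis
    by (simp add: powr_minus_divide mult.commute[of _ "energy f l"] pos_le_divide_eq)
qed

text \<open>The pointwise sum of \<open>\<Delta>\<^sub>i\<close> converges almost everywhere and in \<open>L\<^sub>2\<close>, because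
  \<open>\<Sum>\<^sub>i \<Delta>\<^sub>i\<^sup>2 / w\<^sub>i\<close> is integrable for the summable weights \<open>w\<^sub>i\<close>; this replaces the
  Riesz--Fischer theorem.\<close>

lemma parseval_besov:
  assumes f: "f \<in> L2_unit" and s: "0 < s" and L: "0 \<le> L"
    and en: "\<And>l. -1 \<le> l \<Longrightarrow> energy f l \<le> L\<^sup>2 * 2 powr (- 2 * of_int l * s)"
  shows "(\<lambda>J::nat. \<Sum>l\<in>{-1..int J - 1}. energy f l) \<longlonglongrightarrow> (\<integral>x. (f x)\<^sup>2 \<partial>unif)"
proof -
  \<comment> \<open>The index i stands for level i - 1, so that natural numbers enumerate the levels
    from -1 on.\<close>
  define lev where "lev i = {int i - 1} \<times> positions (int i - 1)" for i
  define \<Delta> where "\<Delta> i = comb (lev i) (cf f)" for i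
  \<comment> \<open>The level energies are of order \<open>w i\<close> squared. Dividing them by
    \<open>w i\<close> leaves a summable sequence, while \<open>w\<close> itself is summable as
    well; Cauchy-Schwarz below needs both.\<close>
  define w where "w i = (2 powr (-s)) ^ i" for i :: nat
  have [simp]: "finite (lev i)" for i by (simp add: lev_def)
  have lev_idx: "lev i \<subseteq> idx" for i by (auto simp: lev_def idx_def)
  have wpos: "0 < w i" for i by (simp add: w_def)
  have "2 powr (-s) < 1" using s by (simp add: powr_less_one)
  then have sw: "summable w" unfolding w_def by (intro summable_geometric) simp
  define W where "W = suminf w"
  have D2: "\<Delta> i \<in> L2_unit" for i unfolding \<Delta>_def by (intro comb_L2) (auto simp: lev_idx)
  have Dm [measurable]: "\<Delta> i \<in> borel_measurable borel" for i using D2 by (rule L2_unit_measurable)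
  have en': "(\<integral>x. (\<Delta> i x)\<^sup>2 \<partial>unif) = energy f (int i - 1)" for i
    unfolding \<Delta>_def using lev_idx
    by (subst integral_comb_sq) (auto simp: lev_def energy_def sum.cartesian_product')
  have en2: "energy f (int i - 1) \<le> L\<^sup>2 * 2 powr (2 * s) * (w i)^2" for i
  proof -
    have "(w i)\<^sup>2 = 2 powr (- 2 * real i * s)"
      by (simp add: w_def powr_power power2_eq_square powr_add[symmetric] algebra_simps)
    then have "L\<^sup>2 * 2 powr (2 * s) * (w i)\<^sup>2 = L\<^sup>2 * (2 powr (2 * s) * 2 powr (- 2 * real i * s))"
      by simp
    also have "\<dots> = L\<^sup>2 * 2 powr (- 2 * of_int (int i - 1) * s)"
      by (simp add: powr_add[symmetric] algebra_simps)
    finally show ?thesis using en[of "int i - 1"] by linarith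
  qed
  define R where "R x = (\<Sum>i. ennreal ((\<Delta> i x)\<^sup>2 / w i))" for x
  have Rm [measurable]: "R \<in> borel_measurable borel" unfolding R_def by measurable
  have "(\<integral>\<^sup>+x. R x \<partial>unif) = (\<Sum>i. \<integral>\<^sup>+x. ennreal ((\<Delta> i x)\<^sup>2 / w i) \<partial>unif)"
    unfolding R_def by (intro nn_integral_suminf) simp
  also have "\<dots> = (\<Sum>i. ennreal (energy f (int i - 1) / w i))"
    using D2 wpos by (subst nn_integral_eq_integral) (auto simp: L2_unit_iff en' less_imp_le)
  also have "\<dots> \<le> (\<Sum>i. ennreal ((L\<^sup>2 * 2 powr (2 * s)) * w i))"
  proof (intro suminf_le ennreal_leI allI)
    fix i show "energy f (int i - 1) / w i \<le> L\<^sup>2 * 2 powr (2 * s) * w i"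
      using en2[of i] wpos[of i] by (simp add: divide_simps power2_eq_square mult_ac)
  qed auto
  also have "\<dots> = ennreal (\<Sum>i. (L\<^sup>2 * 2 powr (2 * s)) * w i)"
    using less_imp_le[OF wpos] sw by (intro suminf_ennreal2) auto
  finally have Rfin: "(\<integral>\<^sup>+x. R x \<partial>unif) < \<infinity>" by (simp add: le_less_trans)
  then have AER: "AE x in unif. R x \<noteq> \<infinity>"
    by (intro nn_integral_noteq_infinite) auto
  define Rr where "Rr x = enn2real (R x)" for x
  have Rrm [measurable]: "Rr \<in> borel_measurable borel" unfolding Rr_def by measurable
  have Rri: "integrable unif Rr"
  proof (rule integrableI_bounded)
    have "(\<integral>\<^sup>+ x. ennreal (norm (Rr x)) \<partial>unif) \<le> (\<integral>\<^sup>+x. R x \<partial>unif)"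
      unfolding Rr_def
    proof (intro nn_integral_mono)
      fix x show "ennreal (norm (enn2real (R x))) \<le> R x" by (cases "R x") auto
    qed
    then show "(\<integral>\<^sup>+ x. ennreal (norm (Rr x)) \<partial>unif) < \<infinity>" using Rfin by simp
  qed simp
  define P where "P J x = (\<Sum>i<J. \<Delta> i x)" for J x
  define g where "g x = (\<Sum>i. \<Delta> i x)" for x
  have gm [measurable]: "g \<in> borel_measurable borel" unfolding g_def by measurable
  have Pm [measurable]: "P J \<in> borel_measurable borel" for J unfolding P_def by measurable
  have Pcomb: "P J = comb (below (int J - 1)) (cf f)" for J
  proof
    fix x
    have "P J x = (\<Sum>i<J. \<Sum>k\<in>positions (int i - 1). cf f (int i - 1, k) * \<psi> (int i - 1) k x)"
      by (simp add: P_def \<Delta>_def comb_def lev_def sum.cartesian_product')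
    also have "\<dots> = (\<Sum>l\<in>{-1..int J - 2}. \<Sum>k\<in>positions l. cf f (l, k) * \<psi> l k x)"
      by (rule sum.reindex_bij_witness[where i="\<lambda>l. nat (l + 1)" and j="\<lambda>i. int i - 1"]) auto
    also have "\<dots> = comb (below (int J - 1)) (cf f) x"
      unfolding comb_def below_def by (subst sum.Sigma) (auto intro!: sum.cong)
    finally show "P J x = comb (below (int J - 1)) (cf f) x" .
  qed
  \<comment> \<open>The bound \<open>W * Rr x\<close> does not depend on J. It dominates all partial
    sums and serves for the limit g itself, for the norms and for the coefficients.\<close>
  have Psq: "(P J x)\<^sup>2 \<le> W * Rr x" and Pconv: "(\<lambda>J. P J x) \<longlonglongrightarrow> g x" if "R x \<noteq> \<infinity>" for J x
  proof -
    have "(\<Sum>i. ennreal ((\<Delta> i x)\<^sup>2 / w i)) \<noteq> \<infinity>" using that by (simp add: R_def)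
    then have sm: "summable (\<lambda>i. (\<Delta> i x)\<^sup>2 / w i)"
      using wpos by (intro summable_suminf_not_top) (auto simp: less_imp_le)
    have Rr: "Rr x = (\<Sum>i. (\<Delta> i x)\<^sup>2 / w i)"
      unfolding Rr_def R_def using sm wpos
      by (subst suminf_ennreal2) (auto simp: less_imp_le intro!: enn2real_ennreal suminf_nonneg)
    have "\<bar>\<Delta> i x\<bar> \<le> w i + (\<Delta> i x)\<^sup>2 / w i" for i
    proof -
      have "w i * \<bar>\<Delta> i x\<bar> \<le> (w i)\<^sup>2 + \<bar>\<Delta> i x\<bar>\<^sup>2"
        using abs_mult_le_sum_sq[of "w i" "\<bar>\<Delta> i x\<bar>"] by simp
      then show ?thesis using wpos[of i] by (simp add: field_simps power2_eq_square)
    qed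
    then have "summable (\<lambda>i. \<Delta> i x)"
      by (intro summable_comparison_test'[OF summable_add[OF sw sm]]) simp
    then show "(\<lambda>J. P J x) \<longlonglongrightarrow> g x"
      unfolding P_def g_def by (rule summable_LIMSEQ)
    have "(P J x)\<^sup>2 = (\<Sum>i<J. sqrt (w i) * (\<Delta> i x / sqrt (w i)))\<^sup>2"
      using wpos by (simp add: P_def less_imp_neq[symmetric])
    also have "\<dots> \<le> (\<Sum>i<J. (sqrt (w i))\<^sup>2) * (\<Sum>i<J. (\<Delta> i x / sqrt (w i))\<^sup>2)"
      by (rule Cauchy_Schwarz_ineq_sum)
    also have "\<dots> = (\<Sum>i<J. w i) * (\<Sum>i<J. (\<Delta> i x)\<^sup>2 / w i)"
      using wpos by (simp add: power_divide less_imp_le)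
    also have "\<dots> \<le> W * Rr x"
      unfolding W_def Rr using sw sm wpos
      by (intro mult_mono sum_le_suminf sum_nonneg suminf_nonneg) (auto simp: less_imp_le)
    finally show "(P J x)\<^sup>2 \<le> W * Rr x" .
  qed
  have PL2: "P J \<in> L2_unit" for J
    unfolding Pcomb by (intro comb_L2) (auto simp: below_subset_idx)
  have gsq: "AE x in unif. (g x)\<^sup>2 \<le> W * Rr x"
    using AER
  proof eventually_elim
    case (elim x)
    have "(\<lambda>J. (P J x)\<^sup>2) \<longlonglongrightarrow> (g x)\<^sup>2" using Pconv[OF elim] by (rule tendsto_power)
    then show ?case by (rule LIMSEQ_le_const2) (use Psq[OF elim] in auto)
  qed
  have g2: "g \<in> L2_unit"
    unfolding L2_unit_iff
  proof safe
    show "integrable unif (\<lambda>x. (g x)\<^sup>2)"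
      by (rule Bochner_Integration.integrable_bound[where f="\<lambda>x. W * Rr x"])
         (use Rri gsq in auto)
  qed (rule gm)
  have lim2: "(\<lambda>J. \<integral>x. (P J x)\<^sup>2 \<partial>unif) \<longlonglongrightarrow> (\<integral>x. (g x)\<^sup>2 \<partial>unif)"
  proof (rule integral_dominated_convergence[where w="\<lambda>x. W * Rr x"])
    show "AE x in unif. (\<lambda>J. (P J x)\<^sup>2) \<longlonglongrightarrow> (g x)\<^sup>2"
      using AER by eventually_elim (rule tendsto_power[OF Pconv])
    show "AE x in unif. norm ((P J x)\<^sup>2) \<le> W * Rr x" for J
      using AER by eventually_elim (use Psq in auto)
  qed (use Rri in auto)
  have cfg: "cf g a = cf f a" if a: "a \<in> idx" for a
  proof -
    have [measurable]: "\<psi> (fst a) (snd a) \<in> borel_measurable borel"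
      using psi_L2[OF a] by (rule L2_unit_measurable)
    have "(\<lambda>J. \<integral>x. P J x * \<psi> (fst a) (snd a) x \<partial>unif)
        \<longlonglongrightarrow> (\<integral>x. g x * \<psi> (fst a) (snd a) x \<partial>unif)"
    proof (rule integral_dominated_convergence[where w="\<lambda>x. W * Rr x + (\<psi> (fst a) (snd a) x)\<^sup>2"])
      show "AE x in unif. (\<lambda>J. P J x * \<psi> (fst a) (snd a) x) \<longlonglongrightarrow> g x * \<psi> (fst a) (snd a) x"
        using AER by eventually_elim (rule tendsto_mult[OF Pconv tendsto_const])
      show "AE x in unif. norm (P J x * \<psi> (fst a) (snd a) x) \<le> W * Rr x + (\<psi> (fst a) (snd a) x)\<^sup>2" for J
        using AER
      proof eventually_elim
        case (elim x)
        show ?case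
          using Psq[OF elim, of J] abs_mult_le_sum_sq[of "P J x" "\<psi> (fst a) (snd a) x"] by simp
      qed
      show "integrable unif (\<lambda>x. W * Rr x + (\<psi> (fst a) (snd a) x)\<^sup>2)"
        using Rri psi_L2[OF a] by (auto simp: L2_unit_iff)
    qed auto
    then have 1: "(\<lambda>J. cf (P J) a) \<longlonglongrightarrow> cf g a"
      using a g2 PL2 by (simp add: cf_unif)
    have ev: "\<forall>\<^sub>F J in sequentially. cf (P J) a = cf f a"
    proof (rule eventually_sequentiallyI[of "nat (fst a + 3)"])
      fix J assume "nat (fst a + 3) \<le> J"
      then have "a \<in> below (int J - 1)" using a by (cases a) (auto simp: below_def idx_def)
      then show "cf (P J) a = cf f a"
        unfolding Pcomb using a by (subst cf_comb) (auto simp: below_subset_idx)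
    qed
    have "(\<lambda>J. cf (P J) a) \<longlonglongrightarrow> cf f a"
      using ev by (rule tendsto_eventually)
    with 1 show ?thesis by (rule LIMSEQ_unique)
  qed
  \<comment> \<open>Completeness of the basis is given in the form that a square-integrable function
    orthogonal to all basis functions has norm zero. It applies to f - g, now that g is
    square-integrable and has the coefficients of f.\<close>
  have d2: "(\<lambda>x. f x - g x) \<in> L2_unit" using f g2 by (rule L2_unit_diff)
  have "L2_inner (\<lambda>x. f x - g x) (\<psi> j k) = 0" if "-1 \<le> j" "k \<in> positions j" for j k
  proof -
    have a: "(j, k) \<in> idx" using that by (auto simp: idx_def)
    have "cf (\<lambda>x. f x - g x) (j, k) = cf f (j, k) - cf g (j, k)"
      using a d2 f g2 psi_L2[OF a] L2_unit_mult_integrable[OF f psi_L2[OF a]]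
        L2_unit_mult_integrable[OF g2 psi_L2[OF a]]
      by (simp add: cf_unif left_diff_distrib)
    then show ?thesis using cfg[OF a] by (simp add: cf_def)
  qed
  then have "L2_norm (\<lambda>x. f x - g x) = 0"
    using onb d2 unfolding orthonormal_basis_def by (elim conjE) simp
  then have "(\<integral>x. (f x - g x)\<^sup>2 \<partial>unif) = 0"
    using L2_norm_sq[OF L2_unit_measurable[OF d2]] by simp
  then have "AE x in unif. (f x - g x)\<^sup>2 = 0"
    using d2 by (subst (asm) integral_nonneg_eq_0_iff_AE) (auto simp: L2_unit_iff)
  then have "(\<integral>x. (f x)\<^sup>2 \<partial>unif) = (\<integral>x. (g x)\<^sup>2 \<partial>unif)"
    using f by (intro integral_cong_AE) auto
  \<comment> \<open>\<open>P J\<close> stops at level J - 2, so the sum over the levels up to J - 1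
    belongs to \<open>Suc J\<close>.\<close>
  moreover have "(\<integral>x. (P (Suc J) x)\<^sup>2 \<partial>unif) = (\<Sum>l\<in>{-1..int J - 1}. energy f l)" for J
  proof -
    have "int (Suc J) - 1 = int J" by simp
    then show ?thesis
      unfolding Pcomb sum_energy by (simp add: integral_comb_sq below_subset_idx)
  qed
  ultimately show ?thesis
    using LIMSEQ_Suc[OF lim2] by simp
qed

end

section \<open>Bias and sup-norm of truncated expansions over a Besov ball\<close>

context onb
begin

text \<open>The squared L2 distance of f from the levels below j (\<open>comb_cf_diff_norm\<close>).
  Written as a difference, it makes splitting off levels pure algebra; \<open>tail_limit\<close>
  identifies it with the series of the remaining energies.\<close>

definition tail :: "(real \<Rightarrow> real) \<Rightarrow> int \<Rightarrow> real" where
  "tail f j = (\<integral>x. (f x)\<^sup>2 \<partial>unif) - (\<Sum>l\<in>{-1..j-1}. energy f l)"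

lemma tail_split:
  assumes "-1 \<le> j" "j \<le> j'"
  shows "tail f j = (\<Sum>l\<in>{j..j'-1}. energy f l) + tail f j'"
proof -
  have "{-1..j'-1} = {-1..j-1} \<union> {j..j'-1}" using assms by auto
  then show ?thesis by (simp add: tail_def sum.union_disjoint)
qed

lemma L2_norm_comb_diff_sq:
  assumes "f \<in> L2_unit"
  shows "(L2_norm (\<lambda>x. comb (below j) c x - f x))\<^sup>2 = (\<Sum>a\<in>below j. (c a - cf f a)\<^sup>2) + tail f j"
proof -
  have "(\<lambda>x. comb (below j) c x - f x) \<in> L2_unit"
    using assms by (intro L2_unit_diff comb_L2) (auto simp: below_subset_idx)
  then show ?thesis
    using assms by (simp add: L2_norm_sq L2_unit_measurable integral_comb_diff_sq below_subset_idx
        tail_def sum_energy)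
qed

text \<open>Both sums use the same coefficients, so only the levels between j and j' survive. The
  selection rule therefore compares empirical energies of these levels with the threshold.\<close>

lemma L2_norm_comb_diff_comb_sq:
  assumes "-1 \<le> j" "j \<le> j'"
  shows "(L2_norm (\<lambda>x. comb (below j) c x - comb (below j') c x))\<^sup>2
    = (\<Sum>l\<in>{j..j'-1}. \<Sum>k\<in>positions l. (c (l, k))\<^sup>2)"
proof -
  have sub: "below j \<subseteq> below j'" using assms by (auto simp: below_def)
  have eq: "below j' - below j = (SIGMA l:{j..j'-1}. positions l)"
    using assms by (auto simp: below_def)
  have eq2: "(comb (below j) c x - comb (below j') c x)\<^sup>2 = (comb (below j' - below j) c x)\<^sup>2" for x
    unfolding comb_def using sub by (simp add: sum_diff power2_commute)
  have "(\<lambda>x. comb (below j) c x - comb (below j') c x) \<in> L2_unit"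
    by (intro L2_unit_diff comb_L2) (auto simp: below_subset_idx)
  then have "(L2_norm (\<lambda>x. comb (below j) c x - comb (below j') c x))\<^sup>2
      = (\<Sum>a\<in>below j' - below j. (c a)\<^sup>2)"
    using below_subset_idx by (subst L2_norm_sq) (auto simp: L2_unit_measurable eq2 intro!: integral_comb_sq)
  then show ?thesis unfolding eq by (subst sum.Sigma) (auto simp: split_def)
qed

lemma tail_limit:
  assumes f: "f \<in> besov_ball \<psi> s L" and s: "0 < s" and L: "0 \<le> L" and j: "-1 \<le> j"
  shows "(\<lambda>J. \<Sum>l\<in>{j..int J - 1}. energy f l) \<longlonglongrightarrow> tail f j"
proof -
  have "(\<lambda>J::nat. \<Sum>l\<in>{-1..int J - 1}. energy f l) \<longlonglongrightarrow> (\<integral>x. (f x)\<^sup>2 \<partial>unif)"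
    using parseval_besov[OF besov_ball_L2[OF f] s L besov_ball_energy[OF f]] .
  then have "(\<lambda>J::nat. (\<Sum>l\<in>{-1..int J - 1}. energy f l) - (\<Sum>l\<in>{-1..j-1}. energy f l))
      \<longlonglongrightarrow> tail f j"
    unfolding tail_def by (intro tendsto_diff tendsto_const)
  moreover have "\<forall>\<^sub>F J in sequentially. (\<Sum>l\<in>{-1..int J - 1}. energy f l) - (\<Sum>l\<in>{-1..j-1}. energy f l)
      = (\<Sum>l\<in>{j..int J - 1}. energy f l)"
  proof (rule eventually_sequentiallyI[of "nat j"])
    fix J assume "nat j \<le> J"
    then have "{-1..int J - 1} = {-1..j-1} \<union> {j..int J - 1}" using j by auto
    then show "(\<Sum>l\<in>{-1..int J - 1}. energy f l) - (\<Sum>l\<in>{-1..j-1}. energy f l)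
      = (\<Sum>l\<in>{j..int J - 1}. energy f l)" by (simp add: sum.union_disjoint)
  qed
  ultimately show ?thesis by (rule Lim_transform_eventually)
qed

lemma tail_nonneg:
  assumes "f \<in> besov_ball \<psi> s L" "0 < s" "0 \<le> L" "-1 \<le> j"
  shows "0 \<le> tail f j"
  by (rule LIMSEQ_le_const[OF tail_limit[OF assms]]) (auto intro!: sum_nonneg energy_nonneg)

text \<open>A geometric series of ratio \<open>2 powr (- 2 * s)\<close>. Its constant is unbounded
  as s tends to 0, which is why uniform constants later require a lower bound \<open>s_low\<close>
  on s.\<close>

lemma tail_le:
  assumes f: "f \<in> besov_ball \<psi> s L" and s: "0 < s" and L: "0 \<le> L" and j: "0 \<le> j"
  shows "tail f j \<le> L\<^sup>2 / (1 - 2 powr (- 2 * s)) * 2 powr (- 2 * of_int j * s)"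
proof (rule LIMSEQ_le_const2[OF tail_limit[OF f s L]])
  define q where "q = 2 powr (- 2 * s)"
  have q: "0 < q" "q < 1" using s by (auto simp: q_def powr_less_one)
  have "(\<Sum>l\<in>{j..int J - 1}. energy f l) \<le> L\<^sup>2 / (1 - q) * 2 powr (- 2 * of_int j * s)" for J
  proof -
    have "(\<Sum>l\<in>{j..int J - 1}. energy f l) \<le> (\<Sum>l\<in>{j..int J - 1}. L\<^sup>2 * 2 powr (- 2 * of_int l * s))"
      using j by (intro sum_mono besov_ball_energy[OF f]) auto
    also have "\<dots> = (\<Sum>i<nat (int J - j). L\<^sup>2 * 2 powr (- 2 * of_int j * s) * q ^ i)"
    proof (rule sum.reindex_bij_witness[where i="\<lambda>i. j + int i" and j="\<lambda>l. nat (l - j)"])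
      fix l assume l: "l \<in> {j..int J - 1}"
      have "q ^ nat (l - j) = 2 powr (- 2 * s * (of_int l - of_int j))"
        using l by (simp add: q_def powr_power mult_ac)
      then show "L\<^sup>2 * 2 powr (- 2 * of_int j * s) * q ^ nat (l - j) = L\<^sup>2 * 2 powr (- 2 * of_int l * s)"
        by (simp add: powr_add[symmetric] algebra_simps)
    qed auto
    also have "\<dots> = L\<^sup>2 * 2 powr (- 2 * of_int j * s) * (\<Sum>i<nat (int J - j). q ^ i)"
      by (rule sum_distrib_left[symmetric])
    also have "\<dots> \<le> L\<^sup>2 * 2 powr (- 2 * of_int j * s) * (1 / (1 - q))"
    proof (rule mult_left_mono)
      have "(\<Sum>i<nat (int J - j). q ^ i) = (1 - q ^ nat (int J - j)) / (1 - q)"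
        using q by (subst sum_gp_strict) auto
      also have "\<dots> \<le> 1 / (1 - q)" using q by (intro divide_right_mono) auto
      finally show "(\<Sum>i<nat (int J - j). q ^ i) \<le> 1 / (1 - q)" .
    qed simp
    finally show ?thesis by (simp add: ac_simps)
  qed
  then show "\<exists>N. \<forall>J\<ge>N. (\<Sum>l\<in>{j..int J - 1}. energy f l)
      \<le> L\<^sup>2 / (1 - 2 powr (- 2 * s)) * 2 powr (- 2 * of_int j * s)"
    unfolding q_def by blast
qed (use j in simp)

text \<open>Level -1 has the Besov weight \<open>2 powr (- 2 * s)\<close>, less than 1, and
  contributes the first summand; the levels from 0 on are the tail.\<close>

lemma besov_ball_norm_le:
  assumes f: "f \<in> besov_ball \<psi> s L" and s: "0 < s" and L: "0 \<le> L"
  shows "(\<integral>x. (f x)\<^sup>2 \<partial>unif) \<le> L\<^sup>2 * (2 powr (2 * s) + 1 / (1 - 2 powr (- 2 * s)))"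
proof -
  have "(\<integral>x. (f x)\<^sup>2 \<partial>unif) = energy f (-1) + tail f 0" by (simp add: tail_def)
  also have "\<dots> \<le> L\<^sup>2 * 2 powr (2 * s) + L\<^sup>2 / (1 - 2 powr (- 2 * s))"
    using besov_ball_energy[OF f, of "-1"] tail_le[OF f s L, of 0] by simp
  finally show ?thesis by (simp add: algebra_simps)
qed

lemma comb_cf_norm_le:
  assumes "f \<in> besov_ball \<psi> s L" "0 < s" "0 \<le> L" "-1 \<le> j"
  shows "(\<integral>x. (comb (below j) (cf f) x)\<^sup>2 \<partial>unif) \<le> (\<integral>x. (f x)\<^sup>2 \<partial>unif)"
  using tail_nonneg[OF assms]
  by (simp add: integral_comb_sq below_subset_idx tail_def sum_energy)

lemma comb_cf_diff_norm:
  assumes "f \<in> L2_unit"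
  shows "(\<integral>x. (f x - comb (below j) (cf f) x)\<^sup>2 \<partial>unif) = tail f j"
  using assms
  by (subst power2_commute) (simp add: integral_comb_diff_sq below_subset_idx tail_def sum_energy)

text \<open>The constant 6 comes from \<open>2 powr (1/4)\<close> being at least 7/6: adding one
  term to six of them gives seven, and seven is at most six times the ratio.\<close>

lemma sum_powr_le:
  fixes q :: real
  assumes "1/4 \<le> q"
  shows "(\<Sum>i<J. 2 powr (real i * q)) \<le> 6 * 2 powr (real J * q)"
proof (induction J)
  case (Suc J)
  have "(7/6 :: real) ^ 4 \<le> (2 powr (1/4)) ^ 4" by (simp add: powr_power) (simp add: power_divide)
  then have "(7/6 :: real) \<le> 2 powr (1/4)"
    by (subst (asm) power_mono_iff) auto
  also have "\<dots> \<le> 2 powr q" using assms by simp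
  finally have "7/6 * 2 powr (real J * q) \<le> 2 powr q * 2 powr (real J * q)"
    by (rule mult_right_mono) simp
  then have "7 * 2 powr (real J * q) \<le> 6 * 2 powr (real (Suc J) * q)"
    by (simp add: powr_add[symmetric] algebra_simps)
  then show ?case using Suc by simp
qed simp

text \<open>Cauchy-Schwarz in level l bounds that level by the root of its energy times
  \<open>Cp * 2 ^ l\<close>, that is, by order \<open>2 powr (l * (1/2 - s))\<close>. Replacing s by
  the smaller s' keeps the exponent at least 1/4, so that the top level dominates the sum with a
  constant that does not depend on s'.\<close>

lemma comb_cf_bounded:
  assumes f: "f \<in> besov_ball \<psi> s L" and L: "0 \<le> L" and s': "s' \<le> s" "s' \<le> 1/4"
    and Cp: "\<And>l x. -1 \<le> l \<Longrightarrow> (\<Sum>k\<in>positions l. (\<psi> l k x)\<^sup>2) \<le> Cp * 2 ^ nat l" and Cp0: "0 \<le> Cp"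
  shows "\<bar>comb (below (int J)) (cf f) x\<bar> \<le> sqrt Cp * L * (2 powr s + 6) * 2 powr (real J * (1/2 - s'))"
proof -
  have lev: "\<bar>\<Sum>k\<in>positions l. cf f (l, k) * \<psi> l k x\<bar> \<le> sqrt Cp * L * (2 powr (- of_int l * s) * sqrt (2 ^ nat l))"
    if "-1 \<le> l" for l
  proof -
    have "(\<Sum>k\<in>positions l. cf f (l, k) * \<psi> l k x)\<^sup>2
        \<le> energy f l * (\<Sum>k\<in>positions l. (\<psi> l k x)\<^sup>2)"
      unfolding energy_def by (rule Cauchy_Schwarz_ineq_sum)
    also have "\<dots> \<le> (L\<^sup>2 * 2 powr (- 2 * of_int l * s)) * (Cp * 2 ^ nat l)"
      using that by (intro mult_mono besov_ball_energy[OF f] Cp) (auto intro!: sum_nonneg)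
    also have "\<dots> = (sqrt Cp * L * (2 powr (- of_int l * s) * sqrt (2 ^ nat l)))\<^sup>2"
      using Cp0 by (simp add: power_mult_distrib powr_power ac_simps)
    finally have "\<bar>\<Sum>k\<in>positions l. cf f (l, k) * \<psi> l k x\<bar>
        \<le> \<bar>sqrt Cp * L * (2 powr (- of_int l * s) * sqrt (2 ^ nat l))\<bar>"
      by (simp add: abs_le_square_iff)
    then show ?thesis using L Cp0 by (simp add: abs_mult)
  qed
  have "comb (below (int J)) (cf f) x = (\<Sum>l\<in>{-1..int J - 1}. \<Sum>k\<in>positions l. cf f (l, k) * \<psi> l k x)"
    unfolding comb_def below_def by (subst sum.Sigma) (auto intro!: sum.cong)
  also have "\<bar>\<dots>\<bar> \<le> (\<Sum>l\<in>{-1..int J - 1}. sqrt Cp * L * (2 powr (- of_int l * s) * sqrt (2 ^ nat l)))"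
    by (rule order_trans[OF sum_abs]) (intro sum_mono lev, auto)
  also have "\<dots> = sqrt Cp * L * (\<Sum>l\<in>{-1..int J - 1}. 2 powr (- of_int l * s) * sqrt (2 ^ nat l))"
    by (simp add: sum_distrib_left)
  finally have 1: "\<bar>comb (below (int J)) (cf f) x\<bar>
      \<le> sqrt Cp * L * (\<Sum>l\<in>{-1..int J - 1}. 2 powr (- of_int l * s) * sqrt (2 ^ nat l))" .
  have "(\<Sum>l\<in>{-1..int J - 1}. 2 powr (- of_int l * s) * sqrt (2 ^ nat l))
      = 2 powr s + (\<Sum>l\<in>{0..int J - 1}. 2 powr (- of_int l * s) * sqrt (2 ^ nat l))"
  proof -
    have "{-1..int J - 1} = insert (-1) {0..int J - 1}" by auto
    then show ?thesis by simp
  qed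
  also have "(\<Sum>l\<in>{0..int J - 1}. 2 powr (- of_int l * s) * sqrt (2 ^ nat l))
      = (\<Sum>i<J. 2 powr (- real i * s) * sqrt (2 ^ i))"
    by (rule sum.reindex_bij_witness[where i=int and j=nat]) auto
  also have "\<dots> \<le> (\<Sum>i<J. 2 powr (real i * (1/2 - s')))"
  proof (rule sum_mono)
    fix i
    have "2 powr (- real i * s) * sqrt (2 ^ i) = 2 powr (real i * (1/2 - s))"
      by (simp add: powr_half_sqrt[symmetric] powr_realpow[symmetric] powr_powr powr_add[symmetric]
          algebra_simps)
    also have "\<dots> \<le> 2 powr (real i * (1/2 - s'))"
      using s' by (simp add: mult_left_mono)
    finally show "2 powr (- real i * s) * sqrt (2 ^ i) \<le> 2 powr (real i * (1/2 - s'))" .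
  qed
  also have "\<dots> \<le> 6 * 2 powr (real J * (1/2 - s'))" using s' by (intro sum_powr_le) simp
  finally have "(\<Sum>l\<in>{-1..int J - 1}. 2 powr (- of_int l * s) * sqrt (2 ^ nat l))
      \<le> 2 powr s + 6 * 2 powr (real J * (1/2 - s'))" by simp
  also have "\<dots> \<le> 2 powr s * 2 powr (real J * (1/2 - s')) + 6 * 2 powr (real J * (1/2 - s'))"
    using s' by (simp add: ge_one_powr_ge_zero)
  finally have 2: "(\<Sum>l\<in>{-1..int J - 1}. 2 powr (- of_int l * s) * sqrt (2 ^ nat l))
      \<le> (2 powr s + 6) * 2 powr (real J * (1/2 - s'))" by (simp add: distrib_right)
  show ?thesis
    using mult_left_mono[OF 2, of "sqrt Cp * L"] L Cp0 1 by (simp add: mult.assoc)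
qed

end

section \<open>Boundedness of the wavelet basis\<close>

text \<open>At a fixed point at most N left edge, N right edge and 2 N + 1 interior functions are
  nonzero. The edge functions are simply all counted; for the interior ones k must lie within N of
  the rescaled point.\<close>

lemma on_interval_sq_sum_le:
  assumes N: "2 * N \<le> 2 ^ j"
    and lf: "\<And>k y. k < N \<Longrightarrow> \<bar>lf k y\<bar> \<le> M" and rt: "\<And>k y. k < N \<Longrightarrow> \<bar>rt k y\<bar> \<le> M"
    and mid: "\<And>y. \<bar>mid y\<bar> \<le> M" and supp: "\<And>y. real N < \<bar>y\<bar> \<Longrightarrow> mid y = 0"
  shows "(\<Sum>k<2 ^ j. (on_interval N lf mid rt j k x)\<^sup>2) \<le> 2 ^ j * (M\<^sup>2 * (4 * real N + 1))"
proof -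
  define y where "y = 2 ^ j * x"
  have M: "0 \<le> M" using mid[of 0] by simp
  have sq: "a\<^sup>2 \<le> M\<^sup>2" if "\<bar>a\<bar> \<le> M" for a using power_mono[OF that, of 2] by simp
  have summand: "(on_interval N lf mid rt j k x)\<^sup>2 \<le> 2 ^ j * (M\<^sup>2 * (of_bool (k < N)
      + of_bool (2 ^ j - N \<le> k) + of_bool (\<bar>y - real k\<bar> \<le> real N)))" if k: "k < 2 ^ j" for k
  proof (cases "x \<in> {0..1}")
    case True
    define v where "v = (if k < N then lf k (2 ^ j * x)
         else if k < 2 ^ j - N then mid (2 ^ j * x - real k)
         else rt (2 ^ j - 1 - k) (2 ^ j * (x - 1)))"
    have eq: "(on_interval N lf mid rt j k x)\<^sup>2 = 2 ^ j * v\<^sup>2"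
      using True by (simp add: on_interval_def v_def[symmetric] power_mult_distrib powr_power powr_realpow)
    consider "k < N" | "\<not> k < N" "k < 2 ^ j - N" | "\<not> k < N" "2 ^ j - N \<le> k" by linarith
    then have "v\<^sup>2 \<le> M\<^sup>2 * (of_bool (k < N) + of_bool (2 ^ j - N \<le> k) + of_bool (\<bar>y - real k\<bar> \<le> real N))"
    proof cases
      case 1
      then have "v\<^sup>2 \<le> M\<^sup>2" using lf by (auto simp: v_def intro!: sq)
      also have "\<dots> \<le> M\<^sup>2 * (of_bool (k < N) + of_bool (2 ^ j - N \<le> k) + of_bool (\<bar>y - real k\<bar> \<le> real N))"
        using 1 M by (auto simp: of_bool_def mult_left_mono)
      finally show ?thesis .
    next
      case 2
      then have v: "v = mid (y - real k)" by (simp add: v_def y_def)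
      show ?thesis
      proof (cases "\<bar>y - real k\<bar> \<le> real N")
        case True
        have "v\<^sup>2 \<le> M\<^sup>2" using mid by (auto simp: v intro!: sq)
        then show ?thesis using True 2 by auto
      next
        case False
        then show ?thesis using supp[of "y - real k"] v by auto
      qed
    next
      case 3
      then have "2 ^ j - 1 - k < N" using k N by linarith
      then have "v\<^sup>2 \<le> M\<^sup>2" using rt[of "2 ^ j - 1 - k"] 3 by (auto simp: v_def intro!: sq)
      also have "\<dots> \<le> M\<^sup>2 * (of_bool (k < N) + of_bool (2 ^ j - N \<le> k) + of_bool (\<bar>y - real k\<bar> \<le> real N))"
        using 3 M by (auto simp: of_bool_def mult_left_mono)
      finally show ?thesis .
    qed
    then show ?thesis unfolding eq by (intro mult_left_mono) auto
  qed (simp add: on_interval_def M)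
  have c1: "(\<Sum>k<2 ^ j. of_bool (k < N)) \<le> real N"
  proof -
    have "(\<Sum>k<2 ^ j. of_bool (k < N)) = real (card ({..<2 ^ j} \<inter> {k. k < N}))" by (simp add: of_bool_def sum.If_cases)
    also have "card ({..<2 ^ j} \<inter> {k. k < N}) \<le> card {..<N}" by (intro card_mono) auto
    finally show ?thesis by simp
  qed
  have c2: "(\<Sum>k<2 ^ j. of_bool (2 ^ j - N \<le> k)) \<le> real N"
  proof -
    have "(\<Sum>k<2 ^ j. of_bool (2 ^ j - N \<le> k)) = real (card ({..<2 ^ j} \<inter> {k. 2 ^ j - N \<le> k}))" by (simp add: of_bool_def sum.If_cases)
    also have "card ({..<2 ^ j} \<inter> {k. 2 ^ j - N \<le> k}) \<le> card {2 ^ j - N..<2 ^ j}" by (intro card_mono) auto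
    finally show ?thesis using N by simp
  qed
  have c3: "(\<Sum>k<2 ^ j. of_bool (\<bar>y - real k\<bar> \<le> real N)) \<le> 2 * real N + 1"
  proof -
    have "(\<Sum>k<2 ^ j. of_bool (\<bar>y - real k\<bar> \<le> real N)) = real (card ({..<2 ^ j} \<inter> {k. \<bar>y - real k\<bar> \<le> real N}))"
      by (simp add: of_bool_def sum.If_cases)
    also have "card ({..<2 ^ j} \<inter> {k. \<bar>y - real k\<bar> \<le> real N}) \<le> card (nat ` {\<lceil>y - N\<rceil>..\<lfloor>y + N\<rfloor>})"
    proof (intro card_mono subsetI)
      fix k assume k: "k \<in> {..<2 ^ j} \<inter> {k. \<bar>y - real k\<bar> \<le> real N}"
      then have "y - N \<le> of_int (int k)" "of_int (int k) \<le> y + N" by (auto simp: abs_if split: if_splits)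
      then have "\<lceil>y - N\<rceil> \<le> int k" "int k \<le> \<lfloor>y + N\<rfloor>"
        unfolding ceiling_le_iff le_floor_iff by blast+
      then have "int k \<in> {\<lceil>y - N\<rceil>..\<lfloor>y + N\<rfloor>}" by simp
      then have "nat (int k) \<in> nat ` {\<lceil>y - N\<rceil>..\<lfloor>y + N\<rfloor>}" by (rule imageI)
      then show "k \<in> nat ` {\<lceil>y - N\<rceil>..\<lfloor>y + N\<rfloor>}" by simp
    qed simp
    also have "\<dots> \<le> card {\<lceil>y - N\<rceil>..\<lfloor>y + N\<rfloor>}" by (rule card_image_le) simp
    also have "\<dots> \<le> nat (2 * int N + 1)"
    proof -
      have "\<lfloor>y + N\<rfloor> = \<lfloor>y\<rfloor> + int N" "\<lceil>y - N\<rceil> = \<lceil>y\<rceil> - int N"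
        using floor_add_int[of y "int N"] ceiling_diff_of_int[of y "int N"] by auto
      moreover have "\<lfloor>y\<rfloor> \<le> \<lceil>y\<rceil>" by (rule floor_le_ceiling)
      ultimately have "\<lfloor>y + N\<rfloor> + 1 - \<lceil>y - N\<rceil> \<le> 2 * int N + 1" by linarith
      then show ?thesis by (simp add: nat_mono)
    qed
    finally show ?thesis by simp
  qed
  have "(\<Sum>k<2 ^ j. (on_interval N lf mid rt j k x)\<^sup>2) \<le> (\<Sum>k<2 ^ j. 2 ^ j * (M\<^sup>2 * (of_bool (k < N)
      + of_bool (2 ^ j - N \<le> k) + of_bool (\<bar>y - real k\<bar> \<le> real N))))"
    by (intro sum_mono summand) auto
  also have "\<dots> = 2 ^ j * (M\<^sup>2 * ((\<Sum>k<2 ^ j. of_bool (k < N))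
      + (\<Sum>k<2 ^ j. of_bool (2 ^ j - N \<le> k)) + (\<Sum>k<2 ^ j. of_bool (\<bar>y - real k\<bar> \<le> real N))))"
    by (simp only: sum_distrib_left[symmetric] sum.distrib)
  also have "\<dots> \<le> 2 ^ j * (M\<^sup>2 * (real N + real N + (2 * real N + 1)))"
    using c1 c2 c3 by (intro mult_left_mono add_mono) auto
  finally show ?thesis by simp
qed

text \<open>The refinement equation in \<open>is_cdv W r\<close> loops as a rewrite rule, so the
  definition must not be unfolded by the simplifier.\<close>

lemma is_cdv_dest:
  assumes "is_cdv W r"
  shows is_cdv_smooth: "times_cont_differentiable r (scaling W)"
    and is_cdv_coarsest: "2 * order_cdv W \<le> 2 ^ coarsest W"
    and is_cdv_orthonormal: "orthonormal_basis (cdv_basis W)"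
    and is_cdv_support: "x \<notin> {1 - real (order_cdv W)..real (order_cdv W)} \<Longrightarrow> scaling W x = 0"
proof -
  have d: "daubechies W" and "times_cont_differentiable r (scaling W)"
    "2 * order_cdv W \<le> 2 ^ coarsest W" "orthonormal_basis (cdv_basis W)"
    using assms unfolding is_cdv_def by - (elim conjE, assumption)+
  then show "times_cont_differentiable r (scaling W)"
    "2 * order_cdv W \<le> 2 ^ coarsest W" "orthonormal_basis (cdv_basis W)" by blast+
  have "\<forall>x. x \<notin> {1 - real (order_cdv W)..real (order_cdv W)} \<longrightarrow> scaling W x = 0"
    using d unfolding daubechies_def Let_def by - (elim conjE, assumption)
  then show "x \<notin> {1 - real (order_cdv W)..real (order_cdv W)} \<Longrightarrow> scaling W x = 0" by blast
qed

text \<open>A continuous function vanishing outside a compact interval. For r = 0 continuity is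
  assumed directly, for r > 0 it follows from the differentiability of the derivative of order
  0.\<close>

lemma cdv_scaling_bounded:
  assumes "is_cdv W r"
  obtains M where "0 \<le> M" "\<And>x. \<bar>scaling W x\<bar> \<le> M"
proof -
  have tcd: "times_cont_differentiable r (scaling W)" by (rule is_cdv_smooth[OF assms])
  have "continuous_on UNIV (scaling W)"
  proof (cases r)
    case 0
    have "continuous_on UNIV ((deriv ^^ r) (scaling W))"
      using tcd unfolding times_cont_differentiable_def by (rule conjunct2)
    then show ?thesis using 0 by simp
  next
    case (Suc r')
    have "\<forall>i<r. (deriv ^^ i) (scaling W) differentiable_on UNIV"
      using tcd unfolding times_cont_differentiable_def by (rule conjunct1)
    then have "0 < r \<longrightarrow> (deriv ^^ 0) (scaling W) differentiable_on UNIV" by (rule spec)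
    then have "scaling W differentiable_on UNIV" using Suc by simp
    then show ?thesis by (rule differentiable_imp_continuous_on)
  qed
  then have "compact (scaling W ` {1 - real (order_cdv W)..real (order_cdv W)})"
    using compact_continuous_image continuous_on_subset[OF _ subset_UNIV] compact_Icc by blast
  then have "bounded (scaling W ` {1 - real (order_cdv W)..real (order_cdv W)})" by (rule compact_imp_bounded)
  then obtain M where "\<forall>y\<in>scaling W ` {1 - real (order_cdv W)..real (order_cdv W)}. norm y \<le> M"
    unfolding bounded_iff by (rule exE)
  then have M: "norm (scaling W x) \<le> M" if "x \<in> {1 - real (order_cdv W)..real (order_cdv W)}" for x
    using that by (auto simp only: ball_simps)
  have "\<bar>scaling W x\<bar> \<le> max M 0" for x
  proof (cases "x \<in> {1 - real (order_cdv W)..real (order_cdv W)}")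
    case True
    then show ?thesis using M[OF True] by simp
  next
    case False
    then have "scaling W x = 0" by (rule is_cdv_support[OF assms])
    then show ?thesis by simp
  qed
  then show ?thesis by (intro that[of "max M 0"]) auto
qed

lemma abs_sum_mult_le:
  fixes c :: "'a \<Rightarrow> real"
  assumes "\<And>a. a \<in> A \<Longrightarrow> \<bar>u a\<bar> \<le> M"
  shows "\<bar>\<Sum>a\<in>A. c a * u a\<bar> \<le> (\<Sum>a\<in>A. \<bar>c a\<bar>) * M"
proof -
  have "\<bar>\<Sum>a\<in>A. c a * u a\<bar> \<le> (\<Sum>a\<in>A. \<bar>c a\<bar> * M)"
    by (rule order_trans[OF sum_abs]) (auto simp: abs_mult intro!: sum_mono mult_left_mono assms)
  then show ?thesis by (simp add: sum_distrib_right)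
qed

text \<open>Adding the bounds of the N edge functions gives one constant for all of them. The
  argument map \<open>e\<close> leaves room for both translates and dilated translates, so edge
  scaling functions and edge wavelets are covered alike.\<close>

lemma cdv_edge_bounded:
  fixes N :: nat
  assumes "\<And>x. \<bar>scaling W x\<bar> \<le> M" "0 \<le> M" "finite A"
  obtains D where "0 \<le> D" "\<And>k x. k < N \<Longrightarrow> \<bar>\<Sum>l\<in>A. c k l * scaling W (e x l)\<bar> \<le> D"
proof
  show "0 \<le> (\<Sum>k<N. (\<Sum>l\<in>A. \<bar>c k l\<bar>) * M)" using assms by (intro sum_nonneg mult_nonneg_nonneg) auto
  fix k x assume k: "k < N"
  have "\<bar>\<Sum>l\<in>A. c k l * scaling W (e x l)\<bar> \<le> (\<Sum>l\<in>A. \<bar>c k l\<bar>) * M"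
    using assms by (intro abs_sum_mult_le) auto
  also have "\<dots> \<le> (\<Sum>k<N. (\<Sum>l\<in>A. \<bar>c k l\<bar>) * M)"
    using assms k by (intro member_le_sum) (auto intro!: mult_nonneg_nonneg sum_nonneg)
  finally show "\<bar>\<Sum>l\<in>A. c k l * scaling W (e x l)\<bar> \<le> (\<Sum>k<N. (\<Sum>l\<in>A. \<bar>c k l\<bar>) * M)" .
qed

lemma ifI_abs: "\<bar>a\<bar> \<le> D \<Longrightarrow> \<bar>b\<bar> \<le> D \<Longrightarrow> \<bar>if P then a else b\<bar> \<le> (D::real)"
  by simp

lemma mother_support:
  assumes W: "is_cdv W r" and x: "real (order_cdv W) < \<bar>x\<bar>"
  shows "mother W x = 0"
proof -
  have "scaling W (2 * x - of_int k) = 0" if k: "k \<in> {1 - int (order_cdv W)..int (order_cdv W)}" for k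
  proof (rule is_cdv_support[OF W])
    have "k \<le> int (order_cdv W)" "1 - int (order_cdv W) \<le> k"
      using k by auto
    then have "real_of_int k \<le> of_int (int (order_cdv W))" "of_int (1 - int (order_cdv W)) \<le> real_of_int k"
      by (simp_all only: of_int_le_iff)
    then show "2 * x - of_int k \<notin> {1 - real (order_cdv W)..real (order_cdv W)}" using x by auto
  qed
  then show ?thesis by (simp add: mother_def)
qed

lemma mother_bounded:
  assumes M: "\<And>x. \<bar>scaling W x\<bar> \<le> M"
  obtains D where "\<And>x. \<bar>mother W x\<bar> \<le> D"
proof
  fix x
  define A where "A = {1 - int (order_cdv W)..int (order_cdv W)}"
  have "\<bar>\<Sum>k\<in>A. ((-1) powi k * lowpass W (1 - k)) * scaling W (2 * x - of_int k)\<bar>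
      \<le> (\<Sum>k\<in>A. \<bar>(-1) powi k * lowpass W (1 - k)\<bar>) * M"
    by (rule abs_sum_mult_le) (rule M)
  then have "sqrt 2 * \<bar>\<Sum>k\<in>A. ((-1) powi k * lowpass W (1 - k)) * scaling W (2 * x - of_int k)\<bar>
      \<le> sqrt 2 * ((\<Sum>k\<in>A. \<bar>(-1) powi k * lowpass W (1 - k)\<bar>) * M)"
    by (rule mult_left_mono) simp
  then show "\<bar>mother W x\<bar> \<le> sqrt 2 * ((\<Sum>k\<in>{1 - int (order_cdv W)..int (order_cdv W)}. \<bar>(-1) powi k * lowpass W (1 - k)\<bar>) * M)"
    unfolding mother_def A_def[symmetric] abs_mult[of "sqrt 2"] by simp
qed

lemma cdv_scaling_sq_sum_le:
  assumes W: "is_cdv W r"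
  obtains C where "0 \<le> C" "\<And>x. (\<Sum>k<2 ^ coarsest W. (cdv_scaling W (coarsest W) k x)\<^sup>2) \<le> 2 ^ coarsest W * C"
proof -
  define N where "N = order_cdv W"
  obtain M where M: "0 \<le> M" "\<And>x. \<bar>scaling W x\<bar> \<le> M" using cdv_scaling_bounded[OF W] by blast
  obtain D1 where D1: "0 \<le> D1" "\<And>k x. k < N \<Longrightarrow>
      \<bar>\<Sum>l\<in>{1 - int N..int N - 1}. left_sc W k l * scaling W (x - of_int l)\<bar> \<le> D1"
    using cdv_edge_bounded[OF M(2,1) finite_atLeastAtMost_int, where N=N and c="left_sc W" and e="\<lambda>x l. x - of_int l"] by blast
  obtain D2 where D2: "0 \<le> D2" "\<And>k x. k < N \<Longrightarrow>
      \<bar>\<Sum>l\<in>{- int N..int N - 2}. right_sc W k l * scaling W (x - of_int l)\<bar> \<le> D2"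
    using cdv_edge_bounded[OF M(2,1) finite_atLeastAtMost_int, where N=N and c="right_sc W" and e="\<lambda>x l. x - of_int l"] by blast
  define D where "D = D1 + D2 + M"
  have D_ge: "D1 \<le> D" "D2 \<le> D" "M \<le> D" and D0: "\<bar>0 :: real\<bar> \<le> D"
    using D1(1) D2(1) M(1) by (simp_all add: D_def)
  have "(\<Sum>k<2 ^ coarsest W. (cdv_scaling W (coarsest W) k x)\<^sup>2) \<le> 2 ^ coarsest W * (D\<^sup>2 * (4 * real N + 1))" for x
    unfolding cdv_scaling_def N_def[symmetric]
  proof (rule on_interval_sq_sum_le)
    show "2 * N \<le> 2 ^ coarsest W" unfolding N_def by (rule is_cdv_coarsest[OF W])
    show "\<bar>left_scaling W k y\<bar> \<le> D" if "k < N" for k y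
      unfolding left_scaling_def N_def[symmetric]
      using D0 order_trans[OF D1(2)[OF that] D_ge(1)] by (rule ifI_abs)
    show "\<bar>right_scaling W k y\<bar> \<le> D" if "k < N" for k y
      unfolding right_scaling_def N_def[symmetric]
      using D0 order_trans[OF D2(2)[OF that] D_ge(2)] by (rule ifI_abs)
    show "\<bar>scaling W y\<bar> \<le> D" for y
      using M(2) D_ge(3) by (rule order_trans)
    show "scaling W y = 0" if "real N < \<bar>y\<bar>" for y
      using that unfolding N_def by (intro is_cdv_support[OF W]) auto
  qed
  moreover have "0 \<le> D\<^sup>2 * (4 * real N + 1)" by (intro mult_nonneg_nonneg) auto
  ultimately show thesis by (rule that[rotated])
qed

lemma cdv_wavelet_sq_sum_le:
  assumes W: "is_cdv W r"
  obtains C where "0 \<le> C" "\<And>j x. coarsest W \<le> j \<Longrightarrow> (\<Sum>k<2 ^ j. (cdv_wavelet W j k x)\<^sup>2) \<le> 2 ^ j * C"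
proof -
  define N where "N = order_cdv W"
  obtain M where M: "0 \<le> M" "\<And>x. \<bar>scaling W x\<bar> \<le> M" using cdv_scaling_bounded[OF W] by blast
  obtain D1 where D1: "0 \<le> D1" "\<And>k x. k < N \<Longrightarrow>
      \<bar>\<Sum>l\<in>{1 - int N..3 * int N - 2}. left_wv W k l * scaling W (2 * x - of_int l)\<bar> \<le> D1"
    using cdv_edge_bounded[OF M(2,1) finite_atLeastAtMost_int, where N=N and c="left_wv W" and e="\<lambda>x l. 2 * x - of_int l"] by blast
  obtain D2 where D2: "0 \<le> D2" "\<And>k x. k < N \<Longrightarrow>
      \<bar>\<Sum>l\<in>{1 - 3 * int N..int N - 2}. right_wv W k l * scaling W (2 * x - of_int l)\<bar> \<le> D2"
    using cdv_edge_bounded[OF M(2,1) finite_atLeastAtMost_int, where N=N and c="right_wv W" and e="\<lambda>x l. 2 * x - of_int l"] by blast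
  obtain D3 where D3: "\<And>x. \<bar>mother W x\<bar> \<le> D3" using mother_bounded[OF M(2)] by blast
  have D30: "0 \<le> D3" by (rule order_trans[OF abs_ge_zero D3])
  define D where "D = D1 + D2 + D3"
  have D_ge: "D1 \<le> D" "D2 \<le> D" "D3 \<le> D" and D0: "\<bar>0 :: real\<bar> \<le> D"
    using D1(1) D2(1) D30 by (simp_all add: D_def)
  have "(\<Sum>k<2 ^ j. (cdv_wavelet W j k x)\<^sup>2) \<le> 2 ^ j * (D\<^sup>2 * (4 * real N + 1))" if j: "coarsest W \<le> j" for j x
    unfolding cdv_wavelet_def N_def[symmetric]
  proof (rule on_interval_sq_sum_le)
    have "2 * N \<le> 2 ^ coarsest W" unfolding N_def by (rule is_cdv_coarsest[OF W])
    also have "(2::nat) ^ coarsest W \<le> 2 ^ j" using j by (intro power_increasing) auto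
    finally show "2 * N \<le> 2 ^ j" .
    show "\<bar>left_wavelet W k y\<bar> \<le> D" if "k < N" for k y
      unfolding left_wavelet_def N_def[symmetric]
      using D0 order_trans[OF D1(2)[OF that] D_ge(1)] by (rule ifI_abs)
    show "\<bar>right_wavelet W k y\<bar> \<le> D" if "k < N" for k y
      unfolding right_wavelet_def N_def[symmetric]
      using D0 order_trans[OF D2(2)[OF that] D_ge(2)] by (rule ifI_abs)
    show "\<bar>mother W y\<bar> \<le> D" for y
      using D3 D_ge(3) by (rule order_trans)
    show "mother W y = 0" if "real N < \<bar>y\<bar>" for y
      using that unfolding N_def by (rule mother_support[OF W])
  qed
  moreover have "0 \<le> D\<^sup>2 * (4 * real N + 1)" by (intro mult_nonneg_nonneg) auto
  ultimately show thesis by (rule that[rotated])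
qed

text \<open>Levels below the coarsest scale hold scaling functions of that scale, whose squares add
  up to order \<open>2 ^ j0\<close> however small the nominal level is. Since \<open>j0\<close> is
  fixed, this factor is absorbed in \<open>Cp\<close>. The map \<open>e\<close> is the position of
  these functions among the \<open>2 ^ j0\<close> scaling functions.\<close>

lemma cdv_basis_sq_sum_le:
  assumes W: "is_cdv W r"
  obtains Cp where "0 < Cp" "\<And>l x. -1 \<le> l \<Longrightarrow> (\<Sum>k\<in>positions l. (cdv_basis W l k x)\<^sup>2) \<le> Cp * 2 ^ nat l"
proof -
  define j0 where "j0 = coarsest W"
  obtain C1 where C1: "0 \<le> C1" "\<And>x. (\<Sum>k<2 ^ j0. (cdv_scaling W j0 k x)\<^sup>2) \<le> 2 ^ j0 * C1"
    unfolding j0_def using cdv_scaling_sq_sum_le[OF W] by blast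
  obtain C2 where C2: "0 \<le> C2" "\<And>j x. j0 \<le> j \<Longrightarrow> (\<Sum>k<2 ^ j. (cdv_wavelet W j k x)\<^sup>2) \<le> 2 ^ j * C2"
    unfolding j0_def using cdv_wavelet_sq_sum_le[OF W] by blast
  define Cp where "Cp = 2 ^ j0 * C1 + C2 + 1"
  have Cp: "2 ^ j0 * C1 \<le> Cp" "C2 \<le> Cp" "0 < Cp"
    using C1(1) C2(1) by (auto simp: Cp_def add_nonneg_pos)
  have "(\<Sum>k\<in>positions l. (cdv_basis W l k x)\<^sup>2) \<le> Cp * 2 ^ nat l" if l: "-1 \<le> l" for l x
  proof (cases "l < int j0")
    case True
    define e where "e k = (if l < 0 then 0 else 2 ^ nat l + k)" for k :: nat
    have inj: "inj_on e (positions l)"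
      by (cases "l < 0") (auto simp: inj_on_def e_def positions_def)
    have sub: "e ` positions l \<subseteq> {..<2 ^ j0}"
    proof (cases "l < 0")
      case True
      then show ?thesis by (auto simp: e_def)
    next
      case False
      have "(2::nat) ^ Suc (nat l) \<le> 2 ^ j0" using True False by (intro power_increasing) auto
      then show ?thesis using False by (auto simp: e_def positions_def)
    qed
    have eq: "cdv_basis W l k = cdv_scaling W j0 (e k)" for k
      using True unfolding cdv_basis_def e_def j0_def by (simp only: if_True)
    have "(\<Sum>k\<in>positions l. (cdv_basis W l k x)\<^sup>2) = (\<Sum>z\<in>e ` positions l. (cdv_scaling W j0 z x)\<^sup>2)"
      unfolding eq using inj by (simp only: sum.reindex o_def)
    also have "\<dots> \<le> (\<Sum>z<2 ^ j0. (cdv_scaling W j0 z x)\<^sup>2)"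
      using sub by (intro sum_mono2) auto
    also have "\<dots> \<le> Cp" by (rule order_trans[OF C1(2) Cp(1)])
    also have "Cp * 1 \<le> Cp * 2 ^ nat l" using Cp(3) by (intro mult_left_mono) auto
    finally show ?thesis by simp
  next
    case False
    then have eq: "cdv_basis W l k = cdv_wavelet W (nat l) k" for k
      unfolding cdv_basis_def j0_def by (simp only: if_False)
    have "(\<Sum>k\<in>positions l. (cdv_basis W l k x)\<^sup>2) \<le> 2 ^ nat l * C2"
      unfolding eq positions_def using False by (intro C2) simp
    also have "\<dots> \<le> 2 ^ nat l * Cp" using Cp(2) by (intro mult_left_mono) auto
    finally show ?thesis by (simp add: mult.commute)
  qed
  with Cp(3) show thesis by (rule that)
qed

section \<open>Moments of centred sums\<close>

context prob_space
begin

lemma fourth_moment_integrable: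
  fixes f :: "'a \<Rightarrow> real"
  assumes "f \<in> borel_measurable M" "integrable M (\<lambda>x. (f x) ^ 4)"
  shows "integrable M (\<lambda>x. (f x)\<^sup>2)" "integrable M f"
proof -
  show 1: "integrable M (\<lambda>x. (f x)\<^sup>2)"
  proof (rule square_integrable_imp_integrable)
    show "integrable M (\<lambda>x. ((f x)\<^sup>2)\<^sup>2)" using assms(2) by (simp add: power_mult[symmetric])
  qed (use assms(1) in simp)
  show "integrable M f"
    using assms(1) 1 by (rule square_integrable_imp_integrable)
qed

text \<open>The cross term vanishes by centring. The nonnegative integral is used because the
  identity is applied inside Tonelli's theorem, with c a function of the remaining
  observations.\<close>

lemma expectation_shifted_sq:
  fixes f :: "'a \<Rightarrow> real"
  assumes [measurable]: "f \<in> borel_measurable M" and f2: "integrable M (\<lambda>x. (f x)\<^sup>2)"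
    and f0: "expectation f = 0"
  shows "(\<integral>\<^sup>+x. ennreal ((c + f x)\<^sup>2) \<partial>M) = ennreal (c\<^sup>2 + expectation (\<lambda>x. (f x)\<^sup>2))"
proof -
  have f1: "integrable M f" using assms(1) f2 by (rule square_integrable_imp_integrable)
  have eq: "(c + f x)\<^sup>2 = c\<^sup>2 + 2 * c * f x + (f x)\<^sup>2" for x by (simp add: power2_sum)
  have "integrable M (\<lambda>x. (c + f x)\<^sup>2)" unfolding eq using f1 f2 by simp
  then have "(\<integral>\<^sup>+x. ennreal ((c + f x)\<^sup>2) \<partial>M) = ennreal (expectation (\<lambda>x. (c + f x)\<^sup>2))"
    by (intro nn_integral_eq_integral) auto
  also have "expectation (\<lambda>x. (c + f x)\<^sup>2) = c\<^sup>2 + expectation (\<lambda>x. (f x)\<^sup>2)"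
    unfolding eq using f1 f2 f0 by (simp add: prob_space)
  finally show ?thesis .
qed

text \<open>Here s is the sum so far, \<zeta> the new vector and c the centring of the old squared
  norm. The new centred squared norm is the old one plus a centred variable, namely twice the inner
  product of s and \<zeta> plus the centred squared norm of \<zeta>. Its square is at most twice the
  sum of the two squares, whence the constants 8 and 2.\<close>

lemma expectation_sq_norm_step:
  fixes \<zeta> :: "'k \<Rightarrow> 'a \<Rightarrow> real" and s :: "'k \<Rightarrow> real"
  assumes Q: "finite Q" and m [measurable]: "\<And>k. k \<in> Q \<Longrightarrow> \<zeta> k \<in> borel_measurable M"
    and i4: "\<And>k. k \<in> Q \<Longrightarrow> integrable M (\<lambda>x. (\<zeta> k x) ^ 4)"
    and c0: "\<And>k. k \<in> Q \<Longrightarrow> expectation (\<zeta> k) = 0"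
  shows "(\<integral>\<^sup>+x. ennreal (((\<Sum>k\<in>Q. (s k + \<zeta> k x)\<^sup>2) - (c + (\<Sum>k\<in>Q. expectation (\<lambda>x. (\<zeta> k x)\<^sup>2))))\<^sup>2) \<partial>M)
    \<le> ennreal (((\<Sum>k\<in>Q. (s k)\<^sup>2) - c)\<^sup>2 + 8 * expectation (\<lambda>x. (\<Sum>k\<in>Q. s k * \<zeta> k x)\<^sup>2)
        + 2 * expectation (\<lambda>x. (\<Sum>k\<in>Q. (\<zeta> k x)\<^sup>2)\<^sup>2))"
proof -
  define X where "X x = (\<Sum>k\<in>Q. s k * \<zeta> k x)" for x
  define V where "V x = (\<Sum>k\<in>Q. (\<zeta> k x)\<^sup>2)" for x
  define d where "d = (\<Sum>k\<in>Q. (s k)\<^sup>2) - c"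
  have i2: "integrable M (\<lambda>x. (\<zeta> k x)\<^sup>2)" and i1: "integrable M (\<zeta> k)" if "k \<in> Q" for k
    using fourth_moment_integrable[OF m[OF that] i4[OF that]] by auto
  have Xm [measurable]: "X \<in> borel_measurable M" and Vm [measurable]: "V \<in> borel_measurable M"
    unfolding X_def V_def by measurable
  have X2: "integrable M (\<lambda>x. (X x)\<^sup>2)"
    unfolding X_def using Q i2 by (intro integrable_sq_sum) (auto simp: power_mult_distrib)
  have V2: "integrable M (\<lambda>x. (V x)\<^sup>2)"
    unfolding V_def using Q i4 by (intro integrable_sq_sum) (auto simp: power_mult[symmetric])
  have X1: "integrable M X" and V1: "integrable M V"
    by (rule square_integrable_imp_integrable[OF Xm X2] square_integrable_imp_integrable[OF Vm V2])+
  have EX: "expectation X = 0" unfolding X_def using i1 c0 by (subst Bochner_Integration.integral_sum) auto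
  have EV: "expectation V = (\<Sum>k\<in>Q. expectation (\<lambda>x. (\<zeta> k x)\<^sup>2))"
    unfolding V_def using i2 by (subst Bochner_Integration.integral_sum) auto
  have eq: "(\<Sum>k\<in>Q. (s k + \<zeta> k x)\<^sup>2) - (c + (\<Sum>k\<in>Q. expectation (\<lambda>x. (\<zeta> k x)\<^sup>2)))
      = d + (2 * X x + (V x - expectation V))" for x
    unfolding EV d_def X_def V_def
    by (simp add: power2_sum sum.distrib sum_distrib_left algebra_simps)
  define U where "U x = 2 * X x + (V x - expectation V)" for x
  have Um [measurable]: "U \<in> borel_measurable M" unfolding U_def by measurable
  have Y2: "integrable M (\<lambda>x. (V x - expectation V)\<^sup>2)"
    using integrable_sq_add[of V M "\<lambda>_. - expectation V"] V2 by simp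
  have U2: "integrable M (\<lambda>x. (U x)\<^sup>2)"
    unfolding U_def using X2 Y2 by (intro integrable_sq_add) (auto simp: power_mult_distrib)
  have EU: "expectation U = 0"
    unfolding U_def using X1 V1 EX by (simp add: prob_space)
  have "expectation (\<lambda>x. (U x)\<^sup>2) \<le> expectation (\<lambda>x. 8 * (X x)\<^sup>2 + 2 * (V x - expectation V)\<^sup>2)"
  proof (rule integral_mono[OF U2])
    fix x
    have "(a + b)\<^sup>2 \<le> 2 * a\<^sup>2 + 2 * b\<^sup>2" for a b :: real
      using sum_squares_bound[of a b] by (simp add: power2_sum)
    from this[of "2 * X x" "V x - expectation V"]
    show "(U x)\<^sup>2 \<le> 8 * (X x)\<^sup>2 + 2 * (V x - expectation V)\<^sup>2" unfolding U_def by (simp add: power_mult_distrib)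
  qed (use X2 Y2 in auto)
  also have "\<dots> = 8 * expectation (\<lambda>x. (X x)\<^sup>2) + 2 * variance V" using X2 Y2 by simp
  also have "variance V \<le> expectation (\<lambda>x. (V x)\<^sup>2)"
    using V1 V2 by (simp add: variance_eq)
  finally have "expectation (\<lambda>x. (U x)\<^sup>2) \<le> 8 * expectation (\<lambda>x. (X x)\<^sup>2) + 2 * expectation (\<lambda>x. (V x)\<^sup>2)"
    by simp
  then show ?thesis
    unfolding eq U_def[symmetric] d_def[symmetric] X_def[symmetric] V_def[symmetric]
    by (subst expectation_shifted_sq) (auto simp: U2 EU simp del: ennreal_plus intro!: ennreal_leI)
qed

text \<open>Coordinate k collects only the observations in \<open>A k\<close>, because in the upper
  levels different coefficients come from different subgroups of machines. The index set
  \<open>I\<close> is a parameter so that observations can be added one at a time.\<close>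

definition sum_on :: "('k \<Rightarrow> 'i set) \<Rightarrow> ('k \<Rightarrow> 'a \<Rightarrow> real) \<Rightarrow> 'i set \<Rightarrow> 'k \<Rightarrow> ('i \<Rightarrow> 'a) \<Rightarrow> real" where
  "sum_on A \<phi> I k \<omega> = (\<Sum>a\<in>I \<inter> A k. \<phi> k (\<omega> a))"

lemma sum_on_measurable [measurable]:
  assumes [measurable]: "\<phi> k \<in> borel_measurable M"
  shows "sum_on A \<phi> I k \<in> borel_measurable (Pi\<^sub>M I (\<lambda>_. M))"
proof -
  have "(\<lambda>\<omega>. \<phi> k (\<omega> a)) \<in> borel_measurable (Pi\<^sub>M I (\<lambda>_. M))" if "a \<in> I" for a
    using that by measurable
  then show ?thesis
    unfolding sum_on_def[abs_def] by (intro borel_measurable_sum) auto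
qed

lemma sum_on_insert:
  assumes "finite I" "b \<notin> I"
  shows "sum_on A \<phi> (insert b I) k (fun_upd \<omega> b y) = sum_on A \<phi> I k \<omega> + of_bool (b \<in> A k) * \<phi> k y"
proof -
  have "(\<Sum>a\<in>I \<inter> A k. \<phi> k (fun_upd \<omega> b y a)) = (\<Sum>a\<in>I \<inter> A k. \<phi> k (\<omega> a))"
    using assms by (intro sum.cong) auto
  then show ?thesis
    using assms by (cases "b \<in> A k") (auto simp: sum_on_def)
qed

lemma prob_space_PiM_const: "prob_space (Pi\<^sub>M I (\<lambda>_. M))"
  by (rule prob_space_PiM) (rule prob_space_axioms)

lemma product_sigma_finite_const: "product_sigma_finite (\<lambda>_. M)"
  by unfold_locales

lemma nn_integral_sum_on_sq:
  assumes "finite I" and [measurable]: "\<phi> k \<in> borel_measurable M"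
    and i2: "integrable M (\<lambda>x. (\<phi> k x)\<^sup>2)" and c0: "expectation (\<phi> k) = 0"
  shows "(\<integral>\<^sup>+\<omega>. ennreal ((sum_on A \<phi> I k \<omega>)\<^sup>2) \<partial>Pi\<^sub>M I (\<lambda>_. M))
    = ennreal (real (card (I \<inter> A k)) * expectation (\<lambda>x. (\<phi> k x)\<^sup>2))"
  using assms(1)
proof (induction I)
  case empty
  show ?case by (simp add: sum_on_def)
next
  case (insert b I)
  interpret P: prob_space "Pi\<^sub>M I (\<lambda>_. M)" by (rule prob_space_PiM_const)
  define e where "e = expectation (\<lambda>x. (\<phi> k x)\<^sup>2)"
  have e0: "0 \<le> e" by (simp add: e_def)
  define u :: real where "u = of_bool (b \<in> A k)"
  have "(\<integral>\<^sup>+\<omega>. ennreal ((sum_on A \<phi> (insert b I) k \<omega>)\<^sup>2) \<partial>Pi\<^sub>M (insert b I) (\<lambda>_. M))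
      = (\<integral>\<^sup>+\<omega>. (\<integral>\<^sup>+y. ennreal ((sum_on A \<phi> (insert b I) k (fun_upd \<omega> b y))\<^sup>2) \<partial>M) \<partial>Pi\<^sub>M I (\<lambda>_. M))"
    using insert by (intro product_sigma_finite.product_nn_integral_insert[OF product_sigma_finite_const]) auto
  also have "\<dots> = (\<integral>\<^sup>+\<omega>. (\<integral>\<^sup>+y. ennreal ((sum_on A \<phi> I k \<omega> + u * \<phi> k y)\<^sup>2) \<partial>M) \<partial>Pi\<^sub>M I (\<lambda>_. M))"
    using insert by (simp add: sum_on_insert u_def)
  also have "\<dots> = (\<integral>\<^sup>+\<omega>. ennreal ((sum_on A \<phi> I k \<omega>)\<^sup>2 + u * e) \<partial>Pi\<^sub>M I (\<lambda>_. M))"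
  proof (rule nn_integral_cong)
    fix \<omega>
    have "expectation (\<lambda>x. (u * \<phi> k x)\<^sup>2) = u * e"
      by (simp add: e_def power_mult_distrib u_def)
    then show "(\<integral>\<^sup>+y. ennreal ((sum_on A \<phi> I k \<omega> + u * \<phi> k y)\<^sup>2) \<partial>M) = ennreal ((sum_on A \<phi> I k \<omega>)\<^sup>2 + u * e)"
      using i2 c0 by (subst expectation_shifted_sq) (auto simp: power_mult_distrib)
  qed
  also have "\<dots> = (\<integral>\<^sup>+\<omega>. ennreal ((sum_on A \<phi> I k \<omega>)\<^sup>2) + ennreal (u * e) \<partial>Pi\<^sub>M I (\<lambda>_. M))"
    using e0 by (simp add: u_def ennreal_plus)
  also have "\<dots> = ennreal (real (card (I \<inter> A k)) * e) + ennreal (u * e)"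
    using insert by (subst nn_integral_add) (auto simp: P.emeasure_space_1 e_def)
  also have "\<dots> = ennreal (real (card (I \<inter> A k)) * e + u * e)"
    using e0 by (simp add: u_def ennreal_plus)
  also have "real (card (I \<inter> A k)) * e + u * e = real (card (insert b I \<inter> A k)) * e"
    using insert by (cases "b \<in> A k") (auto simp: u_def algebra_simps)
  finally show ?case unfolding e_def .
qed

text \<open>Adding the observation \<open>b\<close> changes the squared norm of the vector \<open>S\<close> of sums by
  \<open>2 \<langle>S, \<xi>\<^sub>b\<rangle> + |\<xi>\<^sub>b|\<^sup>2\<close>; after centring, these increments are uncorrelated.\<close>

lemma nn_integral_sq_norm_deviation:
  fixes \<phi> :: "'k \<Rightarrow> 'a \<Rightarrow> real" and A :: "'k \<Rightarrow> 'i set"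
  assumes "finite I" and Q: "finite Q" and m [measurable]: "\<And>k. k \<in> Q \<Longrightarrow> \<phi> k \<in> borel_measurable M"
    and i4: "\<And>k. k \<in> Q \<Longrightarrow> integrable M (\<lambda>x. (\<phi> k x) ^ 4)"
    and c0: "\<And>k. k \<in> Q \<Longrightarrow> expectation (\<phi> k) = 0"
    and lam: "\<And>s. expectation (\<lambda>x. (\<Sum>k\<in>Q. s k * \<phi> k x)\<^sup>2) \<le> lam * (\<Sum>k\<in>Q. (s k)\<^sup>2)"
    and lam0: "0 \<le> lam" and e: "\<And>k. k \<in> Q \<Longrightarrow> e k = expectation (\<lambda>x. (\<phi> k x)\<^sup>2)"
    and N: "\<And>k. k \<in> Q \<Longrightarrow> real (card (I \<inter> A k)) \<le> N"
  shows "(\<integral>\<^sup>+\<omega>. ennreal (((\<Sum>k\<in>Q. (sum_on A \<phi> I k \<omega>)\<^sup>2) - (\<Sum>k\<in>Q. real (card (I \<inter> A k)) * e k))\<^sup>2) \<partial>Pi\<^sub>M I (\<lambda>_. M))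
    \<le> ennreal (\<Sum>a\<in>I. 8 * lam * (\<Sum>k\<in>Q. of_bool (a \<in> A k) * (N * e k))
        + 2 * expectation (\<lambda>x. (\<Sum>k\<in>Q. of_bool (a \<in> A k) * (\<phi> k x)\<^sup>2)\<^sup>2))"
  using assms(1) N
proof (induction I)
  case empty
  show ?case by (simp add: sum_on_def)
next
  case (insert b I)
  interpret P: prob_space "Pi\<^sub>M I (\<lambda>_. M)" by (rule prob_space_PiM_const)
  have e0: "0 \<le> e k" if "k \<in> Q" for k using e[OF that] by simp
  have N': "real (card (I \<inter> A k)) \<le> N" if "k \<in> Q" for k
  proof -
    have "card (I \<inter> A k) \<le> card (insert b I \<inter> A k)" using insert.hyps by (intro card_mono) auto
    then show ?thesis using insert.prems[OF that] by simp
  qed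
  define u :: "'k \<Rightarrow> real" where "u k = of_bool (b \<in> A k)" for k
  have u2: "(u k)\<^sup>2 = u k" "(u k) ^ 4 = u k" "0 \<le> u k" for k by (auto simp: u_def)
  define S where "S k \<omega> = sum_on A \<phi> I k \<omega>" for k \<omega>
  define c where "c = (\<Sum>k\<in>Q. real (card (I \<inter> A k)) * e k)"
  define F where "F a = 8 * lam * (\<Sum>k\<in>Q. of_bool (a \<in> A k) * (N * e k))
        + 2 * expectation (\<lambda>x. (\<Sum>k\<in>Q. of_bool (a \<in> A k) * (\<phi> k x)\<^sup>2)\<^sup>2)" for a
  have N0: "0 \<le> N" if "k \<in> Q" for k using N'[OF that] by linarith
  have F0: "0 \<le> F a" for a
    unfolding F_def using lam0 e0 N0 by (intro add_nonneg_nonneg mult_nonneg_nonneg sum_nonneg) auto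
  have Sm [measurable]: "S k \<in> borel_measurable (Pi\<^sub>M I (\<lambda>_. M))" if "k \<in> Q" for k
    unfolding S_def[abs_def] using m[OF that] by measurable
  have cb: "(\<Sum>k\<in>Q. real (card (insert b I \<inter> A k)) * e k) = c + (\<Sum>k\<in>Q. u k * e k)"
    unfolding c_def sum.distrib[symmetric]
    using insert.hyps by (intro sum.cong) (auto simp: u_def algebra_simps)
  have step: "(\<integral>\<^sup>+y. ennreal (((\<Sum>k\<in>Q. (S k \<omega> + u k * \<phi> k y)\<^sup>2) - (c + (\<Sum>k\<in>Q. u k * e k)))\<^sup>2) \<partial>M)
      \<le> ennreal (((\<Sum>k\<in>Q. (S k \<omega>)\<^sup>2) - c)\<^sup>2) + (\<Sum>k\<in>Q. ennreal (8 * lam * u k) * ennreal ((S k \<omega>)\<^sup>2))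
        + ennreal (2 * expectation (\<lambda>x. (\<Sum>k\<in>Q. u k * (\<phi> k x)\<^sup>2)\<^sup>2))" for \<omega>
  proof -
    define \<zeta> where "\<zeta> k y = u k * \<phi> k y" for k y
    have e': "expectation (\<lambda>x. (\<zeta> k x)\<^sup>2) = u k * e k" if "k \<in> Q" for k
      using e[OF that] by (simp add: \<zeta>_def power_mult_distrib u2)
    have "(\<integral>\<^sup>+y. ennreal (((\<Sum>k\<in>Q. (S k \<omega> + \<zeta> k y)\<^sup>2) - (c + (\<Sum>k\<in>Q. expectation (\<lambda>x. (\<zeta> k x)\<^sup>2))))\<^sup>2) \<partial>M)
      \<le> ennreal (((\<Sum>k\<in>Q. (S k \<omega>)\<^sup>2) - c)\<^sup>2 + 8 * expectation (\<lambda>x. (\<Sum>k\<in>Q. S k \<omega> * \<zeta> k x)\<^sup>2)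
        + 2 * expectation (\<lambda>x. (\<Sum>k\<in>Q. (\<zeta> k x)\<^sup>2)\<^sup>2))"
      using Q i4 c0 by (intro expectation_sq_norm_step) (auto simp: \<zeta>_def[abs_def] power_mult_distrib)
    also have "(\<Sum>k\<in>Q. expectation (\<lambda>x. (\<zeta> k x)\<^sup>2)) = (\<Sum>k\<in>Q. u k * e k)"
      by (intro sum.cong) (auto simp: e')
    also have "(\<lambda>x. (\<Sum>k\<in>Q. (\<zeta> k x)\<^sup>2)\<^sup>2) = (\<lambda>x. (\<Sum>k\<in>Q. u k * (\<phi> k x)\<^sup>2)\<^sup>2)"
      by (simp add: \<zeta>_def power_mult_distrib u2)
    \<comment> \<open>The covariance bound \<open>lam\<close> enters here, applied to S restricted
      to the coordinates that receive the observation b; u is an indicator, so it equals its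
      square.\<close>
    also have "expectation (\<lambda>x. (\<Sum>k\<in>Q. S k \<omega> * \<zeta> k x)\<^sup>2) \<le> (\<Sum>k\<in>Q. lam * u k * (S k \<omega>)\<^sup>2)"
      using lam[of "\<lambda>k. S k \<omega> * u k"]
      by (simp add: \<zeta>_def power_mult_distrib u2 sum_distrib_left ac_simps)
    finally have "(\<integral>\<^sup>+y. ennreal (((\<Sum>k\<in>Q. (S k \<omega> + \<zeta> k y)\<^sup>2) - (c + (\<Sum>k\<in>Q. u k * e k)))\<^sup>2) \<partial>M)
      \<le> ennreal (((\<Sum>k\<in>Q. (S k \<omega>)\<^sup>2) - c)\<^sup>2 + 8 * (\<Sum>k\<in>Q. lam * u k * (S k \<omega>)\<^sup>2)
        + 2 * expectation (\<lambda>x. (\<Sum>k\<in>Q. u k * (\<phi> k x)\<^sup>2)\<^sup>2))"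
      by (simp add: ennreal_leI)
    also have "\<dots> = ennreal (((\<Sum>k\<in>Q. (S k \<omega>)\<^sup>2) - c)\<^sup>2) + ennreal (\<Sum>k\<in>Q. 8 * lam * u k * (S k \<omega>)\<^sup>2)
        + ennreal (2 * expectation (\<lambda>x. (\<Sum>k\<in>Q. u k * (\<phi> k x)\<^sup>2)\<^sup>2))"
    proof -
      have "0 \<le> (\<Sum>k\<in>Q. 8 * lam * u k * (S k \<omega>)\<^sup>2)"
        using lam0 u2(3) by (intro sum_nonneg mult_nonneg_nonneg) auto
      then show ?thesis by (simp add: sum_distrib_left mult.assoc)
    qed
    also have "ennreal (\<Sum>k\<in>Q. 8 * lam * u k * (S k \<omega>)\<^sup>2) = (\<Sum>k\<in>Q. ennreal (8 * lam * u k) * ennreal ((S k \<omega>)\<^sup>2))"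
      using lam0 u2(3) by (subst sum_ennreal[symmetric]) (auto simp: ennreal_mult intro!: mult_nonneg_nonneg)
    finally show ?thesis unfolding \<zeta>_def .
  qed
  have "(\<integral>\<^sup>+\<omega>. ennreal (((\<Sum>k\<in>Q. (sum_on A \<phi> (insert b I) k \<omega>)\<^sup>2) - (\<Sum>k\<in>Q. real (card (insert b I \<inter> A k)) * e k))\<^sup>2) \<partial>Pi\<^sub>M (insert b I) (\<lambda>_. M))
      = (\<integral>\<^sup>+\<omega>. (\<integral>\<^sup>+y. ennreal (((\<Sum>k\<in>Q. (sum_on A \<phi> (insert b I) k (fun_upd \<omega> b y))\<^sup>2)
          - (\<Sum>k\<in>Q. real (card (insert b I \<inter> A k)) * e k))\<^sup>2) \<partial>M) \<partial>Pi\<^sub>M I (\<lambda>_. M))"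
    using insert.hyps by (intro product_sigma_finite.product_nn_integral_insert[OF product_sigma_finite_const]) auto
  also have "\<dots> = (\<integral>\<^sup>+\<omega>. (\<integral>\<^sup>+y. ennreal (((\<Sum>k\<in>Q. (S k \<omega> + u k * \<phi> k y)\<^sup>2) - (c + (\<Sum>k\<in>Q. u k * e k)))\<^sup>2) \<partial>M) \<partial>Pi\<^sub>M I (\<lambda>_. M))"
    unfolding cb using insert.hyps by (simp add: sum_on_insert u_def S_def)
  also have "\<dots> \<le> (\<integral>\<^sup>+\<omega>. ennreal (((\<Sum>k\<in>Q. (S k \<omega>)\<^sup>2) - c)\<^sup>2) + (\<Sum>k\<in>Q. ennreal (8 * lam * u k) * ennreal ((S k \<omega>)\<^sup>2))
        + ennreal (2 * expectation (\<lambda>x. (\<Sum>k\<in>Q. u k * (\<phi> k x)\<^sup>2)\<^sup>2)) \<partial>Pi\<^sub>M I (\<lambda>_. M))"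
    by (intro nn_integral_mono step)
  also have "\<dots> = (\<integral>\<^sup>+\<omega>. ennreal (((\<Sum>k\<in>Q. (S k \<omega>)\<^sup>2) - c)\<^sup>2) \<partial>Pi\<^sub>M I (\<lambda>_. M))
        + (\<Sum>k\<in>Q. ennreal (8 * lam * u k) * (\<integral>\<^sup>+\<omega>. ennreal ((S k \<omega>)\<^sup>2) \<partial>Pi\<^sub>M I (\<lambda>_. M)))
        + ennreal (2 * expectation (\<lambda>x. (\<Sum>k\<in>Q. u k * (\<phi> k x)\<^sup>2)\<^sup>2))"
  proof -
    have "(\<integral>\<^sup>+\<omega>. (\<Sum>k\<in>Q. ennreal (8 * lam * u k) * ennreal ((S k \<omega>)\<^sup>2)) \<partial>Pi\<^sub>M I (\<lambda>_. M))
        = (\<Sum>k\<in>Q. ennreal (8 * lam * u k) * (\<integral>\<^sup>+\<omega>. ennreal ((S k \<omega>)\<^sup>2) \<partial>Pi\<^sub>M I (\<lambda>_. M)))"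
      by (subst nn_integral_sum) (auto intro!: sum.cong nn_integral_cmult)
    then show ?thesis
      by (simp add: nn_integral_add P.emeasure_space_1)
  qed
  \<comment> \<open>Once the earlier observations are integrated out, the cross term only needs the
    second moments of the coordinates of S, each at most N times the variance of a single
    observation.\<close>
  also have "\<dots> \<le> ennreal (\<Sum>a\<in>I. F a) + (\<Sum>k\<in>Q. ennreal (8 * lam * u k) * ennreal (N * e k))
        + ennreal (2 * expectation (\<lambda>x. (\<Sum>k\<in>Q. u k * (\<phi> k x)\<^sup>2)\<^sup>2))"
  proof (intro add_mono order_refl sum_mono mult_left_mono)
    show "(\<integral>\<^sup>+\<omega>. ennreal (((\<Sum>k\<in>Q. (S k \<omega>)\<^sup>2) - c)\<^sup>2) \<partial>Pi\<^sub>M I (\<lambda>_. M)) \<le> ennreal (\<Sum>a\<in>I. F a)"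
      unfolding S_def c_def F_def by (rule insert.IH[OF N'])
    fix k assume k: "k \<in> Q"
    have "(\<integral>\<^sup>+\<omega>. ennreal ((S k \<omega>)\<^sup>2) \<partial>Pi\<^sub>M I (\<lambda>_. M)) = ennreal (real (card (I \<inter> A k)) * e k)"
      unfolding S_def e[OF k] using insert.hyps c0[OF k] fourth_moment_integrable[OF m[OF k] i4[OF k]] m[OF k]
      by (intro nn_integral_sum_on_sq) auto
    also have "\<dots> \<le> ennreal (N * e k)"
      using N'[OF k] e0[OF k] by (intro ennreal_leI mult_right_mono)
    finally show "(\<integral>\<^sup>+\<omega>. ennreal ((S k \<omega>)\<^sup>2) \<partial>Pi\<^sub>M I (\<lambda>_. M)) \<le> ennreal (N * e k)" .
  qed simp
  also have "(\<Sum>k\<in>Q. ennreal (8 * lam * u k) * ennreal (N * e k)) = ennreal (8 * lam * (\<Sum>k\<in>Q. u k * (N * e k)))"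
    using lam0 u2(3) N0 e0
    by (subst sum_distrib_left, subst sum_ennreal[symmetric])
       (auto simp: ennreal_mult[symmetric] mult.assoc intro!: mult_nonneg_nonneg sum.cong)
  also have "ennreal (\<Sum>a\<in>I. F a) + ennreal (8 * lam * (\<Sum>k\<in>Q. u k * (N * e k)))
        + ennreal (2 * expectation (\<lambda>x. (\<Sum>k\<in>Q. u k * (\<phi> k x)\<^sup>2)\<^sup>2)) = ennreal (\<Sum>a\<in>insert b I. F a)"
  proof -
    have 1: "0 \<le> 8 * lam * (\<Sum>k\<in>Q. u k * (N * e k))"
      using lam0 u2(3) N0 e0 by (intro mult_nonneg_nonneg sum_nonneg) auto
    have 2: "0 \<le> 2 * expectation (\<lambda>x. (\<Sum>k\<in>Q. u k * (\<phi> k x)\<^sup>2)\<^sup>2)" by simp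
    have "F b = 8 * lam * (\<Sum>k\<in>Q. u k * (N * e k)) + 2 * expectation (\<lambda>x. (\<Sum>k\<in>Q. u k * (\<phi> k x)\<^sup>2)\<^sup>2)"
      unfolding F_def u_def ..
    then show ?thesis
      using insert.hyps 1 2 F0 by (simp add: ennreal_plus[symmetric] sum_nonneg add.commute add.left_commute del: ennreal_plus)
  qed
  finally show ?case unfolding F_def .
qed

text \<open>An observation may serve some coordinates only. In the fourth-moment term one of the two
  factors is enlarged to the full squared norm V before summing over the observations; then every
  coordinate is counted exactly N times and the sum is N times the second moment of V, however the
  sets \<open>A k\<close> overlap.\<close>

lemma nn_integral_sq_norm_deviation_equal:
  fixes \<phi> :: "'k \<Rightarrow> 'a \<Rightarrow> real" and A :: "'k \<Rightarrow> 'i set" and N :: nat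
  assumes I: "finite I" and Q: "finite Q" and m [measurable]: "\<And>k. k \<in> Q \<Longrightarrow> \<phi> k \<in> borel_measurable M"
    and i4: "\<And>k. k \<in> Q \<Longrightarrow> integrable M (\<lambda>x. (\<phi> k x) ^ 4)"
    and c0: "\<And>k. k \<in> Q \<Longrightarrow> expectation (\<phi> k) = 0"
    and lam: "\<And>s. expectation (\<lambda>x. (\<Sum>k\<in>Q. s k * \<phi> k x)\<^sup>2) \<le> lam * (\<Sum>k\<in>Q. (s k)\<^sup>2)"
    and lam0: "0 \<le> lam"
    and A: "\<And>k. k \<in> Q \<Longrightarrow> A k \<subseteq> I" "\<And>k. k \<in> Q \<Longrightarrow> card (A k) = N"
  defines "E \<equiv> (\<Sum>k\<in>Q. expectation (\<lambda>x. (\<phi> k x)\<^sup>2))"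
  shows "(\<integral>\<^sup>+\<omega>. ennreal (((\<Sum>k\<in>Q. (sum_on A \<phi> I k \<omega>)\<^sup>2) - real N * E)\<^sup>2) \<partial>Pi\<^sub>M I (\<lambda>_. M))
    \<le> ennreal (8 * lam * (real N)\<^sup>2 * E + 2 * real N * expectation (\<lambda>x. (\<Sum>k\<in>Q. (\<phi> k x)\<^sup>2)\<^sup>2))"
proof -
  define e where "e k = expectation (\<lambda>x. (\<phi> k x)\<^sup>2)" for k
  have IA: "I \<inter> A k = A k" if "k \<in> Q" for k using A(1)[OF that] by auto
  have sA: "(\<Sum>a\<in>I. of_bool (a \<in> A k) * r) = real N * r" if "k \<in> Q" for k and r :: real
  proof -
    have "(\<Sum>a\<in>I. of_bool (a \<in> A k) * r) = (\<Sum>a\<in>I \<inter> A k. r)"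
      unfolding sum.inter_restrict[OF I] by (intro sum.cong) auto
    then show ?thesis using IA[OF that] A(2)[OF that] by simp
  qed
  have i2: "integrable M (\<lambda>x. (\<phi> k x)\<^sup>2)" if "k \<in> Q" for k
    using fourth_moment_integrable[OF m[OF that] i4[OF that]] by auto
  define V where "V x = (\<Sum>k\<in>Q. (\<phi> k x)\<^sup>2)" for x
  have Vm [measurable]: "V \<in> borel_measurable M" unfolding V_def[abs_def] by measurable
  have V2: "integrable M (\<lambda>x. (V x)\<^sup>2)"
    unfolding V_def using Q i4 by (intro integrable_sq_sum) (auto simp: power_mult[symmetric])
  have iV: "integrable M (\<lambda>x. (\<phi> k x)\<^sup>2 * V x)" if "k \<in> Q" for k
    using that i4[OF that] m[OF that] V2 by (intro integrable_mult_of_sq) (auto simp: power_mult[symmetric])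
  have eN: "(\<Sum>k\<in>Q. real (card (I \<inter> A k)) * e k) = real N * E"
    unfolding E_def sum_distrib_left by (intro sum.cong) (auto simp: IA A(2) e_def)
  have "(\<integral>\<^sup>+\<omega>. ennreal (((\<Sum>k\<in>Q. (sum_on A \<phi> I k \<omega>)\<^sup>2) - real N * E)\<^sup>2) \<partial>Pi\<^sub>M I (\<lambda>_. M))
    \<le> ennreal (\<Sum>a\<in>I. 8 * lam * (\<Sum>k\<in>Q. of_bool (a \<in> A k) * (real N * e k))
        + 2 * expectation (\<lambda>x. (\<Sum>k\<in>Q. of_bool (a \<in> A k) * (\<phi> k x)\<^sup>2)\<^sup>2))"
    unfolding eN[symmetric] using I Q i4 c0 lam lam0 m
    by (intro nn_integral_sq_norm_deviation) (auto simp: e_def IA A(2))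
  also have "\<dots> \<le> ennreal (\<Sum>a\<in>I. 8 * lam * (\<Sum>k\<in>Q. of_bool (a \<in> A k) * (real N * e k))
        + 2 * (\<Sum>k\<in>Q. of_bool (a \<in> A k) * expectation (\<lambda>x. (\<phi> k x)\<^sup>2 * V x)))"
  proof (intro ennreal_leI sum_mono add_left_mono mult_left_mono)
    fix a
    have "expectation (\<lambda>x. (\<Sum>k\<in>Q. of_bool (a \<in> A k) * (\<phi> k x)\<^sup>2)\<^sup>2)
        \<le> expectation (\<lambda>x. \<Sum>k\<in>Q. of_bool (a \<in> A k) * ((\<phi> k x)\<^sup>2 * V x))"
    proof (rule integral_mono)
      show "integrable M (\<lambda>x. (\<Sum>k\<in>Q. of_bool (a \<in> A k) * (\<phi> k x)\<^sup>2)\<^sup>2)"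
        using Q i4 by (intro integrable_sq_sum) (auto simp: power_mult_distrib power_mult[symmetric])
      show "integrable M (\<lambda>x. \<Sum>k\<in>Q. of_bool (a \<in> A k) * ((\<phi> k x)\<^sup>2 * V x))"
        using iV by (intro Bochner_Integration.integrable_sum integrable_mult_right) auto
      fix x
      have "(\<Sum>k\<in>Q. of_bool (a \<in> A k) * (\<phi> k x)\<^sup>2)\<^sup>2
          \<le> (\<Sum>k\<in>Q. of_bool (a \<in> A k) * (\<phi> k x)\<^sup>2) * V x"
        unfolding power2_eq_square[of "sum _ _"] V_def
        by (intro mult_left_mono sum_mono sum_nonneg) auto
      then show "(\<Sum>k\<in>Q. of_bool (a \<in> A k) * (\<phi> k x)\<^sup>2)\<^sup>2
          \<le> (\<Sum>k\<in>Q. of_bool (a \<in> A k) * ((\<phi> k x)\<^sup>2 * V x))"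
        by (simp add: sum_distrib_right mult.assoc)
    qed
    also have "\<dots> = (\<Sum>k\<in>Q. of_bool (a \<in> A k) * expectation (\<lambda>x. (\<phi> k x)\<^sup>2 * V x))"
      using iV by (subst Bochner_Integration.integral_sum) auto
    finally show "expectation (\<lambda>x. (\<Sum>k\<in>Q. of_bool (a \<in> A k) * (\<phi> k x)\<^sup>2)\<^sup>2)
        \<le> (\<Sum>k\<in>Q. of_bool (a \<in> A k) * expectation (\<lambda>x. (\<phi> k x)\<^sup>2 * V x))" .
  qed simp
  also have "(\<Sum>a\<in>I. 8 * lam * (\<Sum>k\<in>Q. of_bool (a \<in> A k) * (real N * e k))
        + 2 * (\<Sum>k\<in>Q. of_bool (a \<in> A k) * expectation (\<lambda>x. (\<phi> k x)\<^sup>2 * V x)))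
      = 8 * lam * (\<Sum>k\<in>Q. \<Sum>a\<in>I. of_bool (a \<in> A k) * (real N * e k))
        + 2 * (\<Sum>k\<in>Q. \<Sum>a\<in>I. of_bool (a \<in> A k) * expectation (\<lambda>x. (\<phi> k x)\<^sup>2 * V x))"
    by (simp only: sum.distrib sum_distrib_left[symmetric] sum.swap[of _ Q I])
  also have "\<dots> = 8 * lam * (\<Sum>k\<in>Q. real N * (real N * e k)) + 2 * (\<Sum>k\<in>Q. real N * expectation (\<lambda>x. (\<phi> k x)\<^sup>2 * V x))"
    by (simp add: sA)
  also have "(\<Sum>k\<in>Q. real N * (real N * e k)) = (real N)\<^sup>2 * E"
    by (simp add: E_def e_def sum_distrib_left power2_eq_square mult.assoc)
  also have "(\<Sum>k\<in>Q. real N * expectation (\<lambda>x. (\<phi> k x)\<^sup>2 * V x)) = real N * expectation (\<lambda>x. (V x)\<^sup>2)"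
  proof -
    have "(V x)\<^sup>2 = (\<Sum>k\<in>Q. (\<phi> k x)\<^sup>2 * V x)" for x
      by (simp add: power2_eq_square V_def sum_distrib_right)
    then show ?thesis using iV by (simp add: sum_distrib_left)
  qed
  finally show ?thesis by (simp add: V_def mult.assoc)
qed

end

section \<open>The observation noise\<close>

definition gauss :: "real measure" where
  "gauss = density lborel (\<lambda>x. ennreal (std_normal_density x))"

lemma sets_gauss [simp, measurable_cong]: "sets gauss = sets borel"
  by (simp add: gauss_def)

lemma space_gauss [simp]: "space gauss = UNIV"
  by (simp add: gauss_def)

lemma prob_space_gauss: "prob_space gauss"
  unfolding gauss_def using prob_space_normal_density[of 1 0] by simp

interpretation gauss: prob_space gauss
  by (rule prob_space_gauss)

definition design :: "(real \<times> real) measure" where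
  "design = unif \<Otimes>\<^sub>M gauss"

lemma gauss_UNIV [simp]: "measure gauss UNIV = 1"
  using gauss.prob_space by simp

lemma unif_UNIV [simp]: "measure unif UNIV = 1"
  using unif.prob_space by simp

interpretation unif_gauss: pair_prob_space unif gauss
  by unfold_locales

interpretation design: prob_space design
  unfolding design_def by unfold_locales

lemma sets_design [simp, measurable_cong]: "sets design = sets (borel \<Otimes>\<^sub>M borel)"
  unfolding design_def by (intro sets_pair_measure_cong) simp_all

lemma gauss_power: "integrable gauss (\<lambda>x. x ^ k)"
  unfolding gauss_def using integrable_std_normal_moment[of k] by (subst integrable_density) auto

lemma gauss_integral_power:
  "(\<integral>x. x ^ k \<partial>gauss) = (\<integral>x. std_normal_density x * x ^ k \<partial>lborel)"
  unfolding gauss_def by (subst integral_density) auto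

lemma gauss_moments:
  "(\<integral>x. x \<partial>gauss) = 0" "(\<integral>x. x\<^sup>2 \<partial>gauss) = 1" "(\<integral>x. x ^ 4 \<partial>gauss) = 3"
  using gauss_integral_power[of 1] gauss_integral_power[of 2] gauss_integral_power[of 4]
    integral_std_normal_moment_odd[of 0] integral_std_normal_moment_even[of 1]
    integral_std_normal_moment_even[of 2]
  by (simp_all add: fact_numeral)

lemma design_product:
  fixes u v :: "real \<Rightarrow> real"
  assumes [measurable]: "u \<in> borel_measurable borel" "v \<in> borel_measurable borel"
    and "integrable unif u" "integrable gauss v"
  shows "integrable design (\<lambda>z. u (fst z) * v (snd z))"
    and "(\<integral>z. u (fst z) * v (snd z) \<partial>design) = (\<integral>x. u x \<partial>unif) * (\<integral>x. v x \<partial>gauss)"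
proof -
  show 1: "integrable design (\<lambda>z. u (fst z) * v (snd z))"
    unfolding design_def
  proof (rule unif_gauss.Fubini_integrable)
    have "(\<lambda>x. \<integral>y. norm (u (fst (x, y)) * v (snd (x, y))) \<partial>gauss) = (\<lambda>x. \<bar>u x\<bar> * (\<integral>y. \<bar>v y\<bar> \<partial>gauss))"
      by (simp add: abs_mult)
    then show "integrable unif (\<lambda>x. \<integral>y. norm (u (fst (x, y)) * v (snd (x, y))) \<partial>gauss)"
      using assms by simp
  qed (use assms in auto)
  show "(\<integral>z. u (fst z) * v (snd z) \<partial>design) = (\<integral>x. u x \<partial>unif) * (\<integral>x. v x \<partial>gauss)"
    using unif_gauss.integral_fst'[of "\<lambda>z. u (fst z) * v (snd z)"] 1 unfolding design_def by simp
qed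

lemma design_fst:
  fixes u :: "real \<Rightarrow> real"
  assumes "u \<in> borel_measurable borel" "integrable unif u"
  shows "integrable design (\<lambda>z. u (fst z))" and "(\<integral>z. u (fst z) \<partial>design) = (\<integral>x. u x \<partial>unif)"
  using design_product[of u "\<lambda>_. 1", OF assms(1) borel_measurable_const assms(2)] by simp_all

lemma design_fst_power:
  fixes u :: "real \<Rightarrow> real"
  assumes "u \<in> borel_measurable borel" "integrable unif u"
  shows "integrable design (\<lambda>z. u (fst z) * snd z ^ k)"
    and "(\<integral>z. u (fst z) * snd z ^ k \<partial>design) = (\<integral>x. u x \<partial>unif) * (\<integral>x. x ^ k \<partial>gauss)"
proof -
  have "(\<lambda>x. x ^ k) \<in> borel_measurable (borel :: real measure)" by simp
  note d = design_product[OF assms(1) this assms(2) gauss_power]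
  show "integrable design (\<lambda>z. u (fst z) * snd z ^ k)" by (rule d(1))
  show "(\<integral>z. u (fst z) * snd z ^ k \<partial>design) = (\<integral>x. u x \<partial>unif) * (\<integral>x. x ^ k \<partial>gauss)" by (rule d(2))
qed

lemma design_fst_snd:
  fixes u :: "real \<Rightarrow> real"
  assumes "u \<in> borel_measurable borel" "integrable unif u"
  shows "integrable design (\<lambda>z. u (fst z) * snd z)" and "(\<integral>z. u (fst z) * snd z \<partial>design) = 0"
proof -
  note d = design_fst_power[OF assms, of 1, unfolded power_one_right]
  show "integrable design (\<lambda>z. u (fst z) * snd z)" by (rule d(1))
  show "(\<integral>z. u (fst z) * snd z \<partial>design) = 0"
    by (rule trans[OF d(2)]) (simp only: gauss_moments(1) mult_zero_right)
qed

section \<open>Flattening the sample space\<close>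

definition obs :: "real \<Rightarrow> (real \<Rightarrow> real) \<Rightarrow> real \<times> real \<Rightarrow> real \<times> real" where
  "obs \<sigma> f0 z = (fst z, f0 (fst z) + \<sigma> * snd z)"

lemma obs_measurable [measurable]:
  assumes [measurable]: "f0 \<in> borel_measurable borel"
  shows "obs \<sigma> f0 \<in> measurable design (borel \<Otimes>\<^sub>M borel)"
  unfolding obs_def[abs_def] by measurable

lemma obs_component_measurable:
  assumes "f0 \<in> borel_measurable borel" "a \<in> J"
  shows "(\<lambda>x. obs \<sigma> f0 (x a)) \<in> measurable (Pi\<^sub>M J (\<lambda>_. design)) (borel \<Otimes>\<^sub>M borel)"
proof -
  have "(\<lambda>x. x a) \<in> measurable (Pi\<^sub>M J (\<lambda>_. design)) design"
    using assms(2) by (rule measurable_component_singleton)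
  then show ?thesis using obs_measurable[OF assms(1)] by (rule measurable_compose)
qed

lemma obs_law_eq: "obs_law \<sigma> f0 = distr design (borel \<Otimes>\<^sub>M borel) (obs \<sigma> f0)"
  unfolding obs_law_def design_def unif_def gauss_def obs_def[abs_def] by (simp add: split_def)

lemma distr_PiM_map:
  assumes "finite I" "prob_space M" and f [measurable]: "f \<in> measurable M N"
  shows "distr (Pi\<^sub>M I (\<lambda>_. M)) (Pi\<^sub>M I (\<lambda>_. N)) (\<lambda>\<omega>. \<lambda>i\<in>I. f (\<omega> i)) = Pi\<^sub>M I (\<lambda>_. distr M N f)"
proof -
  interpret prob_space M by fact
  have pd: "prob_space (distr M N f)" by (rule prob_space_distr) (rule f)
  have "Pi\<^sub>M I (\<lambda>_. distr M (distr M N f) f) = distr (Pi\<^sub>M I (\<lambda>_. M)) (Pi\<^sub>M I (\<lambda>_. distr M N f)) (compose I f)"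
    using assms pd by (intro distr_PiM_finite_prob_space'[symmetric]) auto
  also have "distr M (distr M N f) f = distr M N f" by (rule distr_cong) auto
  also have "distr (Pi\<^sub>M I (\<lambda>_. M)) (Pi\<^sub>M I (\<lambda>_. distr M N f)) (compose I f)
      = distr (Pi\<^sub>M I (\<lambda>_. M)) (Pi\<^sub>M I (\<lambda>_. N)) (\<lambda>\<omega>. \<lambda>i\<in>I. f (\<omega> i))"
    by (rule distr_cong) (auto simp: compose_def restrict_def intro!: sets_PiM_cong)
  finally show ?thesis by simp
qed

text \<open>The law of all pairs (T, \<epsilon>), not (T, X). It does not depend on the signal, so
  the noise of f, of its truncation and of the remainder can be compared at the same outcome; and
  its single index set suits the induction over observations.\<close>

definition flat_design :: "nat \<Rightarrow> nat \<Rightarrow> (nat \<times> nat \<Rightarrow> real \<times> real) measure" where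
  "flat_design m p = Pi\<^sub>M ({..<m} \<times> {..<p}) (\<lambda>_. design)"

definition nest :: "nat \<Rightarrow> nat \<Rightarrow> real \<Rightarrow> (real \<Rightarrow> real) \<Rightarrow> (nat \<times> nat \<Rightarrow> real \<times> real) \<Rightarrow> sample" where
  "nest m p \<sigma> f0 \<omega> = (\<lambda>i\<in>{..<m}. \<lambda>l\<in>{..<p}. obs \<sigma> f0 (\<omega> (i, l)))"

lemma prob_space_flat_design: "prob_space (flat_design m p)"
  unfolding flat_design_def by (intro prob_space_PiM) unfold_locales

lemma nest_measurable [measurable]:
  assumes [measurable]: "f0 \<in> borel_measurable borel"
  shows "nest m p \<sigma> f0 \<in> measurable (flat_design m p) (sample_space m p)"
proof -
  have "(\<lambda>\<omega>. \<omega> (i, l)) \<in> measurable (flat_design m p) design" if "i < m" "l < p" for i l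
    unfolding flat_design_def using that by (intro measurable_component_singleton) auto
  then have "(\<lambda>\<omega>. obs \<sigma> f0 (\<omega> (i, l))) \<in> measurable (flat_design m p) (borel \<Otimes>\<^sub>M borel)" if "i < m" "l < p" for i l
    using that by (intro measurable_compose[OF _ obs_measurable]) auto
  then show ?thesis
    unfolding nest_def[abs_def] sample_space_def local_space_def
    by (intro measurable_restrict) auto
qed

text \<open>The coordinates of the flat product are independent, hence so are the disjoint blocks
  belonging to the machines, and the joint law of the blocks is the product of their laws. Each
  block is in turn a product of copies of \<open>obs_law\<close>. Independence is expressed through
  products over nonempty index sets, hence the positivity of m and p.\<close>

lemma sample_law_flat:
  assumes f0 [measurable]: "f0 \<in> borel_measurable borel" and m: "0 < m" and p: "0 < p"
  shows "sample_law m p \<sigma> f0 = distr (flat_design m p) (sample_space m p) (nest m p \<sigma> f0)"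
proof -
  interpret P: prob_space "flat_design m p" by (rule prob_space_flat_design)
  define I where "I = {..<m} \<times> {..<p}"
  define N :: "(real \<times> real) measure" where "N = borel \<Otimes>\<^sub>M borel"
  have I: "I \<noteq> {}" using m p by (auto simp: I_def)
  have comp: "(\<lambda>\<omega>. \<omega> a) \<in> measurable (flat_design m p) design" if "a \<in> I" for a
    unfolding flat_design_def I_def[symmetric] using that by (rule measurable_component_singleton)
  have "P.indep_vars (\<lambda>_. design) (\<lambda>a \<omega>. \<omega> a) I"
  proof (subst P.indep_vars_iff_distr_eq_PiM'[OF I comp])
    have "distr (flat_design m p) (Pi\<^sub>M I (\<lambda>_. design)) (\<lambda>x. \<lambda>i\<in>I. x i) = flat_design m p"
      unfolding flat_design_def I_def[symmetric]
      by (rule distr_PiM_reindex[where f="\<lambda>i. i" and M="\<lambda>_. design"]) (auto intro: design.prob_space_axioms)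
    also have "\<dots> = (\<Pi>\<^sub>M i\<in>I. distr (flat_design m p) design (\<lambda>\<omega>. \<omega> i))"
      unfolding flat_design_def I_def[symmetric]
      by (intro PiM_cong refl distr_PiM_component[symmetric] design.prob_space_axioms)
    finally show "distr (flat_design m p) (Pi\<^sub>M I (\<lambda>_. design)) (\<lambda>x. \<lambda>i\<in>I. x i)
      = (\<Pi>\<^sub>M i\<in>I. distr (flat_design m p) design (\<lambda>\<omega>. \<omega> i))" .
  qed auto
  then have "P.indep_vars (\<lambda>i. Pi\<^sub>M ({i} \<times> {..<p}) (\<lambda>_. design)) (\<lambda>i \<omega>. restrict (\<lambda>a. \<omega> a) ({i} \<times> {..<p})) {..<m}"
    by (rule P.indep_vars_restrict) (auto simp: I_def disjoint_family_on_def)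
  then have "P.indep_vars (\<lambda>_. local_space p)
      (\<lambda>i \<omega>. (\<lambda>x. \<lambda>l\<in>{..<p}. obs \<sigma> f0 (x (i, l))) (restrict (\<lambda>a. \<omega> a) ({i} \<times> {..<p}))) {..<m}"
    unfolding local_space_def
  proof (rule P.indep_vars_compose2)
    fix i
    show "(\<lambda>x. \<lambda>l\<in>{..<p}. obs \<sigma> f0 (x (i, l)))
        \<in> measurable (Pi\<^sub>M ({i} \<times> {..<p}) (\<lambda>_. design)) (\<Pi>\<^sub>M l\<in>{..<p}. borel \<Otimes>\<^sub>M borel)"
      by (intro measurable_restrict obs_component_measurable f0) auto
  qed
  then have ind0: "P.indep_vars (\<lambda>_. local_space p)
      (\<lambda>i \<omega>. \<lambda>l\<in>{..<p}. obs \<sigma> f0 (restrict (\<lambda>a. \<omega> a) ({i} \<times> {..<p}) (i, l))) {..<m}" .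
  have re: "(\<lambda>l\<in>{..<p}. obs \<sigma> f0 (restrict (\<lambda>a. \<omega> a) ({i} \<times> {..<p}) (i, l)))
      = (\<lambda>l\<in>{..<p}. obs \<sigma> f0 (\<omega> (i, l)))" for i \<omega> by (auto simp: fun_eq_iff)
  have ind: "P.indep_vars (\<lambda>_. local_space p) (\<lambda>i \<omega>. \<lambda>l\<in>{..<p}. obs \<sigma> f0 (\<omega> (i, l))) {..<m}"
    using ind0 unfolding re .
  have d: "distr (flat_design m p) (local_space p) (\<lambda>\<omega>. \<lambda>l\<in>{..<p}. obs \<sigma> f0 (\<omega> (i, l))) = (\<Pi>\<^sub>M l\<in>{..<p}. obs_law \<sigma> f0)"
    if i: "i < m" for i
  proof -
    have re: "distr (flat_design m p) (Pi\<^sub>M {..<p} (\<lambda>_. design)) (\<lambda>\<omega>. \<lambda>l\<in>{..<p}. \<omega> (i, l)) = Pi\<^sub>M {..<p} (\<lambda>_. design)"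
      unfolding flat_design_def using i
      by (intro distr_PiM_reindex[where f="\<lambda>l. (i, l)" and M="\<lambda>_. design"])
         (auto intro: design.prob_space_axioms inj_onI)
    have "(\<Pi>\<^sub>M l\<in>{..<p}. obs_law \<sigma> f0)
        = distr (Pi\<^sub>M {..<p} (\<lambda>_. design)) (Pi\<^sub>M {..<p} (\<lambda>_. N)) (\<lambda>x. \<lambda>l\<in>{..<p}. obs \<sigma> f0 (x l))"
      unfolding obs_law_eq N_def
      by (rule distr_PiM_map[symmetric]) (auto intro: design.prob_space_axioms)
    also have "\<dots> = distr (distr (flat_design m p) (Pi\<^sub>M {..<p} (\<lambda>_. design)) (\<lambda>\<omega>. \<lambda>l\<in>{..<p}. \<omega> (i, l)))
        (Pi\<^sub>M {..<p} (\<lambda>_. N)) (\<lambda>x. \<lambda>l\<in>{..<p}. obs \<sigma> f0 (x l))" unfolding re ..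
    also have "\<dots> = distr (flat_design m p) (Pi\<^sub>M {..<p} (\<lambda>_. N))
        ((\<lambda>x. \<lambda>l\<in>{..<p}. obs \<sigma> f0 (x l)) \<circ> (\<lambda>\<omega>. \<lambda>l\<in>{..<p}. \<omega> (i, l)))"
    proof (rule distr_distr)
      show "(\<lambda>x. \<lambda>l\<in>{..<p}. obs \<sigma> f0 (x l)) \<in> measurable (Pi\<^sub>M {..<p} (\<lambda>_. design)) (Pi\<^sub>M {..<p} (\<lambda>_. N))"
        unfolding N_def
        by (auto intro!: measurable_restrict obs_component_measurable f0)
      show "(\<lambda>\<omega>. \<lambda>l\<in>{..<p}. \<omega> (i, l)) \<in> measurable (flat_design m p) (Pi\<^sub>M {..<p} (\<lambda>_. design))"
        using i by (auto intro!: measurable_restrict comp simp: I_def)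
    qed
    also have "(\<lambda>x. \<lambda>l\<in>{..<p}. obs \<sigma> f0 (x l)) \<circ> (\<lambda>\<omega>. \<lambda>l\<in>{..<p}. \<omega> (i, l))
        = (\<lambda>\<omega>. \<lambda>l\<in>{..<p}. obs \<sigma> f0 (\<omega> (i, l)))" by (auto simp: fun_eq_iff)
    finally show ?thesis unfolding local_space_def N_def by (rule sym)
  qed
  have rv: "(\<lambda>\<omega>. \<lambda>l\<in>{..<p}. obs \<sigma> f0 (\<omega> (i, l))) \<in> measurable (flat_design m p) (local_space p)" if "i \<in> {..<m}" for i
    using ind that unfolding P.indep_vars_def by auto
  have "distr (flat_design m p) (sample_space m p) (nest m p \<sigma> f0)
      = distr (flat_design m p) (\<Pi>\<^sub>M i\<in>{..<m}. local_space p) (\<lambda>\<omega>. \<lambda>i\<in>{..<m}. \<lambda>l\<in>{..<p}. obs \<sigma> f0 (\<omega> (i, l)))"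
    by (simp add: sample_space_def nest_def[abs_def])
  also have "\<dots> = (\<Pi>\<^sub>M i\<in>{..<m}. distr (flat_design m p) (local_space p) (\<lambda>\<omega>. \<lambda>l\<in>{..<p}. obs \<sigma> f0 (\<omega> (i, l))))"
    using P.indep_vars_iff_distr_eq_PiM'[THEN iffD1, OF _ rv ind] m by auto
  also have "\<dots> = sample_law m p \<sigma> f0"
    unfolding sample_law_def using d by (intro PiM_cong) auto
  finally show ?thesis by simp
qed

section \<open>Centred wavelet observations\<close>

definition signal :: "(real \<Rightarrow> real) \<Rightarrow> real \<Rightarrow> real \<times> real \<Rightarrow> real" where
  "signal g \<sigma> z = g (fst z) + \<sigma> * snd z"

lemma signal_measurable [measurable]:
  assumes [measurable]: "g \<in> borel_measurable borel"
  shows "signal g \<sigma> \<in> borel_measurable design"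
  unfolding signal_def[abs_def] by measurable

lemma bounded_mult_integrable:
  fixes f u :: "real \<Rightarrow> real"
  assumes "integrable unif f" and [measurable]: "u \<in> borel_measurable borel" and "\<And>x. \<bar>u x\<bar> \<le> b"
  shows "integrable unif (\<lambda>x. f x * u x)"
proof (rule Bochner_Integration.integrable_bound)
  show "integrable unif (\<lambda>x. f x * b)" using assms(1) by simp
  have "\<bar>f x\<bar> * \<bar>u x\<bar> \<le> \<bar>f x\<bar> * \<bar>b\<bar>" for x
    using order_trans[OF assms(3) abs_ge_self] by (rule mult_left_mono) simp
  then show "AE x in unif. norm (f x * u x) \<le> norm (f x * b)" by (simp add: abs_mult)
qed (use assms(1) in auto)

text \<open>The mixed term vanishes because the Gaussian noise is centred and independent of the
  design. Boundedness of u makes everything integrable for g that is merely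
  square-integrable.\<close>

lemma signal_sq_weighted:
  assumes g: "g \<in> L2_unit" and u [measurable]: "u \<in> borel_measurable borel" and b: "\<And>x. \<bar>u x\<bar> \<le> b"
  shows "integrable design (\<lambda>z. (signal g \<sigma> z)\<^sup>2 * u (fst z))"
    and "(\<integral>z. (signal g \<sigma> z)\<^sup>2 * u (fst z) \<partial>design) = (\<integral>x. ((g x)\<^sup>2 + \<sigma>\<^sup>2) * u x \<partial>unif)"
proof -
  have gm [measurable]: "g \<in> borel_measurable borel" using g by (rule L2_unit_measurable)
  have g2: "integrable unif (\<lambda>x. (g x)\<^sup>2)" using g by (simp add: L2_unit_iff)
  have g1: "integrable unif g" by (rule unif.square_integrable_imp_integrable[OF _ g2]) simp
  have u1: "integrable unif u" by (rule unif.integrable_const_bound[where B=b]) (use b in auto)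
  have i: "integrable unif (\<lambda>x. (g x)\<^sup>2 * u x)" "integrable unif (\<lambda>x. 2 * \<sigma> * (g x * u x))"
    "integrable unif (\<lambda>x. \<sigma>\<^sup>2 * u x)"
    using bounded_mult_integrable[OF g2 u b]
      integrable_mult_right[OF bounded_mult_integrable[OF g1 u b], of "2 * \<sigma>"]
      integrable_mult_right[OF u1, of "\<sigma>\<^sup>2"] by blast+
  have eq: "(signal g \<sigma> z)\<^sup>2 * u (fst z) = (g (fst z))\<^sup>2 * u (fst z)
      + (2 * \<sigma> * (g (fst z) * u (fst z))) * snd z + (\<sigma>\<^sup>2 * u (fst z)) * (snd z)\<^sup>2" for z
    by (simp add: signal_def power2_eq_square algebra_simps)
  have ms: "(\<lambda>x. (g x)\<^sup>2 * u x) \<in> borel_measurable borel" "(\<lambda>x. 2 * \<sigma> * (g x * u x)) \<in> borel_measurable borel"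
    "(\<lambda>x. \<sigma>\<^sup>2 * u x) \<in> borel_measurable borel" by measurable
  note D1 = design_fst[OF ms(1) i(1)]
  note D2 = design_fst_snd[OF ms(2) i(2)]
  note D3 = design_fst_power[OF ms(3) i(3), of 2, unfolded gauss_moments mult_1_right]
  note D12 = Bochner_Integration.integrable_add[OF D1(1) D2(1)]
  show "integrable design (\<lambda>z. (signal g \<sigma> z)\<^sup>2 * u (fst z))"
    unfolding eq by (rule Bochner_Integration.integrable_add[OF D12 D3(1)])
  have "(\<integral>z. (signal g \<sigma> z)\<^sup>2 * u (fst z) \<partial>design) = (\<integral>x. (g x)\<^sup>2 * u x \<partial>unif) + 0 + (\<integral>x. \<sigma>\<^sup>2 * u x \<partial>unif)"
    unfolding eq Bochner_Integration.integral_add[OF D12 D3(1)]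
      Bochner_Integration.integral_add[OF D1(1) D2(1)] D1(2) D2(2) D3(2) ..
  also have "\<dots> = (\<integral>x. ((g x)\<^sup>2 + \<sigma>\<^sup>2) * u x \<partial>unif)"
    unfolding distrib_right using Bochner_Integration.integral_add[OF i(1,3)] by simp
  finally show "(\<integral>z. (signal g \<sigma> z)\<^sup>2 * u (fst z) \<partial>design) = (\<integral>x. ((g x)\<^sup>2 + \<sigma>\<^sup>2) * u x \<partial>unif)" .
qed

text \<open>Estimating the fourth power of g by K^2 times its square leaves the L2 norm, so the
  bound grows like K^2 only. The constants are 8 from the fourth power of a sum and 3 from the
  Gaussian fourth moment.\<close>

lemma signal_fourth:
  assumes g: "g \<in> L2_unit" and K: "\<And>x. \<bar>g x\<bar> \<le> K"
  shows "integrable design (\<lambda>z. (signal g \<sigma> z) ^ 4)"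
    and "(\<integral>z. (signal g \<sigma> z) ^ 4 \<partial>design) \<le> 8 * K\<^sup>2 * (\<integral>x. (g x)\<^sup>2 \<partial>unif) + 24 * \<sigma> ^ 4"
proof -
  have gm [measurable]: "g \<in> borel_measurable borel" using g by (rule L2_unit_measurable)
  have g2: "integrable unif (\<lambda>x. (g x)\<^sup>2)" using g by (simp add: L2_unit_iff)
  have le: "(signal g \<sigma> z) ^ 4 \<le> 8 * K\<^sup>2 * (g (fst z))\<^sup>2 + (8 * \<sigma> ^ 4) * (snd z) ^ 4" for z
  proof -
    have sq: "(a + b)\<^sup>2 \<le> 2 * a\<^sup>2 + 2 * b\<^sup>2" for a b :: real
      using sum_squares_bound[of a b] by (simp add: power2_sum)
    have 4: "x ^ 4 = (x\<^sup>2)\<^sup>2" for x :: real by (simp add: power_mult[symmetric])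
    have "(a + b) ^ 4 \<le> 8 * a ^ 4 + 8 * b ^ 4" for a b :: real
    proof -
      have "((a + b)\<^sup>2)\<^sup>2 \<le> (2 * a\<^sup>2 + 2 * b\<^sup>2)\<^sup>2" using sq by (rule power_mono) simp
      also have "\<dots> \<le> 2 * (2 * a\<^sup>2)\<^sup>2 + 2 * (2 * b\<^sup>2)\<^sup>2" by (rule sq)
      finally show ?thesis unfolding 4 power_mult_distrib by simp
    qed
    from this[of "g (fst z)" "\<sigma> * snd z"]
    have "(signal g \<sigma> z) ^ 4 \<le> 8 * (g (fst z)) ^ 4 + 8 * (\<sigma> * snd z) ^ 4" by (simp add: signal_def)
    moreover have "(g (fst z)) ^ 4 \<le> K\<^sup>2 * (g (fst z))\<^sup>2"
    proof -
      have "(g (fst z))\<^sup>2 \<le> K\<^sup>2" using power_mono[OF K[of "fst z"], of 2] by simp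
      then show ?thesis unfolding 4 power2_eq_square[of "(g (fst z))\<^sup>2"] by (rule mult_right_mono) simp
    qed
    ultimately show ?thesis by (simp add: power_mult_distrib)
  qed
  have ms: "(\<lambda>x. 8 * K\<^sup>2 * (g x)\<^sup>2) \<in> borel_measurable borel"
    "(\<lambda>x. 8 * \<sigma> ^ 4) \<in> borel_measurable (borel :: real measure)" by measurable
  have ints: "integrable unif (\<lambda>x. 8 * K\<^sup>2 * (g x)\<^sup>2)" "integrable unif (\<lambda>x. 8 * \<sigma> ^ 4)"
    using integrable_mult_right[OF g2, of "8 * K\<^sup>2"] by simp_all
  note D1 = design_fst[OF ms(1) ints(1)]
  note D2 = design_fst_power[OF ms(2) ints(2), of 4, unfolded gauss_moments]
  have D: "integrable design (\<lambda>z. 8 * K\<^sup>2 * (g (fst z))\<^sup>2 + (8 * \<sigma> ^ 4) * (snd z) ^ 4)"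
    by (rule Bochner_Integration.integrable_add[OF D1(1) D2(1)])
  show i: "integrable design (\<lambda>z. (signal g \<sigma> z) ^ 4)"
  proof (rule Bochner_Integration.integrable_bound[OF D])
    show "AE z in design. norm ((signal g \<sigma> z) ^ 4) \<le> norm (8 * K\<^sup>2 * (g (fst z))\<^sup>2 + (8 * \<sigma> ^ 4) * (snd z) ^ 4)"
    proof (rule AE_I2)
      fix z
      have "0 \<le> (signal g \<sigma> z) ^ 4" by simp
      then show "norm ((signal g \<sigma> z) ^ 4) \<le> norm (8 * K\<^sup>2 * (g (fst z))\<^sup>2 + (8 * \<sigma> ^ 4) * (snd z) ^ 4)"
        using le[of z] unfolding real_norm_def by linarith
    qed
  qed simp
  have "(\<integral>z. (signal g \<sigma> z) ^ 4 \<partial>design) \<le> (\<integral>z. 8 * K\<^sup>2 * (g (fst z))\<^sup>2 + (8 * \<sigma> ^ 4) * (snd z) ^ 4 \<partial>design)"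
    using i D le by (rule integral_mono)
  also have "\<dots> = 8 * K\<^sup>2 * (\<integral>x. (g x)\<^sup>2 \<partial>unif) + 24 * \<sigma> ^ 4"
    unfolding Bochner_Integration.integral_add[OF D1(1) D2(1)] D1(2) D2(2) by simp
  finally show "(\<integral>z. (signal g \<sigma> z) ^ 4 \<partial>design) \<le> 8 * K\<^sup>2 * (\<integral>x. (g x)\<^sup>2 \<partial>unif) + 24 * \<sigma> ^ 4" .
qed

locale bounded_onb = onb +
  fixes Cp :: real
  assumes Cp_pos: "0 < Cp"
    and Cp: "-1 \<le> l \<Longrightarrow> (\<Sum>k\<in>positions l. (\<psi> l k x)\<^sup>2) \<le> Cp * 2 ^ nat l"
begin

definition noise_coeff :: "(real \<Rightarrow> real) \<Rightarrow> real \<Rightarrow> int \<Rightarrow> nat \<Rightarrow> real \<times> real \<Rightarrow> real" where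
  "noise_coeff g \<sigma> l k z = signal g \<sigma> z * \<psi> l k (fst z) - cf g (l, k)"

context
  fixes l :: int and g :: "real \<Rightarrow> real" and \<sigma> :: real
  assumes l: "-1 \<le> l" and g: "g \<in> L2_unit"
begin

lemma idx_l: "k \<in> positions l \<Longrightarrow> (l, k) \<in> idx"
  using l by (simp add: idx_def)

lemma psi_measurable [measurable]: "k \<in> positions l \<Longrightarrow> \<psi> l k \<in> borel_measurable borel"
  using psi_L2[OF idx_l] by (simp add: L2_unit_measurable)

lemma psi_sq_bound: "k \<in> positions l \<Longrightarrow> (\<psi> l k x)\<^sup>2 \<le> Cp * 2 ^ nat l"
  using member_le_sum[of k "positions l" "\<lambda>k. (\<psi> l k x)\<^sup>2"] Cp[OF l, of x] by simp

lemma psi_bound: "k \<in> positions l \<Longrightarrow> \<bar>\<psi> l k x\<bar> \<le> sqrt (Cp * 2 ^ nat l)"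
  using real_sqrt_le_mono[OF psi_sq_bound] by simp

lemma noise_coeff_measurable [measurable]:
  assumes "k \<in> positions l"
  shows "noise_coeff g \<sigma> l k \<in> borel_measurable design"
  using psi_measurable[OF assms] L2_unit_measurable[OF g]
  unfolding noise_coeff_def[abs_def] by measurable

lemma signal_psi:
  assumes k: "k \<in> positions l"
  shows "integrable design (\<lambda>z. signal g \<sigma> z * \<psi> l k (fst z))"
    and "(\<integral>z. signal g \<sigma> z * \<psi> l k (fst z) \<partial>design) = cf g (l, k)"
    and "integrable design (\<lambda>z. (signal g \<sigma> z * \<psi> l k (fst z))\<^sup>2)"
    and "(\<integral>z. (signal g \<sigma> z * \<psi> l k (fst z))\<^sup>2 \<partial>design) = (\<integral>x. ((g x)\<^sup>2 + \<sigma>\<^sup>2) * (\<psi> l k x)\<^sup>2 \<partial>unif)"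
proof -
  note [measurable] = psi_measurable[OF k] L2_unit_measurable[OF g]
  have gp: "integrable unif (\<lambda>x. g x * \<psi> l k x)"
    using L2_unit_mult_integrable[OF g psi_L2[OF idx_l[OF k]]] by simp
  have p1: "integrable unif (\<lambda>x. \<sigma> * \<psi> l k x)"
    by (intro integrable_mult_right unif.integrable_const_bound[where B="sqrt (Cp * 2 ^ nat l)"])
       (simp_all add: psi_bound[OF k])
  have eq: "signal g \<sigma> z * \<psi> l k (fst z) = g (fst z) * \<psi> l k (fst z) + (\<sigma> * \<psi> l k (fst z)) * snd z" for z
    by (simp add: signal_def algebra_simps)
  have ms: "(\<lambda>x. g x * \<psi> l k x) \<in> borel_measurable borel" "(\<lambda>x. \<sigma> * \<psi> l k x) \<in> borel_measurable borel"
    by measurable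
  note D1 = design_fst[OF ms(1) gp]
  note D2 = design_fst_snd[OF ms(2) p1]
  show "integrable design (\<lambda>z. signal g \<sigma> z * \<psi> l k (fst z))"
    unfolding eq by (rule Bochner_Integration.integrable_add[OF D1(1) D2(1)])
  show "(\<integral>z. signal g \<sigma> z * \<psi> l k (fst z) \<partial>design) = cf g (l, k)"
    unfolding eq Bochner_Integration.integral_add[OF D1(1) D2(1)] D1(2) D2(2)
    using cf_unif[OF g idx_l[OF k]] by simp
  have b: "\<bar>(\<psi> l k x)\<^sup>2\<bar> \<le> Cp * 2 ^ nat l" for x using psi_sq_bound[OF k] by simp
  have um: "(\<lambda>x. (\<psi> l k x)\<^sup>2) \<in> borel_measurable borel" by measurable
  show "integrable design (\<lambda>z. (signal g \<sigma> z * \<psi> l k (fst z))\<^sup>2)"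
    "(\<integral>z. (signal g \<sigma> z * \<psi> l k (fst z))\<^sup>2 \<partial>design) = (\<integral>x. ((g x)\<^sup>2 + \<sigma>\<^sup>2) * (\<psi> l k x)\<^sup>2 \<partial>unif)"
    unfolding power_mult_distrib using signal_sq_weighted[OF g um b] by auto
qed

lemma noise_coeff_mean:
  assumes k: "k \<in> positions l"
  shows "(\<integral>z. noise_coeff g \<sigma> l k z \<partial>design) = 0"
    and "integrable design (\<lambda>z. (noise_coeff g \<sigma> l k z)\<^sup>2)"
    and "(\<integral>z. (noise_coeff g \<sigma> l k z)\<^sup>2 \<partial>design) \<le> (\<integral>x. ((g x)\<^sup>2 + \<sigma>\<^sup>2) * (\<psi> l k x)\<^sup>2 \<partial>unif)"
proof -
  note s = signal_psi[OF k]
  have sm: "(\<lambda>z. signal g \<sigma> z * \<psi> l k (fst z)) \<in> borel_measurable design"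
    using s(1) by (rule borel_measurable_integrable)
  show "(\<integral>z. noise_coeff g \<sigma> l k z \<partial>design) = 0"
    unfolding noise_coeff_def using s(1,2) by (simp add: design.prob_space)
  show "integrable design (\<lambda>z. (noise_coeff g \<sigma> l k z)\<^sup>2)"
    using integrable_sq_add[OF sm, of "\<lambda>_. - cf g (l, k)"] s(3) unfolding noise_coeff_def by simp
  show "(\<integral>z. (noise_coeff g \<sigma> l k z)\<^sup>2 \<partial>design) \<le> (\<integral>x. ((g x)\<^sup>2 + \<sigma>\<^sup>2) * (\<psi> l k x)\<^sup>2 \<partial>unif)"
    using design.variance_eq[OF s(1,3)] unfolding noise_coeff_def s(2,4) by simp
qed

text \<open>Summing over k before integrating, the pointwise bound on the squares of the basis
  functions applies, and g enters only through its L2 norm. This makes second moments available for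
  the unbounded remainder of the signal as well.\<close>

lemma sum_weighted_psi_sq:
  "(\<Sum>k\<in>positions l. \<integral>x. ((g x)\<^sup>2 + \<sigma>\<^sup>2) * (\<psi> l k x)\<^sup>2 \<partial>unif) \<le> Cp * 2 ^ nat l * ((\<integral>x. (g x)\<^sup>2 \<partial>unif) + \<sigma>\<^sup>2)"
proof -
  have g2: "integrable unif (\<lambda>x. (g x)\<^sup>2 + \<sigma>\<^sup>2)" using g by (simp add: L2_unit_iff)
  have i: "integrable unif (\<lambda>x. ((g x)\<^sup>2 + \<sigma>\<^sup>2) * (\<psi> l k x)\<^sup>2)" if k: "k \<in> positions l" for k
  proof (rule bounded_mult_integrable[OF g2])
    show "(\<lambda>x. (\<psi> l k x)\<^sup>2) \<in> borel_measurable borel" using psi_measurable[OF k] by measurable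
    show "\<bar>(\<psi> l k x)\<^sup>2\<bar> \<le> Cp * 2 ^ nat l" for x using psi_sq_bound[OF k] by simp
  qed
  have "(\<Sum>k\<in>positions l. \<integral>x. ((g x)\<^sup>2 + \<sigma>\<^sup>2) * (\<psi> l k x)\<^sup>2 \<partial>unif)
      = (\<integral>x. (\<Sum>k\<in>positions l. ((g x)\<^sup>2 + \<sigma>\<^sup>2) * (\<psi> l k x)\<^sup>2) \<partial>unif)"
    using i by (subst Bochner_Integration.integral_sum) auto
  also have "\<dots> \<le> (\<integral>x. ((g x)\<^sup>2 + \<sigma>\<^sup>2) * (Cp * 2 ^ nat l) \<partial>unif)"
  proof (rule integral_mono)
    show "integrable unif (\<lambda>x. \<Sum>k\<in>positions l. ((g x)\<^sup>2 + \<sigma>\<^sup>2) * (\<psi> l k x)\<^sup>2)" using i by auto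
    show "integrable unif (\<lambda>x. ((g x)\<^sup>2 + \<sigma>\<^sup>2) * (Cp * 2 ^ nat l))" using g2 by simp
    show "(\<Sum>k\<in>positions l. ((g x)\<^sup>2 + \<sigma>\<^sup>2) * (\<psi> l k x)\<^sup>2) \<le> ((g x)\<^sup>2 + \<sigma>\<^sup>2) * (Cp * 2 ^ nat l)" for x
      unfolding sum_distrib_left[symmetric] by (intro mult_left_mono Cp l) simp
  qed
  also have "\<dots> = Cp * 2 ^ nat l * ((\<integral>x. (g x)\<^sup>2 \<partial>unif) + \<sigma>\<^sup>2)"
    using g by (simp add: L2_unit_iff unif.prob_space)
  finally show ?thesis .
qed

lemma sum_noise_coeff_sq:
  "(\<Sum>k\<in>positions l. \<integral>z. (noise_coeff g \<sigma> l k z)\<^sup>2 \<partial>design) \<le> Cp * 2 ^ nat l * ((\<integral>x. (g x)\<^sup>2 \<partial>unif) + \<sigma>\<^sup>2)"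
  by (rule order_trans[OF sum_mono[OF noise_coeff_mean(3)] sum_weighted_psi_sq])

context
  fixes K :: real
  assumes K: "\<And>x. \<bar>g x\<bar> \<le> K"
begin

text \<open>Pointwise, the squared norm of the noise vector is at most a multiple of
  \<open>2 ^ l\<close> times the squared observation, plus a constant from the centring. Squaring
  leads to the fourth moment of the observation and thus to a factor K^2.\<close>

lemma sum_noise_coeff_sq_sq:
  shows "integrable design (\<lambda>z. (\<Sum>k\<in>positions l. (noise_coeff g \<sigma> l k z)\<^sup>2)\<^sup>2)"
    and "(\<integral>z. (\<Sum>k\<in>positions l. (noise_coeff g \<sigma> l k z)\<^sup>2)\<^sup>2 \<partial>design)
      \<le> 8 * (Cp * 2 ^ nat l)\<^sup>2 * (8 * K\<^sup>2 * (\<integral>x. (g x)\<^sup>2 \<partial>unif) + 24 * \<sigma> ^ 4 + ((\<integral>x. (g x)\<^sup>2 \<partial>unif) + \<sigma>\<^sup>2)\<^sup>2)"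
proof -
  define \<Psi> where "\<Psi> = Cp * 2 ^ nat l"
  define E where "E = (\<integral>x. (g x)\<^sup>2 \<partial>unif) + \<sigma>\<^sup>2"
  have \<Psi>: "0 \<le> \<Psi>" using Cp_pos by (simp add: \<Psi>_def)
  have E0: "0 \<le> E" by (simp add: E_def)
  have c2: "(\<Sum>k\<in>positions l. (cf g (l, k))\<^sup>2) \<le> \<Psi> * E"
  proof -
    have "(cf g (l, k))\<^sup>2 \<le> (\<integral>x. ((g x)\<^sup>2 + \<sigma>\<^sup>2) * (\<psi> l k x)\<^sup>2 \<partial>unif)" if k: "k \<in> positions l" for k
    proof -
      note s = signal_psi[OF k]
      have "0 \<le> (\<integral>z. (signal g \<sigma> z * \<psi> l k (fst z) - cf g (l, k))\<^sup>2 \<partial>design)" by simp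
      then show ?thesis using design.variance_eq[OF s(1,3)] unfolding s(2,4) by simp
    qed
    then show ?thesis
      unfolding \<Psi>_def E_def by (rule order_trans[OF sum_mono sum_weighted_psi_sq])
  qed
  have sq: "(a + b)\<^sup>2 \<le> 2 * a\<^sup>2 + 2 * b\<^sup>2" for a b :: real
    using sum_squares_bound[of a b] by (simp add: power2_sum)
  have le: "(\<Sum>k\<in>positions l. (noise_coeff g \<sigma> l k z)\<^sup>2)\<^sup>2 \<le> 8 * \<Psi>\<^sup>2 * (signal g \<sigma> z) ^ 4 + 8 * \<Psi>\<^sup>2 * E\<^sup>2" for z
  proof -
    have "(\<Sum>k\<in>positions l. (noise_coeff g \<sigma> l k z)\<^sup>2)
        \<le> (\<Sum>k\<in>positions l. 2 * ((signal g \<sigma> z)\<^sup>2 * (\<psi> l k (fst z))\<^sup>2) + 2 * (cf g (l, k))\<^sup>2)"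
    proof (rule sum_mono)
      fix k
      show "(noise_coeff g \<sigma> l k z)\<^sup>2 \<le> 2 * ((signal g \<sigma> z)\<^sup>2 * (\<psi> l k (fst z))\<^sup>2) + 2 * (cf g (l, k))\<^sup>2"
        using sq[of "signal g \<sigma> z * \<psi> l k (fst z)" "- cf g (l, k)"]
        unfolding noise_coeff_def power_mult_distrib by simp
    qed
    also have "\<dots> = 2 * ((signal g \<sigma> z)\<^sup>2 * (\<Sum>k\<in>positions l. (\<psi> l k (fst z))\<^sup>2)) + 2 * (\<Sum>k\<in>positions l. (cf g (l, k))\<^sup>2)"
      by (simp only: sum.distrib sum_distrib_left)
    also have "\<dots> \<le> 2 * ((signal g \<sigma> z)\<^sup>2 * \<Psi>) + 2 * (\<Psi> * E)"
      using Cp[OF l] c2 unfolding \<Psi>_def by (intro add_mono mult_left_mono) auto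
    finally have "(\<Sum>k\<in>positions l. (noise_coeff g \<sigma> l k z)\<^sup>2)\<^sup>2 \<le> (2 * ((signal g \<sigma> z)\<^sup>2 * \<Psi>) + 2 * (\<Psi> * E))\<^sup>2"
      by (rule power_mono) (simp add: sum_nonneg)
    also have "\<dots> \<le> 2 * (2 * ((signal g \<sigma> z)\<^sup>2 * \<Psi>))\<^sup>2 + 2 * (2 * (\<Psi> * E))\<^sup>2" by (rule sq)
    also have "\<dots> = 8 * \<Psi>\<^sup>2 * (signal g \<sigma> z) ^ 4 + 8 * \<Psi>\<^sup>2 * E\<^sup>2"
      by (simp add: power_mult_distrib power_mult[symmetric] mult_ac)
    finally show ?thesis .
  qed
  note f4 = signal_fourth[OF g K, where \<sigma>=\<sigma>]
  have D: "integrable design (\<lambda>z. 8 * \<Psi>\<^sup>2 * (signal g \<sigma> z) ^ 4 + 8 * \<Psi>\<^sup>2 * E\<^sup>2)"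
    using f4(1) by simp
  show i: "integrable design (\<lambda>z. (\<Sum>k\<in>positions l. (noise_coeff g \<sigma> l k z)\<^sup>2)\<^sup>2)"
  proof (rule Bochner_Integration.integrable_bound[OF D])
    show "(\<lambda>z. (\<Sum>k\<in>positions l. (noise_coeff g \<sigma> l k z)\<^sup>2)\<^sup>2) \<in> borel_measurable design"
      by measurable
    show "AE z in design. norm ((\<Sum>k\<in>positions l. (noise_coeff g \<sigma> l k z)\<^sup>2)\<^sup>2)
        \<le> norm (8 * \<Psi>\<^sup>2 * (signal g \<sigma> z) ^ 4 + 8 * \<Psi>\<^sup>2 * E\<^sup>2)"
    proof (rule AE_I2)
      fix z show "norm ((\<Sum>k\<in>positions l. (noise_coeff g \<sigma> l k z)\<^sup>2)\<^sup>2)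
        \<le> norm (8 * \<Psi>\<^sup>2 * (signal g \<sigma> z) ^ 4 + 8 * \<Psi>\<^sup>2 * E\<^sup>2)"
        using order_trans[OF le[of z] abs_ge_self] by simp
    qed
  qed
  have "(\<integral>z. (\<Sum>k\<in>positions l. (noise_coeff g \<sigma> l k z)\<^sup>2)\<^sup>2 \<partial>design)
      \<le> (\<integral>z. 8 * \<Psi>\<^sup>2 * (signal g \<sigma> z) ^ 4 + 8 * \<Psi>\<^sup>2 * E\<^sup>2 \<partial>design)"
    using i D le by (rule integral_mono)
  also have "\<dots> = 8 * \<Psi>\<^sup>2 * (\<integral>z. (signal g \<sigma> z) ^ 4 \<partial>design) + 8 * \<Psi>\<^sup>2 * E\<^sup>2"
    using f4(1) by (simp add: design.prob_space)
  also have "\<dots> \<le> 8 * \<Psi>\<^sup>2 * (8 * K\<^sup>2 * (\<integral>x. (g x)\<^sup>2 \<partial>unif) + 24 * \<sigma> ^ 4) + 8 * \<Psi>\<^sup>2 * E\<^sup>2"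
    using f4(2) by (intro add_mono mult_left_mono) auto
  also have "\<dots> = 8 * \<Psi>\<^sup>2 * (8 * K\<^sup>2 * (\<integral>x. (g x)\<^sup>2 \<partial>unif) + 24 * \<sigma> ^ 4 + E\<^sup>2)"
    by (simp only: distrib_left)
  finally show "(\<integral>z. (\<Sum>k\<in>positions l. (noise_coeff g \<sigma> l k z)\<^sup>2)\<^sup>2 \<partial>design)
      \<le> 8 * (Cp * 2 ^ nat l)\<^sup>2 * (8 * K\<^sup>2 * (\<integral>x. (g x)\<^sup>2 \<partial>unif) + 24 * \<sigma> ^ 4 + ((\<integral>x. (g x)\<^sup>2 \<partial>unif) + \<sigma>\<^sup>2)\<^sup>2)"
    unfolding \<Psi>_def E_def .
qed

lemma noise_coeff_fourth_integrable:
  assumes k: "k \<in> positions l"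
  shows "integrable design (\<lambda>z. (noise_coeff g \<sigma> l k z) ^ 4)"
proof (rule Bochner_Integration.integrable_bound[OF sum_noise_coeff_sq_sq(1)])
  show "(\<lambda>z. (noise_coeff g \<sigma> l k z) ^ 4) \<in> borel_measurable design"
    using noise_coeff_measurable[OF k] by measurable
  show "AE z in design. norm ((noise_coeff g \<sigma> l k z) ^ 4) \<le> norm ((\<Sum>k\<in>positions l. (noise_coeff g \<sigma> l k z)\<^sup>2)\<^sup>2)"
  proof (rule AE_I2)
    fix z
    have "(noise_coeff g \<sigma> l k z)\<^sup>2 \<le> (\<Sum>k\<in>positions l. (noise_coeff g \<sigma> l k z)\<^sup>2)"
      using k by (intro member_le_sum) auto
    then have "((noise_coeff g \<sigma> l k z)\<^sup>2)\<^sup>2 \<le> (\<Sum>k\<in>positions l. (noise_coeff g \<sigma> l k z)\<^sup>2)\<^sup>2"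
      by (rule power_mono) simp
    then show "norm ((noise_coeff g \<sigma> l k z) ^ 4) \<le> norm ((\<Sum>k\<in>positions l. (noise_coeff g \<sigma> l k z)\<^sup>2)\<^sup>2)"
      by (simp add: power_mult[symmetric])
  qed
qed

text \<open>By orthonormality T has squared norm equal to that of s, and the variance of the
  observation times T is at most the integral of (g^2 + \<sigma>^2) T^2. So the covariance matrix
  has operator norm at most K^2 + \<sigma>^2, whereas its trace is of order \<open>2 ^ l\<close>;
  this gap is the source of the concentration.\<close>

lemma noise_coeff_form_le:
  "(\<integral>z. (\<Sum>k\<in>positions l. s k * noise_coeff g \<sigma> l k z)\<^sup>2 \<partial>design) \<le> (K\<^sup>2 + \<sigma>\<^sup>2) * (\<Sum>k\<in>positions l. (s k)\<^sup>2)"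
proof -
  define T where "T x = (\<Sum>k\<in>positions l. s k * \<psi> l k x)" for x
  have Tm [measurable]: "T \<in> borel_measurable borel" unfolding T_def[abs_def] by measurable
  define H where "H z = signal g \<sigma> z * T (fst z)" for z
  have Tc: "T = comb ({l} \<times> positions l) (\<lambda>a. s (snd a))"
    by (simp add: T_def[abs_def] comb_def[abs_def] sum.cartesian_product')
  have sub: "{l} \<times> positions l \<subseteq> idx" using idx_l by auto
  have T2: "(\<integral>x. (T x)\<^sup>2 \<partial>unif) = (\<Sum>k\<in>positions l. (s k)\<^sup>2)" and TL: "T \<in> L2_unit"
    unfolding Tc using sub by (auto simp: integral_comb_sq sum.cartesian_product' intro!: comb_L2)
  define b where "b = (\<Sum>k\<in>positions l. \<bar>s k\<bar>) * sqrt (Cp * 2 ^ nat l)"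
  have Tb: "\<bar>T x\<bar> \<le> b" for x
    unfolding T_def b_def by (rule abs_sum_mult_le) (rule psi_bound)
  have Tb2: "\<bar>(T x)\<^sup>2\<bar> \<le> b\<^sup>2" for x using power_mono[OF Tb[of x], of 2] by simp
  have H1: "integrable design H"
  proof -
    have "H = (\<lambda>z. \<Sum>k\<in>positions l. s k * (signal g \<sigma> z * \<psi> l k (fst z)))"
      by (simp add: H_def[abs_def] T_def sum_distrib_left ac_simps)
    then show ?thesis using signal_psi(1) by simp
  qed
  have EH: "(\<integral>z. H z \<partial>design) = (\<Sum>k\<in>positions l. s k * cf g (l, k))"
  proof -
    have "H z = (\<Sum>k\<in>positions l. s k * (signal g \<sigma> z * \<psi> l k (fst z)))" for z
      by (simp add: H_def T_def sum_distrib_left ac_simps)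
    then show ?thesis using signal_psi(1,2) by simp
  qed
  have um: "(\<lambda>x. (T x)\<^sup>2) \<in> borel_measurable borel" by measurable
  have H2: "integrable design (\<lambda>z. (H z)\<^sup>2)"
    and EH2: "(\<integral>z. (H z)\<^sup>2 \<partial>design) = (\<integral>x. ((g x)\<^sup>2 + \<sigma>\<^sup>2) * (T x)\<^sup>2 \<partial>unif)"
    unfolding H_def power_mult_distrib using signal_sq_weighted[OF g um Tb2] by auto
  have "(\<Sum>k\<in>positions l. s k * noise_coeff g \<sigma> l k z) = H z - (\<integral>z. H z \<partial>design)" for z
    unfolding EH unfolding H_def T_def noise_coeff_def
    by (simp add: right_diff_distrib sum_subtractf sum_distrib_left ac_simps)
  then have "(\<integral>z. (\<Sum>k\<in>positions l. s k * noise_coeff g \<sigma> l k z)\<^sup>2 \<partial>design) \<le> (\<integral>x. ((g x)\<^sup>2 + \<sigma>\<^sup>2) * (T x)\<^sup>2 \<partial>unif)"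
    using design.variance_eq[OF H1 H2] EH2 by simp
  also have "\<dots> \<le> (\<integral>x. (K\<^sup>2 + \<sigma>\<^sup>2) * (T x)\<^sup>2 \<partial>unif)"
  proof (rule integral_mono)
    show "integrable unif (\<lambda>x. ((g x)\<^sup>2 + \<sigma>\<^sup>2) * (T x)\<^sup>2)"
      using g um Tb2 by (intro bounded_mult_integrable) (auto simp: L2_unit_iff)
    show "integrable unif (\<lambda>x. (K\<^sup>2 + \<sigma>\<^sup>2) * (T x)\<^sup>2)" using TL by (simp add: L2_unit_iff)
    fix x
    have "(g x)\<^sup>2 \<le> K\<^sup>2" using power_mono[OF K[of x], of 2] by simp
    then show "((g x)\<^sup>2 + \<sigma>\<^sup>2) * (T x)\<^sup>2 \<le> (K\<^sup>2 + \<sigma>\<^sup>2) * (T x)\<^sup>2" by (intro mult_right_mono) auto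
  qed
  finally show ?thesis by (simp add: T2)
qed

end

end

end

section \<open>Quantisation\<close>

lemma lowest_digit_le: "1 \<le> n \<Longrightarrow> 2 powi lowest_digit n \<le> 2 / sqrt (real n)"
proof -
  assume n: "1 \<le> n"
  have "real_of_int (lowest_digit n) \<le> - (1/2) * log 2 (real n) + 1"
    unfolding lowest_digit_def by linarith
  then have "2 powr real_of_int (lowest_digit n) \<le> 2 powr (- (1/2) * log 2 (real n) + 1)"
    by simp
  also have "- (1/2) * log 2 (real n) + 1 = 1 + log 2 (real n) * (- (1/2))" by simp
  also have "2 powr (1 + log 2 (real n) * (- (1/2))) = 2 * (2 powr log 2 (real n)) powr (- (1/2))"
    unfolding powr_add powr_powr by simp
  also have "\<dots> = 2 / sqrt (real n)"
    using n by (simp add: powr_minus_divide powr_half_sqrt)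
  finally show ?thesis by (simp add: powr_real_of_int')
qed

lemma sum_binary_digits:
  fixes y :: real
  assumes "0 \<le> y" "y < 2 ^ m"
  shows "(\<Sum>i<m. of_bool (odd \<lfloor>y / 2 ^ i\<rfloor>) * 2 ^ i) = real_of_int \<lfloor>y\<rfloor>"
  using assms
proof (induction m arbitrary: y)
  case 0
  then have "0 \<le> y" "y < 1" by simp_all
  then have "\<lfloor>y\<rfloor> = 0" by linarith
  then show ?case by simp
next
  case (Suc m)
  have "(\<Sum>i<Suc m. of_bool (odd \<lfloor>y / 2 ^ i\<rfloor>) * 2 ^ i :: real)
      = of_bool (odd \<lfloor>y\<rfloor>) + (\<Sum>i<m. of_bool (odd \<lfloor>y / 2 ^ Suc i\<rfloor>) * 2 ^ Suc i)"
    by (subst sum.lessThan_Suc_shift) simp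
  also have "(\<Sum>i<m. of_bool (odd \<lfloor>y / 2 ^ Suc i\<rfloor>) * 2 ^ Suc i :: real)
      = 2 * (\<Sum>i<m. of_bool (odd \<lfloor>(y / 2) / 2 ^ i\<rfloor>) * 2 ^ i)"
    unfolding sum_distrib_left by (intro sum.cong refl) (simp add: mult_ac)
  also have "(\<Sum>i<m. of_bool (odd \<lfloor>(y / 2) / 2 ^ i\<rfloor>) * 2 ^ i) = real_of_int \<lfloor>y / 2\<rfloor>"
    using Suc.prems by (intro Suc.IH) auto
  also have "\<lfloor>y / 2\<rfloor> = \<lfloor>y\<rfloor> div 2"
    using floor_divide_real_eq_div[of 2 y] by simp
  also have "of_bool (odd \<lfloor>y\<rfloor>) + 2 * real_of_int (\<lfloor>y\<rfloor> div 2) = real_of_int \<lfloor>y\<rfloor>"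
  proof -
    have "\<lfloor>y\<rfloor> mod 2 = of_bool (odd \<lfloor>y\<rfloor>)" by (rule mod_2_eq_odd)
    then have "\<lfloor>y\<rfloor> = 2 * (\<lfloor>y\<rfloor> div 2) + of_bool (odd \<lfloor>y\<rfloor>)"
      using mult_div_mod_eq[of 2 "\<lfloor>y\<rfloor>"] by simp
    then have "real_of_int \<lfloor>y\<rfloor> = real_of_int (2 * (\<lfloor>y\<rfloor> div 2) + of_bool (odd \<lfloor>y\<rfloor>))" by (rule arg_cong)
    then show ?thesis by simp
  qed
  finally show ?case .
qed

text \<open>Measured in units of the lowest transmitted digit, the transmitted digits are exactly
  the binary digits of the integer part: no digit is lost at the top, because the highest position
  is the floor of the logarithm.\<close>

lemma trans_approx_eq:
  "trans_approx n x = (if x < 0 then -1 else 1) * (2 powi lowest_digit n * real_of_int \<lfloor>\<bar>x\<bar> / 2 powi lowest_digit n\<rfloor>)"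
proof -
  define a where "a = lowest_digit n"
  define c where "c = \<lfloor>log 2 \<bar>x\<bar>\<rfloor>"
  define m where "m = nat (c - a + 1)"
  define y where "y = \<bar>x\<bar> / 2 powi a"
  have len: "length [a..c] = m" by (simp add: m_def)
  have nthd: "map (\<lambda>k. odd \<lfloor>\<bar>x\<bar> / 2 powi k\<rfloor>) [a..c] ! i = odd \<lfloor>y / 2 ^ i\<rfloor>" if "i < m" for i
  proof -
    have "[a..c] ! i = a + int i" using that by (simp add: m_def nth_upto)
    then have "map (\<lambda>k. odd \<lfloor>\<bar>x\<bar> / 2 powi k\<rfloor>) [a..c] ! i = odd \<lfloor>\<bar>x\<bar> / 2 powi (a + int i)\<rfloor>"
      using that len by simp
    also have "\<bar>x\<bar> / 2 powi (a + int i) = y / 2 ^ i" by (simp add: y_def power_int_add)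
    finally show ?thesis .
  qed
  \<comment> \<open>For x = 0 the top digit \<open>c\<close> rests on the default value of the
    logarithm, but then y = 0. If x is smaller than the lowest digit, then m = 0 and the claim is y
    < 1.\<close>
  have ylt: "y < 2 ^ m"
  proof (cases "x = 0")
    case False
    have "\<bar>x\<bar> = 2 powr log 2 \<bar>x\<bar>" using False by simp
    also have "\<dots> < 2 powr real_of_int (c + 1)" unfolding c_def by (intro powr_less_mono) linarith+
    finally have x: "\<bar>x\<bar> < 2 powr real_of_int (c + 1)" .
    have "y = \<bar>x\<bar> * 2 powr (- real_of_int a)"
      by (simp add: y_def powr_real_of_int' powr_minus_divide power_int_minus_divide)
    also have "\<dots> < 2 powr real_of_int (c + 1) * 2 powr (- real_of_int a)"
      using x by (intro mult_strict_right_mono) auto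
    also have "\<dots> = 2 powr real_of_int (c + 1 - a)" by (simp add: powr_add[symmetric])
    also have "\<dots> \<le> 2 powr real m" by (intro powr_mono) (auto simp: m_def)
    finally show ?thesis by (simp add: powr_realpow)
  qed (simp add: y_def)
  have "trans_approx n x = (if x < 0 then -1 else 1) * (\<Sum>i<m. of_bool (odd \<lfloor>y / 2 ^ i\<rfloor>) * 2 powi (a + int i))"
    unfolding trans_approx_def trans_approx_bits_def decode_bits_def a_def[symmetric] c_def[symmetric]
    by (simp add: len m_def[symmetric]) (use nthd len in \<open>auto intro!: sum.cong\<close>)
  also have "(\<Sum>i<m. of_bool (odd \<lfloor>y / 2 ^ i\<rfloor>) * 2 powi (a + int i) :: real) = 2 powi a * (\<Sum>i<m. of_bool (odd \<lfloor>y / 2 ^ i\<rfloor>) * 2 ^ i)"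
    unfolding sum_distrib_left by (intro sum.cong refl) (simp add: power_int_add)
  also have "(\<Sum>i<m. of_bool (odd \<lfloor>y / 2 ^ i\<rfloor>) * 2 ^ i) = real_of_int \<lfloor>y\<rfloor>"
    using ylt by (intro sum_binary_digits) (auto simp: y_def)
  finally show ?thesis by (simp add: a_def y_def)
qed

text \<open>The error per coefficient is of order \<open>1 / sqrt n\<close>. Summed over a level its
  square is at most \<open>4 * 2 ^ l / n\<close>, which never exceeds 4 v_l, so quantisation stays
  below the noise level.\<close>

lemma trans_approx_error:
  assumes "1 \<le> n"
  shows "\<bar>trans_approx n x - x\<bar> \<le> 2 / sqrt (real n)"
proof -
  define q :: real where "q = 2 powi lowest_digit n"
  have q: "0 < q" by (simp add: q_def)
  define r where "r = \<bar>x\<bar> / q - real_of_int \<lfloor>\<bar>x\<bar> / q\<rfloor>"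
  have r: "0 \<le> r" "r \<le> 1" unfolding r_def by linarith+
  have qx: "q * (\<bar>x\<bar> / q) = \<bar>x\<bar>" using q by simp
  have "q * real_of_int \<lfloor>\<bar>x\<bar> / q\<rfloor> = \<bar>x\<bar> - q * r"
    unfolding r_def right_diff_distrib qx by simp
  then have "trans_approx n x - x = (if x < 0 then 1 else -1) * (q * r)"
    unfolding trans_approx_eq q_def[symmetric] by auto
  then have "\<bar>trans_approx n x - x\<bar> = q * r" using q r by simp
  also have "\<dots> \<le> q * 1" using q r by (intro mult_left_mono) auto
  also have "\<dots> \<le> 2 / sqrt (real n)" using lowest_digit_le[OF assms] by (simp add: q_def)
  finally show ?thesis .
qed

section \<open>An oracle inequality for the selection rule\<close>

lemma sum_sq_le_two:
  fixes x y :: real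
  shows "x\<^sup>2 \<le> 2 * (x - y)\<^sup>2 + 2 * y\<^sup>2" "y\<^sup>2 \<le> 2 * x\<^sup>2 + 2 * (x - y)\<^sup>2"
proof -
  have s: "(a + b)\<^sup>2 \<le> 2 * a\<^sup>2 + 2 * b\<^sup>2" for a b :: real
    using sum_squares_bound[of a b] by (simp add: power2_sum)
  show "x\<^sup>2 \<le> 2 * (x - y)\<^sup>2 + 2 * y\<^sup>2" using s[of "x - y" y] by simp
  show "y\<^sup>2 \<le> 2 * x\<^sup>2 + 2 * (x - y)\<^sup>2" using s[of x "y - x"] by (simp add: power2_commute[of x y])
qed

lemma sqrt_sum_le_sum_sqrt:
  assumes "\<And>i. i \<in> A \<Longrightarrow> 0 \<le> f i"
  shows "sqrt (\<Sum>i\<in>A. f i) \<le> (\<Sum>i\<in>A. sqrt (f i))"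
  using assms
proof (induction A rule: infinite_finite_induct)
  case (insert a A)
  have "sqrt (f a + sum f A) \<le> sqrt (f a) + sqrt (sum f A)"
    using insert by (intro sqrt_add_le_add_sqrt sum_nonneg) auto
  then show ?case using insert by fastforce
qed auto

context onb
begin

lemma f_level_comb:
  "f_level \<psi> n m b sm d j = comb (below j) (\<lambda>a. central_coeff \<psi> n m b sm d (fst a) (snd a))"
  unfolding f_level_def[abs_def] comb_def[abs_def] below_def
  by (subst sum.Sigma) (auto simp: split_def)

text \<open>Deterministic, for a fixed sample. The constants interlock as follows. If jh > js, some
  l with l >= jh refutes jh - 1. By \<open>A2\<close> the bias uses at most half of \<tau> v_l, so
  the noise W of the levels js, ..., l - 1 satisfies W^2 >= \<tau> v_l / 4, and 400 c^2 <= \<tau>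
  gives W >= 10 c sqrt(v_l). By \<open>A1\<close> the regular part of W, at most c times the sum of
  the sqrt(v_l'), is at most 5 c sqrt(v_l), hence at most W / 2. The other half is excess, and W is
  at most twice the sum of the excesses.\<close>

lemma oracle_inequality:
  fixes n m :: nat and b \<tau> c :: real and sm :: ereal and d :: sample and f :: "real \<Rightarrow> real" and js :: int
  assumes f: "f \<in> L2_unit" and tail_nonneg: "\<And>j. -1 \<le> j \<Longrightarrow> 0 \<le> tail f j"
    and js: "0 \<le> js" "js < j_max n b sm"
    and v_def: "\<And>l. v l = 2 ^ nat l / real (eff_size n m b sm l)"
    and Njs: "0 < eff_size n m b sm js"
    and A1: "\<And>l. js < l \<Longrightarrow> l \<le> j_max n b sm \<Longrightarrow> 0 < eff_size n m b sm l \<Longrightarrow> (\<Sum>l'\<in>{js..l-1}. sqrt (v l')) \<le> 5 * sqrt (v l)"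
    and A2: "\<And>l. js < l \<Longrightarrow> l \<le> j_max n b sm \<Longrightarrow> 0 < eff_size n m b sm l \<Longrightarrow> tail f js \<le> \<tau> / 4 * v l"
    and c: "0 \<le> c" "400 * c\<^sup>2 \<le> \<tau>"
    and V_def: "\<And>l. V l = (\<Sum>k\<in>positions l. (central_coeff \<psi> n m b sm d l k - cf f (l, k))\<^sup>2)"
  shows "L2_norm (\<lambda>x. f_hat \<psi> \<tau> n m b sm d x - f x)
    \<le> sqrt (2 * \<tau> * v js) + sqrt (tail f js) + sqrt (2 * (\<Sum>l\<in>{-1..js-1}. V l))
      + 2 * (\<Sum>l\<in>{js..j_max n b sm - 1}. max 0 (sqrt (V l) - c * sqrt (v l)))"
proof -
  define J where "J = j_max n b sm"
  define C where "C a = central_coeff \<psi> n m b sm d (fst a) (snd a)" for a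
  define G where "G j l \<longleftrightarrow> (j < l \<longrightarrow> 0 < eff_size n m b sm l \<longrightarrow>
       (L2_norm (\<lambda>x. f_level \<psi> n m b sm d j x - f_level \<psi> n m b sm d l x))\<^sup>2 \<le> \<tau> * v l)" for j l
  define T where "T = {j \<in> {0..J}. \<forall>l\<in>{0..J}. G j l}"
  define jh where "jh = j_hat \<psi> \<tau> n m b sm d"
  define SC where "SC l = (\<Sum>k\<in>positions l. (C (l, k))\<^sup>2)" for l
  have jhT: "jh = Min T"
    unfolding jh_def j_hat_def T_def G_def J_def v_def by (simp add: mult.assoc)
  have Tfin: "finite T" unfolding T_def by (rule finite_subset[of _ "{0..J}"]) auto
  \<comment> \<open>At the top level the selection condition is void, so the set is nonempty and its
    minimum is attained.\<close>
  have "J \<in> T" using js by (auto simp: T_def G_def J_def)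
  then have jh_in: "jh \<in> T" unfolding jhT using Tfin by (intro Min_in) auto
  then have jh: "0 \<le> jh" "jh \<le> J" by (auto simp: T_def)
  have V0: "0 \<le> V l" for l unfolding V_def by (simp add: sum_nonneg)
  have v0: "0 \<le> v l" for l unfolding v_def by simp
  have tau: "0 \<le> \<tau>" using c(2) by (rule order_trans[rotated]) simp
  have norm_hat: "(L2_norm (\<lambda>x. f_hat \<psi> \<tau> n m b sm d x - f x))\<^sup>2 = (\<Sum>l\<in>{-1..jh-1}. V l) + tail f jh"
  proof -
    have "(L2_norm (\<lambda>x. f_hat \<psi> \<tau> n m b sm d x - f x))\<^sup>2 = (\<Sum>a\<in>below jh. (C a - cf f a)\<^sup>2) + tail f jh"
      unfolding f_hat_def jh_def[symmetric] f_level_comb C_def[symmetric]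
      by (rule L2_norm_comb_diff_sq[OF f])
    also have "(\<Sum>a\<in>below jh. (C a - cf f a)\<^sup>2) = (\<Sum>l\<in>{-1..jh-1}. V l)"
      unfolding below_def V_def C_def by (subst sum.Sigma) (auto simp: split_def)
    finally show ?thesis .
  qed
  have norm_diff: "(L2_norm (\<lambda>x. f_level \<psi> n m b sm d j x - f_level \<psi> n m b sm d l x))\<^sup>2 = (\<Sum>l'\<in>{j..l-1}. SC l')"
    if "0 \<le> j" "j < l" for j l
    unfolding f_level_comb C_def[symmetric] SC_def using that by (intro L2_norm_comb_diff_comb_sq) auto
  have SC_V: "SC l \<le> 2 * V l + 2 * energy f l" for l
  proof -
    have "SC l \<le> (\<Sum>k\<in>positions l. 2 * (C (l, k) - cf f (l, k))\<^sup>2 + 2 * (cf f (l, k))\<^sup>2)"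
      unfolding SC_def by (intro sum_mono sum_sq_le_two)
    then show ?thesis by (simp add: sum.distrib V_def C_def energy_def sum_distrib_left)
  qed
  have en_V: "energy f l \<le> 2 * SC l + 2 * V l" for l
  proof -
    have "energy f l \<le> (\<Sum>k\<in>positions l. 2 * (C (l, k))\<^sup>2 + 2 * (C (l, k) - cf f (l, k))\<^sup>2)"
      unfolding energy_def by (intro sum_mono sum_sq_le_two)
    then show ?thesis by (simp add: sum.distrib V_def C_def SC_def sum_distrib_left)
  qed
  define U where "U = (\<Sum>l\<in>{-1..js-1}. V l)"
  have U0: "0 \<le> U" unfolding U_def by (intro sum_nonneg V0)
  define D where "D l = max 0 (sqrt (V l) - c * sqrt (v l))" for l
  have D0: "0 \<le> D l" for l by (simp add: D_def)
  have SD0: "0 \<le> (\<Sum>l\<in>{js..J - 1}. D l)" by (intro sum_nonneg D0)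
  have main: "(L2_norm (\<lambda>x. f_hat \<psi> \<tau> n m b sm d x - f x))\<^sup>2 \<le> R \<Longrightarrow> 
     sqrt R \<le> Z \<Longrightarrow> L2_norm (\<lambda>x. f_hat \<psi> \<tau> n m b sm d x - f x) \<le> Z" for R Z
    using real_sqrt_le_mono[of "(L2_norm (\<lambda>x. f_hat \<psi> \<tau> n m b sm d x - f x))\<^sup>2" R] L2_norm_nonneg by simp
  have t0: "0 \<le> tail f js" using tail_nonneg js by simp
  show ?thesis
  proof (cases "jh \<le> js")
    case True
    have le: "(L2_norm (\<lambda>x. f_hat \<psi> \<tau> n m b sm d x - f x))\<^sup>2 \<le> 2 * \<tau> * v js + tail f js + 2 * U"
    proof -
      have SCle: "(\<Sum>l\<in>{jh..js-1}. SC l) \<le> \<tau> * v js"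
      proof (cases "jh = js")
        case False
        then have "jh < js" using True by simp
        moreover have "G jh js" using jh_in js unfolding T_def J_def by auto
        ultimately show ?thesis unfolding G_def using Njs norm_diff[of jh js] jh(1) by simp
      qed (use tau v0 in simp)
      have "(\<Sum>l\<in>{jh..js-1}. energy f l) \<le> (\<Sum>l\<in>{jh..js-1}. 2 * SC l + 2 * V l)"
        by (intro sum_mono en_V)
      also have "\<dots> = 2 * (\<Sum>l\<in>{jh..js-1}. SC l) + 2 * (\<Sum>l\<in>{jh..js-1}. V l)"
        by (simp only: sum.distrib sum_distrib_left)
      finally have e: "(\<Sum>l\<in>{jh..js-1}. energy f l) \<le> 2 * (\<tau> * v js) + 2 * (\<Sum>l\<in>{jh..js-1}. V l)"
        using SCle by linarith
      have "{-1..js-1} = {-1..jh-1} \<union> {jh..js-1}" using True jh by auto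
      then have Us: "U = (\<Sum>l\<in>{-1..jh-1}. V l) + (\<Sum>l\<in>{jh..js-1}. V l)"
        by (simp add: U_def sum.union_disjoint)
      have "0 \<le> (\<Sum>l\<in>{-1..jh-1}. V l)" by (intro sum_nonneg V0)
      moreover have "tail f jh = (\<Sum>l\<in>{jh..js-1}. energy f l) + tail f js"
        using jh True by (intro tail_split) auto
      ultimately show ?thesis unfolding norm_hat using e Us by linarith
    qed
    show ?thesis
    proof (rule main[OF le])
      have "sqrt (2 * \<tau> * v js + tail f js + 2 * U) \<le> sqrt (2 * \<tau> * v js + tail f js) + sqrt (2 * U)"
        using tau v0 t0 U0 by (intro sqrt_add_le_add_sqrt) auto
      also have "sqrt (2 * \<tau> * v js + tail f js) \<le> sqrt (2 * \<tau> * v js) + sqrt (tail f js)"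
        using tau v0 t0 by (intro sqrt_add_le_add_sqrt) auto
      finally show "sqrt (2 * \<tau> * v js + tail f js + 2 * U) \<le> sqrt (2 * \<tau> * v js) + sqrt (tail f js) + sqrt (2 * (\<Sum>l\<in>{-1..js-1}. V l))
      + 2 * (\<Sum>l\<in>{js..j_max n b sm - 1}. max 0 (sqrt (V l) - c * sqrt (v l)))"
        using SD0 unfolding U_def D_def J_def by linarith
    qed
  next
    case False
    then have jlt: "js \<le> jh - 1" by simp
    have "jh - 1 \<notin> T"
    proof
      assume "jh - 1 \<in> T"
      then have "jh \<le> jh - 1" unfolding jhT using Tfin by (intro Min_le) (simp add: jhT[symmetric])
      then show False by simp
    qed
    \<comment> \<open>The witness refuting jh - 1. It satisfies l >= jh, so the levels jh - 1, ...,
      l - 1 all lie between js and l - 1, and all levels used beyond js are covered by W.\<close>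
    then obtain l where l: "l \<in> {0..J}" "\<not> G (jh - 1) l" using jlt js jh by (auto simp: T_def)
    have ll: "jh - 1 < l" "0 < eff_size n m b sm l" "\<tau> * v l < (\<Sum>l'\<in>{jh-1..l-1}. SC l')"
      using l(2) norm_diff[of "jh - 1" l] jlt js unfolding G_def by auto
    have lJ: "js < l" "l \<le> J" using l ll jlt by auto
    define W where "W = sqrt (\<Sum>l'\<in>{js..l-1}. V l')"
    have W2: "W\<^sup>2 = (\<Sum>l'\<in>{js..l-1}. V l')" unfolding W_def by (simp add: sum_nonneg V0)
    have "(\<Sum>l'\<in>{jh-1..l-1}. SC l') \<le> (\<Sum>l'\<in>{jh-1..l-1}. 2 * V l' + 2 * energy f l')"
      by (intro sum_mono SC_V)
    also have "\<dots> \<le> (\<Sum>l'\<in>{js..l-1}. 2 * V l' + 2 * energy f l')"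
      using jlt V0 energy_nonneg by (intro sum_mono2) auto
    also have "\<dots> = 2 * W\<^sup>2 + 2 * (\<Sum>l'\<in>{js..l-1}. energy f l')"
      unfolding W2 by (simp only: sum.distrib sum_distrib_left)
    also have "(\<Sum>l'\<in>{js..l-1}. energy f l') \<le> tail f js"
      using tail_split[of js l f] tail_nonneg[of l] lJ js by simp
    also have "tail f js \<le> \<tau> / 4 * v l" using A2[of l] lJ ll unfolding J_def by simp
    finally have "\<tau> * v l < 2 * W\<^sup>2 + 2 * (\<tau> / 4 * v l)" using ll(3) by simp
    then have "\<tau> / 4 * v l \<le> W\<^sup>2" by simp
    moreover have "100 * c\<^sup>2 * v l \<le> \<tau> / 4 * v l" using c(2) v0 by (intro mult_right_mono) auto
    ultimately have "(10 * c * sqrt (v l))\<^sup>2 \<le> W\<^sup>2" using v0 by (simp add: power_mult_distrib)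
    then have W10: "10 * c * sqrt (v l) \<le> W"
      by (rule power2_le_imp_le) (simp add: W_def sum_nonneg V0)
    have "W \<le> (\<Sum>l'\<in>{js..l-1}. sqrt (V l'))" unfolding W_def by (intro sqrt_sum_le_sum_sqrt V0)
    also have "\<dots> \<le> (\<Sum>l'\<in>{js..l-1}. c * sqrt (v l') + D l')"
      by (intro sum_mono) (simp add: D_def)
    also have "\<dots> = c * (\<Sum>l'\<in>{js..l-1}. sqrt (v l')) + (\<Sum>l'\<in>{js..l-1}. D l')"
      by (simp only: sum.distrib sum_distrib_left)
    also have "(\<Sum>l'\<in>{js..l-1}. D l') \<le> (\<Sum>l'\<in>{js..J-1}. D l')"
      using lJ D0 by (intro sum_mono2) auto
    also have "c * (\<Sum>l'\<in>{js..l-1}. sqrt (v l')) \<le> c * (5 * sqrt (v l))"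
      using A1[of l] lJ ll c unfolding J_def by (intro mult_left_mono) auto
    finally have "W \<le> c * (5 * sqrt (v l)) + (\<Sum>l'\<in>{js..J-1}. D l')" by simp
    then have WD: "W \<le> 2 * (\<Sum>l'\<in>{js..J-1}. D l')" using W10 by (simp add: mult_ac)
    have le: "(L2_norm (\<lambda>x. f_hat \<psi> \<tau> n m b sm d x - f x))\<^sup>2 \<le> U + W\<^sup>2 + tail f js"
    proof -
      have "{-1..jh-1} = {-1..js-1} \<union> {js..jh-1}" using jlt js by auto
      then have "(\<Sum>l\<in>{-1..jh-1}. V l) = U + (\<Sum>l\<in>{js..jh-1}. V l)"
        by (simp add: U_def sum.union_disjoint)
      moreover have "(\<Sum>l\<in>{js..jh-1}. V l) \<le> W\<^sup>2"
        unfolding W2 using ll V0 by (intro sum_mono2) auto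
      moreover have "tail f jh \<le> tail f js"
        using tail_split[of js jh f] jlt js by (simp add: sum_nonneg energy_nonneg)
      ultimately show ?thesis unfolding norm_hat by simp
    qed
    show ?thesis
    proof (rule main[OF le])
      have W0: "0 \<le> W" by (simp add: W_def sum_nonneg V0)
      have "sqrt (U + W\<^sup>2 + tail f js) \<le> sqrt (U + W\<^sup>2) + sqrt (tail f js)"
        using U0 t0 by (intro sqrt_add_le_add_sqrt) auto
      also have "sqrt (U + W\<^sup>2) \<le> sqrt U + W"
        using sqrt_add_le_add_sqrt[of U "W\<^sup>2"] U0 W0 by simp
      also have "sqrt U \<le> sqrt (2 * U)" using U0 by simp
      finally have "sqrt (U + W\<^sup>2 + tail f js) \<le> sqrt (2 * U) + 2 * (\<Sum>l'\<in>{js..J-1}. D l') + sqrt (tail f js)"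
        using WD by simp
      moreover have "0 \<le> sqrt (2 * \<tau> * v js)" using tau v0 by simp
      ultimately show "sqrt (U + W\<^sup>2 + tail f js) \<le> sqrt (2 * \<tau> * v js) + sqrt (tail f js) + sqrt (2 * (\<Sum>l\<in>{-1..js-1}. V l))
      + 2 * (\<Sum>l\<in>{js..j_max n b sm - 1}. max 0 (sqrt (V l) - c * sqrt (v l)))"
        unfolding U_def D_def J_def by linarith
    qed
  qed
qed

end

section \<open>Expected deviations of the empirical coefficients\<close>

text \<open>Simple functions below f are measurable, so this inequality holds for arbitrary f. It
  spares a proof that the loss, which involves the selected level, is a measurable function of the
  sample.\<close>

lemma nn_integral_distr_le:
  assumes T [measurable]: "T \<in> measurable M N"
  shows "(\<integral>\<^sup>+x. f x \<partial>distr M N T) \<le> (\<integral>\<^sup>+x. f (T x) \<partial>M)"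
  unfolding nn_integral_def[of "distr M N T"]
proof (rule SUP_least)
  fix g assume "g \<in> {g. simple_function (distr M N T) g \<and> g \<le> f}"
  then have g: "simple_function (distr M N T) g" "g \<le> f" by auto
  have gm: "g \<in> borel_measurable N" using borel_measurable_simple_function[OF g(1)] by simp
  have "integral\<^sup>S (distr M N T) g = (\<integral>\<^sup>+x. g x \<partial>distr M N T)"
    by (rule nn_integral_eq_simple_integral[OF g(1), symmetric])
  also have "\<dots> = (\<integral>\<^sup>+x. g (T x) \<partial>M)" using gm by (intro nn_integral_distr) auto
  also have "\<dots> \<le> (\<integral>\<^sup>+x. f (T x) \<partial>M)" using g(2) by (intro nn_integral_mono) (auto simp: le_fun_def)
  finally show "integral\<^sup>S (distr M N T) g \<le> (\<integral>\<^sup>+x. f (T x) \<partial>M)" .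
qed

text \<open>A pointwise Chebyshev bound. Here a is the mean of q and \<mu> an upper bound of it.
  Where q exceeds 2 \<mu>, the ratio q / \<mu> - 1 is at least 1, so its square dominates it and
  hence also the root of q / \<mu>. Integrating bounds the mean excess by the variance divided by
  the power 3/2 of \<mu>.\<close>

lemma sqrt_excess_le:
  fixes q \<mu> a :: real
  assumes q: "0 \<le> q" and \<mu>: "0 < \<mu>" and a: "a \<le> \<mu>"
  shows "max 0 (sqrt q - sqrt (2 * \<mu>)) \<le> 2 / (\<mu> * sqrt \<mu>) * (q - a)\<^sup>2"
proof (cases "q \<le> 2 * \<mu>")
  case True
  then have "sqrt q \<le> sqrt (2 * \<mu>)" by simp
  then have "max 0 (sqrt q - sqrt (2 * \<mu>)) = 0" by simp
  also have "0 \<le> 2 / (\<mu> * sqrt \<mu>) * (q - a)\<^sup>2" using \<mu> by simp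
  finally show ?thesis .
next
  case False
  have s: "0 < sqrt \<mu>" "sqrt \<mu> * sqrt \<mu> = \<mu>" using \<mu> by auto
  have x: "1 \<le> q / \<mu> - 1" using False \<mu> by (simp add: field_simps)
  have "sqrt (q / \<mu>) \<le> q / \<mu>"
  proof -
    have "1 \<le> q / \<mu>" using x by simp
    then have "q / \<mu> \<le> (q / \<mu>)\<^sup>2" by (simp add: self_le_power)
    then show ?thesis using real_sqrt_le_mono[of "q / \<mu>" "(q / \<mu>)\<^sup>2"] q \<mu> by simp
  qed
  also have "q / \<mu> \<le> 2 * (q / \<mu> - 1)" using x by simp
  also have "\<dots> \<le> 2 * (q / \<mu> - 1)\<^sup>2" 
  proof -
    have "q / \<mu> - 1 \<le> (q / \<mu> - 1)\<^sup>2" by (rule self_le_power[OF x]) simp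
    then show ?thesis by (rule mult_left_mono) simp
  qed
  finally have 1: "sqrt (q / \<mu>) \<le> 2 * (q / \<mu> - 1)\<^sup>2" .
  have "sqrt q = sqrt \<mu> * sqrt (q / \<mu>)" using \<mu> by (simp add: real_sqrt_mult[symmetric])
  also have "\<dots> \<le> sqrt \<mu> * (2 * (q / \<mu> - 1)\<^sup>2)" using 1 s by (intro mult_left_mono) auto
  also have "\<dots> = 2 / (\<mu> * sqrt \<mu>) * (q - \<mu>)\<^sup>2"
  proof -
    have "q / \<mu> - 1 = (q - \<mu>) / \<mu>" using \<mu> by (simp add: field_simps)
    then have "sqrt \<mu> * (2 * (q / \<mu> - 1)\<^sup>2) = sqrt \<mu> * 2 * (q - \<mu>)\<^sup>2 / (\<mu> * (sqrt \<mu> * sqrt \<mu>))"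
      using \<mu> by (simp add: power_divide power2_eq_square)
    also have "\<dots> = 2 / (\<mu> * sqrt \<mu>) * (q - \<mu>)\<^sup>2" using s(1) by (simp add: field_simps)
    finally show ?thesis .
  qed
  also have "\<dots> \<le> 2 / (\<mu> * sqrt \<mu>) * (q - a)\<^sup>2"
    using False a \<mu> by (intro mult_left_mono power_mono) auto
  finally have "sqrt q \<le> 2 / (\<mu> * sqrt \<mu>) * (q - a)\<^sup>2" .
  moreover have "0 \<le> sqrt (2 * \<mu>)" using \<mu> by simp
  moreover have "0 \<le> 2 / (\<mu> * sqrt \<mu>) * (q - a)\<^sup>2" using \<mu> by simp
  ultimately show ?thesis by (intro max.boundedI) linarith+
qed

text \<open>The inequality of arithmetic and geometric means with a free scale \<beta>. Choosing
  \<beta> near the expected size of the root replaces Jensen's inequality.\<close>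

lemma sqrt_le_linear:
  fixes q \<beta> :: real
  assumes "0 \<le> q" "0 < \<beta>"
  shows "sqrt q \<le> (q / \<beta> + \<beta>) / 2"
proof -
  have "0 \<le> (sqrt q - \<beta>)\<^sup>2" by simp
  then have "2 * \<beta> * sqrt q \<le> q + \<beta>\<^sup>2" using assms by (simp add: power2_diff mult_ac)
  then show ?thesis using assms by (simp add: field_simps power2_eq_square)
qed

section \<open>Noise of one level of the aggregated coefficients, and the risk in terms of
  it\<close>

context bounded_onb
begin

definition noise_sum :: "(nat \<Rightarrow> nat set) \<Rightarrow> nat \<Rightarrow> nat \<Rightarrow> (real \<Rightarrow> real) \<Rightarrow> real \<Rightarrow> int \<Rightarrow> nat \<Rightarrow> (nat \<times> nat \<Rightarrow> real \<times> real) \<Rightarrow> real" where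
  "noise_sum tr m p g \<sigma> l k \<omega> =
     design.sum_on (\<lambda>k. tr k \<times> {..<p}) (noise_coeff g \<sigma> l) ({..<m} \<times> {..<p}) k \<omega>"

context
  fixes l :: int and tr :: "nat \<Rightarrow> nat set" and m p N :: nat
  assumes l: "-1 \<le> l" and tr: "\<And>k. k \<in> positions l \<Longrightarrow> tr k \<subseteq> {..<m}"
    and N: "\<And>k. k \<in> positions l \<Longrightarrow> card (tr k) * p = N" and N0: "0 < N"
begin

lemma noise_sum_measurable [measurable]:
  assumes "g \<in> L2_unit" "k \<in> positions l"
  shows "noise_sum tr m p g \<sigma> l k \<in> borel_measurable (flat_design m p)"
  unfolding noise_sum_def[abs_def] flat_design_def
  using noise_coeff_measurable[OF l assms] by (rule design.sum_on_measurable)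

lemma noise_sum_sq_norm_le:
  assumes g: "g \<in> L2_unit"
  shows "(\<integral>\<^sup>+\<omega>. ennreal (\<Sum>k\<in>positions l. (noise_sum tr m p g \<sigma> l k \<omega> / real N)\<^sup>2) \<partial>flat_design m p)
    \<le> ennreal (Cp * ((\<integral>x. (g x)\<^sup>2 \<partial>unif) + \<sigma>\<^sup>2) * (2 ^ nat l / real N))"
proof -
  note nm = noise_coeff_mean[OF l g]
  have one: "(\<integral>\<^sup>+\<omega>. ennreal ((noise_sum tr m p g \<sigma> l k \<omega> / real N)\<^sup>2) \<partial>flat_design m p)
      = ennreal ((\<integral>z. (noise_coeff g \<sigma> l k z)\<^sup>2 \<partial>design) / real N)" if k: "k \<in> positions l" for k
  proof -
    have c: "card (({..<m} \<times> {..<p}) \<inter> (tr k \<times> {..<p})) = N"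
      using tr[OF k] N[OF k] by (simp add: Sigma_Int_distrib2[symmetric] Times_Int_Times Int_absorb1 card_cartesian_product)
    have "(\<integral>\<^sup>+\<omega>. ennreal ((noise_sum tr m p g \<sigma> l k \<omega> / real N)\<^sup>2) \<partial>flat_design m p)
        = (\<integral>\<^sup>+\<omega>. ennreal (1 / (real N)\<^sup>2) * ennreal ((noise_sum tr m p g \<sigma> l k \<omega>)\<^sup>2) \<partial>flat_design m p)"
      by (simp add: ennreal_mult[symmetric] power_divide)
    also have "\<dots> = ennreal (1 / (real N)\<^sup>2) * (\<integral>\<^sup>+\<omega>. ennreal ((noise_sum tr m p g \<sigma> l k \<omega>)\<^sup>2) \<partial>flat_design m p)"
    proof (rule nn_integral_cmult)
      note [measurable] = noise_sum_measurable[OF g k]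
      show "(\<lambda>\<omega>. ennreal ((noise_sum tr m p g \<sigma> l k \<omega>)\<^sup>2)) \<in> borel_measurable (flat_design m p)"
        by measurable
    qed
    also have "(\<integral>\<^sup>+\<omega>. ennreal ((noise_sum tr m p g \<sigma> l k \<omega>)\<^sup>2) \<partial>flat_design m p)
        = ennreal (real N * (\<integral>z. (noise_coeff g \<sigma> l k z)\<^sup>2 \<partial>design))"
      unfolding noise_sum_def flat_design_def c[symmetric]
      by (rule design.nn_integral_sum_on_sq) (use nm[OF k] noise_coeff_measurable[OF l g k] in auto)
    also have "ennreal (1 / (real N)\<^sup>2) * ennreal (real N * (\<integral>z. (noise_coeff g \<sigma> l k z)\<^sup>2 \<partial>design))
        = ennreal ((\<integral>z. (noise_coeff g \<sigma> l k z)\<^sup>2 \<partial>design) / real N)"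
      using N0 by (simp add: ennreal_mult[symmetric] power2_eq_square)
    finally show ?thesis .
  qed
  have "(\<integral>\<^sup>+\<omega>. ennreal (\<Sum>k\<in>positions l. (noise_sum tr m p g \<sigma> l k \<omega> / real N)\<^sup>2) \<partial>flat_design m p)
      = (\<integral>\<^sup>+\<omega>. (\<Sum>k\<in>positions l. ennreal ((noise_sum tr m p g \<sigma> l k \<omega> / real N)\<^sup>2)) \<partial>flat_design m p)"
    by (simp add: sum_ennreal)
  also have "\<dots> = (\<Sum>k\<in>positions l. \<integral>\<^sup>+\<omega>. ennreal ((noise_sum tr m p g \<sigma> l k \<omega> / real N)\<^sup>2) \<partial>flat_design m p)"
  proof (rule nn_integral_sum)
    fix k assume k: "k \<in> positions l"
    note [measurable] = noise_sum_measurable[OF g k]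
    show "(\<lambda>\<omega>. ennreal ((noise_sum tr m p g \<sigma> l k \<omega> / real N)\<^sup>2)) \<in> borel_measurable (flat_design m p)"
      by measurable
  qed
  also have "\<dots> = (\<Sum>k\<in>positions l. ennreal ((\<integral>z. (noise_coeff g \<sigma> l k z)\<^sup>2 \<partial>design) / real N))"
    by (intro sum.cong refl one)
  also have "\<dots> = ennreal ((\<Sum>k\<in>positions l. \<integral>z. (noise_coeff g \<sigma> l k z)\<^sup>2 \<partial>design) / real N)"
    by (subst sum_ennreal) (auto simp: sum_divide_distrib)
  also have "\<dots> \<le> ennreal ((Cp * 2 ^ nat l * ((\<integral>x. (g x)\<^sup>2 \<partial>unif) + \<sigma>\<^sup>2)) / real N)"
    by (intro ennreal_leI divide_right_mono sum_noise_coeff_sq[OF l g]) simp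
  finally show ?thesis by (simp add: mult_ac)
qed

text \<open>Write R for \<open>2 ^ nat l\<close>. The variance bound for the squared noise norm has
  two terms: trace times operator norm gives K^2 v^2 / R, and the fourth moments of single
  observations give K^2 v^3 / R. Division by the power 3/2 of C1 v leaves the two summands of the
  claim. The assumption K >= 1 lets K^2 absorb the terms without K.\<close>

lemma noise_sum_excess_le:
  assumes g: "g \<in> L2_unit" and K: "\<And>x. \<bar>g x\<bar> \<le> K" and K1: "1 \<le> K"
    and G: "(\<integral>x. (g x)\<^sup>2 \<partial>unif) \<le> Gb" and C1: "C1 = Cp * (Gb + \<sigma>\<^sup>2)" and \<sigma>: "0 < \<sigma>"
    and v: "v = 2 ^ nat l / real N"
    and C2: "C2 = 8 * Cp\<^sup>2 * (8 * Gb + 24 * \<sigma> ^ 4 + (Gb + \<sigma>\<^sup>2)\<^sup>2)"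
  shows "(\<integral>\<^sup>+\<omega>. ennreal (max 0 (sqrt (\<Sum>k\<in>positions l. (noise_sum tr m p g \<sigma> l k \<omega> / real N)\<^sup>2) - sqrt (2 * (C1 * v)))) \<partial>flat_design m p)
    \<le> ennreal (2 * (8 * (1 + \<sigma>\<^sup>2) * C1 + 2 * C2) / (C1 * sqrt C1) * K\<^sup>2 * (sqrt v + v * sqrt v) / 2 ^ nat l)"
proof -
  note nm = noise_coeff_mean[OF l g]
  define Q where "Q = positions l"
  define E where "E = (\<Sum>k\<in>Q. \<integral>z. (noise_coeff g \<sigma> l k z)\<^sup>2 \<partial>design)"
  define P4 where "P4 = (\<integral>z. (\<Sum>k\<in>Q. (noise_coeff g \<sigma> l k z)\<^sup>2)\<^sup>2 \<partial>design)"
  define lam where "lam = K\<^sup>2 + \<sigma>\<^sup>2"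
  define S where "S k \<omega> = noise_sum tr m p g \<sigma> l k \<omega>" for k \<omega>
  define R where "R = (2::real) ^ nat l"
  have R: "0 < R" by (simp add: R_def)
  have Nr: "0 < real N" using N0 by simp
  have Gb0: "0 \<le> Gb" by (rule order_trans[OF _ G]) simp
  have C1p: "0 < C1" unfolding C1 using Gb0 Cp_pos \<sigma> by (intro mult_pos_pos add_nonneg_pos) auto
  have vp: "0 < v" unfolding v using Nr by simp
  \<comment> \<open>An upper bound for the mean of the squared noise norm. Its constant
    \<open>C1\<close> contains only the L2 bound \<open>Gb\<close>, not K, and it will fix the
    threshold \<tau>.\<close>
  define \<mu> where "\<mu> = C1 * v"
  have \<mu>: "0 < \<mu>" unfolding \<mu>_def using C1p vp by simp
  have E_le: "E \<le> C1 * R"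
  proof -
    have "E \<le> Cp * 2 ^ nat l * ((\<integral>x. (g x)\<^sup>2 \<partial>unif) + \<sigma>\<^sup>2)" unfolding E_def Q_def by (rule sum_noise_coeff_sq[OF l g])
    also have "\<dots> \<le> Cp * 2 ^ nat l * (Gb + \<sigma>\<^sup>2)" using G Cp_pos by (intro mult_left_mono) auto
    finally show ?thesis by (simp add: C1 R_def mult_ac)
  qed
  have E0: "0 \<le> E" unfolding E_def by (intro sum_nonneg) simp
  have P4_le: "P4 \<le> C2 * R\<^sup>2 * K\<^sup>2"
  proof -
    have "P4 \<le> 8 * (Cp * 2 ^ nat l)\<^sup>2 * (8 * K\<^sup>2 * (\<integral>x. (g x)\<^sup>2 \<partial>unif) + 24 * \<sigma> ^ 4 + ((\<integral>x. (g x)\<^sup>2 \<partial>unif) + \<sigma>\<^sup>2)\<^sup>2)"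
      unfolding P4_def Q_def by (rule sum_noise_coeff_sq_sq(2)[OF l g K])
    also have "\<dots> \<le> 8 * (Cp * 2 ^ nat l)\<^sup>2 * (8 * K\<^sup>2 * Gb + 24 * \<sigma> ^ 4 + (Gb + \<sigma>\<^sup>2)\<^sup>2)"
      using G \<sigma> by (intro mult_left_mono add_mono power_mono) auto
    also have "\<dots> \<le> 8 * (Cp * 2 ^ nat l)\<^sup>2 * (K\<^sup>2 * (8 * Gb + 24 * \<sigma> ^ 4 + (Gb + \<sigma>\<^sup>2)\<^sup>2))"
    proof (rule mult_left_mono)
      have "1 \<le> K\<^sup>2" using K1 by simp
      then have "1 * (24 * \<sigma> ^ 4 + (Gb + \<sigma>\<^sup>2)\<^sup>2) \<le> K\<^sup>2 * (24 * \<sigma> ^ 4 + (Gb + \<sigma>\<^sup>2)\<^sup>2)"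
        by (rule mult_right_mono) simp
      then show "8 * K\<^sup>2 * Gb + 24 * \<sigma> ^ 4 + (Gb + \<sigma>\<^sup>2)\<^sup>2 \<le> K\<^sup>2 * (8 * Gb + 24 * \<sigma> ^ 4 + (Gb + \<sigma>\<^sup>2)\<^sup>2)"
        by (simp add: distrib_left mult_ac)
    qed simp
    also have "\<dots> = C2 * R\<^sup>2 * K\<^sup>2" by (simp add: C2 R_def power_mult_distrib mult_ac)
    finally show ?thesis .
  qed
  have lam_le: "lam \<le> (1 + \<sigma>\<^sup>2) * K\<^sup>2"
  proof -
    have "1 \<le> K\<^sup>2" using K1 by simp
    then have "\<sigma>\<^sup>2 * 1 \<le> \<sigma>\<^sup>2 * K\<^sup>2" by (rule mult_left_mono) simp
    then show ?thesis by (simp add: lam_def distrib_right)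
  qed
  have lam0: "0 \<le> lam" by (simp add: lam_def)
  have EN: "E / real N \<le> \<mu>"
    using divide_right_mono[OF E_le, of "real N"] by (simp add: \<mu>_def v R_def)
  have "(\<integral>\<^sup>+\<omega>. ennreal (max 0 (sqrt (\<Sum>k\<in>Q. (S k \<omega> / real N)\<^sup>2) - sqrt (2 * \<mu>))) \<partial>flat_design m p)
      \<le> (\<integral>\<^sup>+\<omega>. ennreal (2 / (\<mu> * sqrt \<mu>) / real N ^ 4) * ennreal (((\<Sum>k\<in>Q. (S k \<omega>)\<^sup>2) - real N * E)\<^sup>2) \<partial>flat_design m p)"
  proof (rule nn_integral_mono)
    fix \<omega>
    define q where "q = (\<Sum>k\<in>Q. (S k \<omega> / real N)\<^sup>2)"
    have "max 0 (sqrt q - sqrt (2 * \<mu>)) \<le> 2 / (\<mu> * sqrt \<mu>) * (q - E / real N)\<^sup>2"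
      using EN \<mu> by (intro sqrt_excess_le) (auto simp: q_def sum_nonneg)
    also have "q - E / real N = ((\<Sum>k\<in>Q. (S k \<omega>)\<^sup>2) - real N * E) / (real N)\<^sup>2"
      using Nr by (simp add: q_def power_divide sum_divide_distrib[symmetric] diff_divide_distrib power2_eq_square)
    also have "2 / (\<mu> * sqrt \<mu>) * (((\<Sum>k\<in>Q. (S k \<omega>)\<^sup>2) - real N * E) / (real N)\<^sup>2)\<^sup>2
        = 2 / (\<mu> * sqrt \<mu>) / real N ^ 4 * ((\<Sum>k\<in>Q. (S k \<omega>)\<^sup>2) - real N * E)\<^sup>2"
      by (simp add: power_divide power_mult[symmetric])
    finally show "ennreal (max 0 (sqrt (\<Sum>k\<in>Q. (S k \<omega> / real N)\<^sup>2) - sqrt (2 * \<mu>)))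
        \<le> ennreal (2 / (\<mu> * sqrt \<mu>) / real N ^ 4) * ennreal (((\<Sum>k\<in>Q. (S k \<omega>)\<^sup>2) - real N * E)\<^sup>2)"
      unfolding q_def using \<mu> by (subst ennreal_mult[symmetric]) (auto intro!: ennreal_leI)
  qed
  also have "\<dots> = ennreal (2 / (\<mu> * sqrt \<mu>) / real N ^ 4)
      * (\<integral>\<^sup>+\<omega>. ennreal (((\<Sum>k\<in>Q. (S k \<omega>)\<^sup>2) - real N * E)\<^sup>2) \<partial>flat_design m p)"
  proof (rule nn_integral_cmult)
    have [measurable]: "S k \<in> borel_measurable (flat_design m p)" if "k \<in> Q" for k
      using noise_sum_measurable[OF g] that unfolding S_def[abs_def] Q_def by auto
    show "(\<lambda>\<omega>. ennreal (((\<Sum>k\<in>Q. (S k \<omega>)\<^sup>2) - real N * E)\<^sup>2)) \<in> borel_measurable (flat_design m p)"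
      by measurable
  qed
  also have "\<dots> \<le> ennreal (2 / (\<mu> * sqrt \<mu>) / real N ^ 4)
      * ennreal (8 * lam * (real N)\<^sup>2 * E + 2 * real N * P4)"
  proof (rule mult_left_mono)
    show "(\<integral>\<^sup>+\<omega>. ennreal (((\<Sum>k\<in>Q. (S k \<omega>)\<^sup>2) - real N * E)\<^sup>2) \<partial>flat_design m p)
        \<le> ennreal (8 * lam * (real N)\<^sup>2 * E + 2 * real N * P4)"
      unfolding S_def noise_sum_def flat_design_def E_def P4_def
    proof (rule design.nn_integral_sq_norm_deviation_equal)
      show "finite ({..<m} \<times> {..<p})" "finite Q" by (auto simp: Q_def)
      show "0 \<le> lam" by (rule lam0)
      show "(\<integral>z. (\<Sum>k\<in>Q. s k * noise_coeff g \<sigma> l k z)\<^sup>2 \<partial>design) \<le> lam * (\<Sum>k\<in>Q. (s k)\<^sup>2)" for s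
        unfolding Q_def lam_def by (rule noise_coeff_form_le[OF l g K])
      fix k assume k: "k \<in> Q"
      then have k': "k \<in> positions l" by (simp add: Q_def)
      show "noise_coeff g \<sigma> l k \<in> borel_measurable design" by (rule noise_coeff_measurable[OF l g k'])
      show "integrable design (\<lambda>z. (noise_coeff g \<sigma> l k z) ^ 4)" by (rule noise_coeff_fourth_integrable[OF l g K k'])
      show "(\<integral>z. noise_coeff g \<sigma> l k z \<partial>design) = 0" by (rule nm(1)[OF k'])
      show "tr k \<times> {..<p} \<subseteq> {..<m} \<times> {..<p}" using tr[OF k'] by auto
      show "card (tr k \<times> {..<p}) = N" using N[OF k'] by (simp add: card_cartesian_product)
    qed
  qed simp
  also have "\<dots> = ennreal (2 / (\<mu> * sqrt \<mu>) / real N ^ 4 * (8 * lam * (real N)\<^sup>2 * E + 2 * real N * P4))"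
  proof (rule ennreal_mult[symmetric])
    show "0 \<le> 2 / (\<mu> * sqrt \<mu>) / real N ^ 4" using \<mu> by simp
    have "0 \<le> P4" unfolding P4_def by simp
    then show "0 \<le> 8 * lam * (real N)\<^sup>2 * E + 2 * real N * P4" using lam0 E0 by simp
  qed
  also have "\<dots> \<le> ennreal (2 * (8 * (1 + \<sigma>\<^sup>2) * C1 + 2 * C2) / (C1 * sqrt C1) * K\<^sup>2 * (sqrt v + v * sqrt v) / 2 ^ nat l)"
  proof (rule ennreal_leI)
    define a where "a = 8 * (1 + \<sigma>\<^sup>2) * C1"
    have a0: "0 \<le> a" unfolding a_def using C1p by simp
    have C20: "0 \<le> C2" unfolding C2 using Gb0 by simp
    have sv: "0 < sqrt v" "sqrt v * sqrt v = v" using vp by auto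
    have NR: "real N = R / v" using vp Nr by (simp add: v R_def)
    have "8 * lam * (real N)\<^sup>2 * E \<le> 8 * ((1 + \<sigma>\<^sup>2) * K\<^sup>2) * (real N)\<^sup>2 * (C1 * R)"
      using lam_le E_le E0 lam0 by (intro mult_mono mult_right_mono mult_left_mono) auto
    moreover have "2 * real N * P4 \<le> 2 * real N * (C2 * R\<^sup>2 * K\<^sup>2)" using P4_le by (intro mult_left_mono) auto
    ultimately have "8 * lam * (real N)\<^sup>2 * E + 2 * real N * P4
        \<le> 8 * ((1 + \<sigma>\<^sup>2) * K\<^sup>2) * (real N)\<^sup>2 * (C1 * R) + 2 * real N * (C2 * R\<^sup>2 * K\<^sup>2)"
      by (rule add_mono)
    also have "\<dots> = a * K\<^sup>2 * (real N)\<^sup>2 * R + 2 * C2 * K\<^sup>2 * real N * R\<^sup>2"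
      by (simp add: a_def algebra_simps)
    finally have "2 / (\<mu> * sqrt \<mu>) / real N ^ 4 * (8 * lam * (real N)\<^sup>2 * E + 2 * real N * P4)
        \<le> 2 / (\<mu> * sqrt \<mu>) / real N ^ 4 * (a * K\<^sup>2 * (real N)\<^sup>2 * R + 2 * C2 * K\<^sup>2 * real N * R\<^sup>2)"
      using \<mu> by (intro mult_left_mono) auto
    also have "\<dots> = 2 * K\<^sup>2 / (C1 * sqrt C1) * (a * sqrt v + 2 * C2 * (v * sqrt v)) / R"
    proof -
      have m1: "\<mu> * sqrt \<mu> = (C1 * sqrt C1) * (v * sqrt v)" by (simp add: \<mu>_def real_sqrt_mult)
      have m2: "(a * K\<^sup>2 * (real N)\<^sup>2 * R + 2 * C2 * K\<^sup>2 * real N * R\<^sup>2) / real N ^ 4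
          = K\<^sup>2 * (a * v\<^sup>2 + 2 * C2 * v ^ 3) / R"
        unfolding NR using R vp by (simp add: field_simps power2_eq_square power3_eq_cube power4_eq_xxxx)
      have m3: "v\<^sup>2 / (v * sqrt v) = sqrt v" "v ^ 3 / (v * sqrt v) = v * sqrt v"
        using sv vp by (simp_all add: field_simps power2_eq_square power3_eq_cube)
      have "2 / (\<mu> * sqrt \<mu>) / real N ^ 4 * (a * K\<^sup>2 * (real N)\<^sup>2 * R + 2 * C2 * K\<^sup>2 * real N * R\<^sup>2)
          = 2 / (\<mu> * sqrt \<mu>) * ((a * K\<^sup>2 * (real N)\<^sup>2 * R + 2 * C2 * K\<^sup>2 * real N * R\<^sup>2) / real N ^ 4)"
        by simp
      also have "\<dots> = 2 / ((C1 * sqrt C1) * (v * sqrt v)) * (K\<^sup>2 * (a * v\<^sup>2 + 2 * C2 * v ^ 3) / R)"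
        unfolding m1 m2 ..
      also have "\<dots> = 2 * K\<^sup>2 / (C1 * sqrt C1) * (a * (v\<^sup>2 / (v * sqrt v)) + 2 * C2 * (v ^ 3 / (v * sqrt v))) / R"
        using C1p R sv vp by (simp add: field_simps)
      finally show ?thesis
        unfolding m3 .
    qed
    also have "\<dots> \<le> 2 * K\<^sup>2 / (C1 * sqrt C1) * ((a + 2 * C2) * (sqrt v + v * sqrt v)) / R"
    proof (intro divide_right_mono mult_left_mono)
      have "0 \<le> a * (v * sqrt v) + 2 * C2 * sqrt v" using a0 C20 vp by simp
      then show "a * sqrt v + 2 * C2 * (v * sqrt v) \<le> (a + 2 * C2) * (sqrt v + v * sqrt v)"
        by (simp add: algebra_simps)
    qed (use C1p R in auto)
    also have "\<dots> = 2 * (a + 2 * C2) / (C1 * sqrt C1) * K\<^sup>2 * (sqrt v + v * sqrt v) / R"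
    proof -
      have "2 * k / D * (w * x) / y = 2 * w / D * k * x / y" for k D w x y :: real by simp
      then show ?thesis .
    qed
    finally show "2 / (\<mu> * sqrt \<mu>) / real N ^ 4 * (8 * lam * (real N)\<^sup>2 * E + 2 * real N * P4)
        \<le> 2 * (8 * (1 + \<sigma>\<^sup>2) * C1 + 2 * C2) / (C1 * sqrt C1) * K\<^sup>2 * (sqrt v + v * sqrt v) / 2 ^ nat l"
      unfolding a_def R_def .
  qed
  finally show ?thesis unfolding Q_def S_def \<mu>_def .
qed

end

text \<open>Apart from rounding, the aggregated coefficient is the average over all observations of
  the transmitting machines. Averaging does not increase the rounding error.\<close>

lemma central_coeff_nest:
  assumes n: "1 \<le> n" and p: "p = n div m" and tr: "tr = transmitters n m b sm l k" "tr \<subseteq> {..<m}"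
    and N: "card tr * p = N" "0 < N"
  shows "\<bar>central_coeff \<psi> n m b sm (nest m p \<sigma> f \<omega>) l k - cf f (l, k)
      - noise_sum (\<lambda>k. transmitters n m b sm l k) m p f \<sigma> l k \<omega> / real N\<bar> \<le> 2 / sqrt (real n)"
proof -
  define x where "x i = local_coeff \<psi> p (nest m p \<sigma> f \<omega> i) l k" for i
  have fin: "finite tr" using tr(2) by (rule finite_subset) simp
  have c0: "0 < card tr" and p0: "0 < p" using N by (auto intro: Nat.gr0I)
  have Nr: "real N = real (card tr) * real p" using N(1) by (metis of_nat_mult)
  have x: "real p * x i = (\<Sum>a<p. signal f \<sigma> (\<omega> (i, a)) * \<psi> l k (fst (\<omega> (i, a))))" if "i \<in> tr" for i
    using that tr(2) p0 by (auto simp: x_def local_coeff_def nest_def obs_def signal_def intro!: sum.cong)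
  have "noise_sum (\<lambda>k. transmitters n m b sm l k) m p f \<sigma> l k \<omega> = (\<Sum>a\<in>tr \<times> {..<p}. noise_coeff f \<sigma> l k (\<omega> a))"
  proof -
    have "({..<m} \<times> {..<p}) \<inter> (tr \<times> {..<p}) = tr \<times> {..<p}" using tr(2) by auto
    then show ?thesis unfolding noise_sum_def design.sum_on_def tr(1)[symmetric] by simp
  qed
  also have "\<dots> = (\<Sum>i\<in>tr. \<Sum>a<p. noise_coeff f \<sigma> l k (\<omega> (i, a)))"
    by (simp add: sum.cartesian_product')
  also have "\<dots> = (\<Sum>i\<in>tr. real p * x i - real p * cf f (l, k))"
    by (intro sum.cong refl) (simp add: x noise_coeff_def sum_subtractf)
  also have "\<dots> = real p * (\<Sum>i\<in>tr. x i) - real N * cf f (l, k)"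
    by (simp add: sum_subtractf sum_distrib_left Nr)
  finally have ns: "noise_sum (\<lambda>k. transmitters n m b sm l k) m p f \<sigma> l k \<omega> / real N
      = (\<Sum>i\<in>tr. x i) / real (card tr) - cf f (l, k)"
    using N(2) p0 c0 by (simp add: diff_divide_distrib Nr)
  have "central_coeff \<psi> n m b sm (nest m p \<sigma> f \<omega>) l k = (\<Sum>i\<in>tr. trans_approx n (x i)) / real (card tr)"
    unfolding central_coeff_def tr(1)[symmetric] p[symmetric] x_def ..
  then have "central_coeff \<psi> n m b sm (nest m p \<sigma> f \<omega>) l k - cf f (l, k)
      - noise_sum (\<lambda>k. transmitters n m b sm l k) m p f \<sigma> l k \<omega> / real N
      = (\<Sum>i\<in>tr. trans_approx n (x i) - x i) / real (card tr)"
    unfolding ns by (simp add: sum_subtractf diff_divide_distrib)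
  also have "\<bar>\<dots>\<bar> \<le> (\<Sum>i\<in>tr. \<bar>trans_approx n (x i) - x i\<bar>) / real (card tr)"
    by (simp add: divide_right_mono)
  also have "\<dots> \<le> (\<Sum>i\<in>tr. 2 / sqrt (real n)) / real (card tr)"
    by (intro divide_right_mono sum_mono trans_approx_error n) simp
  also have "\<dots> = 2 / sqrt (real n)" using c0 by simp
  finally show ?thesis .
qed

text \<open>For fixed design and errors the centred sums are additive in the signal. The whole
  Gaussian noise is assigned to g, so h carries noise level 0 and its contribution is proportional
  to its own norm.\<close>

lemma noise_sum_add:
  assumes "\<And>x. f x = g x + h x" and fgh: "f \<in> L2_unit" "g \<in> L2_unit" "h \<in> L2_unit" and a: "(l, k) \<in> idx"
  shows "noise_sum tr m p f \<sigma> l k \<omega> = noise_sum tr m p g \<sigma> l k \<omega> + noise_sum tr m p h 0 l k \<omega>"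
proof -
  have "cf f (l, k) = cf g (l, k) + cf h (l, k)"
    using L2_unit_mult_integrable[OF fgh(2) psi_L2[OF a]] L2_unit_mult_integrable[OF fgh(3) psi_L2[OF a]]
    unfolding cf_unif[OF fgh(1) a] cf_unif[OF fgh(2) a] cf_unif[OF fgh(3) a] assms(1) distrib_right
    by simp
  then show ?thesis
    unfolding noise_sum_def design.sum_on_def noise_coeff_def signal_def sum.distrib[symmetric]
    by (intro sum.cong) (auto simp: assms(1) algebra_simps)
qed

text \<open>The signal is split into g, its levels below J', and the remainder h. In each level the
  noise is at most rounding plus noise of g plus noise of h: the first is deterministic, the second
  is handled by \<open>noise_sum_excess_le\<close>, the third by its second moment, which is small
  with \<open>tl\<close>. All roots are first replaced by linear bounds, so only nonnegative
  integrals of sums occur.\<close>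

lemma risk_oracle_bound:
  fixes n m p :: nat and b \<tau> \<sigma> s L Gb K tl :: real and sm :: ereal and f :: "real \<Rightarrow> real" and js :: int and J' :: nat
  assumes n: "1 \<le> n" and m: "0 < m" and p: "p = n div m" "0 < p"
    and f: "f \<in> besov_ball \<psi> s L" and s: "0 < s" and L: "0 < L"
    and Gb: "(\<integral>x. (f x)\<^sup>2 \<partial>unif) \<le> Gb" and \<sigma>: "0 < \<sigma>"
    and js: "0 \<le> js" "js < j_max n b sm"
    and N_def: "\<And>l. N l = eff_size n m b sm l"
    and v_def: "\<And>l. v l = 2 ^ nat l / real (N l)"
    and tr: "\<And>l k. -1 \<le> l \<Longrightarrow> l < j_max n b sm \<Longrightarrow> k \<in> positions l \<Longrightarrow> transmitters n m b sm l k \<subseteq> {..<m}"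
    and trN: "\<And>l k. -1 \<le> l \<Longrightarrow> l < j_max n b sm \<Longrightarrow> k \<in> positions l \<Longrightarrow> card (transmitters n m b sm l k) * p = N l"
    and Npos: "\<And>l. -1 \<le> l \<Longrightarrow> l < j_max n b sm \<Longrightarrow> 0 < N l" and Nn: "\<And>l. -1 \<le> l \<Longrightarrow> l < j_max n b sm \<Longrightarrow> N l \<le> n"
    and A1: "\<And>l. js < l \<Longrightarrow> l \<le> j_max n b sm \<Longrightarrow> 0 < N l \<Longrightarrow> (\<Sum>l'\<in>{js..l-1}. sqrt (v l')) \<le> 5 * sqrt (v l)"
    and A2: "\<And>l. js < l \<Longrightarrow> l \<le> j_max n b sm \<Longrightarrow> 0 < N l \<Longrightarrow> tail f js \<le> \<tau> / 4 * v l"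
    and A3: "(\<Sum>l\<in>{-1..js-1}. v l) \<le> 8 * v js"
    and C1: "C1 = Cp * (Gb + \<sigma>\<^sup>2)" and tau: "400 * (2 + sqrt (2 * C1))\<^sup>2 \<le> \<tau>"
    and C2: "C2 = 8 * Cp\<^sup>2 * (8 * Gb + 24 * \<sigma> ^ 4 + (Gb + \<sigma>\<^sup>2)\<^sup>2)"
    and C3: "C3 = 2 * (8 * (1 + \<sigma>\<^sup>2) * C1 + 2 * C2) / (C1 * sqrt C1)"
    and K1: "1 \<le> K" and K: "\<And>x. \<bar>comb (below (int J')) (cf f) x\<bar> \<le> K"
    and tl: "0 < tl" "tail f (int J') \<le> tl\<^sup>2"
  shows "risk m p \<sigma> (f_hat \<psi> \<tau> n m b sm) f
    \<le> ennreal (sqrt (2 * \<tau> * v js) + sqrt (tail f js) + (16 * C1 + 65) * sqrt (v js)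
        + (\<Sum>l\<in>{js..j_max n b sm - 1}. (Cp + 1) * tl * sqrt (v l) + 2 * (C3 * K\<^sup>2 * (sqrt (v l) + v l * sqrt (v l)) / 2 ^ nat l)))"
proof -
  define J where "J = j_max n b sm"
  define g where "g = comb (below (int J')) (cf f)"
  define h where "h x = f x - g x" for x
  have fL: "f \<in> L2_unit" by (rule besov_ball_L2[OF f])
  have gL: "g \<in> L2_unit" unfolding g_def by (intro comb_L2) (auto simp: below_subset_idx)
  have hL: "h \<in> L2_unit" unfolding h_def[abs_def] using fL gL by (rule L2_unit_diff)
  have fgh: "f x = g x + h x" for x by (simp add: h_def)
  have L0: "0 \<le> L" using L by simp
  have tail0: "0 \<le> tail f j" if "-1 \<le> j" for j by (rule tail_nonneg[OF f s L0 that])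
  have hT: "(\<integral>x. (h x)\<^sup>2 \<partial>unif) \<le> tl\<^sup>2"
    unfolding h_def g_def comb_cf_diff_norm[OF fL] by (rule tl(2))
  have gG: "(\<integral>x. (g x)\<^sup>2 \<partial>unif) \<le> Gb"
    unfolding g_def by (rule order_trans[OF comb_cf_norm_le[OF f s L0] Gb]) simp
  have Gb0: "0 \<le> Gb" by (rule order_trans[OF _ Gb]) simp
  have C1p: "0 < C1" unfolding C1 using Gb0 Cp_pos \<sigma> by (intro mult_pos_pos add_nonneg_pos) auto
  define ns where "ns g \<sigma> l k \<omega> = noise_sum (\<lambda>k. transmitters n m b sm l k) m p g \<sigma> l k \<omega>" for g \<sigma> l k \<omega>
  define q where "q g \<sigma> l \<omega> = (\<Sum>k\<in>positions l. (ns g \<sigma> l k \<omega> / real (N l))\<^sup>2)" for g \<sigma> l \<omega>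
  have q0: "0 \<le> q g \<sigma> l \<omega>" for g \<sigma> l \<omega> unfolding q_def by (intro sum_nonneg) simp
  have qm: "(\<lambda>\<omega>. q g \<sigma> l \<omega>) \<in> borel_measurable (flat_design m p)"
    if "-1 \<le> l" "l < J" "g \<in> L2_unit" for g \<sigma> l
  proof -
    have nm: "ns g \<sigma> l k \<in> borel_measurable (flat_design m p)" if "k \<in> positions l" for k
      unfolding ns_def[abs_def]
      by (rule noise_sum_measurable[where N="N l"])
        (use that \<open>-1 \<le> l\<close> \<open>l < J\<close> \<open>g \<in> L2_unit\<close> tr trN Npos in \<open>auto simp: J_def\<close>)
    show ?thesis unfolding q_def
    proof (rule borel_measurable_sum)
      fix k assume "k \<in> positions l"
      note [measurable] = nm[OF this]
      show "(\<lambda>\<omega>. (ns g \<sigma> l k \<omega> / real (N l))\<^sup>2) \<in> borel_measurable (flat_design m p)" by measurable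
    qed
  qed
  have qE: "(\<integral>\<^sup>+\<omega>. ennreal (q g \<sigma> l \<omega>) \<partial>flat_design m p) \<le> ennreal (Cp * ((\<integral>x. (g x)\<^sup>2 \<partial>unif) + \<sigma>\<^sup>2) * v l)"
    if "-1 \<le> l" "l < J" "g \<in> L2_unit" for g \<sigma> l
    unfolding q_def ns_def v_def
    by (rule noise_sum_sq_norm_le) (use that tr trN Npos in \<open>auto simp: J_def\<close>)
  have v0: "0 < v l" if "-1 \<le> l" "l < J" for l
    unfolding v_def using Npos that by (simp add: J_def)
  have vn: "2 ^ nat l / real n \<le> v l" if "-1 \<le> l" "l < J" for l
    unfolding v_def using Npos[of l] Nn[of l] that by (intro divide_left_mono) (auto simp: J_def)
  define V where "V \<omega> l = (\<Sum>k\<in>positions l. (central_coeff \<psi> n m b sm (nest m p \<sigma> f \<omega>) l k - cf f (l, k))\<^sup>2)" for \<omega> l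
  define err where "err \<omega> l k = central_coeff \<psi> n m b sm (nest m p \<sigma> f \<omega>) l k - cf f (l, k) - ns f \<sigma> l k \<omega> / real (N l)" for \<omega> l k
  have err: "\<bar>err \<omega> l k\<bar> \<le> 2 / sqrt (real n)" if "-1 \<le> l" "l < J" "k \<in> positions l" for \<omega> l k
    unfolding err_def ns_def
    by (rule central_coeff_nest[OF n p(1) refl]) (use that tr trN Npos in \<open>auto simp: J_def\<close>)
  have err2: "(\<Sum>k\<in>positions l. (err \<omega> l k)\<^sup>2) \<le> 4 * v l" if l: "-1 \<le> l" "l < J" for \<omega> l
  proof -
    have "(\<Sum>k\<in>positions l. (err \<omega> l k)\<^sup>2) \<le> (\<Sum>k\<in>positions l. 4 / real n)"
    proof (rule sum_mono)
      fix k assume "k \<in> positions l"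
      from power_mono[OF err[OF l this, of \<omega>], of 2]
      show "(err \<omega> l k)\<^sup>2 \<le> 4 / real n" by (simp add: power_divide)
    qed
    also have "\<dots> = 4 * (2 ^ nat l / real n)" by (simp add: positions_def)
    also have "\<dots> \<le> 4 * v l" using vn[OF l] by simp
    finally show ?thesis .
  qed
  have V_le: "V \<omega> l \<le> 2 * q f \<sigma> l \<omega> + 8 * v l" if l: "-1 \<le> l" "l < J" for \<omega> l
  proof -
    have "V \<omega> l \<le> (\<Sum>k\<in>positions l. 2 * (ns f \<sigma> l k \<omega> / real (N l))\<^sup>2 + 2 * (err \<omega> l k)\<^sup>2)"
      unfolding V_def
    proof (rule sum_mono)
      fix k
      have "(a + e)\<^sup>2 \<le> 2 * a\<^sup>2 + 2 * e\<^sup>2" for a e :: real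
        using sum_squares_bound[of a e] by (simp add: power2_sum)
      from this[of "ns f \<sigma> l k \<omega> / real (N l)" "err \<omega> l k"]
      show "(central_coeff \<psi> n m b sm (nest m p \<sigma> f \<omega>) l k - cf f (l, k))\<^sup>2
          \<le> 2 * (ns f \<sigma> l k \<omega> / real (N l))\<^sup>2 + 2 * (err \<omega> l k)\<^sup>2"
        by (simp add: err_def)
    qed
    also have "\<dots> = 2 * q f \<sigma> l \<omega> + 2 * (\<Sum>k\<in>positions l. (err \<omega> l k)\<^sup>2)"
      by (simp only: q_def sum.distrib sum_distrib_left)
    finally show ?thesis using err2[OF l, of \<omega>] by simp
  qed
  have sqrtV: "sqrt (V \<omega> l) \<le> 2 * sqrt (v l) + sqrt (q g \<sigma> l \<omega>) + sqrt (q h 0 l \<omega>)" if l: "-1 \<le> l" "l < J" for \<omega> l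
  proof -
    have nsgh: "ns f \<sigma> l k \<omega> = ns g \<sigma> l k \<omega> + ns h 0 l k \<omega>" if "k \<in> positions l" for k
      unfolding ns_def by (rule noise_sum_add[OF fgh fL gL hL]) (use l that in \<open>simp add: idx_def\<close>)
    have "sqrt (V \<omega> l) = L2_set (\<lambda>k. err \<omega> l k + (ns g \<sigma> l k \<omega> / real (N l) + ns h 0 l k \<omega> / real (N l))) (positions l)"
      unfolding V_def L2_set_def using nsgh
      by (intro arg_cong[where f=sqrt] sum.cong) (auto simp: err_def add_divide_distrib)
    also have "\<dots> \<le> L2_set (err \<omega> l) (positions l)
        + L2_set (\<lambda>k. ns g \<sigma> l k \<omega> / real (N l) + ns h 0 l k \<omega> / real (N l)) (positions l)"
      by (rule L2_set_triangle_ineq)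
    also have "L2_set (\<lambda>k. ns g \<sigma> l k \<omega> / real (N l) + ns h 0 l k \<omega> / real (N l)) (positions l)
        \<le> sqrt (q g \<sigma> l \<omega>) + sqrt (q h 0 l \<omega>)"
      unfolding q_def L2_set_def[symmetric] by (rule L2_set_triangle_ineq)
    also have "L2_set (err \<omega> l) (positions l) \<le> sqrt (4 * v l)"
      unfolding L2_set_def by (rule real_sqrt_le_mono[OF err2[OF l]])
    finally show ?thesis by (simp add: real_sqrt_mult)
  qed
  \<comment> \<open>The 2 accounts for rounding; the root is the level \<open>2 * (C1 * v l)\<close>
    above which the noise of g counts as excess.\<close>
  define c where "c = 2 + sqrt (2 * C1)"
  define Dg where "Dg l \<omega> = max 0 (sqrt (q g \<sigma> l \<omega>) - sqrt (2 * (C1 * v l)))" for l \<omega>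
  \<comment> \<open>The typical size of the noise of h in level l. With this scale in
    \<open>sqrt_le_linear\<close>, mean and correction are both of order
    \<open>tl * sqrt (v l)\<close>, which gives the factor \<open>Cp + 1\<close>.\<close>
  define \<beta> where "\<beta> l = tl * sqrt (v l)" for l
  have \<beta>: "0 < \<beta> l" if "-1 \<le> l" "l < J" for l unfolding \<beta>_def using tl(1) v0[OF that] by simp
  have D_le: "2 * max 0 (sqrt (V \<omega> l) - c * sqrt (v l)) \<le> 2 * Dg l \<omega> + q h 0 l \<omega> / \<beta> l + \<beta> l"
    if l: "-1 \<le> l" "l < J" for \<omega> l
  proof -
    have "c * sqrt (v l) = 2 * sqrt (v l) + sqrt (2 * (C1 * v l))"
      by (simp add: c_def distrib_right real_sqrt_mult)
    then have 1: "sqrt (V \<omega> l) - c * sqrt (v l) \<le> Dg l \<omega> + sqrt (q h 0 l \<omega>)"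
      using sqrtV[OF l, of \<omega>] unfolding Dg_def by linarith
    have 2: "0 \<le> Dg l \<omega> + sqrt (q h 0 l \<omega>)" unfolding Dg_def using q0 by simp
    define M where "M = max 0 (sqrt (V \<omega> l) - c * sqrt (v l))"
    define Y where "Y = q h 0 l \<omega> / \<beta> l + \<beta> l"
    have "M \<le> Dg l \<omega> + sqrt (q h 0 l \<omega>)"
      unfolding M_def using 1 2 by (rule max.boundedI[rotated])
    moreover have "sqrt (q h 0 l \<omega>) \<le> Y / 2"
      unfolding Y_def by (rule sqrt_le_linear[OF q0 \<beta>[OF l]])
    ultimately have "2 * M \<le> 2 * Dg l \<omega> + Y" by linarith
    then show ?thesis unfolding M_def Y_def by (simp only: add.assoc)
  qed
  have v0': "0 \<le> v l" and \<beta>': "0 \<le> \<beta> l" if "-1 \<le> l" "l < J" for l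
    by (rule less_imp_le[OF v0[OF that]], rule less_imp_le[OF \<beta>[OF that]])
  \<comment> \<open>The scale for linearising the root of the noise below js; by \<open>A3\<close>
    that noise has mean of order v_js.\<close>
  define \<alpha> where "\<alpha> = sqrt (v js)"
  have \<alpha>: "0 < \<alpha>" "\<alpha> * \<alpha> = v js" unfolding \<alpha>_def using v0[of js] js by (auto simp: J_def)
  define A0 where "A0 = sqrt (2 * \<tau> * v js) + sqrt (tail f js) + (8 * (\<Sum>l\<in>{-1..js-1}. v l)) / \<alpha> + \<alpha> / 2 + (\<Sum>l\<in>{js..J-1}. \<beta> l)"
  have tau0: "0 \<le> \<tau>" using tau by (rule order_trans[rotated]) simp
  have jsJ: "-1 \<le> js" "js < J" using js by (auto simp: J_def)
  have A00: "0 \<le> A0"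
  proof -
    have "0 \<le> (\<Sum>l\<in>{-1..js-1}. v l)" using jsJ by (intro sum_nonneg v0') auto
    moreover have "0 \<le> (\<Sum>l\<in>{js..J-1}. \<beta> l)" using jsJ by (intro sum_nonneg \<beta>') auto
    moreover have "0 \<le> sqrt (2 * \<tau> * v js)" "0 \<le> sqrt (tail f js)"
      using tau0 v0[OF jsJ] tail0[OF jsJ(1)] by auto
    ultimately show ?thesis unfolding A0_def using \<alpha>(1) by (intro add_nonneg_nonneg divide_nonneg_pos) auto
  qed
  have pw: "L2_norm (\<lambda>x. f_hat \<psi> \<tau> n m b sm (nest m p \<sigma> f \<omega>) x - f x)
      \<le> A0 + (\<Sum>l\<in>{-1..js-1}. 2 / \<alpha> * q f \<sigma> l \<omega>) + (\<Sum>l\<in>{js..J-1}. 2 * Dg l \<omega> + 1 / \<beta> l * q h 0 l \<omega>)" for \<omega>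
  proof -
    define U where "U = (\<Sum>l\<in>{-1..js-1}. V \<omega> l)"
    have U0: "0 \<le> U" unfolding U_def V_def by (intro sum_nonneg) simp
    have "L2_norm (\<lambda>x. f_hat \<psi> \<tau> n m b sm (nest m p \<sigma> f \<omega>) x - f x)
      \<le> sqrt (2 * \<tau> * v js) + sqrt (tail f js) + sqrt (2 * (\<Sum>l\<in>{-1..js-1}. V \<omega> l))
      + 2 * (\<Sum>l\<in>{js..j_max n b sm - 1}. max 0 (sqrt (V \<omega> l) - c * sqrt (v l)))"
    proof (rule oracle_inequality[OF fL tail0 js])
      show "v l = 2 ^ nat l / real (eff_size n m b sm l)" for l by (simp add: v_def N_def)
      show "0 < eff_size n m b sm js" using Npos[of js] js by (simp add: N_def)
      show "0 \<le> c" "400 * c\<^sup>2 \<le> \<tau>" using tau C1p by (auto simp: c_def)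
      show "V \<omega> l = (\<Sum>k\<in>positions l. (central_coeff \<psi> n m b sm (nest m p \<sigma> f \<omega>) l k - cf f (l, k))\<^sup>2)" for l
        by (simp add: V_def)
      fix l assume "js < l" "l \<le> j_max n b sm" "0 < eff_size n m b sm l"
      then show "(\<Sum>l'\<in>{js..l-1}. sqrt (v l')) \<le> 5 * sqrt (v l)" "tail f js \<le> \<tau> / 4 * v l"
        using A1[of l] A2[of l] by (simp_all add: N_def)
    qed
    moreover have "2 * (\<Sum>l\<in>{js..j_max n b sm - 1}. max 0 (sqrt (V \<omega> l) - c * sqrt (v l)))
        \<le> (\<Sum>l\<in>{js..J-1}. 2 * Dg l \<omega> + q h 0 l \<omega> / \<beta> l + \<beta> l)"
      unfolding sum_distrib_left J_def[symmetric] using jsJ by (intro sum_mono D_le) auto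
    moreover have "sqrt (2 * U) \<le> (\<Sum>l\<in>{-1..js-1}. 2 / \<alpha> * q f \<sigma> l \<omega>) + (8 * (\<Sum>l\<in>{-1..js-1}. v l)) / \<alpha> + \<alpha> / 2"
    proof -
      have "sqrt (2 * U) \<le> (2 * U / \<alpha> + \<alpha>) / 2" using U0 \<alpha>(1) by (intro sqrt_le_linear) auto
      also have "\<dots> = U / \<alpha> + \<alpha> / 2" by (simp add: add_divide_distrib)
      finally have 1: "sqrt (2 * U) \<le> U / \<alpha> + \<alpha> / 2" .
      have "U \<le> (\<Sum>l\<in>{-1..js-1}. 2 * q f \<sigma> l \<omega> + 8 * v l)"
        unfolding U_def using jsJ by (intro sum_mono V_le) auto
      also have "\<dots> = 2 * (\<Sum>l\<in>{-1..js-1}. q f \<sigma> l \<omega>) + 8 * (\<Sum>l\<in>{-1..js-1}. v l)"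
        by (simp only: sum.distrib sum_distrib_left)
      finally have "U / \<alpha> \<le> (2 * (\<Sum>l\<in>{-1..js-1}. q f \<sigma> l \<omega>) + 8 * (\<Sum>l\<in>{-1..js-1}. v l)) / \<alpha>"
        using \<alpha>(1) by (intro divide_right_mono) auto
      also have "\<dots> = (\<Sum>l\<in>{-1..js-1}. 2 / \<alpha> * q f \<sigma> l \<omega>) + (8 * (\<Sum>l\<in>{-1..js-1}. v l)) / \<alpha>"
        unfolding sum_distrib_left[symmetric] add_divide_distrib by simp
      finally show ?thesis using 1 by linarith
    qed
    ultimately show ?thesis unfolding A0_def U_def by (simp add: sum.distrib)
  qed
  have "risk m p \<sigma> (f_hat \<psi> \<tau> n m b sm) f
      \<le> (\<integral>\<^sup>+\<omega>. ennreal (L2_norm (\<lambda>x. f_hat \<psi> \<tau> n m b sm (nest m p \<sigma> f \<omega>) x - f x)) \<partial>flat_design m p)"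
    unfolding risk_def sample_law_flat[OF L2_unit_measurable[OF fL] m p(2)]
    by (rule nn_integral_distr_le[OF nest_measurable[OF L2_unit_measurable[OF fL]]])
  also have "\<dots> \<le> (\<integral>\<^sup>+\<omega>. ennreal A0 + ((\<Sum>l\<in>{-1..js-1}. ennreal (2 / \<alpha>) * ennreal (q f \<sigma> l \<omega>))
      + (\<Sum>l\<in>{js..J-1}. ennreal 2 * ennreal (Dg l \<omega>) + ennreal (1 / \<beta> l) * ennreal (q h 0 l \<omega>))) \<partial>flat_design m p)"
  proof (rule nn_integral_mono)
    fix \<omega>
    have Dg0: "0 \<le> Dg l \<omega>" for l by (simp add: Dg_def)
    have b0: "0 \<le> 1 / \<beta> l" if "l \<in> {js..J-1}" for l using \<beta>[of l] that jsJ by simp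
    have e1: "(\<Sum>l\<in>{-1..js-1}. ennreal (2 / \<alpha>) * ennreal (q f \<sigma> l \<omega>)) = ennreal (\<Sum>l\<in>{-1..js-1}. 2 / \<alpha> * q f \<sigma> l \<omega>)"
    proof -
      have "(\<Sum>l\<in>{-1..js-1}. ennreal (2 / \<alpha>) * ennreal (q f \<sigma> l \<omega>)) = (\<Sum>l\<in>{-1..js-1}. ennreal (2 / \<alpha> * q f \<sigma> l \<omega>))"
        using \<alpha>(1) q0 by (intro sum.cong refl ennreal_mult[symmetric]) auto
      also have "\<dots> = ennreal (\<Sum>l\<in>{-1..js-1}. 2 / \<alpha> * q f \<sigma> l \<omega>)"
        using \<alpha>(1) q0 by (intro sum_ennreal mult_nonneg_nonneg) auto
      finally show ?thesis .
    qed
    have e2: "(\<Sum>l\<in>{js..J-1}. ennreal 2 * ennreal (Dg l \<omega>) + ennreal (1 / \<beta> l) * ennreal (q h 0 l \<omega>))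
        = ennreal (\<Sum>l\<in>{js..J-1}. 2 * Dg l \<omega> + 1 / \<beta> l * q h 0 l \<omega>)"
    proof -
      have "(\<Sum>l\<in>{js..J-1}. ennreal 2 * ennreal (Dg l \<omega>) + ennreal (1 / \<beta> l) * ennreal (q h 0 l \<omega>))
          = (\<Sum>l\<in>{js..J-1}. ennreal (2 * Dg l \<omega> + 1 / \<beta> l * q h 0 l \<omega>))"
      proof (rule sum.cong[OF refl])
        fix l assume l: "l \<in> {js..J-1}"
        have "ennreal (2 * Dg l \<omega> + 1 / \<beta> l * q h 0 l \<omega>) = ennreal (2 * Dg l \<omega>) + ennreal (1 / \<beta> l * q h 0 l \<omega>)"
          using Dg0 b0[OF l] q0 by (intro ennreal_plus mult_nonneg_nonneg) auto
        also have "\<dots> = ennreal 2 * ennreal (Dg l \<omega>) + ennreal (1 / \<beta> l) * ennreal (q h 0 l \<omega>)"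
          using Dg0 b0[OF l] q0 by (intro arg_cong2[where f="(+)"] ennreal_mult) auto
        finally show "ennreal 2 * ennreal (Dg l \<omega>) + ennreal (1 / \<beta> l) * ennreal (q h 0 l \<omega>)
            = ennreal (2 * Dg l \<omega> + 1 / \<beta> l * q h 0 l \<omega>)" ..
      qed
      also have "\<dots> = ennreal (\<Sum>l\<in>{js..J-1}. 2 * Dg l \<omega> + 1 / \<beta> l * q h 0 l \<omega>)"
        using Dg0 b0 q0 by (intro sum_ennreal add_nonneg_nonneg mult_nonneg_nonneg) auto
      finally show ?thesis .
    qed
    have s1: "0 \<le> (\<Sum>l\<in>{-1..js-1}. 2 / \<alpha> * q f \<sigma> l \<omega>)"
      using \<alpha>(1) q0 by (intro sum_nonneg mult_nonneg_nonneg) auto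
    have s2: "0 \<le> (\<Sum>l\<in>{js..J-1}. 2 * Dg l \<omega> + 1 / \<beta> l * q h 0 l \<omega>)"
      using Dg0 b0 q0 by (intro sum_nonneg add_nonneg_nonneg mult_nonneg_nonneg) auto
    show "ennreal (L2_norm (\<lambda>x. f_hat \<psi> \<tau> n m b sm (nest m p \<sigma> f \<omega>) x - f x))
        \<le> ennreal A0 + ((\<Sum>l\<in>{-1..js-1}. ennreal (2 / \<alpha>) * ennreal (q f \<sigma> l \<omega>))
      + (\<Sum>l\<in>{js..J-1}. ennreal 2 * ennreal (Dg l \<omega>) + ennreal (1 / \<beta> l) * ennreal (q h 0 l \<omega>)))"
      unfolding e1 e2 ennreal_plus[OF s1 s2, symmetric] ennreal_plus[OF A00 add_nonneg_nonneg[OF s1 s2], symmetric]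
      using pw[of \<omega>] by (intro ennreal_leI) simp
  qed
  also have "\<dots> = ennreal A0 + ((\<Sum>l\<in>{-1..js-1}. ennreal (2 / \<alpha>) * (\<integral>\<^sup>+\<omega>. ennreal (q f \<sigma> l \<omega>) \<partial>flat_design m p))
      + (\<Sum>l\<in>{js..J-1}. ennreal 2 * (\<integral>\<^sup>+\<omega>. ennreal (Dg l \<omega>) \<partial>flat_design m p)
          + ennreal (1 / \<beta> l) * (\<integral>\<^sup>+\<omega>. ennreal (q h 0 l \<omega>) \<partial>flat_design m p)))"
  proof -
    interpret P: prob_space "flat_design m p" by (rule prob_space_flat_design)
    have m1: "(\<lambda>\<omega>. ennreal (q f \<sigma> l \<omega>)) \<in> borel_measurable (flat_design m p)" if "l \<in> {-1..js-1}" for l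
      using qm[of l f \<sigma>] that jsJ fL by auto
    have m2: "(\<lambda>\<omega>. ennreal (q h 0 l \<omega>)) \<in> borel_measurable (flat_design m p)" if "l \<in> {js..J-1}" for l
      using qm[of l h 0] that jsJ hL by auto
    have m3: "(\<lambda>\<omega>. ennreal (Dg l \<omega>)) \<in> borel_measurable (flat_design m p)" if "l \<in> {js..J-1}" for l
    proof -
      have [measurable]: "(\<lambda>\<omega>. q g \<sigma> l \<omega>) \<in> borel_measurable (flat_design m p)"
        using qm[of l g \<sigma>] that jsJ gL by auto
      show ?thesis unfolding Dg_def by measurable
    qed
    have cm: "(\<lambda>\<omega>. c * F \<omega>) \<in> borel_measurable (flat_design m p)"
      if [measurable]: "F \<in> borel_measurable (flat_design m p)" for c :: ennreal and F
      by measurable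
    have i1: "(\<integral>\<^sup>+\<omega>. (\<Sum>l\<in>{-1..js-1}. ennreal (2 / \<alpha>) * ennreal (q f \<sigma> l \<omega>)) \<partial>flat_design m p)
        = (\<Sum>l\<in>{-1..js-1}. ennreal (2 / \<alpha>) * (\<integral>\<^sup>+\<omega>. ennreal (q f \<sigma> l \<omega>) \<partial>flat_design m p))"
    proof (subst nn_integral_sum)
      show "(\<lambda>\<omega>. ennreal (2 / \<alpha>) * ennreal (q f \<sigma> l \<omega>)) \<in> borel_measurable (flat_design m p)"
        if "l \<in> {-1..js-1}" for l by (rule cm[OF m1[OF that]])
      show "(\<Sum>l\<in>{-1..js-1}. \<integral>\<^sup>+\<omega>. ennreal (2 / \<alpha>) * ennreal (q f \<sigma> l \<omega>) \<partial>flat_design m p)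
        = (\<Sum>l\<in>{-1..js-1}. ennreal (2 / \<alpha>) * (\<integral>\<^sup>+\<omega>. ennreal (q f \<sigma> l \<omega>) \<partial>flat_design m p))"
        by (intro sum.cong refl nn_integral_cmult m1)
    qed
    have i2: "(\<integral>\<^sup>+\<omega>. (\<Sum>l\<in>{js..J-1}. ennreal 2 * ennreal (Dg l \<omega>) + ennreal (1 / \<beta> l) * ennreal (q h 0 l \<omega>)) \<partial>flat_design m p)
        = (\<Sum>l\<in>{js..J-1}. ennreal 2 * (\<integral>\<^sup>+\<omega>. ennreal (Dg l \<omega>) \<partial>flat_design m p)
          + ennreal (1 / \<beta> l) * (\<integral>\<^sup>+\<omega>. ennreal (q h 0 l \<omega>) \<partial>flat_design m p))"
    proof (subst nn_integral_sum)
      fix l assume l: "l \<in> {js..J-1}"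
      note [measurable] = m2[OF l] m3[OF l]
      show "(\<lambda>\<omega>. ennreal 2 * ennreal (Dg l \<omega>) + ennreal (1 / \<beta> l) * ennreal (q h 0 l \<omega>)) \<in> borel_measurable (flat_design m p)"
        by measurable
    next
      show "(\<Sum>l\<in>{js..J-1}. \<integral>\<^sup>+\<omega>. ennreal 2 * ennreal (Dg l \<omega>) + ennreal (1 / \<beta> l) * ennreal (q h 0 l \<omega>) \<partial>flat_design m p)
        = (\<Sum>l\<in>{js..J-1}. ennreal 2 * (\<integral>\<^sup>+\<omega>. ennreal (Dg l \<omega>) \<partial>flat_design m p)
          + ennreal (1 / \<beta> l) * (\<integral>\<^sup>+\<omega>. ennreal (q h 0 l \<omega>) \<partial>flat_design m p))"
      proof (rule sum.cong[OF refl])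
        fix l assume l: "l \<in> {js..J-1}"
        note [measurable] = m2[OF l] m3[OF l]
        show "(\<integral>\<^sup>+\<omega>. ennreal 2 * ennreal (Dg l \<omega>) + ennreal (1 / \<beta> l) * ennreal (q h 0 l \<omega>) \<partial>flat_design m p)
          = ennreal 2 * (\<integral>\<^sup>+\<omega>. ennreal (Dg l \<omega>) \<partial>flat_design m p)
          + ennreal (1 / \<beta> l) * (\<integral>\<^sup>+\<omega>. ennreal (q h 0 l \<omega>) \<partial>flat_design m p)"
          by (subst nn_integral_add) (measurable, simp add: nn_integral_cmult)
      qed
    qed
    have M1: "(\<lambda>\<omega>. \<Sum>l\<in>{-1..js-1}. ennreal (2 / \<alpha>) * ennreal (q f \<sigma> l \<omega>)) \<in> borel_measurable (flat_design m p)"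
      by (intro borel_measurable_sum cm m1)
    have M2: "(\<lambda>\<omega>. \<Sum>l\<in>{js..J-1}. ennreal 2 * ennreal (Dg l \<omega>) + ennreal (1 / \<beta> l) * ennreal (q h 0 l \<omega>)) \<in> borel_measurable (flat_design m p)"
      by (intro borel_measurable_sum borel_measurable_add cm m2 m3)
    show ?thesis
      unfolding i1[symmetric] i2[symmetric] nn_integral_add[OF M1 M2, symmetric]
      using M1 M2 by (subst nn_integral_add) (auto simp: P.emeasure_space_1)
  qed
  also have "\<dots> \<le> ennreal A0 + ((\<Sum>l\<in>{-1..js-1}. ennreal (2 / \<alpha>) * ennreal (C1 * v l))
      + (\<Sum>l\<in>{js..J-1}. ennreal 2 * ennreal (C3 * K\<^sup>2 * (sqrt (v l) + v l * sqrt (v l)) / 2 ^ nat l)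
          + ennreal (1 / \<beta> l) * ennreal (Cp * tl\<^sup>2 * v l)))"
  proof (intro add_mono order_refl sum_mono mult_left_mono)
    fix l assume "l \<in> {-1..js-1}"
    then have l: "-1 \<le> l" "l < J" using jsJ by auto
    have "(\<integral>\<^sup>+\<omega>. ennreal (q f \<sigma> l \<omega>) \<partial>flat_design m p) \<le> ennreal (Cp * ((\<integral>x. (f x)\<^sup>2 \<partial>unif) + \<sigma>\<^sup>2) * v l)"
      by (rule qE[OF l fL])
    also have "\<dots> \<le> ennreal (C1 * v l)"
      unfolding C1 using Gb Cp_pos v0[OF l] by (intro ennreal_leI mult_right_mono mult_left_mono) auto
    finally show "(\<integral>\<^sup>+\<omega>. ennreal (q f \<sigma> l \<omega>) \<partial>flat_design m p) \<le> ennreal (C1 * v l)" .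
  next
    fix l assume "l \<in> {js..J-1}"
    then have l: "-1 \<le> l" "l < J" using jsJ by auto
    show "(\<integral>\<^sup>+\<omega>. ennreal (Dg l \<omega>) \<partial>flat_design m p) \<le> ennreal (C3 * K\<^sup>2 * (sqrt (v l) + v l * sqrt (v l)) / 2 ^ nat l)"
      unfolding Dg_def q_def ns_def C3
      by (rule noise_sum_excess_le[where Gb=Gb])
        (use l gL tr trN Npos K K1 gG C1 \<sigma> v_def C2 in \<open>auto simp: J_def g_def\<close>)
    have "(\<integral>\<^sup>+\<omega>. ennreal (q h 0 l \<omega>) \<partial>flat_design m p) \<le> ennreal (Cp * ((\<integral>x. (h x)\<^sup>2 \<partial>unif) + 0\<^sup>2) * v l)"
      by (rule qE[OF l hL])
    also have "\<dots> \<le> ennreal (Cp * tl\<^sup>2 * v l)"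
      using hT Cp_pos v0[OF l] by (intro ennreal_leI mult_right_mono mult_left_mono) auto
    finally show "(\<integral>\<^sup>+\<omega>. ennreal (q h 0 l \<omega>) \<partial>flat_design m p) \<le> ennreal (Cp * tl\<^sup>2 * v l)" .
  qed auto
  also have "\<dots> = ennreal (A0 + ((\<Sum>l\<in>{-1..js-1}. 2 / \<alpha> * (C1 * v l))
      + (\<Sum>l\<in>{js..J-1}. 2 * (C3 * K\<^sup>2 * (sqrt (v l) + v l * sqrt (v l)) / 2 ^ nat l) + 1 / \<beta> l * (Cp * tl\<^sup>2 * v l))))"
  proof -
    have C30: "0 \<le> C3" unfolding C3 C2 using C1p Gb0 by (intro divide_nonneg_nonneg) auto
    have p1: "0 \<le> 2 / \<alpha> * (C1 * v l)" if "l \<in> {-1..js-1}" for l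
      using \<alpha>(1) C1p v0[of l] that jsJ by auto
    have p2: "0 \<le> C3 * K\<^sup>2 * (sqrt (v l) + v l * sqrt (v l)) / 2 ^ nat l" if "l \<in> {js..J-1}" for l
      using C30 v0[of l] that jsJ by auto
    have p3: "0 \<le> 1 / \<beta> l * (Cp * tl\<^sup>2 * v l)" if "l \<in> {js..J-1}" for l
      using Cp_pos v0[of l] \<beta>[of l] that jsJ by auto
    have e1: "(\<Sum>l\<in>{-1..js-1}. ennreal (2 / \<alpha>) * ennreal (C1 * v l)) = ennreal (\<Sum>l\<in>{-1..js-1}. 2 / \<alpha> * (C1 * v l))"
    proof -
      have "(\<Sum>l\<in>{-1..js-1}. ennreal (2 / \<alpha>) * ennreal (C1 * v l)) = (\<Sum>l\<in>{-1..js-1}. ennreal (2 / \<alpha> * (C1 * v l)))"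
      proof (intro sum.cong refl ennreal_mult[symmetric])
        fix l assume "l \<in> {-1..js-1}"
        then show "0 \<le> C1 * v l" using C1p v0[of l] jsJ by auto
      qed (use \<alpha>(1) in auto)
      also have "\<dots> = ennreal (\<Sum>l\<in>{-1..js-1}. 2 / \<alpha> * (C1 * v l))" by (rule sum_ennreal[OF p1])
      finally show ?thesis .
    qed
    have e2: "(\<Sum>l\<in>{js..J-1}. ennreal 2 * ennreal (C3 * K\<^sup>2 * (sqrt (v l) + v l * sqrt (v l)) / 2 ^ nat l)
          + ennreal (1 / \<beta> l) * ennreal (Cp * tl\<^sup>2 * v l))
      = ennreal (\<Sum>l\<in>{js..J-1}. 2 * (C3 * K\<^sup>2 * (sqrt (v l) + v l * sqrt (v l)) / 2 ^ nat l) + 1 / \<beta> l * (Cp * tl\<^sup>2 * v l))"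
    proof -
      have "(\<Sum>l\<in>{js..J-1}. ennreal 2 * ennreal (C3 * K\<^sup>2 * (sqrt (v l) + v l * sqrt (v l)) / 2 ^ nat l)
          + ennreal (1 / \<beta> l) * ennreal (Cp * tl\<^sup>2 * v l))
        = (\<Sum>l\<in>{js..J-1}. ennreal (2 * (C3 * K\<^sup>2 * (sqrt (v l) + v l * sqrt (v l)) / 2 ^ nat l) + 1 / \<beta> l * (Cp * tl\<^sup>2 * v l)))"
      proof (rule sum.cong[OF refl])
        fix l assume l: "l \<in> {js..J-1}"
        define X where "X = C3 * K\<^sup>2 * (sqrt (v l) + v l * sqrt (v l)) / 2 ^ nat l"
        define Y where "Y = Cp * tl\<^sup>2 * v l"
        have X: "0 \<le> X" using p2[OF l] by (simp add: X_def)
        have Y: "0 \<le> Y" "0 \<le> 1 / \<beta> l" using Cp_pos v0[of l] \<beta>[of l] l jsJ by (auto simp: Y_def)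
        have "ennreal (2 * X + 1 / \<beta> l * Y) = ennreal (2 * X) + ennreal (1 / \<beta> l * Y)"
          using X Y by (intro ennreal_plus mult_nonneg_nonneg) auto
        also have "\<dots> = ennreal 2 * ennreal X + ennreal (1 / \<beta> l) * ennreal Y"
          using X Y by (intro arg_cong2[where f="(+)"] ennreal_mult) auto
        finally show "ennreal 2 * ennreal (C3 * K\<^sup>2 * (sqrt (v l) + v l * sqrt (v l)) / 2 ^ nat l)
            + ennreal (1 / \<beta> l) * ennreal (Cp * tl\<^sup>2 * v l)
          = ennreal (2 * (C3 * K\<^sup>2 * (sqrt (v l) + v l * sqrt (v l)) / 2 ^ nat l) + 1 / \<beta> l * (Cp * tl\<^sup>2 * v l))"
          unfolding X_def[symmetric] Y_def[symmetric] ..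
      qed
      also have "\<dots> = ennreal (\<Sum>l\<in>{js..J-1}. 2 * (C3 * K\<^sup>2 * (sqrt (v l) + v l * sqrt (v l)) / 2 ^ nat l) + 1 / \<beta> l * (Cp * tl\<^sup>2 * v l))"
        using p2 p3 by (intro sum_ennreal add_nonneg_nonneg[OF mult_nonneg_nonneg]) auto
      finally show ?thesis .
    qed
    have s1: "0 \<le> (\<Sum>l\<in>{-1..js-1}. 2 / \<alpha> * (C1 * v l))" by (rule sum_nonneg[OF p1])
    have s2: "0 \<le> (\<Sum>l\<in>{js..J-1}. 2 * (C3 * K\<^sup>2 * (sqrt (v l) + v l * sqrt (v l)) / 2 ^ nat l) + 1 / \<beta> l * (Cp * tl\<^sup>2 * v l))"
      using p2 p3 by (intro sum_nonneg add_nonneg_nonneg[OF mult_nonneg_nonneg]) auto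
    show ?thesis
      unfolding e1 e2 ennreal_plus[OF s1 s2, symmetric] ennreal_plus[OF A00 add_nonneg_nonneg[OF s1 s2], symmetric] ..
  qed
  also have "\<dots> \<le> ennreal (sqrt (2 * \<tau> * v js) + sqrt (tail f js) + (16 * C1 + 65) * sqrt (v js)
        + (\<Sum>l\<in>{js..j_max n b sm - 1}. (Cp + 1) * tl * sqrt (v l) + 2 * (C3 * K\<^sup>2 * (sqrt (v l) + v l * sqrt (v l)) / 2 ^ nat l)))"
  proof (rule ennreal_leI)
    define sv where "sv = (\<Sum>l\<in>{-1..js-1}. v l)"
    have svb: "sv / \<alpha> \<le> 8 * \<alpha>"
      using A3 \<alpha> by (simp add: sv_def[symmetric] pos_divide_le_eq mult.assoc)
    have "1 / \<beta> l * (Cp * tl\<^sup>2 * v l) = Cp * tl * sqrt (v l)" if "l \<in> {js..J-1}" for l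
    proof -
      have vl: "0 < v l" using v0[of l] that jsJ by auto
      have "tl\<^sup>2 * v l = \<beta> l * (tl * sqrt (v l))"
        using vl by (simp add: \<beta>_def power2_eq_square)
      then show ?thesis using \<beta>[of l] that jsJ by (simp add: mult.assoc)
    qed
    then have t1: "(\<Sum>l\<in>{js..J-1}. 2 * (C3 * K\<^sup>2 * (sqrt (v l) + v l * sqrt (v l)) / 2 ^ nat l) + 1 / \<beta> l * (Cp * tl\<^sup>2 * v l))
        = (\<Sum>l\<in>{js..J-1}. 2 * (C3 * K\<^sup>2 * (sqrt (v l) + v l * sqrt (v l)) / 2 ^ nat l) + Cp * tl * sqrt (v l))"
      by (intro sum.cong refl arg_cong2[where f="(+)"])
    have t2: "(\<Sum>l\<in>{js..J-1}. \<beta> l) + (\<Sum>l\<in>{js..J-1}. 2 * (C3 * K\<^sup>2 * (sqrt (v l) + v l * sqrt (v l)) / 2 ^ nat l) + Cp * tl * sqrt (v l))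
        = (\<Sum>l\<in>{js..J-1}. (Cp + 1) * tl * sqrt (v l) + 2 * (C3 * K\<^sup>2 * (sqrt (v l) + v l * sqrt (v l)) / 2 ^ nat l))"
      unfolding sum.distrib[symmetric] by (intro sum.cong refl) (simp add: \<beta>_def distrib_right)
    have t3: "(\<Sum>l\<in>{-1..js-1}. 2 / \<alpha> * (C1 * v l)) = 2 * C1 * (sv / \<alpha>)"
    proof -
      have "(\<Sum>l\<in>{-1..js-1}. 2 / \<alpha> * (C1 * v l)) = 2 / \<alpha> * (C1 * sv)"
        unfolding sv_def by (simp only: sum_distrib_left)
      then show ?thesis by simp
    qed
    \<comment> \<open>Rounding contributes 8 * 8 and the term \<open>\<alpha> / 2\<close>, together
      at most 65, and the noise 2 * 8 * \<open>C1\<close>.\<close>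
    have "8 * sv / \<alpha> + 2 * C1 * (sv / \<alpha>) \<le> 8 * (8 * \<alpha>) + 2 * C1 * (8 * \<alpha>)"
      using svb C1p mult_left_mono[OF svb, of "2 * C1"] by simp
    then have "8 * sv / \<alpha> + \<alpha> / 2 + 2 * C1 * (sv / \<alpha>) \<le> (16 * C1 + 65) * \<alpha>"
      using \<alpha>(1) by (simp add: algebra_simps)
    then show "A0 + ((\<Sum>l\<in>{-1..js-1}. 2 / \<alpha> * (C1 * v l))
        + (\<Sum>l\<in>{js..J-1}. 2 * (C3 * K\<^sup>2 * (sqrt (v l) + v l * sqrt (v l)) / 2 ^ nat l) + 1 / \<beta> l * (Cp * tl\<^sup>2 * v l)))
      \<le> sqrt (2 * \<tau> * v js) + sqrt (tail f js) + (16 * C1 + 65) * sqrt (v js)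
        + (\<Sum>l\<in>{js..j_max n b sm - 1}. (Cp + 1) * tl * sqrt (v l) + 2 * (C3 * K\<^sup>2 * (sqrt (v l) + v l * sqrt (v l)) / 2 ^ nat l))"
      unfolding t1 t3 A0_def J_def[symmetric] t2[symmetric] \<alpha>_def[symmetric] sv_def[symmetric] by linarith
  qed
  finally show ?thesis .
qed

end

section \<open>Sizes of the groups of machines\<close>

text \<open>A quotient that is at least 1 loses at most a factor 2 by rounding down.\<close>

lemma half_le_div:
  fixes x k :: nat
  assumes "1 \<le> x div k"
  shows "real x / (2 * real k) \<le> real (x div k)"
proof -
  have k: "0 < k" using assms by (cases k) auto
  have "x mod k \<le> k * 1" using k by (simp add: less_imp_le)
  also have "\<dots> \<le> k * (x div k)" using assms by (rule mult_le_mono2)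
  finally have "x \<le> 2 * (k * (x div k))" using mult_div_mod_eq[of k x] by linarith
  then have "real x \<le> real (2 * (k * (x div k)))" by (rule of_nat_mono)
  then show ?thesis using k by (simp add: field_simps)
qed

locale budget =
  fixes n m :: nat and b :: real and sm :: ereal
  assumes n2: "2 \<le> n" and lg_le: "log 2 (real n) \<le> b" and adm: "admissible n m b sm"
begin

definition lg :: real where "lg = log 2 (real n)"
definition p :: nat where "p = n div m"
definition J :: int where "J = j_max n b sm"
definition jB :: int where "jB = j_B n b"
definition N :: "int \<Rightarrow> nat" where "N l = eff_size n m b sm l"
definition v :: "int \<Rightarrow> real" where "v l = 2 ^ nat l / real (N l)"

lemma lg1: "1 \<le> lg"
proof -
  have "log 2 2 \<le> log 2 (real n)" using n2 by (subst log_le_cancel_iff) auto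
  then show ?thesis by (simp add: lg_def)
qed

lemma b_lg: "lg \<le> b" using lg_le by (simp add: lg_def)

lemma b1: "1 \<le> b" using b_lg lg1 by simp

lemma m2: "2 \<le> m"
proof -
  have "1 \<le> m div 2" using adm by (simp add: admissible_def first_half_def)
  then show ?thesis by linarith
qed

lemma mp: "m * p = n"
  using adm by (simp add: admissible_def p_def)

lemma p0: "0 < p"
  using mp n2 by (intro Nat.gr0I) auto

text \<open>Each of the two floors in \<open>j_B\<close> costs at most a factor 2, hence the 4.
  Since log n <= b, the inner floor is at least 1 and its logarithm nonnegative.\<close>

lemma jB0: "0 \<le> jB" and jB_le: "2 ^ nat jB \<le> b / lg" and jB_ge: "b / (4 * lg) \<le> 2 ^ nat jB"
proof -
  define x where "x = b / lg"
  define u where "u = \<lfloor>x\<rfloor>"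
  have x1: "1 \<le> x" using b_lg lg1 by (simp add: pos_le_divide_eq x_def)
  then have u1: "1 \<le> u" unfolding u_def by simp
  have ux: "real_of_int u \<le> x" unfolding u_def by (rule of_int_floor_le)
  have xu1: "x < real_of_int u + 1" unfolding u_def by (rule real_of_int_floor_add_one_gt)
  have "1 \<le> real_of_int u" using u1 by simp
  then have xu: "x \<le> 2 * real_of_int u" using xu1 by linarith
  have jB: "jB = \<lfloor>log 2 (real_of_int u)\<rfloor>" unfolding jB_def j_B_def u_def x_def lg_def ..
  have "log 2 1 \<le> log 2 (real_of_int u)" using u1 by (subst log_le_cancel_iff) auto
  then show j0: "0 \<le> jB" unfolding jB by simp
  have pw: "(2::real) ^ nat jB = 2 powr real_of_int jB"
    using j0 by (simp add: powr_realpow[symmetric])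
  have "2 powr real_of_int jB \<le> 2 powr log 2 (real_of_int u)" unfolding jB by (intro powr_mono) auto
  also have "2 powr log 2 (real_of_int u) = real_of_int u" using u1 by simp
  also have "\<dots> \<le> b / lg" using ux by (simp add: x_def)
  finally show "2 ^ nat jB \<le> b / lg" unfolding pw .
  have "real_of_int u = 2 powr log 2 (real_of_int u)" using u1 by simp
  also have "\<dots> \<le> 2 powr (real_of_int jB + 1)" unfolding jB by (intro powr_mono) linarith+
  also have "\<dots> = 2 * 2 ^ nat jB" unfolding pw by (simp add: powr_add)
  finally have "real_of_int u \<le> 2 * 2 ^ nat jB" .
  then have "b / lg \<le> 4 * 2 ^ nat jB" using xu unfolding x_def by linarith
  then show "b / (4 * lg) \<le> 2 ^ nat jB" using lg1 by (simp add: field_simps)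
qed

definition gs :: nat where "gs = group_size n m b sm"
definition ng :: nat where "ng = n_groups n b sm"

lemma gs_le: "ng * gs \<le> (m + 1) div 2"
  unfolding gs_def ng_def group_size_def by (simp add: mult.commute)

lemma ng_eq: "ng = nat (J - jB)"
  by (simp add: ng_def n_groups_def J_def jB_def)

lemma N_below: "l < jB \<Longrightarrow> N l = (m div 2) * p"
  by (simp add: N_def eff_size_def first_half_def jB_def p_def)

lemma N_above: "jB \<le> l \<Longrightarrow> N l = (gs div 2 ^ nat (l - jB)) * p"
  by (simp add: N_def eff_size_def subgroup_size_def gs_def jB_def p_def)

lemma subgroup_pos: "jB \<le> l \<Longrightarrow> l < J \<Longrightarrow> 1 \<le> gs div 2 ^ nat (l - jB)"
  using adm unfolding admissible_def subgroup_size_def gs_def[symmetric] ng_def[symmetric] ng_eq by auto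

lemma N_pos: "l < J \<Longrightarrow> 0 < N l"
  using subgroup_pos[of l] p0 m2 by (cases "l < jB") (auto simp: N_below N_above)

lemma transmitters_below: "l < jB \<Longrightarrow> transmitters n m b sm l k = {..<m div 2}"
  by (simp add: transmitters_def first_half_def jB_def)

lemma transmitters_above:
  "jB \<le> l \<Longrightarrow> transmitters n m b sm l k = (let t = nat (l - jB); r = gs div 2 ^ t; i = k div 2 ^ nat jB; a = m div 2 + t * gs
    in {a + i * r..<a + (i + 1) * r})"
  by (simp add: transmitters_def subgroup_def subgroup_size_def gs_def jB_def Let_def)

lemma position_block:
  assumes "jB \<le> l" "k \<in> positions l"
  shows "k div 2 ^ nat jB < 2 ^ nat (l - jB)"
proof -
  have "nat l = nat (l - jB) + nat jB" using assms(1) jB0 by simp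
  then have "k < 2 ^ nat (l - jB) * 2 ^ nat jB" using assms(2) by (simp add: positions_def power_add)
  then show ?thesis by (simp add: less_mult_imp_div_less)
qed

lemma block_bounds:
  assumes "jB \<le> l" "l < J" "k \<in> positions l"
  defines "t \<equiv> nat (l - jB)"
  defines "r \<equiv> gs div 2 ^ t"
  shows "(k div 2 ^ nat jB + 1) * r \<le> gs" "(t + 1) * gs \<le> (m + 1) div 2"
proof -
  have "(k div 2 ^ nat jB + 1) * r \<le> 2 ^ t * r"
    using position_block[OF assms(1,3)] unfolding t_def by (intro mult_le_mono1) simp
  also have "\<dots> \<le> gs" by (simp add: r_def)
  finally show "(k div 2 ^ nat jB + 1) * r \<le> gs" .
  have "t + 1 \<le> ng" using assms(1,2) unfolding ng_eq t_def by simp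
  then have "(t + 1) * gs \<le> ng * gs" by (rule mult_le_mono1)
  also have "\<dots> \<le> (m + 1) div 2" by (rule gs_le)
  finally show "(t + 1) * gs \<le> (m + 1) div 2" .
qed

lemma transmitters_subset:
  assumes "l < J" "k \<in> positions l"
  shows "transmitters n m b sm l k \<subseteq> {..<m}"
proof (cases "l < jB")
  case True
  then show ?thesis using transmitters_below by auto
next
  case False
  then have l: "jB \<le> l" by simp
  define t where "t = nat (l - jB)"
  define r where "r = gs div 2 ^ t"
  define i where "i = k div 2 ^ nat jB"
  have "(i + 1) * r \<le> gs" "(t + 1) * gs \<le> (m + 1) div 2"
    using block_bounds[OF l assms] unfolding t_def r_def i_def by auto
  then have "m div 2 + t * gs + (i + 1) * r \<le> m div 2 + (m + 1) div 2" by simp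
  also have "\<dots> = m" by linarith
  finally have "{m div 2 + t * gs + i * r..<m div 2 + t * gs + (i + 1) * r} \<subseteq> {..<m}" by auto
  then show ?thesis unfolding transmitters_above[OF l] Let_def t_def r_def i_def .
qed

lemma transmitters_card:
  "card (transmitters n m b sm l k) * p = N l"
proof (cases "l < jB")
  case False
  then have l: "jB \<le> l" by simp
  show ?thesis unfolding transmitters_above[OF l] N_above[OF l] Let_def by (simp add: algebra_simps)
qed (simp add: transmitters_below N_below)

lemma gs_le_m: "gs \<le> (m + 1) div 2"
  unfolding gs_def group_size_def by (rule div_le_dividend)

lemma N_le: "N l \<le> n"
proof (cases "l < jB")
  case True
  have "(m div 2) * p \<le> m * p" by (intro mult_le_mono1) simp
  then show ?thesis using True mp by (simp add: N_below)
next
  case False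
  have "gs div 2 ^ nat (l - jB) \<le> gs" by (rule div_le_dividend)
  also have "\<dots> \<le> m" using gs_le_m m2 by linarith
  finally have "(gs div 2 ^ nat (l - jB)) * p \<le> m * p" by (rule mult_le_mono1)
  then show ?thesis using False mp by (simp add: N_above)
qed

text \<open>The factor 2 is needed where the lower levels meet the groups: for odd m a single group
  can be larger than the first half of the machines.\<close>

lemma N_mono:
  assumes "l' \<le> l"
  shows "N l \<le> 2 * N l'"
proof (cases "l' < jB")
  case True
  show ?thesis
  proof (cases "l < jB")
    case False
    have "gs div 2 ^ nat (l - jB) \<le> gs" by (rule div_le_dividend)
    also have "\<dots> \<le> 2 * (m div 2)" using gs_le_m m2 by linarith
    finally have "(gs div 2 ^ nat (l - jB)) * p \<le> 2 * (m div 2) * p" by (rule mult_le_mono1)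
    then show ?thesis using True False by (simp add: N_above N_below)
  qed (simp add: True N_below)
next
  case False
  have "gs div 2 ^ nat (l - jB) \<le> gs div 2 ^ nat (l' - jB)"
    using assms by (intro div_le_mono2 power_increasing) auto
  then have "(gs div 2 ^ nat (l - jB)) * p \<le> (gs div 2 ^ nat (l' - jB)) * p" by (rule mult_le_mono1)
  moreover have "N l = (gs div 2 ^ nat (l - jB)) * p" "N l' = (gs div 2 ^ nat (l' - jB)) * p"
    using assms False by (auto intro!: N_above)
  ultimately show ?thesis by linarith
qed

text \<open>From \<open>jB\<close> on, the \<open>2 ^ t\<close> subgroups of a group are disjoint,
  so \<open>N l * 2 ^ t\<close> is at most n, and \<open>2 ^ jB\<close> is at most b. This yields
  the lower bound of order 4^l / (n b) for v_l, where no logarithm is lost.\<close>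

lemma N_scaled_le:
  assumes "0 \<le> l"
  shows "real (N l) * 2 ^ nat l \<le> real n * b"
proof (cases "l < jB")
  case True
  have "(2::real) ^ nat l \<le> 2 ^ nat jB" using True by (intro power_increasing) auto
  also have "\<dots> \<le> b / lg" by (rule jB_le)
  also have "\<dots> \<le> b" using lg1 b1 by (simp add: pos_divide_le_eq)
  finally have "2 ^ nat l \<le> b" .
  then show ?thesis using N_le[of l] by (intro mult_mono) auto
next
  case False
  define t where "t = nat (l - jB)"
  have "nat l = t + nat jB" using False jB0 by (simp add: t_def)
  then have pw: "(2::real) ^ nat l = 2 ^ t * 2 ^ nat jB" by (simp add: power_add)
  have "(gs div 2 ^ t) * 2 ^ t \<le> gs" by simp
  also have "\<dots> \<le> m" using gs_le_m m2 by linarith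
  finally have "(gs div 2 ^ t) * 2 ^ t * p \<le> m * p" by (rule mult_le_mono1)
  then have "N l * 2 ^ t \<le> n" using False mp by (simp add: N_above t_def mult_ac)
  then have "real (N l * 2 ^ t) \<le> real n" by (rule of_nat_mono)
  then have "real (N l) * 2 ^ t \<le> real n" by simp
  moreover have "2 ^ nat jB \<le> b"
  proof -
    have "2 ^ nat jB \<le> b / lg" by (rule jB_le)
    also have "\<dots> \<le> b" using lg1 b1 by (simp add: pos_divide_le_eq)
    finally show ?thesis .
  qed
  ultimately have "(real (N l) * 2 ^ t) * 2 ^ nat jB \<le> real n * b" by (intro mult_mono) auto
  then show ?thesis unfolding pw by (simp only: mult.assoc)
qed

lemma v_ge:
  assumes "0 \<le> l" "0 < N l"
  shows "2 ^ nat l / real n \<le> v l" "(2 ^ nat l)\<^sup>2 / (real n * b) \<le> v l"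
proof -
  show "2 ^ nat l / real n \<le> v l"
    unfolding v_def using assms N_le[of l] n2 by (intro divide_left_mono) auto
  have "0 < real n * b" using n2 b1 by simp
  then show "(2 ^ nat l)\<^sup>2 / (real n * b) \<le> v l"
    using assms N_scaled_le[OF assms(1)] unfolding v_def
    by (simp add: divide_le_eq power2_eq_square field_simps)
qed

lemma v_mono:
  assumes "0 \<le> l'" "l' \<le> l" "0 < N l"
  shows "v l' \<le> 2 * (1/2) ^ nat (l - l') * v l"
proof -
  have Nl': "0 < N l'" using N_mono[OF assms(2)] assms(3) by linarith
  have "real (N l) \<le> 2 * real (N l')" using of_nat_mono[OF N_mono[OF assms(2)], where 'a=real] by simp
  have "nat l = nat l' + nat (l - l')" using assms by simp
  then have pw: "(2::real) ^ nat l = 2 ^ nat l' * 2 ^ nat (l - l')" by (simp add: power_add)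
  have "v l' \<le> 2 ^ nat l' * (2 / real (N l))"
    unfolding v_def using \<open>real (N l) \<le> 2 * real (N l')\<close> Nl' assms(3) by (simp add: field_simps)
  also have "\<dots> = 2 * (1/2) ^ nat (l - l') * v l"
    unfolding v_def pw using assms(3) by (simp add: field_simps power_divide)
  finally show ?thesis .
qed

lemma v_nonneg: "0 \<le> v l" by (simp add: v_def)

lemma v_mono_strict:
  assumes "0 \<le> l'" "l' < l" "0 < N l"
  shows "v l' \<le> v l"
proof -
  have "v l' \<le> 2 * (1/2) ^ nat (l - l') * v l" using assms by (intro v_mono) auto
  also have "\<dots> \<le> 1 * v l"
  proof (rule mult_right_mono[OF _ v_nonneg])
    obtain i where "nat (l - l') = Suc i" using assms by (metis diff_gt_0_iff_gt gr0_implies_Suc zero_less_nat_eq)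
    then show "2 * (1/2) ^ nat (l - l') \<le> (1::real)" by (simp add: power_le_one)
  qed
  finally show ?thesis by simp
qed

text \<open>The roots decay downwards by the factor \<open>1 / sqrt 2\<close>, at most 4/5, starting
  with at most the root of v_l itself. So the constant is 1 / (1 - 4/5) = 5.\<close>

lemma sum_sqrt_v_le:
  assumes "0 \<le> js" "js < l" "0 < N l"
  shows "(\<Sum>l'\<in>{js..l-1}. sqrt (v l')) \<le> 5 * sqrt (v l)"
proof -
  define x where "x = 1 / sqrt 2"
  have x: "0 < x" "x\<^sup>2 = 1/2" by (simp_all add: x_def power_divide)
  have x8: "x \<le> 4/5"
  proof (rule power2_le_imp_le)
    show "x\<^sup>2 \<le> (4/5)\<^sup>2" unfolding x(2) by (simp add: power2_eq_square)
  qed simp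
  have "sqrt (v l') \<le> x ^ nat (l - 1 - l') * sqrt (v l)" if l': "l' \<in> {js..l-1}" for l'
  proof -
    define i where "i = nat (l - 1 - l')"
    have i: "nat (l - l') = Suc i" using l' by (simp add: i_def Suc_nat_eq_nat_zadd1)
    have "v l' \<le> 2 * (1/2) ^ Suc i * v l" unfolding i[symmetric] using l' assms by (intro v_mono) auto
    also have "\<dots> = (x ^ i)\<^sup>2 * v l"
    proof -
      have "(x ^ i)\<^sup>2 = (1/2) ^ i" unfolding x(2)[symmetric] by (simp add: power_mult[symmetric] mult.commute)
      then show ?thesis by simp
    qed
    finally have "sqrt (v l') \<le> sqrt ((x ^ i)\<^sup>2 * v l)" by simp
    also have "\<dots> = x ^ i * sqrt (v l)" using x by (simp add: real_sqrt_mult)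
    finally show ?thesis by (simp add: i_def)
  qed
  then have "(\<Sum>l'\<in>{js..l-1}. sqrt (v l')) \<le> (\<Sum>l'\<in>{js..l-1}. x ^ nat (l - 1 - l') * sqrt (v l))" by (rule sum_mono)
  also have "\<dots> = (\<Sum>l'\<in>{js..l-1}. x ^ nat (l - 1 - l')) * sqrt (v l)" by (rule sum_distrib_right[symmetric])
  also have "(\<Sum>l'\<in>{js..l-1}. x ^ nat (l - 1 - l')) = (\<Sum>i<nat (l - js). x ^ i)"
    by (rule sum.reindex_bij_witness[where i="\<lambda>i. l - 1 - int i" and j="\<lambda>l'. nat (l - 1 - l')"]) (use assms in auto)
  also have "(\<Sum>i<nat (l - js). x ^ i) = (1 - x ^ nat (l - js)) / (1 - x)"
    using x8 by (subst sum_gp_strict) auto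
  also have "\<dots> \<le> 5"
  proof -
    have "5 * x \<le> 4" using x8 by simp
    moreover have "0 \<le> x ^ nat (l - js)" using x by simp
    ultimately have "1 - x ^ nat (l - js) \<le> 5 * (1 - x)" unfolding right_diff_distrib by simp
    then show ?thesis using x8 by (simp add: pos_divide_le_eq)
  qed
  finally show ?thesis by (simp add: mult_right_mono v_nonneg)
qed

text \<open>\<open>nat (-1)\<close> is 0, so level -1 adds one more 1 to the sum 1 + 2 + 4 + ... and
  completes it to a power of two.\<close>

lemma sum_pow2: "0 \<le> j \<Longrightarrow> (\<Sum>l\<in>{-1..j-1}. (2::real) ^ nat l) = 2 ^ nat j"
proof (induction j rule: int_ge_induct)
  case (step j)
  have "{-1..j + 1 - 1} = insert j {-1..j-1}" using step.hyps by auto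
  then have "(\<Sum>l\<in>{-1..j + 1 - 1}. (2::real) ^ nat l) = 2 ^ nat j + 2 ^ nat j" using step by simp
  also have "\<dots> = 2 ^ nat (j + 1)" using step.hyps by (simp add: nat_add_distrib)
  finally show ?case .
qed simp

lemma sum_v_le:
  assumes js: "0 \<le> js" "0 < N js"
  shows "(\<Sum>l\<in>{-1..js-1}. v l) \<le> 8 * v js"
proof -
  have "(\<Sum>l\<in>{-1..js-1}. v l) \<le> (\<Sum>l\<in>{-1..js-1}. 2 ^ nat l * (2 / real (N js)))"
  proof (rule sum_mono)
    fix l assume "l \<in> {-1..js-1}"
    then have le: "N js \<le> 2 * N l" by (intro N_mono) auto
    have "0 < N l" using le js(2) by linarith
    moreover have "real (N js) \<le> 2 * real (N l)" using of_nat_mono[OF le, where 'a=real] by simp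
    ultimately show "v l \<le> 2 ^ nat l * (2 / real (N js))"
      unfolding v_def using js(2) by (simp add: field_simps)
  qed
  also have "\<dots> = 2 * v js"
    unfolding sum_distrib_right[symmetric] sum_pow2[OF js(1)] v_def by simp
  also have "\<dots> \<le> 8 * v js" using v_nonneg[of js] by simp
  finally show ?thesis .
qed

end

section \<open>Resolution, noise levels and the critical level when the minimal smoothness is
  finite\<close>

locale finite_budget = budget +
  fixes r :: real
  assumes sm: "sm = ereal r" and r0: "0 \<le> r"
begin

lemma J_eq: "J = min \<lceil>log 2 (real n * b) / (2 + 2 * r)\<rceil> \<lceil>log 2 (real n) / (1 + 2 * r)\<rceil>"
proof -
  have eqs: "2 + 2 * ereal r = ereal (2 + 2 * r)" "1 + 2 * ereal r = ereal (1 + 2 * r)"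
    by (simp_all add: numeral_eq_ereal one_ereal_def)
  then have "j_max n b (ereal r) = min \<lceil>log 2 (real n * b) / (2 + 2 * r)\<rceil> \<lceil>log 2 (real n) / (1 + 2 * r)\<rceil>"
    unfolding j_max_def eqs using r0 by simp
  then show ?thesis unfolding J_def by (simp only: sm)
qed

lemma nb2: "2 \<le> real n * b"
  using n2 b1 mult_mono[of 2 "real n" 1 b] by simp

lemma J1: "1 \<le> J"
proof -
  have "0 < log 2 (real n * b) / (2 + 2 * r)" "0 < log 2 (real n) / (1 + 2 * r)"
    using nb2 n2 r0 by auto
  then show ?thesis unfolding J_eq by simp
qed

lemma J_le_lg: "real_of_int J \<le> 2 * lg"
proof -
  have "lg / (1 + 2 * r) \<le> lg" using lg1 r0 by (simp add: divide_le_eq mult_le_cancel_left1)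
  then have "real_of_int J \<le> lg + 1" unfolding J_eq lg_def by linarith
  then show ?thesis using lg1 by simp
qed

lemma pow_J: "(2::real) ^ nat J = 2 powr real_of_int J"
  using J1 by (simp add: powr_realpow[symmetric])

lemma pow_J_le: "2 ^ nat J \<le> 2 * real n" "2 ^ nat J \<le> 2 * sqrt (real n * b)"
proof -
  have "lg / (1 + 2 * r) \<le> lg" using lg1 r0 by (simp add: divide_le_eq mult_le_cancel_left1)
  then have "real_of_int J \<le> lg + 1" unfolding J_eq lg_def by linarith
  then have "2 powr real_of_int J \<le> 2 powr (lg + 1)" by simp
  then show "2 ^ nat J \<le> 2 * real n" unfolding pow_J using n2 by (simp add: powr_add lg_def)
  have "log 2 (real n * b) / (2 + 2 * r) \<le> log 2 (real n * b) / 2"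
    using nb2 r0 by (intro divide_left_mono) auto
  then have "real_of_int J \<le> log 2 (real n * b) * (1/2) + 1" unfolding J_eq by linarith
  then have "2 powr real_of_int J \<le> 2 powr (log 2 (real n * b) * (1/2) + 1)" by simp
  also have "\<dots> = 2 * sqrt (real n * b)"
    using nb2 unfolding powr_add powr_powr[symmetric] by (simp add: powr_half_sqrt)
  finally show "2 ^ nat J \<le> 2 * sqrt (real n * b)" unfolding pow_J .
qed

text \<open>Both terms of the minimum decrease in the smoothness, so at s >= r each is at least the
  logarithm of the resolution wanted for s. As J is a minimum, only one of the two bounds is
  guaranteed.\<close>

lemma pow_J_ge:
  assumes "r \<le> s"
  shows "(real n * b) powr (1 / (2 + 2 * s)) \<le> 2 ^ nat J \<or> real n powr (1 / (1 + 2 * s)) \<le> 2 ^ nat J"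
proof -
  have pw: "x powr (1 / c') \<le> 2 powr real_of_int \<lceil>log 2 x / c\<rceil>" if "2 \<le> x" "0 < c" "c \<le> c'" for x c c' :: real
  proof -
    have "x powr (1 / c') = 2 powr (log 2 x / c')" using that by (simp add: powr_def log_def)
    also have "\<dots> \<le> 2 powr real_of_int \<lceil>log 2 x / c\<rceil>"
    proof (rule powr_mono)
      have "log 2 x / c' \<le> log 2 x / c" using that by (intro divide_left_mono) auto
      then show "log 2 x / c' \<le> real_of_int \<lceil>log 2 x / c\<rceil>" by linarith
    qed simp
    finally show ?thesis .
  qed
  show ?thesis
  proof (cases "\<lceil>log 2 (real n * b) / (2 + 2 * r)\<rceil> \<le> \<lceil>log 2 (real n) / (1 + 2 * r)\<rceil>")
    case True
    then have "J = \<lceil>log 2 (real n * b) / (2 + 2 * r)\<rceil>" unfolding J_eq by simp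
    then show ?thesis unfolding pow_J using pw[OF nb2, of "2 + 2 * r" "2 + 2 * s"] r0 assms by simp
  next
    case False
    then have "J = \<lceil>log 2 (real n) / (1 + 2 * r)\<rceil>" unfolding J_eq by simp
    then show ?thesis unfolding pow_J using pw[of "real n" "1 + 2 * r" "1 + 2 * s"] n2 r0 assms by simp
  qed
qed

lemma v_le_below:
  assumes "l < jB"
  shows "v l \<le> 3 * 2 ^ nat l / real n"
proof -
  have "m \<le> 3 * (m div 2)" using m2 by linarith
  then have "m * p \<le> 3 * (m div 2) * p" by (rule mult_le_mono1)
  then have "n \<le> 3 * N l" using mp assms by (simp add: N_below)
  then have "real n \<le> 3 * real (N l)" by linarith
  then have "1 / real (N l) \<le> 3 / real n" using n2 by (simp add: field_simps)
  from mult_left_mono[OF this, of "2 ^ nat l"] show ?thesis by (simp add: v_def mult.commute)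
qed

text \<open>The three roundings (half of the machines, groups, subgroups) cost a factor 2 each and
  give 8. The lower bound for \<open>2 ^ jB\<close> contributes \<open>4 * lg\<close>, and the
  number of groups is at most \<open>2 * lg\<close>; hence 8 * 4 * 2 = 64 and the squared
  logarithm.\<close>

lemma v_le_above:
  assumes l: "jB \<le> l" "l \<le> J" "0 < N l"
  shows "v l \<le> 64 * (2 ^ nat l)\<^sup>2 * lg\<^sup>2 / (real n * b)"
proof -
  define t where "t = nat (l - jB)"
  have g1: "1 \<le> gs div 2 ^ t" using l N_above[OF l(1)] by (auto simp: t_def intro: Suc_leI Nat.gr0I)
  then have gpos: "0 < gs" by (auto intro: Nat.gr0I)
  then have gs1: "1 \<le> gs" by simp
  have gse: "gs = (m + 1) div 2 div ng" unfolding gs_def ng_def group_size_def ..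
  have ng0: "0 < ng" using gpos unfolding gse by (cases ng) auto
  have "real ng \<le> real_of_int J" using ng0 jB0 unfolding ng_eq by simp
  then have ngl: "real ng \<le> 2 * lg" using J_le_lg by simp
  have "real m / 2 \<le> real ((m + 1) div 2)" by linarith
  then have "real m / 2 / (2 * real ng) \<le> real ((m + 1) div 2) / (2 * real ng)" by (rule divide_right_mono) simp
  also have "\<dots> \<le> real gs" unfolding gse by (rule half_le_div) (use gs1 gse in simp)
  finally have "real m / 2 / (2 * real ng) / (2 * real (2 ^ t)) \<le> real gs / (2 * real (2 ^ t))" by (rule divide_right_mono) simp
  also have "\<dots> \<le> real (gs div 2 ^ t)" using g1 by (rule half_le_div)
  finally have "real m / 2 / (2 * real ng) / (2 * real (2 ^ t)) * real p \<le> real (gs div 2 ^ t) * real p" by (rule mult_right_mono) simp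
  then have "real (m * p) / (8 * real ng * 2 ^ t) \<le> real (N l)" using N_above[OF l(1)] by (simp add: t_def mult_ac)
  then have A: "real n \<le> real (N l) * (8 * real ng * 2 ^ t)" using ng0 unfolding mp by (simp add: pos_divide_le_eq)
  have pw: "(2::real) ^ nat l = 2 ^ t * 2 ^ nat jB"
    using l(1) jB0 by (simp add: t_def power_add[symmetric] nat_add_distrib[symmetric])
  have "b \<le> 4 * lg * 2 ^ nat jB" using jB_ge lg1 by (simp add: pos_divide_le_eq mult_ac)
  then have "real n * b \<le> (real (N l) * (8 * real ng * 2 ^ t)) * (4 * lg * 2 ^ nat jB)"
    using A b1 by (intro mult_mono) auto
  also have "\<dots> = 32 * real (N l) * lg * 2 ^ nat l * real ng" unfolding pw by (simp add: mult_ac)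
  also have "\<dots> \<le> 32 * real (N l) * lg * 2 ^ nat l * (2 * lg)"
    using ngl lg1 by (intro mult_left_mono) auto
  finally have "real n * b \<le> 64 * real (N l) * lg\<^sup>2 * 2 ^ nat l" by (simp add: power2_eq_square mult_ac)
  then have "2 ^ nat l * (real n * b) \<le> 2 ^ nat l * (64 * real (N l) * lg\<^sup>2 * 2 ^ nat l)" by (intro mult_left_mono) auto
  then have "2 ^ nat l * (real n * b) \<le> 64 * (2 ^ nat l)\<^sup>2 * lg\<^sup>2 * real (N l)" by (simp add: power2_eq_square mult_ac)
  moreover have "0 < real n * b" using nb2 by simp
  ultimately show ?thesis unfolding v_def using l(3) by (simp add: divide_le_eq le_divide_eq mult_ac)
qed

lemma lg_sq1: "1 \<le> lg\<^sup>2"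
  using lg1 by simp

lemma v_le_lg:
  assumes l: "0 \<le> l" "l \<le> J" "0 < N l"
  shows "v l \<le> 256 * lg\<^sup>2"
proof -
  have pl: "(2::real) ^ nat l \<le> 2 ^ nat J" using l by (intro power_increasing) auto
  show ?thesis
  proof (cases "l < jB")
    case True
    have "v l \<le> 3 * 2 ^ nat l / real n" by (rule v_le_below[OF True])
    also have "\<dots> \<le> 3 * (2 * real n) / real n"
      by (intro divide_right_mono mult_left_mono order_trans[OF pl pow_J_le(1)]) auto
    also have "\<dots> \<le> 256 * 1" using n2 by simp
    also have "\<dots> \<le> 256 * lg\<^sup>2" using lg_sq1 by (intro mult_left_mono) auto
    finally show ?thesis .
  next
    case False
    have nb: "0 < real n * b" using nb2 by simp
    have "v l \<le> 64 * (2 ^ nat l)\<^sup>2 * lg\<^sup>2 / (real n * b)" using False l by (intro v_le_above) auto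
    also have "(2 ^ nat l)\<^sup>2 \<le> (2 * sqrt (real n * b))\<^sup>2"
      by (intro power_mono order_trans[OF pl pow_J_le(2)]) simp
    also have "(2 * sqrt (real n * b))\<^sup>2 = 4 * (real n * b)" using nb by (simp add: power_mult_distrib)
    finally show ?thesis using nb n2 b1 by (simp add: divide_right_mono mult_right_mono)
  qed
qed

text \<open>Above \<open>jB\<close>, v_l / 4^l is constant up to squared logarithms; below, it
  decreases in l. So the factor sqrt(v_l) / 2^l of the excess bounds is, up to one logarithm,
  largest at js. The upper bounds on v_l are compared with the lower bounds of \<open>v_ge\<close>
  at js.\<close>

lemma v_ratio:
  assumes js: "0 \<le> js" "js \<le> l" "l < J"
  shows "sqrt (v l) / 2 ^ nat l \<le> 8 * lg * (sqrt (v js) / 2 ^ nat js)"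
proof -
  have Nl: "0 < N l" "0 < N js" using N_pos js by auto
  have nb: "0 < real n * b" using nb2 by simp
  have le: "v l / (2 ^ nat l)\<^sup>2 \<le> 64 * lg\<^sup>2 * (v js / (2 ^ nat js)\<^sup>2)"
  proof (cases "l < jB")
    case True
    have pj: "(2::real) ^ nat js \<le> 2 ^ nat l" using js by (intro power_increasing) auto
    have "v l / (2 ^ nat l)\<^sup>2 \<le> (3 * 2 ^ nat l / real n) / (2 ^ nat l)\<^sup>2"
      by (intro divide_right_mono v_le_below[OF True]) simp
    also have "\<dots> = 3 / real n * (1 / 2 ^ nat l)" by (simp add: power2_eq_square)
    also have "\<dots> \<le> 3 / real n * (1 / 2 ^ nat js)" using pj by (intro mult_left_mono divide_left_mono) auto
    also have "\<dots> = 3 * ((2 ^ nat js / real n) / (2 ^ nat js)\<^sup>2)" by (simp add: power2_eq_square)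
    also have "\<dots> \<le> 3 * (v js / (2 ^ nat js)\<^sup>2)"
      using v_ge(1)[OF js(1) Nl(2)] by (intro mult_left_mono divide_right_mono) auto
    also have "\<dots> \<le> 64 * lg\<^sup>2 * (v js / (2 ^ nat js)\<^sup>2)"
      using lg_sq1 v_nonneg[of js] by (intro mult_right_mono) auto
    finally show ?thesis .
  next
    case False
    have "v l / (2 ^ nat l)\<^sup>2 \<le> (64 * (2 ^ nat l)\<^sup>2 * lg\<^sup>2 / (real n * b)) / (2 ^ nat l)\<^sup>2"
      using False js Nl by (intro divide_right_mono v_le_above) auto
    also have "\<dots> = 64 * lg\<^sup>2 * (((2 ^ nat js)\<^sup>2 / (real n * b)) / (2 ^ nat js)\<^sup>2)" by simp
    also have "\<dots> \<le> 64 * lg\<^sup>2 * (v js / (2 ^ nat js)\<^sup>2)"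
      using v_ge(2)[OF js(1) Nl(2)] by (intro mult_left_mono divide_right_mono) auto
    finally show ?thesis .
  qed
  have "sqrt (v l) / 2 ^ nat l = sqrt (v l / (2 ^ nat l)\<^sup>2)" by (simp add: real_sqrt_divide)
  also have "\<dots> \<le> sqrt (64 * lg\<^sup>2 * (v js / (2 ^ nat js)\<^sup>2))" using le by simp
  also have "\<dots> = 8 * lg * (sqrt (v js) / 2 ^ nat js)"
    using lg1 by (simp add: real_sqrt_mult real_sqrt_divide)
  finally show ?thesis .
qed

text \<open>The noise is taken at j + 1 because the argument after overshooting tests only levels
  above j. Below J, a vanishing \<open>N (j + 1)\<close> means j + 1 = J, a level without assigned
  machines, where the selection rule tests nothing.\<close>

definition critical :: "real \<Rightarrow> real \<Rightarrow> int \<Rightarrow> bool" where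
  "critical A s j \<longleftrightarrow> N (j + 1) = 0 \<or> 2 powr (- 2 * real_of_int j * s) \<le> A * v (j + 1)"

text \<open>The resolution \<open>2 ^ J\<close> is large enough for the bias at J to be below v_J,
  in either case of \<open>pow_J_ge\<close>. Going down to J - 1 enlarges the squared bias by
  \<open>4 powr s\<close>, which A covers.\<close>

lemma critical_last:
  assumes s: "r \<le> s" and A: "4 powr s \<le> A"
  shows "critical A s (J - 1)"
proof (cases "N J = 0")
  case False
  then have NJ: "0 < N J" by simp
  have s0: "0 \<le> s" using r0 s by simp
  define y where "y = (2::real) ^ nat J"
  have y: "0 < y" "y = 2 powr real_of_int J" unfolding y_def using pow_J by auto
  have e: "2 powr (- 2 * real_of_int (J - 1) * s) = 4 powr s * y powr (- 2 * s)"
  proof -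
    have "(4::real) powr s = 2 powr (2 * s)" using powr_powr[of 2 2 s] by simp
    then show ?thesis unfolding y(2) powr_powr by (simp add: powr_add[symmetric] algebra_simps)
  qed
  have nb: "0 < real n * b" using nb2 by simp
  have "y powr (- 2 * s) \<le> v J"
    using pow_J_ge[OF s]
  proof
    assume "real n powr (1 / (1 + 2 * s)) \<le> 2 ^ nat J"
    then have "(real n powr (1 / (1 + 2 * s))) powr (1 + 2 * s) \<le> y powr (1 + 2 * s)"
      unfolding y_def using s0 by (intro powr_mono2) auto
    then have "real n \<le> y powr (1 + 2 * s)" using s0 n2 by (simp add: powr_powr)
    then have "y powr (- 2 * s) * real n \<le> y powr (- 2 * s) * y powr (1 + 2 * s)" by (intro mult_left_mono) auto
    also have "\<dots> = y" using y by (simp add: powr_add[symmetric])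
    finally have "y powr (- 2 * s) \<le> y / real n" using n2 by (simp add: pos_le_divide_eq)
    then show ?thesis using v_ge(1)[OF _ NJ] J1 unfolding y_def by simp
  next
    assume "(real n * b) powr (1 / (2 + 2 * s)) \<le> 2 ^ nat J"
    then have "((real n * b) powr (1 / (2 + 2 * s))) powr (2 + 2 * s) \<le> y powr (2 + 2 * s)"
      unfolding y_def using s0 by (intro powr_mono2) auto
    then have "real n * b \<le> y powr (2 + 2 * s)" using s0 nb by (simp add: powr_powr)
    then have "y powr (- 2 * s) * (real n * b) \<le> y powr (- 2 * s) * y powr (2 + 2 * s)" by (intro mult_left_mono) auto
    also have "\<dots> = y\<^sup>2" using y by (simp add: powr_add[symmetric])
    finally have "y powr (- 2 * s) \<le> y\<^sup>2 / (real n * b)" using nb by (simp add: pos_le_divide_eq)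
    then show ?thesis using v_ge(2)[OF _ NJ] J1 unfolding y_def by simp
  qed
  then have "4 powr s * y powr (- 2 * s) \<le> A * v J"
    using A v_nonneg order_trans[OF powr_ge_zero A] by (intro mult_mono) auto
  then show ?thesis unfolding critical_def e by simp
qed (simp add: critical_def)

text \<open>The least critical level. Minimality gives the bound on v_js: the level before is not
  critical, so its squared bias, which is \<open>4 powr s\<close> times that of js, exceeds A v_js.
  At js = 0 the bound is trivial since v_0 <= 1.\<close>

lemma obtain_critical:
  assumes s: "r \<le> s" and A: "4 powr s \<le> A"
  obtains js where "0 \<le> js" "js < J" "critical A s js" "v js \<le> 4 powr s * 2 powr (- 2 * real_of_int js * s)"
proof -
  have s0: "0 \<le> s" using r0 s by simp
  have A1: "1 \<le> A" using A ge_one_powr_ge_zero[of 4 s] s0 by simp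
  define P where "P i \<longleftrightarrow> critical A s (int i)" for i
  have "P (nat (J - 1))" using critical_last[OF assms] J1 by (simp add: P_def)
  then have LP: "P (LEAST i. P i)" and Lle: "(LEAST i. P i) \<le> nat (J - 1)"
    by (rule LeastI, rule Least_le)
  define js where "js = int (LEAST i. P i)"
  have 1: "0 \<le> js" "js < J" "critical A s js" using LP Lle J1 by (auto simp: js_def P_def)
  have 2: "v js \<le> 4 powr s * 2 powr (- 2 * real_of_int js * s)"
  proof (cases "js = 0")
    case True
    have "1 \<le> real (N 0)" using N_pos[of 0] J1 by linarith
    then have "v 0 \<le> 1" unfolding v_def by simp
    also have "1 \<le> 4 powr s * 2 powr (- 2 * real_of_int 0 * s)" using s0 by (simp add: ge_one_powr_ge_zero)
    finally show ?thesis using True by simp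
  next
    case False
    define i where "i = nat (js - 1)"
    have i: "int i = js - 1" using False 1 by (simp add: i_def)
    have "i < (LEAST i. P i)" using i by (simp add: js_def)
    then have "\<not> P i" by (rule not_less_Least)
    then have "A * v js < 2 powr (- 2 * real_of_int (js - 1) * s)" unfolding P_def critical_def i by simp
    moreover have "1 * v js \<le> A * v js" using A1 v_nonneg by (rule mult_right_mono)
    moreover have "2 powr (- 2 * real_of_int (js - 1) * s) = 4 powr s * 2 powr (- 2 * real_of_int js * s)"
    proof -
      have "(4::real) powr s = 2 powr (2 * s)" using powr_powr[of 2 2 s] by simp
      then show ?thesis by (simp add: powr_add[symmetric] algebra_simps)
    qed
    ultimately show ?thesis by simp
  qed
  show ?thesis using 1 2 by (rule that)
qed

lemma critical_bias:
  assumes "critical A s js" "0 \<le> js" "js < l" "l \<le> J" "0 < N l" "0 \<le> A"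
  shows "2 powr (- 2 * real_of_int js * s) \<le> A * v l"
proof -
  have "N l \<le> 2 * N (js + 1)" using assms by (intro N_mono) auto
  then have "N (js + 1) \<noteq> 0" using assms by linarith
  then have "2 powr (- 2 * real_of_int js * s) \<le> A * v (js + 1)" using assms by (simp add: critical_def)
  also have "\<dots> \<le> A * v l"
  proof (cases "js + 1 = l")
    case False
    then show ?thesis using assms by (intro mult_left_mono v_mono_strict) auto
  qed simp
  finally show ?thesis .
qed

end

section \<open>The rate\<close>

text \<open>Both branches of the rate are the power -s of a resolution X. In the second branch the
  exponents of the logarithm combine to 2 s / (2 + 2 s), so that M_n becomes the division of n b by
  the squared logarithm.\<close>

lemma rate_eq_powr:
  fixes n :: nat and b s L :: real
  assumes n: "2 \<le> n" and b: "0 < b" and s: "0 < s"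
  defines "X \<equiv> (if b \<ge> 4 * L powr (2 / (1 + 2 * s)) * real n powr (1 / (1 + 2 * s)) * log 2 (real n)
    then real n powr (1 / (1 + 2 * s)) else (real n * b / (log 2 (real n))\<^sup>2) powr (1 / (2 + 2 * s)))"
  shows "rate L s n b = X powr (- s)"
proof (cases "b \<ge> 4 * L powr (2 / (1 + 2 * s)) * real n powr (1 / (1 + 2 * s)) * log 2 (real n)")
  case True
  then show ?thesis unfolding rate_def X_def by (simp add: powr_powr)
next
  case False
  define g where "g = log 2 (real n)"
  have g: "0 < g" unfolding g_def using n by simp
  have n0: "0 < real n" using n by simp
  have pw: "x powr a = exp (a * ln x)" if "0 < x" for x a :: real using that by (simp add: powr_def)
  have ln_g2: "ln (g\<^sup>2) = 2 * ln g" using g by (simp add: ln_realpow)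
  have l1: "ln (real n * b / g\<^sup>2) = ln n + ln b - 2 * ln g"
    using n0 b g by (simp add: ln_div ln_mult ln_g2)
  have l2: "ln (real n powr (1 / (1 + 2 * s)) / (b * g)) = ln n / (1 + 2 * s) - (ln b + ln g)"
    using n0 b g by (simp add: ln_div ln_mult ln_powr)
  have pos: "0 < real n powr (1 / (1 + 2 * s)) / (b * g)" "0 < real n * b / g\<^sup>2" using n0 b g by simp_all
  have "g powr (3 * s / (2 + 2 * s)) * (real n powr (1 / (1 + 2 * s)) / (b * g)) powr (s / (2 + 2 * s)) * real n powr (- s / (1 + 2 * s))
      = exp (3 * s / (2 + 2 * s) * ln g + s / (2 + 2 * s) * (ln n / (1 + 2 * s) - (ln b + ln g)) + (- s / (1 + 2 * s)) * ln n)"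
    unfolding pw[OF g] pw[OF pos(1)] l2 unfolding pw[OF n0] by (simp only: exp_add)
  also have "3 * s / (2 + 2 * s) * ln g + s / (2 + 2 * s) * (ln n / (1 + 2 * s) - (ln b + ln g)) + (- s / (1 + 2 * s)) * ln n
      = - s * (1 / (2 + 2 * s) * (ln n + ln b - 2 * ln g))"
  proof -
    have nz: "1 + 2 * s \<noteq> 0" "2 + 2 * s \<noteq> 0" using s by auto
    show ?thesis using nz by (simp add: divide_simps) (simp add: algebra_simps)
  qed
  also have "exp (- s * (1 / (2 + 2 * s) * (ln n + ln b - 2 * ln g))) = ((real n * b / g\<^sup>2) powr (1 / (2 + 2 * s))) powr (- s)"
    unfolding powr_powr unfolding pw[OF pos(2)] l1 by (simp add: mult_ac)
  finally show ?thesis using False unfolding rate_def X_def g_def by simp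
qed

context finite_budget
begin

text \<open>The level balancing bias and variance is large enough for the bias to be of the order of the
  rate. Close to the boundary between the two regimes it may drop to \<open>j\<^sub>B - 1\<close>, because the number of
  groups may be much smaller than \<open>log n\<close>.\<close>

lemma critical_large:
  assumes s: "0 < s" "r \<le> s" and A: "1 \<le> A" and js: "0 \<le> js" "js < J" "critical A s js" and L: "0 < L"
  defines "CL \<equiv> 4 * L powr (2 / (1 + 2 * s))"
  defines "X \<equiv> (if b \<ge> CL * real n powr (1 / (1 + 2 * s)) * log 2 (real n)
    then real n powr (1 / (1 + 2 * s)) else (real n * b / (log 2 (real n))\<^sup>2) powr (1 / (2 + 2 * s)))"
  defines "c \<equiv> min (min (1/2) (CL powr (1 / (2 + 2 * s)) / 2)) (min (min (CL / 8) (1 / (2 * CL powr (1 / (2 + 2 * s)))))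
     (min ((6 * A) powr (- 1 / (1 + 2 * s)) * min 1 (1 / CL powr (1 / (2 + 2 * s)))) ((256 * A) powr (- 1 / (2 + 2 * s)))))"
  shows "c * X \<le> 2 ^ nat js"
proof -
  define e1 where "e1 = 1 / (1 + 2 * s)"
  define e2 where "e2 = 1 / (2 + 2 * s)"
  have e: "0 < e1" "0 < e2" using s by (auto simp: e1_def e2_def)
  define K where "K = CL powr e2"
  have CL: "0 < CL" using L by (simp add: CL_def)
  have K: "0 < K" using CL by (simp add: K_def)
  define Y where "Y = real n powr e1"
  have Y: "0 < Y" using n2 by (simp add: Y_def)
  have Xdef: "X = (if b \<ge> CL * Y * lg then Y else (real n * b / lg\<^sup>2) powr e2)"
    unfolding X_def Y_def lg_def e1_def e2_def ..
  define y where "y = (2::real) ^ nat js"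
  have y: "0 < y" and y_powr: "y = 2 powr real_of_int js" unfolding y_def using js by (auto simp: powr_realpow[symmetric])
  have ys: "2 powr (- 2 * real_of_int js * s) = y powr (- 2 * s)" unfolding y_powr by (simp add: powr_powr mult_ac)
  have nb: "0 < real n * b" using nb2 by simp
  have lg0: "0 < lg" using lg1 by simp
  have X0: "0 < X" unfolding Xdef using Y nb lg0 n2 by auto
  \<comment> \<open>At the boundary of the two regimes b is of order Y up to a logarithm, and there
    the resolutions of the two regimes agree up to the factor K.\<close>
  have nY: "(CL * (real n * Y)) powr e2 = K * Y"
  proof -
    have "real n * Y = real n powr (1 + e1)" unfolding Y_def using n2 by (simp add: powr_add)
    moreover have "(1 + e1) * e2 = e1" using s by (simp add: e1_def e2_def field_simps)
    ultimately have "(real n * Y) powr e2 = Y" unfolding Y_def by (simp add: powr_powr)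
    moreover have "(CL * (real n * Y)) powr e2 = CL powr e2 * (real n * Y) powr e2"
      using CL Y n2 by (intro powr_mult)
    ultimately show ?thesis by (simp add: K_def)
  qed
  have c_le: "c \<le> 1/2" "c \<le> K / 2" "c \<le> CL / 8" "c \<le> 1 / (2 * K)"
    "c \<le> (6 * A) powr (- e1) * min 1 (1 / K)" "c \<le> (256 * A) powr (- e2)"
  proof -
    have e': "- 1 / (1 + 2 * s) = - e1" "- 1 / (2 + 2 * s) = - e2" by (simp_all add: e1_def e2_def)
    have c: "c = min (min (1/2) (K / 2)) (min (min (CL / 8) (1 / (2 * K)))
        (min ((6 * A) powr (- e1) * min 1 (1 / K)) ((256 * A) powr (- e2))))"
      unfolding c_def e' unfolding e2_def[symmetric] K_def[symmetric] ..
    have min6: "min (min a1 a2) (min (min a3 a4) (min a5 a6)) \<le> a1" "min (min a1 a2) (min (min a3 a4) (min a5 a6)) \<le> a2"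
      "min (min a1 a2) (min (min a3 a4) (min a5 a6)) \<le> a3" "min (min a1 a2) (min (min a3 a4) (min a5 a6)) \<le> a4"
      "min (min a1 a2) (min (min a3 a4) (min a5 a6)) \<le> a5" "min (min a1 a2) (min (min a3 a4) (min a5 a6)) \<le> a6"
      for a1 a2 a3 a4 a5 a6 :: real by (auto simp: min_le_iff_disj)
    show "c \<le> 1/2" "c \<le> K / 2" "c \<le> CL / 8" "c \<le> 1 / (2 * K)"
      "c \<le> (6 * A) powr (- e1) * min 1 (1 / K)" "c \<le> (256 * A) powr (- e2)"
      unfolding c by (rule min6)+
  qed
  have case2: "X \<le> K * Y" "X \<le> (real n * b) powr e2" if "\<not> b \<ge> CL * Y * lg"
  proof -
    have X: "X = (real n * b / lg\<^sup>2) powr e2" using that unfolding Xdef by simp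
    have "real n * b / lg\<^sup>2 \<le> real n * (CL * Y * lg) / lg\<^sup>2"
      using that by (intro divide_right_mono mult_left_mono) auto
    also have "\<dots> = CL * (real n * Y) / lg" using lg0 by (simp add: power2_eq_square)
    also have "\<dots> \<le> CL * (real n * Y) / 1"
      using lg1 CL Y lg0 by (intro divide_left_mono mult_nonneg_nonneg) auto
    also have "\<dots> = CL * (real n * Y)" by simp
    finally have "X \<le> (CL * (real n * Y)) powr e2" unfolding X using nb lg0 e by (intro powr_mono2) auto
    then show "X \<le> K * Y" unfolding nY .
    have "real n * b / lg\<^sup>2 \<le> real n * b" using lg_sq1 nb by (simp add: divide_le_eq mult_le_cancel_left1)
    then show "X \<le> (real n * b) powr e2" unfolding X using nb lg0 e by (intro powr_mono2) auto
  qed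
  have case1: "K * Y \<le> (real n * b) powr e2" if "b \<ge> CL * Y * lg"
  proof -
    have "CL * Y * 1 \<le> CL * Y * lg" using lg1 CL Y by (intro mult_left_mono) auto
    then have "CL * Y \<le> b" using that by simp
    then have "real n * (CL * Y) \<le> real n * b" by (intro mult_left_mono) auto
    then have "(CL * (real n * Y)) powr e2 \<le> (real n * b) powr e2"
      using CL Y e by (intro powr_mono2) (auto simp: mult_ac)
    then show ?thesis unfolding nY .
  qed
  show ?thesis
  proof (cases "N (js + 1) = 0")
    case True
    \<comment> \<open>Only the top level can be without machines, so js is one below J and
      \<open>pow_J_ge\<close> supplies the resolution, whichever of its cases holds.\<close>
    have jJ: "js + 1 = J"
    proof (rule ccontr)
      assume "js + 1 \<noteq> J"
      then have "0 < N (js + 1)" using js by (intro N_pos) simp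
      then show False using True by simp
    qed
    have "nat J = Suc (nat js)" using jJ js by simp
    then have yJ: "(2::real) ^ nat J = 2 * y" by (simp add: y_def)
    have "(real n * b) powr e2 \<le> 2 * y \<or> Y \<le> 2 * y"
      using pow_J_ge[OF s(2)] unfolding yJ Y_def e1_def e2_def .
    then have "c * X \<le> y"
    proof
      assume h: "(real n * b) powr e2 \<le> 2 * y"
      show ?thesis
      proof (cases "b \<ge> CL * Y * lg")
        case True
        then have "c * X \<le> K / 2 * Y" unfolding Xdef using c_le Y by (simp add: mult_right_mono)
        also have "\<dots> \<le> y" using case1[OF True] h by simp
        finally show ?thesis .
      next
        case False
        have "c * X \<le> 1/2 * X" using c_le X0 by (intro mult_right_mono) auto
        also have "\<dots> \<le> y" using case2(2)[OF False] h by simp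
        finally show ?thesis .
      qed
    next
      assume h: "Y \<le> 2 * y"
      show ?thesis
      proof (cases "b \<ge> CL * Y * lg")
        case True
        have "c * X \<le> 1/2 * Y" using True unfolding Xdef using c_le Y by (simp add: mult_right_mono)
        also have "\<dots> \<le> y" using h by simp
        finally show ?thesis .
      next
        case False
        have "c * X \<le> 1 / (2 * K) * X" using c_le X0 by (intro mult_right_mono) auto
        also have "\<dots> \<le> 1 / (2 * K) * (K * Y)" using case2(1)[OF False] K by (intro mult_left_mono) auto
        also have "\<dots> \<le> y" using h K by simp
        finally show ?thesis .
      qed
    qed
    then show ?thesis unfolding y_def .
  next
    case False
    then have Np: "0 < N (js + 1)" by simp
    have crit: "y powr (- 2 * s) \<le> A * v (js + 1)" using js(3) False unfolding critical_def ys by simp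
    have y1: "(2::real) ^ nat (js + 1) = 2 * y" using js by (simp add: y_def nat_add_distrib)
    have "c * X \<le> y"
    proof (cases "js + 1 < jB")
      case True
      \<comment> \<open>Below \<open>jB\<close> the noise is that of the undistributed problem, and
        criticality is the usual balance: y to the power 1 + 2 s is at least of order n.\<close>
      have "y powr (- 2 * s) \<le> A * (3 * (2 * y) / real n)"
        using crit mult_left_mono[OF v_le_below[OF True], of A] A unfolding y1 by simp
      then have "y powr (2 * s) * y powr (- 2 * s) \<le> y powr (2 * s) * (A * (3 * (2 * y) / real n))" by (intro mult_left_mono) auto
      then have "1 \<le> y powr (2 * s) * (A * (3 * (2 * y) / real n))" using y by (simp add: powr_add[symmetric])
      also have "\<dots> = 6 * A * (y powr (2 * s) * y) / real n" by simp
      also have "y powr (2 * s) * y = y powr (1 + 2 * s)" using y by (simp add: powr_add)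
      finally have "real n \<le> 6 * A * y powr (1 + 2 * s)" using n2 by (simp add: pos_le_divide_eq)
      then have "real n powr e1 \<le> (6 * A * y powr (1 + 2 * s)) powr e1" using e by (intro powr_mono2) auto
      also have "\<dots> = (6 * A) powr e1 * y" using A y s by (simp add: powr_mult powr_powr e1_def)
      finally have Yy: "Y \<le> (6 * A) powr e1 * y" unfolding Y_def .
      have pp: "(6 * A) powr (- e1) * (6 * A) powr e1 = 1" using A by (simp add: powr_add[symmetric])
      have "min 1 (1 / K) * X \<le> Y"
      proof (cases "b \<ge> CL * Y * lg")
        case True
        then have "X = Y" unfolding Xdef by simp
        moreover have "min 1 (1 / K) * Y \<le> 1 * Y" using Y by (intro mult_right_mono) auto
        ultimately show ?thesis by simp
      next
        case False
        have "min 1 (1 / K) * X \<le> 1 / K * X" using X0 by (intro mult_right_mono) auto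
        also have "\<dots> \<le> 1 / K * (K * Y)" using case2(1)[OF False] K by (intro mult_left_mono) auto
        finally show ?thesis using K by simp
      qed
      then have "(6 * A) powr (- e1) * (min 1 (1 / K) * X) \<le> (6 * A) powr (- e1) * ((6 * A) powr e1 * y)"
        using Yy by (intro mult_left_mono) auto
      also have "\<dots> = y" using pp by (simp only: mult.assoc[symmetric] mult_1_left)
      finally have "(6 * A) powr (- e1) * min 1 (1 / K) * X \<le> y" by (simp only: mult.assoc)
      moreover have "c * X \<le> (6 * A) powr (- e1) * min 1 (1 / K) * X" using c_le(5) X0 by (intro mult_right_mono) auto
      ultimately show ?thesis by simp
    next
      case False
      then have above: "jB \<le> js + 1" by simp
      show ?thesis
      proof (cases "b \<ge> CL * Y * lg")
        case True
        have "(2::real) ^ nat jB \<le> 2 ^ nat (js + 1)" using above by (intro power_increasing) auto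
        then have "b / (4 * lg) \<le> 2 * y" using jB_ge unfolding y1 by simp
        moreover have "CL * Y / 4 \<le> b / (4 * lg)" using True lg0 by (simp add: field_simps)
        ultimately have "CL / 8 * Y \<le> y" by simp
        moreover have "c * X \<le> CL / 8 * Y" using True c_le(3) Y unfolding Xdef by (simp add: mult_right_mono)
        ultimately show ?thesis by simp
      next
        case False
        then have X: "X = (real n * b / lg\<^sup>2) powr e2" unfolding Xdef by simp
        \<comment> \<open>Above \<open>jB\<close> the noise grows like 4^l, so the balance becomes:
          y to the power 2 + 2 s is at least of order n b over the squared logarithm.\<close>
        have "v (js + 1) \<le> 64 * (2 * y)\<^sup>2 * lg\<^sup>2 / (real n * b)"
          using v_le_above[OF above _ Np] js unfolding y1 by simp
        then have "y powr (- 2 * s) \<le> A * (64 * (2 * y)\<^sup>2 * lg\<^sup>2 / (real n * b))"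
          by (intro order_trans[OF crit] mult_left_mono) (use A in auto)
        then have "y powr (2 * s) * y powr (- 2 * s) \<le> y powr (2 * s) * (A * (64 * (2 * y)\<^sup>2 * lg\<^sup>2 / (real n * b)))" by (intro mult_left_mono) auto
        then have "1 \<le> y powr (2 * s) * (A * (64 * (2 * y)\<^sup>2 * lg\<^sup>2 / (real n * b)))" using y by (simp add: powr_add[symmetric])
        also have "\<dots> = 256 * A * (y powr (2 * s) * y\<^sup>2) * lg\<^sup>2 / (real n * b)" by (simp add: power_mult_distrib)
        also have "y powr (2 * s) * y\<^sup>2 = y powr (2 + 2 * s)"
        proof -
          have "y powr (2 + 2 * s) = y powr 2 * y powr (2 * s)" by (rule powr_add)
          also have "y powr 2 = y\<^sup>2" using y by simp
          finally show ?thesis by simp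
        qed
        finally have "real n * b / lg\<^sup>2 \<le> 256 * A * y powr (2 + 2 * s)"
          using nb lg0 by (simp add: pos_le_divide_eq pos_divide_le_eq)
        then have "X \<le> (256 * A * y powr (2 + 2 * s)) powr e2" unfolding X using nb lg0 e by (intro powr_mono2) auto
        also have "\<dots> = (256 * A) powr e2 * y" using A y s by (simp add: powr_mult powr_powr e2_def)
        finally have "(256 * A) powr (- e2) * X \<le> (256 * A) powr (- e2) * ((256 * A) powr e2 * y)" by (intro mult_left_mono) auto
        also have "\<dots> = ((256 * A) powr (- e2) * (256 * A) powr e2) * y" by (simp only: mult.assoc)
        also have "(256 * A) powr (- e2) * (256 * A) powr e2 = 1" using A by (simp add: powr_add[symmetric])
        finally have "(256 * A) powr (- e2) * X \<le> y" by simp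
        moreover have "c * X \<le> (256 * A) powr (- e2) * X" using c_le(6) X0 by (intro mult_right_mono) auto
        ultimately show ?thesis by simp
      qed
    qed
    then show ?thesis unfolding y_def .
  qed
qed

text \<open>Because b >= log n, the target resolution is polynomial in n up to a logarithm in both
  regimes. A small negative power of it therefore beats any power of log n.\<close>

lemma rate_base_ge:
  assumes s: "0 < s"
  shows "(real n / lg) powr (1 / (2 + 2 * s))
    \<le> (if C then real n powr (1 / (1 + 2 * s)) else (real n * b / lg\<^sup>2) powr (1 / (2 + 2 * s)))"
proof -
  have lg0: "0 < lg" using lg1 by simp
  have "real n / lg \<le> real n" using lg1 n2 by (simp add: divide_le_eq mult_le_cancel_left1)
  then have "(real n / lg) powr (1 / (2 + 2 * s)) \<le> real n powr (1 / (2 + 2 * s))"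
    using s lg0 by (intro powr_mono2) auto
  also have "\<dots> \<le> real n powr (1 / (1 + 2 * s))"
    using s n2 by (intro powr_mono divide_left_mono) auto
  finally have 1: "(real n / lg) powr (1 / (2 + 2 * s)) \<le> real n powr (1 / (1 + 2 * s))" .
  have "real n / lg = real n * lg / lg\<^sup>2" using lg0 by (simp add: power2_eq_square)
  also have "\<dots> \<le> real n * b / lg\<^sup>2" using b_lg by (intro divide_right_mono mult_left_mono) auto
  finally have "(real n / lg) powr (1 / (2 + 2 * s)) \<le> (real n * b / lg\<^sup>2) powr (1 / (2 + 2 * s))"
    using s lg0 by (intro powr_mono2) auto
  with 1 show ?thesis by simp
qed

end

section \<open>The risk bound at a fixed sample size\<close>

context bounded_onb
begin

text \<open>The constants \<open>Cb\<close>, \<open>Gb\<close>, \<open>C1\<close> and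
  \<open>A\<close>, and with them the conditions on \<tau>, depend on s only through
  \<open>s_low\<close> and \<open>s_max\<close>; only c, s' and s2 involve s itself. The assumption
  \<open>growth\<close> is what n has to satisfy for the gain of order y to the power -s2 to absorb
  four logarithms.\<close>

lemma risk_rate:
  fixes n m :: nat and b r s s_low s_max L \<tau> \<sigma> :: real and sm :: ereal and f :: "real \<Rightarrow> real"
  assumes fb: "finite_budget n m b sm r" and rs: "r \<le> s"
    and s_low: "0 < s_low" "s_low \<le> s" and s_max: "s \<le> s_max"
    and L: "0 < L" and \<sigma>: "0 < \<sigma>" and f: "f \<in> besov_ball \<psi> s L"
  defines "s' \<equiv> min s (1/4)"
  defines "s2 \<equiv> min s' (s * s')"
  defines "Cb \<equiv> L\<^sup>2 / (1 - 2 powr (- 2 * s_low))"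
  defines "Gb \<equiv> L\<^sup>2 * (2 powr (2 * s_max) + 1 / (1 - 2 powr (- 2 * s_low)))"
  defines "C1 \<equiv> Cp * (Gb + \<sigma>\<^sup>2)"
  defines "C2 \<equiv> 8 * Cp\<^sup>2 * (8 * Gb + 24 * \<sigma> ^ 4 + (Gb + \<sigma>\<^sup>2)\<^sup>2)"
  defines "C3 \<equiv> 2 * (8 * (1 + \<sigma>\<^sup>2) * C1 + 2 * C2) / (C1 * sqrt C1)"
  defines "A \<equiv> 4 powr s_max"
  defines "CL \<equiv> 4 * L powr (2 / (1 + 2 * s))"
  defines "c \<equiv> min (min (1/2) (CL powr (1 / (2 + 2 * s)) / 2)) (min (min (CL / 8) (1 / (2 * CL powr (1 / (2 + 2 * s)))))
     (min ((6 * A) powr (- 1 / (1 + 2 * s)) * min 1 (1 / CL powr (1 / (2 + 2 * s)))) ((256 * A) powr (- 1 / (2 + 2 * s)))))"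
  defines "D \<equiv> 2 powr s_max"
  defines "K0 \<equiv> max 1 (sqrt Cp * L * (2 powr s_max + 6))"
  defines "C6 \<equiv> 32 * (Cp + 1) * sqrt Cb + 16448 * C3 * K0\<^sup>2 * D"
  assumes tau: "400 * (2 + sqrt (2 * C1))\<^sup>2 \<le> \<tau>" "4 * Cb * A \<le> \<tau>"
    and growth: "(log 2 (real n)) ^ 4 \<le> (c * (real n / log 2 (real n)) powr (1 / (2 + 2 * s))) powr s2"
  shows "risk m (n div m) \<sigma> (f_hat \<psi> \<tau> n m b sm) f
    \<le> ennreal ((sqrt (2 * \<tau>) * D + sqrt Cb + (16 * C1 + 65) * D + C6) * c powr (- s) * rate L s n b)"
proof -
  interpret F: finite_budget n m b sm r by (rule fb)
  define lg where "lg = log 2 (real n)"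
  have lgF: "lg = F.lg" by (simp add: lg_def F.lg_def)
  have lg1: "1 \<le> lg" unfolding lgF by (rule F.lg1)
  have s0: "0 < s" using s_low by simp
  have s': "0 < s'" "s' \<le> s" "s' \<le> 1/4" using s0 by (auto simp: s'_def)
  have s2: "0 < s2" "s2 \<le> s'" "s2 \<le> s * s'" using s' s0 by (auto simp: s2_def)
  have q: "0 < 1 - 2 powr (- 2 * s_low)" "1 - 2 powr (- 2 * s_low) \<le> 1 - 2 powr (- 2 * s)"
    using s_low by (auto simp: powr_less_one)
  have q2: "0 < 1 - 2 powr (- 2 * s)" using q by linarith
  have Cb0: "0 < Cb" unfolding Cb_def using L q by simp
  have A1: "1 \<le> A" unfolding A_def using s0 s_max by (simp add: ge_one_powr_ge_zero)
  have Gb0: "0 \<le> Gb" unfolding Gb_def using q by (intro mult_nonneg_nonneg add_nonneg_nonneg) auto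
  have C10: "0 < C1" unfolding C1_def using Gb0 Cp_pos \<sigma> by (intro mult_pos_pos add_nonneg_pos) auto
  have C30: "0 \<le> C3" unfolding C3_def C2_def using C10 Gb0 by (intro divide_nonneg_nonneg) auto
  have D0: "0 < D" by (simp add: D_def)
  have K01: "1 \<le> K0" by (simp add: K0_def)
  have tau0: "0 \<le> \<tau>" using tau(1) by (rule order_trans[rotated]) simp
  have CL0: "0 < CL" using L by (simp add: CL_def)
  have c0: "0 < c" unfolding c_def using CL0 A1 by auto
  have f2: "(\<integral>x. (f x)\<^sup>2 \<partial>unif) \<le> Gb"
  proof -
    have "(\<integral>x. (f x)\<^sup>2 \<partial>unif) \<le> L\<^sup>2 * (2 powr (2 * s) + 1 / (1 - 2 powr (- 2 * s)))"
      using L by (intro besov_ball_norm_le[OF f s0]) simp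
    also have "\<dots> \<le> Gb" unfolding Gb_def
      using s_max q q2 by (intro mult_left_mono add_mono divide_left_mono mult_pos_pos) auto
    finally show ?thesis .
  qed
  have tail_b: "tail f j \<le> Cb * 2 powr (- 2 * of_int j * s)" if "0 \<le> j" for j
  proof -
    have "tail f j \<le> L\<^sup>2 / (1 - 2 powr (- 2 * s)) * 2 powr (- 2 * of_int j * s)"
      using L that by (intro tail_le[OF f s0]) auto
    also have "\<dots> \<le> Cb * 2 powr (- 2 * of_int j * s)"
      unfolding Cb_def using q q2 by (intro mult_right_mono divide_left_mono mult_pos_pos) auto
    finally show ?thesis .
  qed
  obtain js where js: "0 \<le> js" "js < F.J" "F.critical A s js"
    and vjs: "F.v js \<le> 4 powr s * 2 powr (- 2 * real_of_int js * s)"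
    using F.obtain_critical[OF rs, of A] s_max unfolding A_def by (auto simp: powr_mono)
  define y where "y = (2::real) powr real_of_int js"
  have y0: "0 < y" by (simp add: y_def)
  have y2: "(2::real) ^ nat js = y" using js by (simp add: y_def powr_realpow[symmetric])
  define w where "w = y powr (- s)"
  have w0: "0 < w" using y0 by (simp add: w_def)
  have w2: "2 powr (- 2 * real_of_int js * s) = w\<^sup>2"
    unfolding w_def y_def powr_powr by (simp add: power2_eq_square powr_add[symmetric] algebra_simps)
  have sv: "sqrt (F.v js) \<le> D * w"
  proof -
    have "(4::real) powr s = (2 powr s)\<^sup>2"
      using powr_powr[of 2 2 s] by (simp add: power2_eq_square powr_add[symmetric])
    then have "F.v js \<le> (2 powr s * w)\<^sup>2" using vjs unfolding w2 by (simp add: power_mult_distrib)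
    then have "sqrt (F.v js) \<le> 2 powr s * w" using w0 by (intro real_le_lsqrt) auto
    also have "\<dots> \<le> D * w" unfolding D_def using s_max w0 by (intro mult_right_mono) auto
    finally show ?thesis .
  qed
  \<comment> \<open>The truncation height: high enough above js for the remainder to be smaller than
    the bias at js, low enough for the sup-norm of the rest to stay below
    \<open>2 powr (js / 2)\<close> in order.\<close>
  define J' where "J' = nat \<lceil>(1 + s') * real_of_int js\<rceil>"
  have J': "(1 + s') * real_of_int js \<le> real J'" "real J' \<le> (1 + s') * real_of_int js + 1"
  proof -
    define x where "x = (1 + s') * real_of_int js"
    have x0: "0 \<le> x" unfolding x_def using s' js by simp
    then have "real J' = real_of_int \<lceil>x\<rceil>" by (simp add: J'_def x_def)
    moreover have "x \<le> real_of_int \<lceil>x\<rceil>" by (rule le_of_int_ceiling)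
    moreover have "real_of_int \<lceil>x\<rceil> \<le> x + 1" by (rule of_int_ceiling_le_add_one)
    ultimately show "(1 + s') * real_of_int js \<le> real J'" "real J' \<le> (1 + s') * real_of_int js + 1"
      by (simp_all add: x_def)
  qed
  define K where "K = K0 * 2 powr (real J' * (1/2 - s'))"
  define tl where "tl = sqrt Cb * 2 powr (- real J' * s)"
  have K1: "1 \<le> K"
  proof -
    have "1 \<le> (2::real) powr (real J' * (1/2 - s'))" using s' by (simp add: ge_one_powr_ge_zero)
    then have "1 * 1 \<le> K0 * 2 powr (real J' * (1/2 - s'))" using K01 by (intro mult_mono) auto
    then show ?thesis by (simp add: K_def)
  qed
  have Kb: "\<bar>comb (below (int J')) (cf f) x\<bar> \<le> K" for x
  proof -
    have "\<bar>comb (below (int J')) (cf f) x\<bar> \<le> sqrt Cp * L * (2 powr s + 6) * 2 powr (real J' * (1/2 - s'))"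
      using L s' Cp Cp_pos by (intro comb_cf_bounded[OF f]) auto
    also have "\<dots> \<le> K0 * 2 powr (real J' * (1/2 - s'))"
    proof (rule mult_right_mono)
      have "sqrt Cp * L * (2 powr s + 6) \<le> sqrt Cp * L * (2 powr s_max + 6)"
        using L Cp_pos s_max by (intro mult_left_mono) auto
      then show "sqrt Cp * L * (2 powr s + 6) \<le> K0" by (simp add: K0_def)
    qed simp
    finally show ?thesis by (simp add: K_def)
  qed
  have tl0: "0 < tl" unfolding tl_def using Cb0 by simp
  have tlt: "tail f (int J') \<le> tl\<^sup>2"
  proof -
    have "tl\<^sup>2 = Cb * 2 powr (- 2 * of_int (int J') * s)"
      unfolding tl_def power_mult_distrib using Cb0
      by (simp add: power2_eq_square powr_add[symmetric] algebra_simps)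
    then show ?thesis using tail_b[of "int J'"] by simp
  qed
  define z where "z = y powr (- s2)"
  have y1: "1 \<le> y" unfolding y_def using js by (simp add: ge_one_powr_ge_zero)
  \<comment> \<open>Here w is the order of the rate and z the spare factor. Cutting above js by the
    proportion s' gains y to the power - s s', and s2 is the smaller of this exponent and the s'
    gained below.\<close>
  have tl_le: "tl \<le> sqrt Cb * (w * z)"
  proof -
    have "(2::real) powr (- real J' * s) \<le> 2 powr (- ((1 + s') * real_of_int js) * s)"
      using J'(1) s0 by (intro powr_mono) (auto intro: mult_right_mono)
    also have "\<dots> = w * y powr (- (s * s'))"
      unfolding w_def y_def powr_powr powr_add[symmetric] by (simp add: algebra_simps)
    also have "\<dots> \<le> w * z"
      unfolding z_def using s2 y1 w0 by (intro mult_left_mono powr_mono) auto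
    finally show ?thesis unfolding tl_def using Cb0 by (intro mult_left_mono) auto
  qed
  \<comment> \<open>The decisive exponent is (1 + s') (1 - 2 s') <= 1 - s': the squared sup-norm is
    smaller than y by a power of y.\<close>
  have K2_le: "K\<^sup>2 / y \<le> 2 * K0\<^sup>2 * z"
  proof -
    have "(2 powr (real J' * (1/2 - s')))\<^sup>2 = 2 powr (real J' * (1 - 2 * s'))"
      by (simp add: power2_eq_square powr_add[symmetric] algebra_simps)
    also have "\<dots> \<le> 2 powr (((1 + s') * real_of_int js + 1) * (1 - 2 * s'))"
      using J'(2) s' by (intro powr_mono mult_right_mono) auto
    also have "\<dots> \<le> 2 powr ((1 - s') * real_of_int js + 1)"
    proof (rule powr_mono)
      have "(1 + s') * (1 - 2 * s') \<le> 1 - s'" using s' by (simp add: algebra_simps)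
      then have "(1 + s') * (1 - 2 * s') * real_of_int js \<le> (1 - s') * real_of_int js"
        using js by (intro mult_right_mono) auto
      then show "((1 + s') * real_of_int js + 1) * (1 - 2 * s') \<le> (1 - s') * real_of_int js + 1"
        using s' by (simp add: algebra_simps)
    qed simp
    also have "\<dots> = 2 * (y * y powr (- s'))"
    proof -
      have "(1 - s') * real_of_int js + 1 = 1 + (real_of_int js + real_of_int js * (- s'))" by (simp add: algebra_simps)
      then have "2 powr ((1 - s') * real_of_int js + 1) = 2 powr 1 * (2 powr real_of_int js * 2 powr (real_of_int js * (- s')))"
        by (simp only: powr_add)
      then show ?thesis unfolding y_def powr_powr by simp
    qed
    also have "\<dots> \<le> 2 * (y * z)"
      unfolding z_def using s2 y1 by (intro mult_left_mono powr_mono) auto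
    finally have "K\<^sup>2 \<le> K0\<^sup>2 * (2 * (y * z))"
      unfolding K_def power_mult_distrib by (intro mult_left_mono) auto
    then have "K\<^sup>2 / y \<le> K0\<^sup>2 * (2 * (y * z)) / y" using y0 by (intro divide_right_mono) auto
    then show ?thesis using y0 by (simp add: mult_ac)
  qed
  define X where "X = (if b \<ge> CL * real n powr (1 / (1 + 2 * s)) * log 2 (real n)
    then real n powr (1 / (1 + 2 * s)) else (real n * b / (log 2 (real n))\<^sup>2) powr (1 / (2 + 2 * s)))"
  have cX: "c * X \<le> y"
    unfolding y2[symmetric] c_def X_def CL_def
    by (rule F.critical_large[OF s0 rs A1 js L])
  have Xge: "(real n / lg) powr (1 / (2 + 2 * s)) \<le> X"
    unfolding X_def lgF F.lg_def[symmetric] by (rule F.rate_base_ge[OF s0])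
  have X0: "0 < X"
  proof -
    have "0 < (real n / lg) powr (1 / (2 + 2 * s))" using F.n2 lg1 by simp
    then show ?thesis using Xge by linarith
  qed
  have rateX: "rate L s n b = X powr (- s)"
    unfolding X_def CL_def using F.n2 F.b1 s0 by (intro rate_eq_powr) auto
  have w_rate: "w \<le> c powr (- s) * rate L s n b"
  proof -
    have "w \<le> (c * X) powr (- s)" unfolding w_def using cX c0 X0 s0 by (intro powr_mono2') auto
    also have "\<dots> = c powr (- s) * X powr (- s)" using c0 X0 by (simp add: powr_mult)
    finally show ?thesis unfolding rateX .
  qed
  \<comment> \<open>Three of the four logarithms come from the single levels and one from their
    number.\<close>
  have lgz: "lg ^ 4 * z \<le> 1"
  proof -
    have "c * (real n / lg) powr (1 / (2 + 2 * s)) \<le> y"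
      using cX mult_left_mono[OF Xge, of c] c0 by linarith
    then have "(c * (real n / lg) powr (1 / (2 + 2 * s))) powr s2 \<le> y powr s2"
      using c0 s2 by (intro powr_mono2) auto
    then have "lg ^ 4 \<le> y powr s2" using growth unfolding lg_def[symmetric] by linarith
    then have "lg ^ 4 * z \<le> y powr s2 * z" by (intro mult_right_mono) (auto simp: z_def)
    also have "\<dots> = 1" unfolding z_def using y0 by (simp add: powr_add[symmetric])
    finally show ?thesis .
  qed
  have z0: "0 < z" using y0 by (simp add: z_def)
  \<comment> \<open>In the excess term two logarithms come from bounding 1 + v_l by
    \<open>257 * lg^2\<close> and one from \<open>v_ratio\<close>; the remainder term needs only
    one. The factor 8224 is 2 * 257 * 8 * 2.\<close>
  have summand: "(Cp + 1) * tl * sqrt (F.v l) + 2 * (C3 * K\<^sup>2 * (sqrt (F.v l) + F.v l * sqrt (F.v l)) / 2 ^ nat l)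
      \<le> lg ^ 3 * z * w * (16 * (Cp + 1) * sqrt Cb + 8224 * C3 * K0\<^sup>2 * D)" if l: "js \<le> l" "l < F.J" for l
  proof -
    have Nl: "0 < F.N l" using l by (intro F.N_pos) simp
    have vl: "F.v l \<le> 256 * lg\<^sup>2" unfolding lgF using l js Nl by (intro F.v_le_lg) auto
    have svl: "sqrt (F.v l) \<le> 16 * lg"
    proof (rule real_le_lsqrt)
      show "F.v l \<le> (16 * lg)\<^sup>2" using vl by (simp add: power_mult_distrib)
    qed (use lg1 F.v_nonneg in auto)
    have p3: "lg \<le> lg ^ 3" using self_le_power[OF lg1, of 3] by simp
    have t1: "(Cp + 1) * tl * sqrt (F.v l) \<le> lg ^ 3 * z * w * (16 * (Cp + 1) * sqrt Cb)"
    proof -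
      have "(Cp + 1) * tl * sqrt (F.v l) \<le> (Cp + 1) * (sqrt Cb * (w * z)) * (16 * lg)"
        using tl_le svl tl0 Cp_pos Cb0 w0 z0 F.v_nonneg[of l] by (intro mult_mono mult_left_mono mult_nonneg_nonneg) auto
      also have "\<dots> \<le> (Cp + 1) * (sqrt Cb * (w * z)) * (16 * lg ^ 3)"
        using p3 Cp_pos Cb0 w0 z0 by (intro mult_left_mono) auto
      finally show ?thesis by (simp add: mult_ac)
    qed
    have t2: "C3 * K\<^sup>2 * (sqrt (F.v l) + F.v l * sqrt (F.v l)) / 2 ^ nat l \<le> lg ^ 3 * z * w * (4112 * C3 * K0\<^sup>2 * D)"
    proof -
      have "1 \<le> lg\<^sup>2" using lg1 by simp
      then have v1: "1 + F.v l \<le> 257 * lg\<^sup>2" using vl by linarith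
      have "C3 * K\<^sup>2 * (sqrt (F.v l) + F.v l * sqrt (F.v l)) / 2 ^ nat l = C3 * K\<^sup>2 * ((1 + F.v l) * (sqrt (F.v l) / 2 ^ nat l))"
        by (simp add: algebra_simps add_divide_distrib)
      also have "\<dots> \<le> C3 * K\<^sup>2 * ((257 * lg\<^sup>2) * (8 * lg * (sqrt (F.v js) / 2 ^ nat js)))"
      proof (intro mult_left_mono mult_mono v1)
        show "sqrt (F.v l) / 2 ^ nat l \<le> 8 * lg * (sqrt (F.v js) / 2 ^ nat js)"
          unfolding lgF by (rule F.v_ratio[OF js(1) l])
      qed (use C30 F.v_nonneg in auto)
      also have "\<dots> \<le> C3 * K\<^sup>2 * ((257 * lg\<^sup>2) * (8 * lg * (D * w / y)))"
        unfolding y2 using sv C30 lg1 y0 by (intro mult_left_mono divide_right_mono) auto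
      also have "\<dots> = C3 * (2056 * (lg\<^sup>2 * lg) * D * w) * (K\<^sup>2 / y)" by (simp add: mult_ac)
      also have "\<dots> \<le> C3 * (2056 * (lg\<^sup>2 * lg) * D * w) * (2 * K0\<^sup>2 * z)"
        using K2_le C30 lg1 D0 w0 by (intro mult_left_mono) auto
      also have "\<dots> = lg ^ 3 * z * w * (4112 * C3 * K0\<^sup>2 * D)" by (simp add: power3_eq_cube power2_eq_square)
      finally show ?thesis .
    qed
    have "(Cp + 1) * tl * sqrt (F.v l) + 2 * (C3 * K\<^sup>2 * (sqrt (F.v l) + F.v l * sqrt (F.v l)) / 2 ^ nat l)
        \<le> lg ^ 3 * z * w * (16 * (Cp + 1) * sqrt Cb) + 2 * (lg ^ 3 * z * w * (4112 * C3 * K0\<^sup>2 * D))"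
      by (intro add_mono t1 mult_left_mono t2) simp
    also have "\<dots> = lg ^ 3 * z * w * (16 * (Cp + 1) * sqrt Cb + 8224 * C3 * K0\<^sup>2 * D)" by (simp add: distrib_left)
    finally show ?thesis .
  qed
  define E where "E = 16 * (Cp + 1) * sqrt Cb + 8224 * C3 * K0\<^sup>2 * D"
  have E0: "0 \<le> E" unfolding E_def using Cp_pos Cb0 C30 D0 by simp
  have C6E: "C6 = 2 * E" by (simp add: C6_def E_def)
  have sum_le: "(\<Sum>l\<in>{js..F.J-1}. (Cp + 1) * tl * sqrt (F.v l) + 2 * (C3 * K\<^sup>2 * (sqrt (F.v l) + F.v l * sqrt (F.v l)) / 2 ^ nat l)) \<le> C6 * w"
  proof -
    have "(\<Sum>l\<in>{js..F.J-1}. (Cp + 1) * tl * sqrt (F.v l) + 2 * (C3 * K\<^sup>2 * (sqrt (F.v l) + F.v l * sqrt (F.v l)) / 2 ^ nat l))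
        \<le> (\<Sum>l\<in>{js..F.J-1}. lg ^ 3 * z * w * E)"
      unfolding E_def by (intro sum_mono summand) auto
    also have "\<dots> = real (nat (F.J - js)) * (lg ^ 3 * z * w * E)" using js by simp
    also have "\<dots> \<le> (2 * lg) * (lg ^ 3 * z * w * E)"
    proof (rule mult_right_mono)
      have "real (nat (F.J - js)) = of_int F.J - of_int js" using js by simp
      also have "\<dots> \<le> 2 * lg" using F.J_le_lg js unfolding lgF by simp
      finally show "real (nat (F.J - js)) \<le> 2 * lg" .
      show "0 \<le> lg ^ 3 * z * w * E" using lg1 z0 w0 E0 by simp
    qed
    also have "\<dots> = (lg ^ 4 * z) * (C6 * w)" unfolding C6E by (simp add: power3_eq_cube power4_eq_xxxx mult_ac)
    also have "\<dots> \<le> 1 * (C6 * w)" using lgz E0 w0 unfolding C6E by (intro mult_right_mono) auto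
    finally show ?thesis by simp
  qed
  have main: "risk m F.p \<sigma> (f_hat \<psi> \<tau> n m b sm) f
    \<le> ennreal (sqrt (2 * \<tau> * F.v js) + sqrt (tail f js) + (16 * C1 + 65) * sqrt (F.v js)
        + (\<Sum>l\<in>{js..j_max n b sm - 1}. (Cp + 1) * tl * sqrt (F.v l) + 2 * (C3 * K\<^sup>2 * (sqrt (F.v l) + F.v l * sqrt (F.v l)) / 2 ^ nat l)))"
  proof (rule risk_oracle_bound[where N=F.N and Gb=Gb and J'=J' and s=s and L=L and ?C2.0=C2])
    show "1 \<le> n" "0 < m" using F.n2 F.m2 by auto
    show "F.p = n div m" "0 < F.p" by (auto simp: F.p_def F.p0[unfolded F.p_def])
    show "f \<in> besov_ball \<psi> s L" "0 < s" "0 < L" "0 < \<sigma>" by fact+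
    show "0 \<le> js" "js < j_max n b sm" using js by (auto simp: F.J_def)
    show "F.N l = eff_size n m b sm l" for l by (simp add: F.N_def)
    show "F.v l = 2 ^ nat l / real (F.N l)" for l by (simp add: F.v_def)
    show "transmitters n m b sm l k \<subseteq> {..<m}" if "l < j_max n b sm" "k \<in> positions l" for l k
      using that by (intro F.transmitters_subset) (auto simp: F.J_def)
    show "card (transmitters n m b sm l k) * F.p = F.N l" for l k by (rule F.transmitters_card)
    show "0 < F.N l" if "l < j_max n b sm" for l using that by (intro F.N_pos) (simp add: F.J_def)
    show "F.N l \<le> n" for l by (rule F.N_le)
    show "(\<Sum>l'\<in>{js..l-1}. sqrt (F.v l')) \<le> 5 * sqrt (F.v l)" if "js < l" "0 < F.N l" for l
      using that js by (intro F.sum_sqrt_v_le) auto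
    show "tail f js \<le> \<tau> / 4 * F.v l" if "js < l" "l \<le> j_max n b sm" "0 < F.N l" for l
    proof -
      have "tail f js \<le> Cb * 2 powr (- 2 * of_int js * s)" by (rule tail_b[OF js(1)])
      also have "\<dots> \<le> Cb * (A * F.v l)"
        using F.critical_bias[OF js(3,1) that(1)] that A1 Cb0 by (intro mult_left_mono) (auto simp: F.J_def)
      also have "\<dots> = (4 * Cb * A) / 4 * F.v l" by simp
      also have "\<dots> \<le> \<tau> / 4 * F.v l" using tau(2) F.v_nonneg[of l] by (intro mult_right_mono) auto
      finally show ?thesis .
    qed
    show "(\<Sum>l\<in>{-1..js-1}. F.v l) \<le> 8 * F.v js" using js by (intro F.sum_v_le F.N_pos) auto
    show "C1 = Cp * (Gb + \<sigma>\<^sup>2)" "C2 = 8 * Cp\<^sup>2 * (8 * Gb + 24 * \<sigma> ^ 4 + (Gb + \<sigma>\<^sup>2)\<^sup>2)"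
      by (simp_all add: C1_def C2_def)
    show "C3 = 2 * (8 * (1 + \<sigma>\<^sup>2) * C1 + 2 * C2) / (C1 * sqrt C1)" unfolding C3_def ..
    show "(\<integral>x. (f x)\<^sup>2 \<partial>unif) \<le> Gb" "400 * (2 + sqrt (2 * C1))\<^sup>2 \<le> \<tau>" by fact+
    show "1 \<le> K" "\<bar>comb (below (int J')) (cf f) x\<bar> \<le> K" "0 < tl" "tail f (int J') \<le> tl\<^sup>2" for x
      by (rule K1 Kb tl0 tlt)+
  qed
  have "risk m (n div m) \<sigma> (f_hat \<psi> \<tau> n m b sm) f
      \<le> ennreal ((sqrt (2 * \<tau>) * D + sqrt Cb + (16 * C1 + 65) * D + C6) * w)"
  proof (rule order_trans[OF main[unfolded F.p_def]], rule ennreal_leI)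
    have a: "sqrt (2 * \<tau> * F.v js) \<le> sqrt (2 * \<tau>) * (D * w)"
      unfolding real_sqrt_mult[of "2 * \<tau>"] using sv tau0 by (intro mult_left_mono) auto
    have b: "sqrt (tail f js) \<le> sqrt Cb * w"
    proof -
      have "sqrt (tail f js) \<le> sqrt (Cb * w\<^sup>2)" using tail_b[OF js(1)] unfolding w2 by simp
      then show ?thesis using w0 by (simp add: real_sqrt_mult)
    qed
    have c: "(16 * C1 + 65) * sqrt (F.v js) \<le> (16 * C1 + 65) * (D * w)"
      using sv C10 by (intro mult_left_mono) auto
    have "sqrt (2 * \<tau> * F.v js) + sqrt (tail f js) + (16 * C1 + 65) * sqrt (F.v js)
        + (\<Sum>l\<in>{js..j_max n b sm - 1}. (Cp + 1) * tl * sqrt (F.v l) + 2 * (C3 * K\<^sup>2 * (sqrt (F.v l) + F.v l * sqrt (F.v l)) / 2 ^ nat l))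
      \<le> sqrt (2 * \<tau>) * (D * w) + sqrt Cb * w + (16 * C1 + 65) * (D * w) + C6 * w"
      by (intro add_mono a b c sum_le[unfolded F.J_def])
    then show "sqrt (2 * \<tau> * F.v js) + sqrt (tail f js) + (16 * C1 + 65) * sqrt (F.v js)
        + (\<Sum>l\<in>{js..j_max n b sm - 1}. (Cp + 1) * tl * sqrt (F.v l) + 2 * (C3 * K\<^sup>2 * (sqrt (F.v l) + F.v l * sqrt (F.v l)) / 2 ^ nat l))
      \<le> (sqrt (2 * \<tau>) * D + sqrt Cb + (16 * C1 + 65) * D + C6) * w" by (simp add: distrib_right mult.assoc)
  qed
  also have "\<dots> \<le> ennreal ((sqrt (2 * \<tau>) * D + sqrt Cb + (16 * C1 + 65) * D + C6) * (c powr (- s) * rate L s n b))"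
    using w_rate tau0 D0 Cb0 C10 E0 unfolding C6E by (intro ennreal_leI mult_left_mono add_nonneg_nonneg mult_nonneg_nonneg) auto
  finally show ?thesis by (simp only: mult.assoc)
qed

end

text \<open>With d = e \<delta>, moving the power of the logarithm to the left turns the claim into
  a bound of the logarithm to the power 4 + d by a multiple of n to the power d, which follows from
  ln n being negligible against n to the power d / (4 + d).\<close>

lemma log_power_growth:
  fixes c e \<delta> :: real
  assumes "0 < c" "0 < e" "0 < \<delta>"
  shows "\<forall>\<^sub>F n::nat in sequentially. (log 2 (real n)) ^ 4 \<le> (c * (real n / log 2 (real n)) powr e) powr \<delta>"
proof -
  define d where "d = e * \<delta>"
  have d: "0 < d" using assms by (simp add: d_def)
  have lim: "(\<lambda>n::nat. (ln (real n) / real n powr (d / (4 + d))) powr (4 + d)) \<longlonglongrightarrow> 0"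
    using d lim_ln_over_power[of "d / (4 + d)"]
    by (intro tendsto_zero_powrI[where b="4 + d"]) (auto intro!: eventually_sequentiallyI[of 1] divide_nonneg_nonneg)
  define h where "h = c powr \<delta> * (ln 2) powr (4 + d)"
  have h: "0 < h" using assms by (simp add: h_def)
  have "\<forall>\<^sub>F n::nat in sequentially. (ln (real n) / real n powr (d / (4 + d))) powr (4 + d) < h"
    using lim h by (rule order_tendstoD)
  then show ?thesis
    using eventually_ge_at_top[of 2]
  proof eventually_elim
    case (elim n)
    define g where "g = log 2 (real n)"
    have n0: "0 < real n" using elim by simp
    have g: "0 < g" "ln (real n) = g * ln 2" using elim by (auto simp: g_def log_def)
    have "(g * ln 2) powr (4 + d) \<le> h * real n powr d"
      using elim(1) elim(2) n0 d unfolding g(2)[symmetric] by (simp add: powr_divide powr_powr pos_divide_less_eq less_imp_le)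
    then have "g powr (4 + d) * (ln 2) powr (4 + d) \<le> c powr \<delta> * real n powr d * (ln 2) powr (4 + d)"
      using g by (simp add: powr_mult h_def mult_ac)
    then have "g powr (4 + d) \<le> c powr \<delta> * real n powr d"
      by (rule mult_right_le_imp_le) simp
    then have "g powr 4 * g powr d \<le> c powr \<delta> * real n powr d" by (simp add: powr_add)
    then have "g powr 4 \<le> c powr \<delta> * real n powr d / g powr d" using g by (simp add: pos_le_divide_eq)
    also have "\<dots> = (c * (real n / g) powr e) powr \<delta>"
      using assms g n0 by (simp add: powr_mult powr_powr powr_divide d_def)
    finally show ?case using g by (simp add: g_def[symmetric] powr_numeral)
  qed
qed

text \<open>Only the constants of \<open>risk_rate\<close> that are uniform over s between
  \<open>s_low\<close> and \<open>s_max\<close> enter \<open>\<tau>0\<close>. So it can be fixed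
  before m, B and s, whereas C may depend on all of them and on \<tau>.\<close>

theorem risk_part:
  fixes W :: cdv and s_max :: nat and \<sigma> L s_low :: real
  assumes W: "is_cdv W s_max" and \<sigma>: "0 < \<sigma>" and L: "0 < L" and s_low: "0 < s_low"
  shows "\<exists>\<tau>0 :: real. 1 \<le> \<tau>0 \<and>
          (\<forall>(\<tau> :: real) (m :: nat \<Rightarrow> nat) (B :: nat \<Rightarrow> real) (s :: real).
             \<tau>0 < \<tau> \<longrightarrow> (\<forall>\<^sub>F n in sequentially. log 2 (real n) \<le> B n) \<longrightarrow>
             s_low \<le> s \<longrightarrow> s_min m B \<le> ereal s \<longrightarrow> s < real s_max \<longrightarrow>
             (\<exists>C > 0. \<forall>\<^sub>F n in sequentially. admissible n (m n) (B n) (s_min m B) \<longrightarrow>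
                (SUP f0 \<in> besov_ball (cdv_basis W) s L.
                   risk (m n) (n div m n) \<sigma>
                     (f_hat (cdv_basis W) \<tau> n (m n) (B n) (s_min m B)) f0)
                \<le> ennreal (C * rate L s n (B n))))"
proof -
  obtain Cp where Cp: "0 < Cp" "\<And>l x. -1 \<le> l \<Longrightarrow> (\<Sum>k\<in>positions l. (cdv_basis W l k x)\<^sup>2) \<le> Cp * 2 ^ nat l"
    using cdv_basis_sq_sum_le[OF W] by blast
  interpret bounded_onb "cdv_basis W" Cp
    by unfold_locales (use is_cdv_orthonormal[OF W] Cp in auto)
  define Cb where "Cb = L\<^sup>2 / (1 - 2 powr (- 2 * s_low))"
  define Gb where "Gb = L\<^sup>2 * (2 powr (2 * real s_max) + 1 / (1 - 2 powr (- 2 * s_low)))"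
  define C1 where "C1 = Cp * (Gb + \<sigma>\<^sup>2)"
  define A :: real where "A = 4 powr real s_max"
  define \<tau>0 where "\<tau>0 = max 1 (max (400 * (2 + sqrt (2 * C1))\<^sup>2) (4 * Cb * A))"
  show ?thesis
  proof (rule exI[of _ \<tau>0], intro conjI allI impI)
    show "1 \<le> \<tau>0" by (simp add: \<tau>0_def)
    fix \<tau> :: real and m :: "nat \<Rightarrow> nat" and B :: "nat \<Rightarrow> real" and s :: real
    assume tau: "\<tau>0 < \<tau>" and B: "\<forall>\<^sub>F n in sequentially. log 2 (real n) \<le> B n"
      and s: "s_low \<le> s" "s_min m B \<le> ereal s" "s < real s_max"
    \<comment> \<open>The infimum is over positive numbers and bounded by s, hence finite. This
      makes \<open>j_max\<close> a genuine logarithmic expression.\<close>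
    have "0 \<le> s_min m B" unfolding s_min_def by (rule Inf_greatest) auto
    then obtain r where r: "s_min m B = ereal r" "0 \<le> r" "r \<le> s"
      using s(2) by (cases "s_min m B") auto
    define s' where "s' = min s (1/4)"
    define s2 where "s2 = min s' (s * s')"
    have s0: "0 < s" using s_low s by simp
    have s20: "0 < s2" using s0 by (simp add: s2_def s'_def)
    define CL where "CL = 4 * L powr (2 / (1 + 2 * s))"
    define c where "c = min (min (1/2) (CL powr (1 / (2 + 2 * s)) / 2)) (min (min (CL / 8) (1 / (2 * CL powr (1 / (2 + 2 * s)))))
     (min ((6 * A) powr (- 1 / (1 + 2 * s)) * min 1 (1 / CL powr (1 / (2 + 2 * s)))) ((256 * A) powr (- 1 / (2 + 2 * s)))))"
    have c0: "0 < c" unfolding c_def CL_def A_def using L by auto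
    define C2 where "C2 = 8 * Cp\<^sup>2 * (8 * Gb + 24 * \<sigma> ^ 4 + (Gb + \<sigma>\<^sup>2)\<^sup>2)"
    define C3 where "C3 = 2 * (8 * (1 + \<sigma>\<^sup>2) * C1 + 2 * C2) / (C1 * sqrt C1)"
    define K0 where "K0 = max 1 (sqrt Cp * L * (2 powr real s_max + 6))"
    define C6 where "C6 = 32 * (Cp + 1) * sqrt Cb + 16448 * C3 * K0\<^sup>2 * 2 powr real s_max"
    define Q where "Q = (sqrt (2 * \<tau>) * 2 powr real s_max + sqrt Cb + (16 * C1 + 65) * 2 powr real s_max + C6) * c powr (- s)"
    have ev: "\<forall>\<^sub>F n in sequentially. (log 2 (real n)) ^ 4 \<le> (c * (real n / log 2 (real n)) powr (1 / (2 + 2 * s))) powr s2"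
      using s0 by (intro log_power_growth c0 s20) simp
    have "\<forall>\<^sub>F n in sequentially. admissible n (m n) (B n) (s_min m B) \<longrightarrow>
                (SUP f0 \<in> besov_ball (cdv_basis W) s L.
                   risk (m n) (n div m n) \<sigma>
                     (f_hat (cdv_basis W) \<tau> n (m n) (B n) (s_min m B)) f0)
                \<le> ennreal ((\<bar>Q\<bar> + 1) * rate L s n (B n))"
      using ev B eventually_ge_at_top[of 2]
    proof eventually_elim
      case (elim n)
      show ?case
      proof (intro impI SUP_least)
        fix f assume adm: "admissible n (m n) (B n) (s_min m B)" and f: "f \<in> besov_ball (cdv_basis W) s L"
        have fb: "finite_budget n (m n) (B n) (s_min m B) r"
          by unfold_locales (use elim adm r in auto)
        have t: "400 * (2 + sqrt (2 * C1))\<^sup>2 \<le> \<tau>" "4 * Cb * A \<le> \<tau>"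
          using tau unfolding \<tau>0_def by auto
        have "risk (m n) (n div m n) \<sigma> (f_hat (cdv_basis W) \<tau> n (m n) (B n) (s_min m B)) f
            \<le> ennreal (Q * rate L s n (B n))"
          unfolding Q_def C6_def K0_def C3_def C2_def c_def CL_def C1_def Cb_def Gb_def A_def
          by (rule risk_rate[OF fb r(3) s_low s(1) less_imp_le[OF s(3)] L \<sigma> f
              t[unfolded C1_def Cb_def Gb_def A_def] elim(1)[unfolded s2_def s'_def c_def CL_def A_def]])
        also have "\<dots> \<le> ennreal ((\<bar>Q\<bar> + 1) * rate L s n (B n))"
          by (intro ennreal_leI mult_right_mono) (auto simp: rate_def)
        finally show "risk (m n) (n div m n) \<sigma> (f_hat (cdv_basis W) \<tau> n (m n) (B n) (s_min m B)) f
            \<le> ennreal ((\<bar>Q\<bar> + 1) * rate L s n (B n))" .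
      qed
    qed
    then show "\<exists>C > 0. \<forall>\<^sub>F n in sequentially. admissible n (m n) (B n) (s_min m B) \<longrightarrow>
                (SUP f0 \<in> besov_ball (cdv_basis W) s L.
                   risk (m n) (n div m n) \<sigma>
                     (f_hat (cdv_basis W) \<tau> n (m n) (B n) (s_min m B)) f0)
                \<le> ennreal (C * rate L s n (B n))"
      \<comment> \<open>The absolute value and the added 1 make the constant positive without
        examining the sign of Q.\<close>
      by (intro exI[of _ "\<bar>Q\<bar> + 1"]) auto
  qed
qed

section \<open>Transmission by a prefix-free code\<close>

text \<open>Sign and number of quantisation steps: all that the transmitted number depends on.
  \<open>trans_approx_bits\<close> itself is not prefix-free, since its length varies and the digits
  come in increasing order; a concatenation of its strings could not be split. As the estimator only
  uses the numbers, another code for these pairs may carry them.\<close>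

definition quantise :: "nat \<Rightarrow> real \<Rightarrow> bool \<times> nat" where
  "quantise n x = (x < 0, nat \<lfloor>\<bar>x\<bar> / 2 powi lowest_digit n\<rfloor>)"

lemma trans_approx_quantise:
  "quantise n x = quantise n y \<Longrightarrow> trans_approx n x = trans_approx n y"
proof -
  assume eq: "quantise n x = quantise n y"
  have "0 \<le> \<lfloor>\<bar>z\<bar> / 2 powi lowest_digit n\<rfloor>" for z :: real by simp
  then have "\<lfloor>\<bar>x\<bar> / 2 powi lowest_digit n\<rfloor> = \<lfloor>\<bar>y\<bar> / 2 powi lowest_digit n\<rfloor>"
    using eq unfolding quantise_def by (metis eq_nat_nat_iff prod.inject)
  moreover have "(x < 0) = (y < 0)" using eq by (simp add: quantise_def)
  ultimately show ?thesis unfolding trans_approx_eq by simp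
qed

text \<open>The integer part is sent in unary and the \<open>K\<close> binary digits after the point literally. On
  average the unary part costs only a constant, and the code is prefix-free, so that codewords can be
  concatenated without separators.\<close>

definition prefix_code :: "nat \<Rightarrow> bool \<times> nat \<Rightarrow> bool list" where
  "prefix_code K a = fst a # replicate (snd a div 2 ^ K) True @ False # map (bit (snd a)) [0..<K]"

lemma replicate_True_cancel:
  "replicate u True @ False # xs = replicate u' True @ False # ys \<Longrightarrow> u = u' \<and> xs = ys"
proof (induction u arbitrary: u')
  case 0
  then show ?case by (cases u') auto
next
  case (Suc u)
  then show ?case by (cases u') auto
qed

lemma prefix_code_cancel:
  assumes "prefix_code K a @ xs = prefix_code K a' @ ys"
  shows "a = a' \<and> xs = ys"
proof -
  have f: "fst a = fst a'" and
    "replicate (snd a div 2 ^ K) True @ False # (map (bit (snd a)) [0..<K] @ xs)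
      = replicate (snd a' div 2 ^ K) True @ False # (map (bit (snd a')) [0..<K] @ ys)"
    using assms by (auto simp: prefix_code_def)
  then have d: "snd a div 2 ^ K = snd a' div 2 ^ K"
    and "map (bit (snd a)) [0..<K] @ xs = map (bit (snd a')) [0..<K] @ ys"
    using replicate_True_cancel by blast+
  then have b: "map (bit (snd a)) [0..<K] = map (bit (snd a')) [0..<K]" and r: "xs = ys"
    by (simp_all add: append_eq_append_conv)
  have "take_bit K (snd a) = take_bit K (snd a')"
    using arg_cong[OF b, of "horner_sum of_bool (2::nat)"] unfolding horner_sum_bit_eq_take_bit .
  then have "snd a mod 2 ^ K = snd a' mod 2 ^ K" by (simp add: take_bit_eq_mod)
  then have "snd a = snd a'" using d by (metis div_mult_mod_eq)
  then show ?thesis using f r by (simp add: prod_eq_iff)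
qed

text \<open>The list of coefficients a machine sends is fixed in advance and does not depend on the
  data. Reading the string from the left, prefix-freeness recovers one value after the
  other.\<close>

lemma concat_prefix_code_inj:
  assumes "concat (map (\<lambda>a. prefix_code K (f a)) xs) = concat (map (\<lambda>a. prefix_code K (g a)) xs)"
  shows "\<forall>a\<in>set xs. f a = g a"
  using assms
proof (induction xs)
  case (Cons a xs)
  then have "f a = g a \<and> concat (map (\<lambda>a. prefix_code K (f a)) xs) = concat (map (\<lambda>a. prefix_code K (g a)) xs)"
    by (intro prefix_code_cancel[of K]) simp
  then show ?case using Cons.IH by simp
qed simp

text \<open>The fractional digits number at most half of log n, sign and delimiter take two bits,
  and the unary integer part is at most the absolute value of x. In the mean, about half of log n
  remains free for these extras.\<close>

lemma prefix_code_length: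
  assumes "1 \<le> n" and K: "K = nat (- lowest_digit n)"
  shows "real (length (prefix_code K (quantise n x))) \<le> \<bar>x\<bar> + (2 + log 2 (real n) / 2)"
proof -
  have lg: "0 \<le> log 2 (real n)" using assms(1) by simp
  have "lowest_digit n \<le> 0" unfolding lowest_digit_def using lg by simp
  then have l: "lowest_digit n = - int K" by (simp add: K)
  have "- (1/2) * log 2 (real n) \<le> real_of_int (lowest_digit n)" unfolding lowest_digit_def by linarith
  then have Kl: "real K \<le> log 2 (real n) / 2" unfolding l by simp
  define q where "q = nat \<lfloor>\<bar>x\<bar> * 2 ^ K\<rfloor>"
  have q: "snd (quantise n x) = q" by (simp add: quantise_def q_def l power_int_minus field_simps)
  have "real q = real_of_int \<lfloor>\<bar>x\<bar> * 2 ^ K\<rfloor>" by (simp add: q_def)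
  then have "real q \<le> \<bar>x\<bar> * 2 ^ K" by linarith
  moreover have "real (q div 2 ^ K) * 2 ^ K \<le> real q"
  proof -
    have "real (q div 2 ^ K * 2 ^ K) \<le> real q" by (intro of_nat_mono) simp
    then show ?thesis by simp
  qed
  ultimately have "real (q div 2 ^ K) * 2 ^ K \<le> \<bar>x\<bar> * 2 ^ K" by linarith
  then have "real (q div 2 ^ K) \<le> \<bar>x\<bar>" by (rule mult_right_le_imp_le) simp
  then show ?thesis using Kl by (simp add: prefix_code_def q)
qed

lemma quantise_measurable: "quantise n \<in> measurable borel (count_space UNIV)"
  unfolding measurable_count_space_eq2_countable
proof (intro conjI ballI)
  fix y :: "bool \<times> nat"
  have "quantise n -` {y} \<inter> space borel
      = {x \<in> space borel. (x < 0) = fst y \<and> nat \<lfloor>\<bar>x\<bar> / 2 powi lowest_digit n\<rfloor> = snd y}"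
    by (auto simp: quantise_def prod_eq_iff)
  also have "\<dots> \<in> sets borel" by measurable
  finally show "quantise n -` {y} \<inter> space borel \<in> sets borel" .
qed auto

lemma concat_measurable:
  fixes F :: "'a \<Rightarrow> 'b \<Rightarrow> 'c::countable list"
  assumes "\<And>a. a \<in> set xs \<Longrightarrow> F a \<in> measurable M (count_space UNIV)"
  shows "(\<lambda>d. concat (map (\<lambda>a. F a d) xs)) \<in> measurable M (count_space UNIV)"
  using assms
proof (induction xs)
  case (Cons a xs)
  have F: "F a \<in> measurable M (count_space UNIV)" using Cons.prems by simp
  have G: "(\<lambda>d. concat (map (\<lambda>a. F a d) xs)) \<in> measurable M (count_space UNIV)" using Cons by simp
  have "(\<lambda>d. F a d @ l) \<in> measurable M (count_space UNIV)" for l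
    using F by (rule measurable_compose) simp
  from measurable_compose_countable[OF this G] show ?case by simp
qed simp

section \<open>The communication budget\<close>

context budget
begin

definition sent :: "nat \<Rightarrow> (int \<times> nat) set" where
  "sent i = {a \<in> below J. i \<in> transmitters n m b sm (fst a) (snd a)}"

lemma finite_sent: "finite (sent i)"
  unfolding sent_def by simp

text \<open>A machine of the first half sends the levels below \<open>jB\<close>, altogether
  \<open>2 ^ jB\<close> coefficients. Any other machine belongs to at most one subgroup, which fixes
  a single level and a block of \<open>2 ^ jB\<close> consecutive positions in it; leftover machines
  send nothing.\<close>

lemma card_sent_le: "real (card (sent i)) \<le> 2 ^ nat jB"
proof (cases "i < m div 2")
  case True
  have "sent i \<subseteq> below jB"
  proof
    fix a assume a: "a \<in> sent i"
    obtain l k where [simp]: "a = (l, k)" by (cases a)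
    have "l < jB"
    proof (rule ccontr)
      assume "\<not> l < jB"
      then have "jB \<le> l" by simp
      from transmitters_above[OF this, of k] a True show False by (auto simp: sent_def Let_def)
    qed
    then show "a \<in> below jB" using a by (auto simp: sent_def below_def)
  qed
  then have "card (sent i) \<le> card (below jB)" by (intro card_mono) auto
  also have "card (below jB) = (\<Sum>l\<in>{-1..jB-1}. 2 ^ nat l)"
    unfolding below_def by (subst card_SigmaI) (auto simp: positions_def)
  finally have "real (card (sent i)) \<le> real (\<Sum>l\<in>{-1..jB-1}. 2 ^ nat l)" by (rule of_nat_mono)
  then show ?thesis using sum_pow2[OF jB0] by simp
next
  case False
  \<comment> \<open>Group and subgroup are read off from the machine number by division. For a
    leftover machine the values are meaningless, but then there is no transmitted position to be
    located.\<close>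
  define t where "t = (i - m div 2) div gs"
  define u where "u = ((i - m div 2) mod gs) div (gs div 2 ^ t)"
  define B where "B = (2::nat) ^ nat jB"
  have "sent i \<subseteq> {jB + int t} \<times> {u * B..<u * B + B}"
  proof
    fix a assume a: "a \<in> sent i"
    obtain l k where [simp]: "a = (l, k)" by (cases a)
    have lk: "l < J" "k \<in> positions l" "i \<in> transmitters n m b sm l k"
      using a by (auto simp: sent_def below_def)
    have l: "jB \<le> l"
    proof (rule ccontr)
      assume "\<not> jB \<le> l"
      then show False using lk(3) False transmitters_below[of l k] by simp
    qed
    define t' where "t' = nat (l - jB)"
    define r where "r = gs div 2 ^ t'"
    define q where "q = k div B"
    have bb: "(q + 1) * r \<le> gs" using block_bounds(1)[OF l lk(1,2)] unfolding t'_def r_def q_def B_def .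
    have i: "m div 2 + t' * gs + q * r \<le> i" "i < m div 2 + t' * gs + (q * r + r)"
      using lk(3) unfolding transmitters_above[OF l] Let_def t'_def r_def q_def B_def by auto
    define e where "e = i - (m div 2 + t' * gs + q * r)"
    have e: "i - m div 2 = t' * gs + (q * r + e)" "e < r" using i unfolding e_def by linarith+
    have small: "q * r + e < gs" using bb e(2) by simp
    have t: "t' = t" unfolding t_def e(1) using small by simp
    have "u = (q * r + e) div r" unfolding u_def t[symmetric] r_def[symmetric] e(1) using small by simp
    then have u: "u = q" using e(2) by simp
    have "k div B * B \<le> k" "k < k div B * B + B"
      using dividend_less_div_times[of B k] by (auto simp: B_def)
    then show "a \<in> {jB + int t} \<times> {u * B..<u * B + B}"
      using l unfolding u q_def t[symmetric] t'_def by simp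
  qed
  then have "card (sent i) \<le> card ({jB + int t} \<times> {u * B..<u * B + B})" by (intro card_mono) auto
  then have "card (sent i) \<le> B" by (simp add: card_cartesian_product)
  then have "real (card (sent i)) \<le> real B" by (rule of_nat_mono)
  then show ?thesis by (simp add: B_def)
qed

text \<open>Membership in the class is claimed for every s > 0, so the minimal smoothness may be
  infinite. Division by infinity then gives 0 in both terms of \<open>j_max\<close>.\<close>

lemma J_nonneg:
  assumes "0 \<le> sm"
  shows "0 \<le> J"
proof (cases sm)
  case (real r)
  interpret finite_budget n m b sm r
    by unfold_locales (use real assms in auto)
  show ?thesis using J1 by simp
next
  case PInf
  have "j_max n b sm = 0" unfolding PInf j_max_def by simp
  then show ?thesis by (simp add: J_def)
next
  case MInf
  then show ?thesis using assms by simp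
qed

end

section \<open>Membership in the class of distributed estimators\<close>

text \<open>The selected level, too, is a function of the aggregated coefficients below
  \<open>j_max\<close>. Nonnegativity of \<open>j_max\<close> makes the minimum range over a
  nonempty set, so that the selected level does not exceed \<open>j_max\<close>.\<close>

lemma f_hat_cong:
  assumes J: "0 \<le> j_max n b sm"
    and eq: "\<And>l k. -1 \<le> l \<Longrightarrow> l < j_max n b sm \<Longrightarrow> k \<in> positions l \<Longrightarrow>
      central_coeff \<psi> n m b sm d l k = central_coeff \<psi> n m b sm d' l k"
  shows "f_hat \<psi> \<tau> n m b sm d = f_hat \<psi> \<tau> n m b sm d'"
proof -
  have lev: "f_level \<psi> n m b sm d j = f_level \<psi> n m b sm d' j" if "j \<le> j_max n b sm" for j
    unfolding f_level_def[abs_def] using that by (intro ext sum.cong refl) (auto simp: eq)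
  define P where "P d j \<longleftrightarrow> (\<forall>l\<in>{0..j_max n b sm}. j < l \<longrightarrow> 0 < eff_size n m b sm l \<longrightarrow>
       (L2_norm (\<lambda>x. f_level \<psi> n m b sm d j x - f_level \<psi> n m b sm d l x))\<^sup>2
         \<le> \<tau> * 2 ^ nat l / real (eff_size n m b sm l))" for d j
  have jh: "j_hat \<psi> \<tau> n m b sm d = Min {j \<in> {0..j_max n b sm}. P d j}" for d
    unfolding j_hat_def P_def ..
  have "P d j \<longleftrightarrow> P d' j" if "j \<in> {0..j_max n b sm}" for j
    unfolding P_def using that by (intro ball_cong refl) (simp add: lev)
  then have s: "{j \<in> {0..j_max n b sm}. P d j} = {j \<in> {0..j_max n b sm}. P d' j}" by blast
  define S where "S = {j \<in> {0..j_max n b sm}. P d' j}"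
  have "j_max n b sm \<in> S" using J by (simp add: S_def P_def)
  moreover have "finite S" unfolding S_def by (rule finite_subset[of _ "{0..j_max n b sm}"]) auto
  ultimately have "Min S \<in> S" by (intro Min_in) auto
  then have "j_hat \<psi> \<tau> n m b sm d' \<le> j_max n b sm" unfolding jh S_def[symmetric] by (auto simp: S_def)
  then show ?thesis unfolding f_hat_def using lev jh s by simp
qed

lemma local_coeff_measurable:
  assumes [measurable]: "\<psi> j k \<in> borel_measurable borel"
  shows "(\<lambda>d. local_coeff \<psi> p d j k) \<in> borel_measurable (local_space p)"
proof -
  have "(\<lambda>d. snd (d l) * \<psi> j k (fst (d l))) \<in> borel_measurable (local_space p)" if "l < p" for l
  proof -
    have "(\<lambda>d. d l) \<in> measurable (local_space p) (borel \<Otimes>\<^sub>M borel)"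
      unfolding local_space_def using that by (intro measurable_component_singleton) simp
    moreover have "(\<lambda>z. snd z * \<psi> j k (fst z)) \<in> borel_measurable (borel \<Otimes>\<^sub>M borel)" by measurable
    ultimately show ?thesis by (rule measurable_compose)
  qed
  then show ?thesis unfolding local_coeff_def
    by (intro borel_measurable_divide borel_measurable_sum) auto
qed

context bounded_onb
begin

text \<open>Controls the unary part of the code. Pointwise, the absolute value of observation times
  basis function is at most the sum of the squares of signal, noise and basis function, and the last
  has integral 1. The bound is the same for all coefficients and uses the signal only through its L2
  norm.\<close>

lemma local_coeff_mean_le:
  assumes f: "f \<in> L2_unit" and a: "a \<in> idx" and i: "i < m" and p: "0 < p"
    and G: "(\<integral>x. (f x)\<^sup>2 \<partial>unif) \<le> G"
  shows "(\<integral>\<^sup>+\<omega>. ennreal \<bar>local_coeff \<psi> p (nest m p \<sigma> f \<omega> i) (fst a) (snd a)\<bar> \<partial>flat_design m p) \<le> ennreal (G + \<sigma>\<^sup>2 + 1)"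
proof -
  define u where "u = \<psi> (fst a) (snd a)"
  have u: "u \<in> L2_unit" "(\<integral>x. (u x)\<^sup>2 \<partial>unif) = 1"
    using psi_L2[OF a] psi_inner_unif[OF a a] by (simp_all add: u_def power2_eq_square)
  have [measurable]: "f \<in> borel_measurable borel" "u \<in> borel_measurable borel"
    using f u by (auto simp: L2_unit_iff)
  define h where "h z = ((f (fst z))\<^sup>2 + \<sigma>\<^sup>2 * snd z ^ 2) + (u (fst z))\<^sup>2" for z
  have h0: "0 \<le> h z" for z by (simp add: h_def)
  have hm [measurable]: "h \<in> borel_measurable design" unfolding h_def[abs_def] by measurable
  have fi: "integrable unif (\<lambda>x. (f x)\<^sup>2)" "integrable unif (\<lambda>x. (u x)\<^sup>2)" using f u by (auto simp: L2_unit_iff)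
  have hE: "(\<integral>\<^sup>+z. ennreal (h z) \<partial>design) \<le> ennreal (G + \<sigma>\<^sup>2 + 1)"
  proof -
    have i1: "integrable design (\<lambda>z. (f (fst z))\<^sup>2)" "(\<integral>z. (f (fst z))\<^sup>2 \<partial>design) = (\<integral>x. (f x)\<^sup>2 \<partial>unif)"
      using design_fst[of "\<lambda>x. (f x)\<^sup>2"] fi by simp_all
    have i2: "integrable design (\<lambda>z. (u (fst z))\<^sup>2)" "(\<integral>z. (u (fst z))\<^sup>2 \<partial>design) = 1"
      using design_fst[of "\<lambda>x. (u x)\<^sup>2"] fi u by simp_all
    have i3: "integrable design (\<lambda>z. \<sigma>\<^sup>2 * snd z ^ 2)" "(\<integral>z. \<sigma>\<^sup>2 * snd z ^ 2 \<partial>design) = \<sigma>\<^sup>2"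
      using design_fst_power[of "\<lambda>x. \<sigma>\<^sup>2" 2] gauss_moments(2) by simp_all
    have hi: "integrable design h" unfolding h_def[abs_def] by (intro Bochner_Integration.integrable_add i1 i2 i3)
    have "(\<integral>\<^sup>+z. ennreal (h z) \<partial>design) = ennreal (\<integral>z. h z \<partial>design)"
      by (rule nn_integral_eq_integral[OF hi]) (simp add: h0)
    also have "(\<integral>z. h z \<partial>design) = (\<integral>x. (f x)\<^sup>2 \<partial>unif) + \<sigma>\<^sup>2 + 1"
      unfolding h_def[abs_def] using i1 i2 i3 by simp
    finally have "(\<integral>\<^sup>+z. ennreal (h z) \<partial>design) = ennreal ((\<integral>x. (f x)\<^sup>2 \<partial>unif) + \<sigma>\<^sup>2 + 1)" .
    also have "\<dots> \<le> ennreal (G + \<sigma>\<^sup>2 + 1)" using G by (intro ennreal_leI) simp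
    finally show ?thesis .
  qed
  have comp: "(\<integral>\<^sup>+\<omega>. ennreal (h (\<omega> (i, l))) \<partial>flat_design m p) \<le> ennreal (G + \<sigma>\<^sup>2 + 1)" if l: "l < p" for l
  proof -
    have il: "(i, l) \<in> {..<m} \<times> {..<p}" using i l by simp
    have d: "distr (flat_design m p) design (\<lambda>\<omega>. \<omega> (i, l)) = design"
      unfolding flat_design_def by (rule distr_PiM_component[OF design.prob_space_axioms il])
    have mm: "(\<lambda>\<omega>. \<omega> (i, l)) \<in> measurable (flat_design m p) design"
      unfolding flat_design_def by (rule measurable_component_singleton[OF il])
    have "(\<integral>\<^sup>+\<omega>. ennreal (h (\<omega> (i, l))) \<partial>flat_design m p) = (\<integral>\<^sup>+z. ennreal (h z) \<partial>distr (flat_design m p) design (\<lambda>\<omega>. \<omega> (i, l)))"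
      by (rule nn_integral_distr[symmetric, OF mm]) measurable
    then show ?thesis unfolding d using hE by simp
  qed
  have pw: "\<bar>local_coeff \<psi> p (nest m p \<sigma> f \<omega> i) (fst a) (snd a)\<bar> \<le> (\<Sum>l<p. 1 / real p * h (\<omega> (i, l)))" for \<omega>
  proof -
    have "\<bar>(f x + \<sigma> * e) * u x\<bar> \<le> h (x, e)" for x e
    proof -
      have "2 * \<bar>(f x + \<sigma> * e) * u x\<bar> \<le> (f x + \<sigma> * e)\<^sup>2 + (u x)\<^sup>2"
        using sum_squares_bound[of "\<bar>f x + \<sigma> * e\<bar>" "\<bar>u x\<bar>"] by (simp add: abs_mult mult.assoc)
      also have "(f x + \<sigma> * e)\<^sup>2 \<le> 2 * ((f x)\<^sup>2 + \<sigma>\<^sup>2 * e\<^sup>2)"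
        using sum_squares_bound[of "f x" "\<sigma> * e"] by (simp add: power2_sum power_mult_distrib)
      finally have "2 * \<bar>(f x + \<sigma> * e) * u x\<bar> \<le> 2 * ((f x)\<^sup>2 + \<sigma>\<^sup>2 * e\<^sup>2) + (u x)\<^sup>2" by simp
      moreover have "y \<le> v + w" if "2 * y \<le> 2 * v + w" "0 \<le> w" for y v w :: real using that by linarith
      ultimately have "\<bar>(f x + \<sigma> * e) * u x\<bar> \<le> (f x)\<^sup>2 + \<sigma>\<^sup>2 * e\<^sup>2 + (u x)\<^sup>2" using zero_le_power2 by blast
      then show ?thesis by (simp add: h_def)
    qed
    then have b: "\<bar>snd (obs \<sigma> f z) * u (fst (obs \<sigma> f z))\<bar> \<le> h z" for z
      by (cases z) (simp add: obs_def)
    have "\<bar>local_coeff \<psi> p (nest m p \<sigma> f \<omega> i) (fst a) (snd a)\<bar>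
        = \<bar>\<Sum>l<p. snd (obs \<sigma> f (\<omega> (i, l))) * u (fst (obs \<sigma> f (\<omega> (i, l))))\<bar> / real p"
      unfolding local_coeff_def u_def using i by (simp add: nest_def)
    also have "\<dots> \<le> (\<Sum>l<p. h (\<omega> (i, l))) / real p"
      by (intro divide_right_mono order_trans[OF sum_abs] sum_mono b) simp
    also have "\<dots> = (\<Sum>l<p. 1 / real p * h (\<omega> (i, l)))" by (simp add: sum_divide_distrib)
    finally show ?thesis .
  qed
  have "(\<integral>\<^sup>+\<omega>. ennreal \<bar>local_coeff \<psi> p (nest m p \<sigma> f \<omega> i) (fst a) (snd a)\<bar> \<partial>flat_design m p)
      \<le> (\<integral>\<^sup>+\<omega>. (\<Sum>l<p. ennreal (1 / real p) * ennreal (h (\<omega> (i, l)))) \<partial>flat_design m p)"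
  proof (rule nn_integral_mono)
    fix \<omega>
    have "(\<Sum>l<p. ennreal (1 / real p) * ennreal (h (\<omega> (i, l)))) = (\<Sum>l<p. ennreal (1 / real p * h (\<omega> (i, l))))"
      by (intro sum.cong refl ennreal_mult[symmetric] h0) simp
    also have "\<dots> = ennreal (\<Sum>l<p. 1 / real p * h (\<omega> (i, l)))"
      by (rule sum_ennreal) (intro mult_nonneg_nonneg h0, simp)
    finally show "ennreal \<bar>local_coeff \<psi> p (nest m p \<sigma> f \<omega> i) (fst a) (snd a)\<bar> \<le> (\<Sum>l<p. ennreal (1 / real p) * ennreal (h (\<omega> (i, l))))"
      using ennreal_leI[OF pw[of \<omega>]] by simp
  qed
  also have "\<dots> = (\<Sum>l<p. ennreal (1 / real p) * (\<integral>\<^sup>+\<omega>. ennreal (h (\<omega> (i, l))) \<partial>flat_design m p))"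
  proof -
    have mm: "(\<lambda>\<omega>. ennreal (h (\<omega> (i, l)))) \<in> borel_measurable (flat_design m p)" if l: "l < p" for l
    proof -
      have "(\<lambda>\<omega>. \<omega> (i, l)) \<in> measurable (flat_design m p) design"
        unfolding flat_design_def using i l by (intro measurable_component_singleton) simp
      moreover have "(\<lambda>z. ennreal (h z)) \<in> borel_measurable design" by measurable
      ultimately show ?thesis by (rule measurable_compose)
    qed
    have cm: "(\<lambda>\<omega>. ennreal (1 / real p) * ennreal (h (\<omega> (i, l)))) \<in> borel_measurable (flat_design m p)" if l: "l < p" for l
    proof -
      note [measurable] = mm[OF l]
      show ?thesis by measurable
    qed
    have "(\<integral>\<^sup>+\<omega>. (\<Sum>l<p. ennreal (1 / real p) * ennreal (h (\<omega> (i, l)))) \<partial>flat_design m p)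
        = (\<Sum>l<p. \<integral>\<^sup>+\<omega>. ennreal (1 / real p) * ennreal (h (\<omega> (i, l))) \<partial>flat_design m p)"
      using cm by (intro nn_integral_sum) auto
    also have "\<dots> = (\<Sum>l<p. ennreal (1 / real p) * (\<integral>\<^sup>+\<omega>. ennreal (h (\<omega> (i, l))) \<partial>flat_design m p))"
      using mm by (intro sum.cong refl nn_integral_cmult) auto
    finally show ?thesis .
  qed
  also have "\<dots> \<le> (\<Sum>l<p. ennreal (1 / real p) * ennreal (G + \<sigma>\<^sup>2 + 1))"
    using comp by (intro sum_mono mult_left_mono) auto
  also have "\<dots> = ennreal (G + \<sigma>\<^sup>2 + 1)"
  proof -
    have "0 \<le> G" using G by (rule order_trans[rotated]) simp
    then have G0: "0 \<le> G + \<sigma>\<^sup>2 + 1" by simp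
    have "(\<Sum>l<p. ennreal (1 / real p) * ennreal (G + \<sigma>\<^sup>2 + 1)) = (\<Sum>l<p. ennreal (1 / real p * (G + \<sigma>\<^sup>2 + 1)))"
      using G0 by (intro sum.cong refl ennreal_mult[symmetric]) auto
    also have "\<dots> = ennreal (\<Sum>l<p. 1 / real p * (G + \<sigma>\<^sup>2 + 1))" using G0 by (intro sum_ennreal) auto
    also have "(\<Sum>l<p. 1 / real p * (G + \<sigma>\<^sup>2 + 1)) = G + \<sigma>\<^sup>2 + 1" using p by simp
    finally show ?thesis .
  qed
  finally show ?thesis .
qed

text \<open>Equal strings of all machines force equal quantised values of every coefficient in use,
  so the estimator factors through the strings. For the length, at most b / log n codewords of mean
  length at most log n are sent.\<close>

lemma f_hat_distributed:
  assumes bu: "budget n m b sm" and sm: "0 \<le> sm"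
    and Fs: "\<And>f. f \<in> Fs \<Longrightarrow> f \<in> L2_unit" "\<And>f. f \<in> Fs \<Longrightarrow> (\<integral>x. (f x)\<^sup>2 \<partial>unif) \<le> G"
    and G0: "0 \<le> G" and large: "G + \<sigma>\<^sup>2 + 3 \<le> log 2 (real n) / 2"
  shows "f_hat \<psi> \<tau> n m b sm \<in> dist_estimators m (n div m) \<sigma> (\<lambda>i. b) Fs"
proof -
  interpret F: budget n m b sm by (rule bu)
  define p where "p = n div m"
  have p: "0 < p" using F.p0 by (simp add: p_def F.p_def)
  define K where "K = nat (- lowest_digit n)"
  have "\<exists>xs. set xs = F.sent i \<and> distinct xs" for i
    using finite_distinct_list[OF F.finite_sent] by blast
  then obtain xs where xs: "set (xs i) = F.sent i" "distinct (xs i)" for i by metis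
  define q where "q d a = quantise n (local_coeff \<psi> p d (fst a) (snd a))" for d a
  define Y where "Y i d = concat (map (\<lambda>a. prefix_code K (q d a)) (xs i))" for i d
  define YY where "YY d = (\<lambda>i\<in>{..<m}. Y i (d i))" for d
  have inj: "f_hat \<psi> \<tau> n m b sm d = f_hat \<psi> \<tau> n m b sm d'" if eq: "YY d = YY d'" for d d'
  proof (rule f_hat_cong)
    show "0 \<le> j_max n b sm" using F.J_nonneg[OF sm] by (simp add: F.J_def)
    fix l k assume l: "-1 \<le> l" "l < j_max n b sm" and k: "k \<in> positions l"
    show "central_coeff \<psi> n m b sm d l k = central_coeff \<psi> n m b sm d' l k"
      unfolding central_coeff_def
    proof (intro arg_cong2[where f="(/)"] sum.cong refl trans_approx_quantise)
      fix i assume i: "i \<in> transmitters n m b sm l k"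
      have "i < m" using F.transmitters_subset[of l k] l k i by (auto simp: F.J_def)
      then have "Y i (d i) = Y i (d' i)" using fun_cong[OF eq, of i] by (simp add: YY_def)
      then have "\<forall>a\<in>set (xs i). q (d i) a = q (d' i) a"
        unfolding Y_def by (rule concat_prefix_code_inj)
      moreover have "(l, k) \<in> F.sent i" using l k i by (simp add: F.sent_def below_def F.J_def)
      ultimately show "quantise n (local_coeff \<psi> (n div m) (d i) l k) = quantise n (local_coeff \<psi> (n div m) (d' i) l k)"
        unfolding xs q_def p_def by auto
    qed
  qed
  define S where "S = space (sample_space m p)"
  \<comment> \<open>The central machine's decoder, obtained by choosing any sample that produces the
    received strings; the choice is irrelevant by \<open>inj\<close>. Strings that no sample
    produces are sent to the zero function, which is square-integrable.\<close>
  define GG where "GG y = (if \<exists>d\<in>S. YY d = y then f_hat \<psi> \<tau> n m b sm (SOME d. d \<in> S \<and> YY d = y) else (\<lambda>_. 0))" for y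
  have sub: "F.sent i \<subseteq> idx" for i unfolding F.sent_def using below_subset_idx by auto
  show ?thesis
    unfolding dist_estimators_def mem_Collect_eq p_def[symmetric]
  proof (intro exI[of _ Y] exI[of _ GG] conjI allI ballI impI)
    show "Y i \<in> measurable (local_space p) (count_space UNIV)" for i
      unfolding Y_def[abs_def]
    proof (rule concat_measurable)
      fix a assume "a \<in> set (xs i)"
      then have "a \<in> idx" using xs(1) sub by auto
      then have "\<psi> (fst a) (snd a) \<in> borel_measurable borel" using psi_L2 L2_unit_iff by blast
      then have "(\<lambda>d. q d a) \<in> measurable (local_space p) (count_space UNIV)"
        unfolding q_def by (intro measurable_compose[OF local_coeff_measurable quantise_measurable])
      then show "(\<lambda>d. prefix_code K (q d a)) \<in> measurable (local_space p) (count_space UNIV)"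
        by (rule measurable_compose) simp
    qed
    show "GG y \<in> L2_unit" for y
    proof -
      have "f_hat \<psi> \<tau> n m b sm d \<in> L2_unit" for d
        unfolding f_hat_def f_level_comb by (intro comb_L2) (auto simp: below_subset_idx)
      moreover have "(\<lambda>_. 0) \<in> L2_unit" by (simp add: L2_unit_iff)
      ultimately show ?thesis by (simp add: GG_def)
    qed
    show "f_hat \<psi> \<tau> n m b sm d = GG (\<lambda>i\<in>{..<m}. Y i (d i))" if "d \<in> space (sample_space m p)" for d
    proof -
      have ex: "\<exists>d'. d' \<in> S \<and> YY d' = YY d" using that by (auto simp: S_def)
      have "YY (SOME d'. d' \<in> S \<and> YY d' = YY d) = YY d" using someI_ex[OF ex] by blast
      then have "GG (YY d) = f_hat \<psi> \<tau> n m b sm d"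
        unfolding GG_def using ex by (auto intro: inj)
      then show ?thesis by (simp add: YY_def)
    qed
    fix f i assume f: "f \<in> Fs" and i: "i < m"
    define c where "c = 2 + log 2 (real n) / 2"
    have c0: "0 \<le> c" using F.lg1 by (simp add: c_def F.lg_def)
    define M where "M = G + \<sigma>\<^sup>2 + 1"
    have M0: "0 \<le> M" using G0 by (simp add: M_def)
    interpret P: prob_space "flat_design m p" by (rule prob_space_flat_design)
    define lc where "lc a \<omega> = \<bar>local_coeff \<psi> p (nest m p \<sigma> f \<omega> i) (fst a) (snd a)\<bar>" for a \<omega>
    have fm: "f \<in> borel_measurable borel" using Fs(1)[OF f] by (simp add: L2_unit_iff)
    have lcm: "(\<lambda>\<omega>. ennreal (lc a \<omega>)) \<in> borel_measurable (flat_design m p)" if a: "a \<in> F.sent i" for a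
    proof -
      have "\<psi> (fst a) (snd a) \<in> borel_measurable borel" using psi_L2 L2_unit_iff a sub by blast
      moreover have "(\<lambda>\<omega>. nest m p \<sigma> f \<omega> i) \<in> measurable (flat_design m p) (local_space p)"
      proof (rule measurable_compose[OF nest_measurable[OF fm]])
        show "(\<lambda>x. x i) \<in> measurable (sample_space m p) (local_space p)"
          unfolding sample_space_def using i by (intro measurable_component_singleton) simp
      qed
      ultimately have [measurable]: "(\<lambda>\<omega>. local_coeff \<psi> p (nest m p \<sigma> f \<omega> i) (fst a) (snd a)) \<in> borel_measurable (flat_design m p)"
        by (intro measurable_compose[OF _ local_coeff_measurable])
      show ?thesis unfolding lc_def by measurable
    qed
    have len: "ennreal (real (length (Y i (nest m p \<sigma> f \<omega> i)))) \<le> (\<Sum>a\<in>F.sent i. ennreal (lc a \<omega>) + ennreal c)" for \<omega>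
    proof -
      have "real (length (Y i (nest m p \<sigma> f \<omega> i))) = (\<Sum>a\<in>F.sent i. real (length (prefix_code K (q (nest m p \<sigma> f \<omega> i) a))))"
        unfolding Y_def length_concat map_map xs(1)[symmetric] using xs(2) by (simp add: sum_list_distinct_conv_sum_set o_def)
      also have "\<dots> \<le> (\<Sum>a\<in>F.sent i. lc a \<omega> + c)"
        unfolding q_def lc_def c_def by (intro sum_mono prefix_code_length) (use F.n2 in \<open>auto simp: K_def\<close>)
      finally have "ennreal (real (length (Y i (nest m p \<sigma> f \<omega> i)))) \<le> ennreal (\<Sum>a\<in>F.sent i. lc a \<omega> + c)" by (rule ennreal_leI)
      also have "\<dots> = (\<Sum>a\<in>F.sent i. ennreal (lc a \<omega> + c))" using c0 by (intro sum_ennreal[symmetric]) (simp add: lc_def)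
      also have "\<dots> = (\<Sum>a\<in>F.sent i. ennreal (lc a \<omega>) + ennreal c)"
        using c0 by (intro sum.cong refl ennreal_plus) (simp_all add: lc_def)
      finally show ?thesis .
    qed
    have "(\<integral>\<^sup>+ d. ennreal (real (length (Y i (d i)))) \<partial>sample_law m p \<sigma> f)
        \<le> (\<integral>\<^sup>+\<omega>. ennreal (real (length (Y i (nest m p \<sigma> f \<omega> i)))) \<partial>flat_design m p)"
      unfolding sample_law_flat[OF fm less_le_trans[OF zero_less_numeral F.m2] p]
      by (rule nn_integral_distr_le[OF nest_measurable[OF fm]])
    also have "\<dots> \<le> (\<integral>\<^sup>+\<omega>. (\<Sum>a\<in>F.sent i. ennreal (lc a \<omega>) + ennreal c) \<partial>flat_design m p)"
      by (intro nn_integral_mono len)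
    also have "\<dots> = (\<Sum>a\<in>F.sent i. \<integral>\<^sup>+\<omega>. (ennreal (lc a \<omega>) + ennreal c) \<partial>flat_design m p)"
      by (intro nn_integral_sum borel_measurable_add lcm borel_measurable_const)
    also have "\<dots> = (\<Sum>a\<in>F.sent i. (\<integral>\<^sup>+\<omega>. ennreal (lc a \<omega>) \<partial>flat_design m p) + ennreal c)"
      by (intro sum.cong refl) (simp add: nn_integral_add lcm P.emeasure_space_1)
    also have "\<dots> \<le> (\<Sum>a\<in>F.sent i. ennreal M + ennreal c)"
      unfolding lc_def M_def
      by (intro sum_mono add_mono order_refl local_coeff_mean_le) (use Fs f i p sub in auto)
    also have "\<dots> = (\<Sum>a\<in>F.sent i. ennreal (M + c))" using M0 c0 by (simp add: ennreal_plus)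
    also have "\<dots> = ennreal (\<Sum>a\<in>F.sent i. M + c)" using M0 c0 by (intro sum_ennreal) simp
    also have "\<dots> \<le> ennreal b"
    proof (rule ennreal_leI)
      \<comment> \<open>Number of codewords times mean length: \<open>jB_le\<close> makes the first
        at most b / log n, and \<open>large\<close> makes \<open>M + c\<close>, which is G +
        \<sigma>^2 + 3 plus half of log n, at most log n.\<close>
      have "real (card (F.sent i)) \<le> b / F.lg" using F.card_sent_le F.jB_le by (rule order_trans)
      moreover have "M + c \<le> F.lg" using large by (simp add: M_def c_def F.lg_def)
      ultimately have "real (card (F.sent i)) * (M + c) \<le> b / F.lg * F.lg"
        using M0 c0 F.lg1 F.b1 by (intro mult_mono) auto
      then show "(\<Sum>a\<in>F.sent i. M + c) \<le> b" using F.lg1 by simp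
    qed
    finally show "(\<integral>\<^sup>+ d. ennreal (real (length (Y i (d i)))) \<partial>sample_law m p \<sigma> f) \<le> ennreal b" .
  qed
qed

end

theorem distributed_part:
  assumes W: "is_cdv W s_max" and L: "0 < L" and s: "0 < s"
    and B: "\<forall>\<^sub>F n in sequentially. log 2 (real n) \<le> B n"
  shows "\<forall>\<^sub>F n in sequentially. admissible n (m n) (B n) (s_min m B) \<longrightarrow>
           f_hat (cdv_basis W) \<tau> n (m n) (B n) (s_min m B)
             \<in> dist_estimators (m n) (n div m n) \<sigma> (\<lambda>i. B n) (besov_ball (cdv_basis W) s L)"
proof -
  obtain Cp where Cp: "0 < Cp" "\<And>l x. -1 \<le> l \<Longrightarrow> (\<Sum>k\<in>positions l. (cdv_basis W l k x)\<^sup>2) \<le> Cp * 2 ^ nat l"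
    using cdv_basis_sq_sum_le[OF W] by blast
  interpret bounded_onb "cdv_basis W" Cp
    by unfold_locales (use is_cdv_orthonormal[OF W] Cp in auto)
  define G where "G = L\<^sup>2 * (2 powr (2 * s) + 1 / (1 - 2 powr (- 2 * s)))"
  have "0 < 1 - 2 powr (- 2 * s)" using s by (simp add: powr_less_one)
  then have G0: "0 \<le> G" unfolding G_def by (intro mult_nonneg_nonneg add_nonneg_nonneg) auto
  have sm: "0 \<le> s_min m B" unfolding s_min_def by (rule Inf_greatest) auto
  \<comment> \<open>Half of log n pays for the fractional digits; the other half must cover the mean
    unary length, the sign and the delimiter, which is a condition on n.\<close>
  have "\<forall>\<^sub>F n in sequentially. 2 * (G + \<sigma>\<^sup>2 + 3) \<le> log 2 (real n)"
    using eventually_ge_at_top[of "nat \<lceil>2 powr (2 * (G + \<sigma>\<^sup>2 + 3))\<rceil>"]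
  proof eventually_elim
    case (elim n)
    then have le: "2 powr (2 * (G + \<sigma>\<^sup>2 + 3)) \<le> real n" by linarith
    moreover have "0 < real n" by (rule less_le_trans[OF _ le]) simp
    ultimately show ?case by (subst le_log_iff) auto
  qed
  then show ?thesis using B eventually_ge_at_top[of 2]
  proof eventually_elim
    case (elim n)
    show ?case
    proof
      assume adm: "admissible n (m n) (B n) (s_min m B)"
      show "f_hat (cdv_basis W) \<tau> n (m n) (B n) (s_min m B)
             \<in> dist_estimators (m n) (n div m n) \<sigma> (\<lambda>i. B n) (besov_ball (cdv_basis W) s L)"
      proof (rule f_hat_distributed[OF _ sm _ _ G0])
        show "budget n (m n) (B n) (s_min m B)" by unfold_locales (use elim adm in auto)
        show "f \<in> L2_unit" "(\<integral>x. (f x)\<^sup>2 \<partial>unif) \<le> G" if "f \<in> besov_ball (cdv_basis W) s L" for f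
          using besov_ball_L2[OF that] besov_ball_norm_le[OF that s] L by (auto simp: G_def)
        show "G + \<sigma>\<^sup>2 + 3 \<le> log 2 (real n) / 2" using elim(1) by simp
      qed
    qed
  qed
qed

text \<open>The threshold \<open>\<tau>0\<close> depends on the basis, \<sigma>, L and a lower bound
  \<open>s_low\<close> for the smoothness, but neither on n nor on s. The lower bound controls the
  constant 1 / (1 - 2^(-2 s)) of bias and norm over the Besov ball, which is unbounded as s tends to
  0.\<close>

theorem theorem2p10:
  fixes W :: cdv and s_max :: nat and \<sigma> :: real
  assumes wavelets: "is_cdv W s_max"
    and sigma: "0 < \<sigma>"
  shows
    "(\<forall>(m :: nat \<Rightarrow> nat) (B :: nat \<Rightarrow> real) (\<tau> :: real) (L :: real) (s :: real).
        (\<forall>\<^sub>F n in sequentially. log 2 (real n) \<le> B n) \<longrightarrow> 1 < \<tau> \<longrightarrow> 0 < L \<longrightarrow> 0 < s \<longrightarrow>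
        (\<forall>\<^sub>F n in sequentially. admissible n (m n) (B n) (s_min m B) \<longrightarrow>
           f_hat (cdv_basis W) \<tau> n (m n) (B n) (s_min m B)
             \<in> dist_estimators (m n) (n div m n) \<sigma> (\<lambda>i. B n) (besov_ball (cdv_basis W) s L)))
     \<and>
     (\<forall>(L :: real) (s_low :: real). 0 < L \<longrightarrow> 0 < s_low \<longrightarrow>
        (\<exists>\<tau>0 :: real. 1 \<le> \<tau>0 \<and>
          (\<forall>(\<tau> :: real) (m :: nat \<Rightarrow> nat) (B :: nat \<Rightarrow> real) (s :: real).
             \<tau>0 < \<tau> \<longrightarrow> (\<forall>\<^sub>F n in sequentially. log 2 (real n) \<le> B n) \<longrightarrow>
             s_low \<le> s \<longrightarrow> s_min m B \<le> ereal s \<longrightarrow> s < real s_max \<longrightarrow>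
             (\<exists>C > 0. \<forall>\<^sub>F n in sequentially. admissible n (m n) (B n) (s_min m B) \<longrightarrow>
                (SUP f0 \<in> besov_ball (cdv_basis W) s L.
                   risk (m n) (n div m n) \<sigma>
                     (f_hat (cdv_basis W) \<tau> n (m n) (B n) (s_min m B)) f0)
                \<le> ennreal (C * rate L s n (B n))))))"
  using distributed_part[OF wavelets] risk_part[OF wavelets sigma] by blast

end
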